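(* Assume that: (i) $b\in C^2(\mathbb{R}^d,\mathbb{R}^d)$ has bounded derivatives $\frac{\partial b_i}{\partial \xi_j}$ and $\frac{\partial^2 b_i}{\partial \xi_j\partial\xi_k}$, $i,j,k=1,\dots,d$. (ii) There is a $\rho>0$ such that $$\liminf_{\varepsilon\downarrow 0}\varepsilon^{\rho}\, m_j\{|\xi|\ge\varepsilon\}\in(0,+\infty],\qquad j=1,\dots,d.$$ (iii) There is a $\delta>0$ such that each $m_j$ restricted to $(-\delta,\delta)$ is absolutely continuous with respect to Lebesgue measure; moreover the density $\rho_j=\frac{\mathrm{d}m_j}{\mathrm{d}\xi}$ is of class $C^1((-\delta,\delta)\setminus\{0\})$ and there exists $\kappa>1$ such that for all $j$, $$\int_{-\delta}^{\delta}|\xi|^{\kappa}\rho_j(\xi)\,\mathrm{d}\xi<+\infty,\qquad \int_{-\delta}^{\delta}|\xi|^{2\kappa}\left(\frac{\rho_j'(\xi)}{\rho_j(\xi)}\right)^2\rho_j(\xi)\,\mathrm{d}\xi<+\infty,\qquad \int_{-\delta}^{\delta}|\xi|^{2\kappa-2}\rho_j(\xi)\,\mathrm{d}\xi<+\infty.$$ Then there are integrable random fields $Y(t)=(Y_1(t),\dots,Y_d(t))$ and $Y(t,x)=(Y_1(t,x),\dots,Y_d(t,x))$, $t>0$, $x\in\mathbb{R}^d$ (not depending on $f$), such that for any $f\in B_b(\mathbb{R}^d)$, $t>0$, $x\in\mathbb{R}^d$, $$\nabla Q_tf(x)=\mathbb{E}\, f(Z^x(t))\,Y(t)\qquad\text{and}\qquad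 \nabla P_tf(x)=\mathbb{E}\, f(X^x(t))\,Y(t,x).$$ Moreover, for any $T>0$ there is a constant $C$, independent of $t\in(0,T]$ and $x\in\mathbb{R}^d$, such that $$\mathbb{E}\left(|Y(t)|+|Y(t,x)|\right)\le C\,t^{-\frac{\kappa}{\rho}+\frac12}.$$ Finally, for any $T>0$ and $\varepsilon\in(0,1/2)$ there is a constant $C_\varepsilon$ such that for all $t\in(0,T]$ and $x\in\mathbb{R}^d$, $$\mathbb{E}\,|Y(t)-Y(t,x)|\le C_\varepsilon\, t^{-\frac{\kappa}{\rho}+\frac32}.$$
   Context: $Z(t)=(Z_1(t),\dots,Z_d(t))^*$ is a Lévy process in $\mathbb{R}^d$ whose coordinates $Z_1,\dots,Z_d$ are independent real-valued Lévy processes; $m_j$ is the Lévy measure of $Z_j$ (so $\int_{\mathbb{R}}(\xi^2\wedge1)\,m_j(\mathrm{d}\xi)<+\infty$). Each $Z_j$ is of purely jump type: $$Z_j(t)=\int_0^t\int_{\{|\xi|\ge1\}}\xi\,\Pi_j(\mathrm{d}s,\mathrm{d}\xi)+\int_0^t\int_{\{|\xi|<1\}}\xi\,[\Pi_j(\mathrm{d}s,\mathrm{d}\xi)-\mathrm{d}s\,m_j(\mathrm{d}\xi)],$$ where $\Pi_j$ is a Poisson random measure on $[0,+\infty)\times\mathbb{R}$ with intensity measure $\mathrm{d}s\,m_j(\mathrm{d}\xi)$. $b\colon\mathbb{R}^d\to\mathbb{R}^d$ is the drift, and $X^x$ is the solution of $\mathrm{d}X^x(t)=b(X^x(t))\,\mathrm{d}t+\mathrm{d}Z(t)$,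 $X^x(0)=x\in\mathbb{R}^d$. $B_b(\mathbb{R}^d)$ is the space of bounded Borel functions $f\colon\mathbb{R}^d\to\mathbb{R}$. The transition semigroups are $P_tf(x)=\mathbb{E}f(X^x(t))$ and $Q_tf(x)=\mathbb{E}f(Z^x(t))$, where $Z^x(t)=x+Z(t)$. Gradients are row vectors. *)

theory Defs
  imports "HOL-Probability.Probability"
begin

definition levy_process :: "'w measure \<Rightarrow> (real \<Rightarrow> 'w \<Rightarrow> 'a::euclidean_space) \<Rightarrow> bool" where
  "levy_process M Z \<longleftrightarrow>
     (\<forall>t\<ge>0. Z t \<in> borel_measurable M) \<and>
     (AE \<omega> in M. Z 0 \<omega> = 0) \<and>
     (\<forall>(n::nat) (\<tau>::nat \<Rightarrow> real). 0 \<le> \<tau> 0 \<longrightarrow> mono \<tau> \<longrightarrow>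
        prob_space.indep_vars M (\<lambda>_. borel) (\<lambda>i \<omega>. Z (\<tau> (Suc i)) \<omega> - Z (\<tau> i) \<omega>) {..<n}) \<and>
     (\<forall>s t. 0 \<le> s \<longrightarrow> s \<le> t \<longrightarrow>
        distr M borel (\<lambda>\<omega>. Z t \<omega> - Z s \<omega>) = distr M borel (Z (t - s))) \<and>
     (AE \<omega> in M. \<forall>t\<ge>0.
        ((\<lambda>s. Z s \<omega>) \<longlongrightarrow> Z t \<omega>) (at_right t) \<and>
        (t > 0 \<longrightarrow> (\<exists>l. ((\<lambda>s. Z s \<omega>) \<longlongrightarrow> l) (at_left t))))"

text \<open>Independence of the coordinates as processes: each coordinate is viewed as a random element
  of the path space \<open>\<real>\<close> to the power \<open>[0,\<infinity>)\<close> with its product \<open>\<sigma>\<close>-algebra.\<close>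

definition independent_coordinates ::
    "'w measure \<Rightarrow> (real \<Rightarrow> 'w \<Rightarrow> real ^ 'd::finite) \<Rightarrow> bool" where
  "independent_coordinates M Z \<longleftrightarrow>
     prob_space.indep_vars M (\<lambda>_. PiM {0..} (\<lambda>_. borel))
       (\<lambda>j \<omega>. restrict (\<lambda>t. Z t \<omega> $ j) {0..}) (UNIV :: 'd set)"

definition levy_measure :: "real measure \<Rightarrow> bool" where
  "levy_measure m \<longleftrightarrow>
     sets m = sets borel \<and> emeasure m {0} = 0 \<and>
     (\<integral>\<^sup>+ \<xi>. ennreal (min (\<xi>\<^sup>2) 1) \<partial>m) < \<infinity>"

text \<open>The law is written out because the intensity of a set may be \<open>0\<close> (then \<open>0 ^ 0 = 1\<close> gives the
  point mass at \<open>0\<close>), which is excluded in \<open>poisson_pmf\<close>.\<close>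

definition poisson_random_measure ::
    "'w measure \<Rightarrow> ('w \<Rightarrow> 'e measure) \<Rightarrow> 'e measure \<Rightarrow> bool" where
  "poisson_random_measure M N \<nu> \<longleftrightarrow>
     (\<forall>\<omega>\<in>space M. sets (N \<omega>) = sets \<nu>) \<and>
     (\<forall>A\<in>sets \<nu>. (\<lambda>\<omega>. emeasure (N \<omega>) A) \<in> borel_measurable M) \<and>
     (\<forall>A\<in>sets \<nu>. emeasure \<nu> A < \<infinity> \<longrightarrow>
        (\<forall>k::nat. measure M {\<omega>\<in>space M. emeasure (N \<omega>) A = of_nat k} =
                  measure \<nu> A ^ k / fact k * exp (- measure \<nu> A))) \<and>
     (\<forall>A\<in>sets \<nu>. emeasure \<nu> A = \<infinity> \<longrightarrow> (AE \<omega> in M. emeasure (N \<omega>) A = \<infinity>)) \<and>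
     (\<forall>A :: nat \<Rightarrow> 'e set. range A \<subseteq> sets \<nu> \<longrightarrow> disjoint_family A \<longrightarrow>
        prob_space.indep_vars M (\<lambda>_. borel) (\<lambda>i \<omega>. emeasure (N \<omega>) (A i)) UNIV)"

definition jump_intensity :: "real measure \<Rightarrow> (real \<times> real) measure" where
  "jump_intensity m = restrict_space lborel {0..} \<Otimes>\<^sub>M m"

definition large_jumps :: "('w \<Rightarrow> (real \<times> real) measure) \<Rightarrow> real \<Rightarrow> 'w \<Rightarrow> real" where
  "large_jumps N t \<omega> = (LINT z:{0..t} \<times> {\<xi>. 1 \<le> \<bar>\<xi>\<bar>}|N \<omega>. snd z)"

definition truncated_small_jumps ::
    "('w \<Rightarrow> (real \<times> real) measure) \<Rightarrow> real measure \<Rightarrow> real \<Rightarrow> real \<Rightarrow> 'w \<Rightarrow> real" where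
  "truncated_small_jumps N m \<epsilon> t \<omega> =
     (LINT z:{0..t} \<times> {\<xi>. \<epsilon> \<le> \<bar>\<xi>\<bar> \<and> \<bar>\<xi>\<bar> < 1}|N \<omega>. snd z)
     - t * (LINT \<xi>:{\<xi>. \<epsilon> \<le> \<bar>\<xi>\<bar> \<and> \<bar>\<xi>\<bar> < 1}|m. \<xi>)"

text \<open>The integral of \<open>\<xi>\<close> over \<open>[0,t] \<times> {|\<xi>| < 1}\<close> against the compensated measure is not a pathwise
  integral; it is the mean-square limit of the truncated compensated integrals.\<close>

definition is_compensated_small_jumps ::
    "'w measure \<Rightarrow> ('w \<Rightarrow> (real \<times> real) measure) \<Rightarrow> real measure \<Rightarrow> real \<Rightarrow> ('w \<Rightarrow> real) \<Rightarrow> bool" where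
  "is_compensated_small_jumps M N m t S \<longleftrightarrow>
     S \<in> borel_measurable M \<and>
     ((\<lambda>\<epsilon>. \<integral>\<^sup>+ \<omega>. ennreal ((S \<omega> - truncated_small_jumps N m \<epsilon> t \<omega>)\<^sup>2) \<partial>M) \<longlongrightarrow> 0) (at_right 0)"

definition purely_jump_type ::
    "'w measure \<Rightarrow> ('w \<Rightarrow> (real \<times> real) measure) \<Rightarrow> real measure \<Rightarrow> (real \<Rightarrow> 'w \<Rightarrow> real) \<Rightarrow> bool" where
  "purely_jump_type M N m Z \<longleftrightarrow>
     (\<forall>t\<ge>0. \<exists>S. is_compensated_small_jumps M N m t S \<and>
        (AE \<omega> in M. Z t \<omega> = large_jumps N t \<omega> + S \<omega>))"

text \<open>The noise is additive, so the equation is meaningful path by path.\<close>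

definition sde_solution ::
    "'w measure \<Rightarrow> ('a \<Rightarrow> 'a) \<Rightarrow> (real \<Rightarrow> 'w \<Rightarrow> 'a) \<Rightarrow> 'a \<Rightarrow> (real \<Rightarrow> 'w \<Rightarrow> 'a::euclidean_space) \<Rightarrow> bool" where
  "sde_solution M b Z x X \<longleftrightarrow>
     (\<forall>t\<ge>0. X t \<in> borel_measurable M) \<and>
     (AE \<omega> in M. \<forall>t\<ge>0.
        set_integrable lborel {0..t} (\<lambda>s. b (X s \<omega>)) \<and>
        X t \<omega> = x + (LINT s:{0..t}|lborel. b (X s \<omega>)) + Z t \<omega>)"

definition transition_semigroup ::
    "'w measure \<Rightarrow> ('a \<Rightarrow> real \<Rightarrow> 'w \<Rightarrow> 'a) \<Rightarrow> real \<Rightarrow> ('a \<Rightarrow> real) \<Rightarrow> 'a \<Rightarrow> real" where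
  "transition_semigroup M X t f x = (\<integral>\<omega>. f (X x t \<omega>) \<partial>M)"

definition bounded_borel :: "('a::euclidean_space \<Rightarrow> real) set" where
  "bounded_borel = {f \<in> borel_measurable borel. bounded (range f)}"

definition partial_deriv :: "'d::finite \<Rightarrow> (real ^ 'd \<Rightarrow> real) \<Rightarrow> real ^ 'd \<Rightarrow> real" where
  "partial_deriv j g x = deriv (\<lambda>h. g (x + h *\<^sub>R axis j 1)) 0"

definition C1_function :: "(real ^ 'd::finite \<Rightarrow> real) \<Rightarrow> bool" where
  "C1_function g \<longleftrightarrow>
     (\<forall>j. (\<forall>x. (\<lambda>h. g (x + h *\<^sub>R axis j 1)) differentiable (at 0)) \<and>
          continuous_on UNIV (partial_deriv j g))"

definition C2_function :: "(real ^ 'd::finite \<Rightarrow> real) \<Rightarrow> bool" where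
  "C2_function g \<longleftrightarrow> C1_function g \<and> (\<forall>j. C1_function (partial_deriv j g))"

end

theory Submission
 imports Defs
begin

text \<open>Fix a coordinate \<open>Z_j\<close>, a time \<open>ta\<close> and a weight \<open>V(x)\<close> of order \<open>|x|^(2 kappa)\<close> near \<open>0\<close>, and let \<open>S\<close> be the
sum of \<open>V\<close> over the jumps of \<open>Z_j\<close> in \<open>[0,ta]\<close>. Inserting \<open>1 = \<integral> S exp(-t S) dt\<close> and using Palm's formula for \<open>S\<close>, the
law of the path of \<open>Z_j\<close> equals the law of the path of \<open>Z_j\<close> with one more jump \<open>x\<close> at time \<open>s\<close>, where \<open>(t, s, w, x)\<close> has density
\<open>exp(-t S(w)) exp(-t V(x)) V(x) p_j(x)\<close>. Under this law one integrates by parts in the single real variable \<open>x\<close>; Young's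
inequality and \<open>E exp(-t S) = exp(-ta \<integral> (1 - exp(-t V)) dm_j)\<close> bound the mean score by \<open>C ta^(1/2 - kappa/rho)\<close>.

The noise is additive, so \<open>X(t)\<close> is a path functional, and moving its starting point by \<open>h\<close> has the same effect
at time \<open>t\<close> as changing the additional jumps by \<open>alpha(h) = h + O(ta)\<close>. Integration by parts turns this into a weight on the
enlarged space, which differs from the weight of the case \<open>b = 0\<close> by a factor \<open>O(ta)\<close>. A Radon-Nikodym
derivative makes the weights functions of the path of \<open>Z\<close>; continuity of the law of \<open>X(t)\<close> in total variation carries the formula
from smooth to Borel functions.\<close>

section \<open>The flow of the equation\<close>

text \<open>The power \<open>t^(-ka/ro + 1/2)\<close> arises from balancing. The score of the added
  jump is a product \<open>w * A\<close>, where \<open>w\<close> is the square root of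
  \<open>V\<close> and \<open>A\<^sup>2 * p\<close> is integrable by the assumptions on the density.
  Young's inequality with parameter \<open>ga\<close> turns \<open>w * A\<close> into
  \<open>ga * V\<close>, which reproduces the density and integrates to \<open>ga\<close>, and
  \<open>A\<^sup>2 / ga\<close>, which leaves the integral of \<open>ta * exp(-ta * aa t)\<close>
  over \<open>t\<close>, of order \<open>ta^(1 - 2 ka/ro)\<close>; then
  \<open>ga = ta^(1/2 - ka/ro)\<close>. Two obstacles shape the rest. The small jumps are a
  mean-square limit, so a jump cannot be inserted in the Poisson integrals path by path: the law of
  the enlarged path is identified by joint characteristic functions at dyadic times, and paths are
  rebuilt from these values. The direction \<open>alpha\<close> exists only on a short window, so
  jumps are added before \<open>min t t0\<close> even if the solution is observed at a later
  \<open>t\<close>; since the exponent is not positive, this costs a constant on bounded time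
  intervals.\<close>

abbreviation tends (infixr "---->" 60) where "X ----> L == X \<longlonglongrightarrow> L"
abbreviation scR (infixr "*R" 75) where "x *R y == x *\<^sub>R y"
abbreviation "bmf == borel_measurable"
abbreviation "bm == bmf borel"
abbreviation "indi == indicator"
abbreviation ei :: "real => complex" where "ei x == exp (\<i> * of_real x)"
lemmas int_bound = Bochner_Integration.integrable_bound and int_cong = Bochner_Integration.integral_cong

text \<open>Bounded and measurable replaces cadlag: the class is closed under sums, indicators and
  \<open>vint\<close>, its members are integrable on bounded intervals, and additive noise asks for
  no more.\<close>

definition bpath :: "(real => 'a::euclidean_space) => bool" where
 "bpath f \<longleftrightarrow> f : bm & bounded (range f)"

text \<open>Integration stops at \<open>T\<close>: paths are defined on the whole line, but only \<open>[0,T]\<close> matters.\<close>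

definition vint :: "real => (real => 'a::euclidean_space) => real => 'a" where
 "vint T f s = (LINT v:{0..min s T}|lborel. f v)"

lemma bpath_meas[measurable_dest]: "bpath f ==> f : bm"
 by (simp add: bpath_def)

lemma bpath_bound: "bpath f ==> EX B>0. ALL s. norm (f s) <= B"
 by (auto simp: bpath_def bounded_pos)

lemma bpathI: "f : bm ==> (!!s. norm (f s) <= B) ==> bpath f"
 by (auto simp: bpath_def bounded_iff)

lemma bpath_const[simp]: "bpath (%s. c)"
 by (auto simp: bpath_def)

lemma bpath_add: "bpath f ==> bpath g ==> bpath (%s. f s + g s)"
 unfolding bpath_def by (auto intro: bounded_plus_comp)

lemma bpath_diff: "bpath f ==> bpath g ==> bpath (%s. f s - g s)"
 unfolding bpath_def by (auto intro: bounded_minus_comp)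

lemma bpath_scaleR: "bpath f ==> bpath (%s. c *R f s)"
 unfolding bpath_def by (auto intro: bounded_scaleR_comp)

lemma bpath_norm: "bpath f ==> bpath (%s. norm (f s))"
 unfolding bpath_def by (auto simp: bounded_iff)

lemma bpath_sum: "finite A ==> (!!i. i : A ==> bpath (f i)) ==> bpath (%s. SUM i:A. f i s)"
 by (induction rule: finite_induct) (auto intro: bpath_add)

lemma bpath_set_integrable:
 assumes "bpath f" shows "set_integrable lborel {a..c} f"
proof -
 obtain B where B: "B > 0" "!!s. norm (f s) <= B" using bpath_bound[OF assms] by auto
 have m[measurable]: "f : bm" using assms by (rule bpath_meas)
 have "integrable lborel (%x. indi {a..c} x *R B)"
  using borel_integrable_atLeastAtMost'[of a c "%x. B"] by (simp add: set_integrable_def)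
 then show ?thesis
  unfolding set_integrable_def
  by (rule int_bound) (auto simp: B indicator_def less_imp_le)
qed

lemma vint_add: "bpath f ==> bpath g ==> vint T (%v. f v + g v) s = vint T f s + vint T g s"
 unfolding vint_def by (simp add: set_integral_add bpath_set_integrable)

lemma vint_diff: "bpath f ==> bpath g ==> vint T (%v. f v - g v) s = vint T f s - vint T g s"
 unfolding vint_def by (simp add: set_integral_diff bpath_set_integrable)

lemma vint_scaleR: "vint T (%v. c *R f v) s = c *R vint T f s"
 unfolding vint_def by simp

lemma vint_cmult: "vint T (%v. c * f v) s = c * vint T f s" for f :: "real => real"
 using vint_scaleR[of T c f s] by simp

lemma vint_zero[simp]: "vint T (%v. 0) s = 0"
 by (simp add: vint_def)

lemma vint_mono:
 fixes f g :: "real => real"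
 assumes "bpath f" "bpath g" "!!v. 0 <= v ==> v <= s ==> v <= T ==> f v <= g v"
 shows "vint T f s <= vint T g s"
 unfolding vint_def by (rule set_integral_mono) (use assms bpath_set_integrable in auto)

lemma vint_const: "vint T (%v. c) s = max 0 (min s T) *R c"
proof (cases "0 <= min s T")
 case True
 then show ?thesis unfolding vint_def by (simp add: set_integral_const)
next
 case False
 then have "{0..min s T} = {}" "max 0 (min s T) = 0" by auto
 then show ?thesis unfolding vint_def by (simp add: set_lebesgue_integral_def)
qed

lemma norm_vint_le:
 assumes "bpath f" shows "norm (vint T f s) <= vint T (%v. norm (f v)) s"
 unfolding vint_def
 by (rule set_integral_norm_bound[OF bpath_set_integrable[OF assms]])

lemma vint_cong: "(!!v. 0 <= v ==> v <= s ==> v <= T ==> f v = g v) ==> vint T f s = vint T g s"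
 unfolding vint_def by (rule set_lebesgue_integral_cong) auto

lemma norm_vint_bound:
 assumes "bpath f" "!!v. 0 <= v ==> v <= s ==> v <= T ==> norm (f v) <= B"
 shows "norm (vint T f s) <= B * max 0 (min s T)"
proof -
 have "norm (vint T f s) <= vint T (%v. norm (f v)) s" by (rule norm_vint_le[OF assms(1)])
 also have "... <= vint T (%v. B) s"
  by (rule vint_mono) (use assms bpath_norm in auto)
 finally show ?thesis by (simp add: vint_const mult.commute)
qed

lemma vint_measurable_param:
 fixes f :: "'l => real => 'a::euclidean_space"
 assumes [measurable]: "(%(l, v). f l v) : bmf (N \<Otimes>\<^sub>M borel)"
 shows "(%(l, s). vint T (f l) s) : bmf (N \<Otimes>\<^sub>M borel)"
proof -
 have [measurable]: "(%p. f (fst p) (snd p)) : bmf (N \<Otimes>\<^sub>M borel)"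
  using assms by (simp add: case_prod_beta)
 have "(%p. LINT v|lborel. indi {v. 0 <= v & v <= min (snd p) T} v *R f (fst p) v) : bmf (N \<Otimes>\<^sub>M borel)"
  by measurable
 moreover have "{v. 0 <= v & v <= min s T} = {0..min s T}" for s by auto
 ultimately have "(%p. LINT v|lborel. indi {0..min (snd p) T} v *R f (fst p) v) : bmf (N \<Otimes>\<^sub>M borel)"
  by (simp only:)
 then show ?thesis
  by (simp add: vint_def set_lebesgue_integral_def case_prod_beta)
qed

lemma bpath_vint:
 assumes "bpath f" shows "bpath (vint T f)"
proof -
 obtain B where B: "B > 0" "!!s. norm (f s) <= B" using bpath_bound[OF assms] by auto
 have [measurable]: "f : bm" using assms by (rule bpath_meas)
 \<comment> \<open>A one-point parameter space turns the parametrised statement into measurability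
   of a single path.\<close>
 have "(%(l::unit, s). vint T f s) : bmf (count_space UNIV \<Otimes>\<^sub>M borel)"
  by (rule vint_measurable_param) measurable
 from measurable_compose[OF measurable_Pair[OF measurable_const measurable_ident] this, of "()"]
 have 1: "vint T f : bm" by simp
 have "norm (vint T f s) <= B * max 0 T" for s
 proof -
  have "norm (vint T f s) <= B * max 0 (min s T)" by (rule norm_vint_bound[OF assms]) (rule B)
  also have "... <= B * max 0 T" using B(1) by (intro mult_left_mono) auto
  finally show ?thesis .
 qed
 with 1 show ?thesis by (rule bpathI)
qed

text \<open>The exponent \<open>2 * K\<close> is chosen so that \<open>K\<close> times integration
  gains a factor \<open>1/2\<close> against this weight. In the sup norm weighted in this way the
  Volterra operator is a contraction for every \<open>T\<close>; Gronwall's inequality and the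
  Picard iteration both rest on that.\<close>

lemma vint_exp:
 assumes "K >= 0"
 shows "K * vint T (%v. exp (2 * K * max 0 (min v T))) s <= exp (2 * K * max 0 (min s T)) / 2"
proof (cases "K = 0 | min s T < 0")
 case True
 then show ?thesis by (auto simp: vint_def set_lebesgue_integral_def)
next
 case False
 then have K: "K > 0" and c: "0 <= min s T" using assms by auto
 have "vint T (%v. exp (2 * K * max 0 (min v T))) s = vint T (%v. exp (2 * K * v)) s"
  by (rule vint_cong) auto
 also have "... = (LINT v|lborel. indi {0..min s T} v *R exp (2 * K * v))"
  by (simp add: vint_def set_lebesgue_integral_def)
 also have "... = exp (2 * K * min s T) / (2 * K) - exp (2 * K * 0) / (2 * K)"
 proof (rule integral_FTC_Icc)
  show "((%v. exp (2 * K * v) / (2 * K)) has_vector_derivative exp (2 * K * x)) (at x within {0..min s T})" for x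
   using K unfolding has_real_derivative_iff_has_vector_derivative[symmetric]
   by (auto intro!: derivative_eq_intros)
 qed (use c in \<open>auto intro!: continuous_intros\<close>)
 finally have "K * vint T (%v. exp (2 * K * max 0 (min v T))) s = exp (2 * K * min s T) / 2 - 1 / 2"
  using K by (simp add: field_simps)
 moreover have "max 0 (min s T) = min s T" using c by auto
 ultimately show ?thesis by simp
qed

lemma bpath_exp_weight: "bpath (%v. exp (2 * K * max 0 (min v T)) :: real)" if "K >= 0" "T >= 0"
proof (rule bpathI)
 fix s
 have "2 * K * max 0 (min s T) <= 2 * K * T" using that by (intro mult_left_mono) auto
 then show "norm (exp (2 * K * max 0 (min s T))) <= exp (2 * K * T)" by simp
qed measurable

text \<open>Boundedness of \<open>e\<close> makes the supremum \<open>m\<close> of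
  \<open>e / W\<close> finite, and \<open>vint_exp\<close> yields \<open>m <= r + m / 2\<close>. The
  factor \<open>2\<close> in the conclusion comes from this inequality.\<close>

lemma gronwall:
 fixes e :: "real => real"
 assumes e: "bpath e" "!!s. 0 <= e s" and K: "K >= 0" and T: "T >= 0" and r: "r >= 0"
  and le: "!!s. e s <= r + K * vint T e s"
 shows "e s <= 2 * r * exp (2 * K * max 0 (min s T))"
proof -
 define W where "W s = exp (2 * K * max 0 (min s T))" for s
 have W1: "W s >= 1" for s using K by (auto simp: W_def)
 have W0: "W s > 0" for s by (auto simp: W_def)
 obtain B where B: "B > 0" "!!s. norm (e s) <= B" using bpath_bound[OF e(1)] by auto
 have bdd: "bdd_above (range (%s. e s / W s))"
 proof (rule bdd_aboveI2)
  fix s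
  have "e s / W s <= e s / 1" using W1[of s] e(2)[of s] by (intro divide_left_mono) auto
  also have "... <= B" using B(2)[of s] by auto
  finally show "e s / W s <= B" .
 qed
 define m where "m = (SUP s. e s / W s)"
 have up: "e s <= m * W s" for s
  using cSUP_upper[OF _ bdd, of s] W0[of s] by (simp add: m_def field_simps)
 have m0: "m >= 0" using up[of 0] e(2)[of 0] W0[of 0] by (smt (verit) mult_neg_pos)
 have "e s / W s <= r + m / 2" for s
 proof -
  have "bpath (%v. m * W v)"
   using bpath_scaleR[OF bpath_exp_weight[OF K T], of m] by (simp add: W_def)
  then have "vint T e s <= vint T (%v. m * W v) s"
   using e up by (intro vint_mono) auto
  then have "K * vint T e s <= K * vint T (%v. m * W v) s" using K by (rule mult_left_mono)
  also have "... = m * (K * vint T W s)" by (simp add: vint_cmult)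
  also have "... <= m * (W s / 2)"
   using vint_exp[OF K, of T s] m0 unfolding W_def by (intro mult_left_mono) auto
  finally have "e s <= r + m * (W s / 2)" using le[of s] by simp
  also have "... <= r * W s + m * (W s / 2)" using r W1[of s] by (simp add: mult_le_cancel_left1)
  finally show ?thesis using W0[of s] by (simp add: field_simps)
 qed
 then have "m <= r + m / 2" unfolding m_def by (intro cSUP_least) auto
 then have "m <= 2 * r" by simp
 then have "m * W s <= 2 * r * W s" using W0[of s] by (intro mult_right_mono) auto
 with up[of s] show ?thesis unfolding W_def by linarith
qed

primrec picard :: "real => (real => 'a::euclidean_space) => (real => 'a => 'a) => nat => real => 'a" where
 "picard T a F 0 = a"
| "picard T a F (Suc n) = (%s. a s + vint T (%v. F v (picard T a F n v)) s)"

text \<open>A limit of iterates instead of a choice among solutions: measurability in parameters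
  passes from the iterates to the limit.\<close>

definition vsol :: "real => (real => 'a::euclidean_space) => (real => 'a => 'a) => real => 'a" where
 "vsol T a F s = lim (%n. picard T a F n s)"

text \<open>The closure condition on bounded paths stands for joint measurability and growth. It
  covers both the fixed field \<open>b\<close> and the time-dependent linear fields
  \<open>Db (Sol z v)\<close>.\<close>

definition lip_field :: "real => (real => 'a::euclidean_space => 'a) => bool" where
 "lip_field K F \<longleftrightarrow> K >= 0 & (ALL y. bpath y --> bpath (%v. F v (y v))) &
   (ALL v y y'. norm (F v y - F v y') <= K * norm (y - y'))"

lemma bpath_picard:
 assumes "bpath a" "lip_field K F" shows "bpath (picard T a F n)"
proof (induction n)
 case (Suc n)
 then have "bpath (%v. F v (picard T a F n v))" using assms(2) unfolding lip_field_def by blast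
 then show ?case unfolding picard.simps by (intro bpath_add assms(1) bpath_vint)
qed (use assms in auto)

text \<open>Each Picard step halves the increments in the sup norm weighted by \<open>W\<close>, so
  the telescoping series is dominated by a geometric one, uniformly in \<open>s\<close>, whatever
  the length of \<open>[0,T]\<close>.\<close>

lemma vsol_solves:
 assumes a: "bpath a" and F: "lip_field K F" and T: "T >= 0"
 shows vsol_lim: "(%n. picard T a F n s) ----> vsol T a F s"
  and bpath_vsol: "bpath (vsol T a F)"
  and vsol_eq: "vsol T a F s = a s + vint T (%v. F v (vsol T a F v)) s"
proof -
 let ?y = "picard T a F"
 define W where "W s = exp (2 * K * max 0 (min s T))" for s
 have K: "K >= 0" and Fp: "!!y. bpath y ==> bpath (%v. F v (y v))"
  and Fl: "!!v y y'. norm (F v y - F v y') <= K * norm (y - y')"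
  using F by (auto simp: lip_field_def)
 have W1: "W s >= 1" for s using K by (auto simp: W_def)
 have WT: "W s <= W T" for s
  using K T by (auto simp: W_def intro!: mult_left_mono)
 have py: "bpath (?y n)" for n by (rule bpath_picard[OF a F])
 note Fpy = Fp[OF py]
 have pW: "bpath W" unfolding W_def by (rule bpath_exp_weight[OF K T])
 have "bpath (%s. ?y 1 s - ?y 0 s)" by (rule bpath_diff[OF py py])
 then obtain C where C: "C > 0" "!!s. norm (?y 1 s - ?y 0 s) <= C" using bpath_bound by blast
 have d: "norm (?y (Suc n) s - ?y n s) <= C * (1/2)^n * W s" for n s
 proof (induction n arbitrary: s)
  case 0
  have "norm (?y (Suc 0) s - ?y 0 s) <= C * 1" using C(2)[of s] by simp
  also have "... <= C * W s" using W1[of s] C by (intro mult_left_mono) auto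
  finally show ?case by simp
 next
  case (Suc n)
  have "?y (Suc (Suc n)) s - ?y (Suc n) s = vint T (%v. F v (?y (Suc n) v) - F v (?y n v)) s"
   by (subst vint_diff[OF Fpy[of "Suc n"] Fpy[of n]]) simp
  also have "norm ... <= vint T (%v. norm (F v (?y (Suc n) v) - F v (?y n v))) s"
   by (intro norm_vint_le bpath_diff Fp py)
  also have "... <= vint T (%v. (K * (C * (1/2)^n)) *R W v) s"
  proof (rule vint_mono)
   fix v
   have "norm (F v (?y (Suc n) v) - F v (?y n v)) <= K * norm (?y (Suc n) v - ?y n v)" by (rule Fl)
   also have "... <= K * (C * (1/2)^n * W v)" using K Suc.IH by (rule mult_left_mono[rotated])
   finally show "norm (F v (?y (Suc n) v) - F v (?y n v)) <= (K * (C * (1/2)^n)) *R W v" by (simp add: mult_ac)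
  qed (intro bpath_norm bpath_diff Fp py bpath_scaleR pW)+
  also have "... = (C * (1/2)^n) * (K * vint T W s)" by (subst vint_scaleR) simp
  also have "... <= (C * (1/2)^n) * (W s / 2)"
   using vint_exp[OF K, of T s] C unfolding W_def by (intro mult_left_mono) auto
  finally show ?case by simp
 qed
 have d': "norm (?y (Suc n) s - ?y n s) <= C * W T * (1/2)^n" for n s
 proof -
  have "C * (1/2)^n * W s <= C * (1/2)^n * W T" using WT C by (intro mult_left_mono) auto
  with d[of n s] show ?thesis by (simp add: mult_ac)
 qed
 have geo: "summable (%n. C * W T * (1/2::real)^n)" by (intro summable_mult) simp
 have tel: "?y n s = a s + (SUM k<n. ?y (Suc k) s - ?y k s)" for n s
  by (subst sum_lessThan_telescope) simp
 have bd: "norm (?y n s - a s) <= 2 * C * W T" for n s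
 proof -
  have "norm (?y n s - a s) <= (SUM k<n. norm (?y (Suc k) s - ?y k s))"
   by (subst tel) (simp add: norm_sum)
  also have "... <= (SUM k<n. C * W T * (1/2)^k)" by (intro sum_mono d')
  also have "... <= (\<Sum>k. C * W T * (1/2)^k)"
   using C W1[of T] by (intro sum_le_suminf geo) auto
  also have "... = 2 * C * W T" by (subst suminf_mult) (simp_all add: suminf_geometric)
  finally show ?thesis .
 qed
 have conv: "(%n. ?y n s) ----> vsol T a F s" for s
 proof -
  have "summable (%k. ?y (Suc k) s - ?y k s)"
   by (rule summable_norm_cancel, rule summable_comparison_test'[OF geo]) (use d' in auto)
  then have "(%n. SUM k<n. ?y (Suc k) s - ?y k s) ----> (\<Sum>k. ?y (Suc k) s - ?y k s)"
   by (rule summable_LIMSEQ)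
  then have "(%n. a s + (SUM k<n. ?y (Suc k) s - ?y k s)) ----> a s + (\<Sum>k. ?y (Suc k) s - ?y k s)"
   by (intro tendsto_intros)
  then have "convergent (%n. ?y n s)" by (subst tel[abs_def]) (auto simp: convergent_def)
  then show ?thesis unfolding vsol_def by (simp add: convergent_LIMSEQ_iff)
 qed
 show "(%n. ?y n s) ----> vsol T a F s" by (rule conv)
 have bd2: "norm (vsol T a F s - a s) <= 2 * C * W T" for s
 proof (rule LIMSEQ_le_const2)
  show "(%n. norm (?y n s - a s)) ----> norm (vsol T a F s - a s)" by (intro tendsto_intros conv)
 qed (use bd in blast)
 obtain A where A: "A > 0" "!!s. norm (a s) <= A" using bpath_bound[OF a] by auto
 show ps: "bpath (vsol T a F)"
 proof (rule bpathI)
  show "vsol T a F : bm"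
   using py by (intro borel_measurable_LIMSEQ_metric[OF _ conv]) (auto dest: bpath_meas)
  fix s show "norm (vsol T a F s) <= A + 2 * C * W T"
   using norm_triangle_sub[of "vsol T a F s" "a s"] A(2)[of s] bd2[of s] by linarith
 qed
 obtain G where G: "G > 0" "!!s. norm (F s (a s)) <= G" using bpath_bound[OF Fp[OF a]] by auto
 have "(%n. vint T (%v. F v (?y n v)) s) ----> vint T (%v. F v (vsol T a F v)) s"
  unfolding vint_def set_lebesgue_integral_def
 proof (rule integral_dominated_convergence[where w="%v. indi {0..min s T} v *R (G + K * (2 * C * W T))"])
  show "integrable lborel (%v. indi {0..min s T} v *R (G + K * (2 * C * W T)))"
   using bpath_set_integrable[of "%v. (G + K * (2 * C * W T))"] by (simp add: set_integrable_def)
  have [measurable]: "(%v. F v (?y n v)) : bm" for n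
   by (intro bpath_meas Fp py)
  have [measurable]: "(%v. F v (vsol T a F v)) : bm"
   by (intro bpath_meas Fp ps)
  show "(%v. indi {0..min s T} v *R F v (?y n v)) : bmf lborel" for n by measurable
  show "(%v. indi {0..min s T} v *R F v (vsol T a F v)) : bmf lborel" by measurable
  have "(%n. F v (?y n v)) ----> F v (vsol T a F v)" for v
  proof (rule Lim_null_comparison[where g="%n. K * norm (?y n v - vsol T a F v)", THEN LIM_zero_cancel])
   have "(%n. K * norm (?y n v - vsol T a F v)) ----> K * norm (vsol T a F v - vsol T a F v)"
    by (intro tendsto_intros conv)
   then show "(%n. K * norm (?y n v - vsol T a F v)) ----> 0" by simp
  qed (use Fl in auto)
  then show "AE v in lborel. (%n. indi {0..min s T} v *R F v (?y n v)) ----> indi {0..min s T} v *R F v (vsol T a F v)"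
   by (intro AE_I2 tendsto_intros)
  show "AE v in lborel. norm (indi {0..min s T} v *R F v (?y n v)) <= indi {0..min s T} v *R (G + K * (2 * C * W T))" for n
  proof (rule AE_I2)
   fix v
   have "norm (F v (?y n v)) <= norm (F v (a v)) + norm (F v (?y n v) - F v (a v))"
    by (rule norm_triangle_sub)
   also have "... <= G + K * (2 * C * W T)"
    using Fl[of v "?y n v" "a v"] mult_left_mono[OF bd[of n v] K] G(2)[of v] by linarith
   finally show "norm (indi {0..min s T} v *R F v (?y n v)) <= indi {0..min s T} v *R (G + K * (2 * C * W T))"
    by (auto simp: indicator_def)
  qed
 qed
 then have "(%n. ?y (Suc n) s) ----> a s + vint T (%v. F v (vsol T a F v)) s"
  by (simp add: tendsto_intros)
 moreover have "(%n. ?y (Suc n) s) ----> vsol T a F s" using conv by (rule LIMSEQ_Suc)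
 ultimately show "vsol T a F s = a s + vint T (%v. F v (vsol T a F v)) s"
  using LIMSEQ_unique by blast
qed

text \<open>The equations are given on \<open>[0,T]\<close> only, so the difference is cut off
  outside this interval before Gronwall's inequality is applied. Driving paths that agree merely on
  \<open>[0,T]\<close> can thus be compared.\<close>

lemma vsol_unique_on:
 assumes F: "lip_field K F" and T: "T >= 0"
  and p: "bpath y" "bpath y'"
  and y: "!!s. 0 <= s ==> s <= T ==> y s = a s + vint T (%v. F v (y v)) s"
  and y': "!!s. 0 <= s ==> s <= T ==> y' s = a s + vint T (%v. F v (y' v)) s"
  and s: "0 <= s" "s <= T"
 shows "y s = y' s"
proof -
 have K: "K >= 0" and Fp: "!!y. bpath y ==> bpath (%v. F v (y v))"
  and Fl: "!!v y y'. norm (F v y - F v y') <= K * norm (y - y')"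
  using F by (auto simp: lip_field_def)
 define e where "e s = indi {0..T} s * norm (y s - y' s)" for s
 have pe: "bpath e"
 proof -
  have pd: "bpath (%s. norm (y s - y' s))" using p by (intro bpath_norm bpath_diff)
  then obtain B where B: "B > 0" "!!s. norm (norm (y s - y' s)) <= B" using bpath_bound by blast
  have [measurable]: "(%s. norm (y s - y' s)) : bm" using pd by (rule bpath_meas)
  show ?thesis unfolding e_def
   by (rule bpathI[where B=B]) (use B in \<open>auto simp: indicator_def less_imp_le\<close>)
 qed
 have "e s <= 2 * 0 * exp (2 * K * max 0 (min s T))"
 proof (rule gronwall[OF pe _ K T])
  fix s
  show "0 <= e s" by (auto simp: e_def)
  have v0: "0 <= vint T e s"
   using vint_mono[of "%v. 0" e s T] pe by (auto simp: e_def)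
  show "e s <= 0 + K * vint T e s"
  proof (cases "0 <= s & s <= T")
   case True
   then have "e s = norm (vint T (%v. F v (y v) - F v (y' v)) s)"
    by (subst vint_diff) (use p Fp y[of s] y'[of s] in \<open>auto simp: e_def\<close>)
   also have "... <= vint T (%v. norm (F v (y v) - F v (y' v))) s"
    by (intro norm_vint_le bpath_diff Fp p)
   also have "... <= vint T (%v. K *R e v) s"
    by (intro vint_mono bpath_norm bpath_diff Fp p bpath_scaleR pe) (use Fl in \<open>auto simp: e_def\<close>)
   finally show ?thesis by (simp add: vint_cmult)
  next
   case False
   then have "e s = 0" by (auto simp: e_def indicator_def)
   with v0 K show ?thesis by simp
  qed
 qed simp
 moreover have "0 <= e s" by (auto simp: e_def)
 ultimately have "e s = 0" by simp
 with s show ?thesis by (simp add: e_def)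
qed

lemma picard_measurable_param:
 fixes a :: "'l => real => 'a::euclidean_space"
 assumes a: "(%(l, v). a l v) : bmf (N \<Otimes>\<^sub>M borel)"
  and F[measurable]: "F : bm"
 shows "(%(l, v). picard T (a l) (%v. F) n v) : bmf (N \<Otimes>\<^sub>M borel)"
proof (induction n)
 case (Suc n)
 have "(%(l, v). F (picard T (a l) (%v. F) n v)) : bmf (N \<Otimes>\<^sub>M borel)"
  using measurable_compose[OF Suc F] by (simp add: case_prod_beta)
 from vint_measurable_param[OF this, of T]
 have "(%p. a (fst p) (snd p) + vint T (%v. F (picard T (a (fst p)) (%v. F) n v)) (snd p)) : bmf (N \<Otimes>\<^sub>M borel)"
  using a by (simp add: case_prod_beta)
 then show ?case by (simp add: case_prod_beta)
qed (use a in simp)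

lemma vsol_unique:
 assumes F: "lip_field K F" and T: "T >= 0" and a: "bpath a" and p: "bpath y"
  and y: "!!s. y s = a s + vint T (%v. F v (y v)) s"
 shows "y = vsol T a F"
proof
 fix s
 have e: "y s = vsol T a F s" if "0 <= s" "s <= T" for s
  by (rule vsol_unique_on[where y'="vsol T a F" and a=a, OF F T p bpath_vsol[OF a F T] y vsol_eq[OF a F T] that])
 have "vint T (%v. F v (y v)) s = vint T (%v. F v (vsol T a F v)) s"
  by (rule vint_cong) (use e in auto)
 then show "y s = vsol T a F s" using y[of s] vsol_eq[OF a F T, of s] by simp
qed

lemma bpath_indicator:
 assumes "bpath f" "A : sets borel" shows "bpath (%s. indi A s *R f s)"
proof -
 obtain B where B: "B > 0" "!!s. norm (f s) <= B" using bpath_bound[OF assms(1)] by auto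
 have [measurable]: "f : bm" using assms(1) by (rule bpath_meas)
 note [measurable] = assms(2)
 show ?thesis by (rule bpathI[where B=B]) (use B in \<open>auto simp: indicator_def less_imp_le\<close>)
qed

lemma vint_nonneg:
 fixes f :: "real => real"
 assumes "bpath f" "!!v. 0 <= f v" shows "0 <= vint T f s"
 using vint_mono[of "%v. 0" f s T] assms by simp

text \<open>Cutting the path at \<open>s\<close> allows a bound \<open>r\<close> that is valid only
  before \<open>s\<close>. In \<open>Quad_small\<close> this keeps the bound proportional to
  \<open>s\<close> instead of \<open>T\<close>.\<close>

lemma gronwall_upto:
 fixes y :: "real => 'a::euclidean_space"
 assumes y: "bpath y" and K: "K >= 0" and T: "T >= 0" and r: "r >= 0"
  and le: "!!v. v <= s ==> norm (y v) <= r + K * vint T (%v. norm (y v)) v"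
 shows "norm (y s) <= 2 * r * exp (2 * K * max 0 (min s T))"
proof -
 define e where "e v = indi {..s} v *R norm (y v)" for v
 have pe: "bpath e" unfolding e_def by (rule bpath_indicator) (auto intro: bpath_norm y)
 have e0: "0 <= e v" for v by (auto simp: e_def)
 have "e s <= 2 * r * exp (2 * K * max 0 (min s T))"
 proof (rule gronwall[OF pe e0 K T r])
  fix v
  show "e v <= r + K * vint T e v"
  proof (cases "v <= s")
   case True
   then have "vint T (%v. norm (y v)) v = vint T e v"
    by (intro vint_cong) (auto simp: e_def)
   with le[OF True] True show ?thesis by (simp add: e_def)
  next
   case False
   then have "e v = 0" by (simp add: e_def)
   then show ?thesis using r K vint_nonneg[OF pe e0, of T v] by simp
  qed
 qed
 then show ?thesis by (simp add: e_def)
qed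

lemma gronwall_const:
 fixes y :: "real => 'a::euclidean_space"
 assumes y: "bpath y" and K: "K >= 0" and T: "T >= 0" and r: "r >= 0"
  and le: "!!v. norm (y v) <= r + K * vint T (%v. norm (y v)) v"
 shows "norm (y s) <= 2 * r * exp (2 * K * T)"
proof -
 have "norm (y s) <= 2 * r * exp (2 * K * max 0 (min s T))"
  by (rule gronwall_upto[OF y K T r le])
 also have "... <= 2 * r * exp (2 * K * T)"
  using K T r by (intro mult_left_mono) (auto intro!: mult_left_mono)
 finally show ?thesis .
qed

lemma quadratic_bound_imp_deriv:
 fixes f :: "real => 'a::real_normed_vector"
 assumes "!!e. norm (f e - f 0 - e *R d) <= C * e\<^sup>2"
 shows "(f has_vector_derivative d) (at 0)"
proof -
 have lim: "((%h. C * \<bar>h\<bar>) \<longlongrightarrow> C * \<bar>0\<bar>) (at (0::real))" by (intro tendsto_intros)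
 have "((%h. norm (f (0 + h) - f 0 - h *R d) / norm h) \<longlongrightarrow> 0) (at 0)"
 proof (rule Lim_null_comparison)
  show "((%h. C * \<bar>h\<bar>) \<longlongrightarrow> 0) (at (0::real))" using lim by simp
  show "\<forall>\<^sub>F h in at 0. norm (norm (f (0 + h) - f 0 - h *R d) / norm h) <= C * \<bar>h\<bar>"
  proof (rule eventually_at_filter[THEN iffD2], rule always_eventually, safe)
   fix h :: real assume h: "h ~= 0"
   have "norm (f h - f 0 - h *R d) / \<bar>h\<bar> <= C * h\<^sup>2 / \<bar>h\<bar>"
    using assms by (intro divide_right_mono) auto
   also have "... = C * \<bar>h\<bar>" using h by (simp add: power2_eq_square field_simps)
   finally show "norm (norm (f (0 + h) - f 0 - h *R d) / norm h) <= C * \<bar>h\<bar>" by simp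
  qed
 qed
 then show ?thesis
  unfolding has_vector_derivative_def has_derivative_at by (simp add: bounded_linear_scaleR_left)
qed

section \<open>Derivatives of the solution with respect to the driving path\<close>

locale flow =
 fixes b :: "'a::euclidean_space => 'a" and Db :: "'a => 'a => 'a"
  and D2b :: "'a => 'a => 'a => 'a" and L T :: real
 assumes b_deriv: "(b has_derivative Db x) (at x)"
  and Db_deriv: "((%x. Db x v) has_derivative (%w. D2b x w v)) (at x)"
  and Db_bound: "norm (Db x v) <= L * norm v"
  and D2b_bound: "norm (D2b x w v) <= L * norm w * norm v"
  and D2b_lin: "linear (%v. D2b x w v)"
  and D2b_cont: "continuous_on UNIV (%x. D2b x w v)"
  and L0: "L >= 0" and T0: "T >= 0"
begin

lemma Db_lin: "linear (Db x)"
 using b_deriv[of x] by (blast dest: has_derivative_bounded_linear bounded_linear.linear)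

lemma D2b_lin1: "linear (%w. D2b x w v)"
 using Db_deriv[of v x] by (blast dest: has_derivative_bounded_linear bounded_linear.linear)

lemma Db_diff: "Db x v - Db x w = Db x (v - w)"
 using Db_lin by (simp add: linear_diff)

lemma b_lip: "norm (b x - b y) <= L * norm (x - y)"
proof (rule differentiable_bound[of UNIV b Db])
 show "onorm (Db x) <= L" for x by (rule onorm_bound[OF L0 Db_bound])
qed (auto intro: b_deriv has_derivative_at_withinI)

lemma Db_lip: "norm (Db x v - Db y v) <= L * norm (x - y) * norm v"
proof -
 have "norm (Db x v - Db y v) <= (L * norm v) * norm (x - y)"
 proof (rule differentiable_bound[of UNIV "%x. Db x v" "%x w. D2b x w v"])
  show "onorm (%w. D2b x w v) <= L * norm v" for x
   by (rule onorm_bound) (use L0 D2b_bound in \<open>auto simp: mult_ac\<close>)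
 qed (auto intro: Db_deriv has_derivative_at_withinI)
 then show ?thesis by (simp add: mult_ac)
qed

lemma b_taylor: "norm (b y - b x - Db x (y - x)) <= L * (norm (y - x))\<^sup>2"
proof -
 have "norm ((b y - Db x y) - (b x - Db x x)) <= (L * norm (y - x)) * norm (y - x)"
 proof (rule differentiable_bound[of "cball x (norm (y - x))" "%z. b z - Db x z" "%z w. Db z w - Db x w"])
  fix z assume z: "z : cball x (norm (y - x))"
  show "((%z. b z - Db x z) has_derivative (%w. Db z w - Db x w)) (at z within cball x (norm (y - x)))"
   by (intro has_derivative_diff b_deriv[THEN has_derivative_at_withinI] bounded_linear_imp_has_derivative
     linear_conv_bounded_linear[THEN iffD1] Db_lin)
  show "onorm (%w. Db z w - Db x w) <= L * norm (y - x)"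
  proof (rule onorm_bound)
   fix w
   have "norm (Db z w - Db x w) <= L * norm (z - x) * norm w" by (rule Db_lip)
   also have "... <= L * norm (y - x) * norm w"
    using z L0 by (intro mult_right_mono mult_left_mono) (auto simp: dist_norm norm_minus_commute)
   finally show "norm (Db z w - Db x w) <= L * norm (y - x) * norm w" .
  qed (use L0 in auto)
 qed (auto simp: dist_norm norm_minus_commute)
 moreover have "(b y - Db x y) - (b x - Db x x) = b y - b x - Db x (y - x)"
  by (simp flip: Db_diff)
 ultimately show ?thesis by (simp add: power2_eq_square mult_ac)
qed

lemma b_meas[measurable]: "b : bm"
 by (intro borel_measurable_continuous_onI continuous_at_imp_continuous_on)
  (use b_deriv has_derivative_continuous in blast)

lemma Db_meas[measurable]: "(%x. Db x v) : bm"
 by (intro borel_measurable_continuous_onI continuous_at_imp_continuous_on)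
  (use Db_deriv has_derivative_continuous in blast)

lemma D2b_meas[measurable]: "(%x. D2b x w v) : bm"
 by (intro borel_measurable_continuous_onI D2b_cont)

text \<open>Reduces measurability of \<open>Db (u v) (y v)\<close>, where both arguments vary, to
  the finitely many functions \<open>%x. Db x i\<close>.\<close>

lemma Db_basis: "Db x v = (SUM i:Basis. (v \<bullet> i) *R Db x i)"
proof -
 have "Db x v = Db x (SUM i:Basis. (v \<bullet> i) *R i)" by (simp only: euclidean_representation)
 also have "... = (SUM i:Basis. (v \<bullet> i) *R Db x i)"
  by (simp add: linear_sum[OF Db_lin] linear_scale[OF Db_lin])
 finally show ?thesis .
qed

lemma D2b_basis: "D2b x w v = (SUM i:Basis. SUM j:Basis. ((w \<bullet> i) * (v \<bullet> j)) *R D2b x i j)"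
proof -
 have "D2b x w v = D2b x w (SUM j:Basis. (v \<bullet> j) *R j)" by (simp only: euclidean_representation)
 also have "... = (SUM j:Basis. (v \<bullet> j) *R D2b x w j)"
  by (simp add: linear_sum[OF D2b_lin] linear_scale[OF D2b_lin])
 also have "... = (SUM j:Basis. (v \<bullet> j) *R D2b x (SUM i:Basis. (w \<bullet> i) *R i) j)"
  by (simp only: euclidean_representation)
 also have "... = (SUM j:Basis. (v \<bullet> j) *R (SUM i:Basis. (w \<bullet> i) *R D2b x i j))"
  by (simp add: linear_sum[OF D2b_lin1] linear_scale[OF D2b_lin1])
 also have "... = (SUM j:Basis. SUM i:Basis. ((w \<bullet> i) * (v \<bullet> j)) *R D2b x i j)"
  by (simp add: scaleR_sum_right mult_ac)
 also have "... = (SUM i:Basis. SUM j:Basis. ((w \<bullet> i) * (v \<bullet> j)) *R D2b x i j)"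
  by (rule sum.swap)
 finally show ?thesis .
qed

lemma bpath_b:
 assumes "bpath y" shows "bpath (%v. b (y v))"
proof -
 obtain B where B: "B > 0" "!!s. norm (y s) <= B" using bpath_bound[OF assms] by auto
 have [measurable]: "y : bm" using assms by (rule bpath_meas)
 show ?thesis
 proof (rule bpathI)
  fix s
  have "norm (b (y s)) <= norm (b 0) + norm (b (y s) - b 0)" by (rule norm_triangle_sub)
  also have "... <= norm (b 0) + L * B"
   using b_lip[of "y s" 0] mult_left_mono[OF B(2)[of s] L0] by simp
  finally show "norm (b (y s)) <= norm (b 0) + L * B" .
 qed measurable
qed

lemma bpath_Db:
 assumes u: "bpath u" and y: "bpath y" shows "bpath (%v. Db (u v) (y v))"
proof -
 obtain B where B: "B > 0" "!!s. norm (y s) <= B" using bpath_bound[OF y] by auto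
 have [measurable]: "y : bm" "u : bm"
  using u y by (auto dest: bpath_meas)
 show ?thesis
 proof (rule bpathI)
  fix s
  show "norm (Db (u s) (y s)) <= L * B"
   using Db_bound[of "u s" "y s"] mult_left_mono[OF B(2)[of s] L0] by simp
  show "(%v. Db (u v) (y v)) : bm"
   by (subst Db_basis) measurable
 qed
qed

lemma bpath_D2b:
 assumes u: "bpath u" and w: "bpath w" and y: "bpath y" shows "bpath (%v. D2b (u v) (w v) (y v))"
proof -
 obtain B where B: "B > 0" "!!s. norm (y s) <= B" using bpath_bound[OF y] by auto
 obtain C where C: "C > 0" "!!s. norm (w s) <= C" using bpath_bound[OF w] by auto
 have [measurable]: "y : bm" "u : bm" "w : bm"
  using u y w by (auto dest: bpath_meas)
 show ?thesis
 proof (rule bpathI)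
  fix s
  have "norm (D2b (u s) (w s) (y s)) <= L * norm (w s) * norm (y s)" by (rule D2b_bound)
  also have "... <= L * C * B" using L0 B C by (intro mult_mono) auto
  finally show "norm (D2b (u s) (w s) (y s)) <= L * C * B" .
  show "(%v. D2b (u v) (w v) (y v)) : bm"
   by (subst D2b_basis) measurable
 qed
qed

lemma lip_field_b: "lip_field L (%v. b)"
 unfolding lip_field_def using L0 b_lip bpath_b by auto

lemma lip_field_Db: "bpath u ==> lip_field L (%v. Db (u v))"
 unfolding lip_field_def using L0 bpath_Db by (auto simp: Db_diff Db_bound)

text \<open>\<open>Lin\<close> and \<open>Quad\<close> are the first and second derivatives of the solution \<open>Sol z\<close> with respect to the driving path \<open>z\<close>.\<close>

definition Sol :: "(real => 'a) => real => 'a" where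
 "Sol z = vsol T z (%v. b)"

definition Lin :: "(real => 'a) => (real => 'a) => real => 'a" where
 "Lin z e = vsol T e (%v. Db (Sol z v))"

definition Quad :: "(real => 'a) => (real => 'a) => (real => 'a) => real => 'a" where
 "Quad z e u = vsol T (vint T (%v. D2b (Sol z v) (Lin z u v) (Lin z e v))) (%v. Db (Sol z v))"

lemma bpath_Sol: "bpath z ==> bpath (Sol z)"
 unfolding Sol_def by (rule bpath_vsol[OF _ lip_field_b T0])

lemma Sol_eq: "bpath z ==> Sol z s = z s + vint T (%v. b (Sol z v)) s"
 unfolding Sol_def by (rule vsol_eq[OF _ lip_field_b T0])

lemma bpath_Lin: "bpath z ==> bpath e ==> bpath (Lin z e)"
 unfolding Lin_def by (rule bpath_vsol[OF _ lip_field_Db[OF bpath_Sol] T0])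

lemma Lin_eq: "bpath z ==> bpath e ==> Lin z e s = e s + vint T (%v. Db (Sol z v) (Lin z e v)) s"
 unfolding Lin_def by (rule vsol_eq[OF _ lip_field_Db[OF bpath_Sol] T0])

lemma Lin_unique:
 "bpath z ==> bpath e ==> bpath y ==> (!!s. y s = e s + vint T (%v. Db (Sol z v) (y v)) s) ==> y = Lin z e"
 unfolding Lin_def by (rule vsol_unique[OF lip_field_Db[OF bpath_Sol] T0])

lemma bpath_D2b_Lin:
 "bpath z ==> bpath e ==> bpath u ==> bpath (%v. D2b (Sol z v) (Lin z u v) (Lin z e v))"
 by (intro bpath_D2b bpath_Sol bpath_Lin)

lemma bpath_Quad: "bpath z ==> bpath e ==> bpath u ==> bpath (Quad z e u)"
 unfolding Quad_def
 by (rule bpath_vsol[OF bpath_vint[OF bpath_D2b_Lin] lip_field_Db[OF bpath_Sol] T0])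

lemma Quad_eq:
 "bpath z ==> bpath e ==> bpath u ==> Quad z e u s =
  vint T (%v. D2b (Sol z v) (Lin z u v) (Lin z e v)) s + vint T (%v. Db (Sol z v) (Quad z e u v)) s"
 unfolding Quad_def
 by (rule vsol_eq[OF bpath_vint[OF bpath_D2b_Lin] lip_field_Db[OF bpath_Sol] T0])

definition WT :: real where "WT = 2 * exp (2 * L * T)"

lemma WT_pos: "WT > 0" by (simp add: WT_def)

lemma gronwall_flow:
 assumes y: "bpath y" and r: "r >= 0"
  and le: "!!v. norm (y v) <= r + L * vint T (%v. norm (y v)) v"
 shows "norm (y s) <= r * WT"
 using gronwall_const[OF y L0 T0 r le, of s] by (simp add: WT_def mult_ac)

lemma Sol_lip:
 assumes z: "bpath z" and z': "bpath z'" and r: "!!s. norm (z s - z' s) <= r"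
 shows "norm (Sol z s - Sol z' s) <= r * WT"
proof (rule gronwall_flow[of "%s. Sol z s - Sol z' s"])
 note p = bpath_Sol[OF z] bpath_Sol[OF z']
 show "bpath (%s. Sol z s - Sol z' s)" by (intro bpath_diff p)
 show "r >= 0" by (rule order_trans[OF norm_ge_zero r[of 0]])
 fix s
 have "norm (Sol z s - Sol z' s) = norm ((z s - z' s) + vint T (%v. b (Sol z v) - b (Sol z' v)) s)"
  by (simp add: vint_diff bpath_b p Sol_eq[OF z, of s] Sol_eq[OF z', of s] del: minus_apply) (simp add: algebra_simps)
 also have "... <= r + vint T (%v. norm (b (Sol z v) - b (Sol z' v))) s"
  by (intro norm_triangle_le add_mono r norm_vint_le bpath_diff bpath_b p)
 also have "vint T (%v. norm (b (Sol z v) - b (Sol z' v))) s <= vint T (%v. L *R norm (Sol z v - Sol z' v)) s"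
  by (intro vint_mono bpath_norm bpath_diff bpath_b p bpath_scaleR) (simp add: b_lip)
 finally show "norm (Sol z s - Sol z' s) <= r + L * vint T (%v. norm (Sol z v - Sol z' v)) s"
  by (simp add: vint_cmult)
qed

lemma norm_vint_Db_le:
 assumes "bpath u" "bpath y"
 shows "norm (vint T (%v. Db (u v) (y v)) s) <= L * vint T (%v. norm (y v)) s"
proof -
 have "norm (vint T (%v. Db (u v) (y v)) s) <= vint T (%v. norm (Db (u v) (y v))) s"
  by (intro norm_vint_le bpath_Db assms)
 also have "... <= vint T (%v. L *R norm (y v)) s"
  by (intro vint_mono bpath_norm bpath_Db assms bpath_scaleR) (simp add: Db_bound)
 finally show ?thesis by (simp add: vint_cmult)
qed

lemma linear_gronwall:
 assumes z: "bpath z" and a: "bpath a" and y: "bpath y"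
  and eq: "!!s. y s = a s + vint T (%v. Db (Sol z v) (y v)) s" and r: "!!v. v <= s ==> norm (a v) <= r"
 shows "norm (y s) <= 2 * r * exp (2 * L * max 0 (min s T))"
proof (rule gronwall_upto[OF y L0 T0])
 show "r >= 0" by (rule order_trans[OF norm_ge_zero r[of s]]) simp
 fix v assume v: "v <= s"
 have "norm (y v) <= norm (a v) + norm (vint T (%v. Db (Sol z v) (y v)) v)"
  using norm_triangle_ineq[of "a v" "vint T (%v. Db (Sol z v) (y v)) v"] by (simp only: eq[of v, symmetric])
 also have "... <= r + L * vint T (%v. norm (y v)) v"
  by (intro add_mono r v norm_vint_Db_le bpath_Sol z y)
 finally show "norm (y v) <= r + L * vint T (%v. norm (y v)) v" .
qed

lemma linear_gronwall_WT:
 assumes z: "bpath z" and a: "bpath a" and y: "bpath y"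
  and eq: "!!s. y s = a s + vint T (%v. Db (Sol z v) (y v)) s" and r: "!!v. norm (a v) <= r"
 shows "norm (y s) <= r * WT"
proof -
 have r0: "r >= 0" by (rule order_trans[OF norm_ge_zero r[of 0]])
 have "norm (y s) <= 2 * r * exp (2 * L * max 0 (min s T))" by (rule linear_gronwall[OF z a y eq r])
 also have "... <= 2 * r * exp (2 * L * T)"
  using L0 T0 r0 by (intro mult_left_mono) (auto intro!: mult_left_mono)
 finally show ?thesis by (simp add: WT_def mult_ac)
qed

lemma Lin_bound_upto:
 assumes "bpath z" "bpath e" "!!s. norm (e s) <= r"
 shows "norm (Lin z e s) <= 2 * r * exp (2 * L * max 0 (min s T))"
 by (rule linear_gronwall[OF assms(1,2) bpath_Lin[OF assms(1,2)] Lin_eq[OF assms(1,2)] assms(3)])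

lemma Lin_bound:
 assumes "bpath z" "bpath e" "!!s. norm (e s) <= r"
 shows "norm (Lin z e s) <= r * WT"
 by (rule linear_gronwall_WT[OF assms(1,2) bpath_Lin[OF assms(1,2)] Lin_eq[OF assms(1,2)] assms(3)])

lemma vint_Db_add:
 "bpath u ==> bpath y ==> bpath y' ==>
  vint T (%v. Db (u v) (y v + y' v)) s = vint T (%v. Db (u v) (y v)) s + vint T (%v. Db (u v) (y' v)) s"
 by (subst vint_add[symmetric]) (auto intro: bpath_Db simp: linear_add[OF Db_lin])

lemma vint_Db_scaleR:
 "vint T (%v. Db (u v) (c *R y v)) s = c *R vint T (%v. Db (u v) (y v)) s"
 by (subst vint_scaleR[symmetric]) (auto simp: linear_scale[OF Db_lin])

lemma Lin_add:
 assumes z: "bpath z" and p: "bpath e" "bpath u"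
 shows "Lin z (%s. e s + u s) s = Lin z e s + Lin z u s"
proof -
 have "(%s. Lin z e s + Lin z u s) = Lin z (%s. e s + u s)"
 proof (rule Lin_unique[OF z])
  fix s show "Lin z e s + Lin z u s = e s + u s + vint T (%v. Db (Sol z v) (Lin z e v + Lin z u v)) s"
   by (subst vint_Db_add) (use Lin_eq[OF z p(1), of s] Lin_eq[OF z p(2), of s] in \<open>auto intro: bpath_Sol bpath_Lin z p\<close>)
 qed (intro bpath_add bpath_Lin z p)+
 from fun_cong[OF this, of s] show ?thesis by simp
qed

lemma Lin_scaleR:
 assumes z: "bpath z" and p: "bpath e"
 shows "Lin z (%s. c *R e s) s = c *R Lin z e s"
proof -
 have "(%s. c *R Lin z e s) = Lin z (%s. c *R e s)"
 proof (rule Lin_unique[OF z])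
  fix s show "c *R Lin z e s = c *R e s + vint T (%v. Db (Sol z v) (c *R Lin z e v)) s"
   by (subst vint_Db_scaleR) (use Lin_eq[OF z p, of s] in \<open>auto simp: scaleR_add_right\<close>)
 qed (intro bpath_scaleR bpath_Lin z p)+
 from fun_cong[OF this, of s] show ?thesis by simp
qed

text \<open>The difference is an integral over \<open>[0,s]\<close>, hence of order
  \<open>s\<close>. Together with \<open>Quad_small\<close> this is the source of the additional
  factor \<open>t\<close> in the comparison of the two weights.\<close>

lemma Lin_minus_small:
 assumes z: "bpath z" and p: "bpath e" and r: "!!s. norm (e s) <= r" and s: "0 <= s" "s <= T"
 shows "norm (Lin z e s - e s) <= 2 * L * exp (2 * L * s) * s * r"
proof -
 have r0: "r >= 0" by (rule order_trans[OF norm_ge_zero r[of 0]])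
 have "norm (Lin z e s - e s) = norm (vint T (%v. Db (Sol z v) (Lin z e v)) s)"
  using Lin_eq[OF z p, of s] by simp
 also have "... <= (L * (2 * r * exp (2 * L * s))) * max 0 (min s T)"
 proof (rule norm_vint_bound)
  show "bpath (%v. Db (Sol z v) (Lin z e v))" by (intro bpath_Db bpath_Sol bpath_Lin z p)
  fix v assume v: "0 <= v" "v <= s" "v <= T"
  have "norm (Lin z e v) <= 2 * r * exp (2 * L * max 0 (min v T))"
   by (rule Lin_bound_upto[OF z p r])
  also have "... <= 2 * r * exp (2 * L * s)"
   using v L0 r0 by (intro mult_left_mono) (auto intro!: mult_left_mono)
  finally have "L * norm (Lin z e v) <= L * (2 * r * exp (2 * L * s))"
   using L0 by (rule mult_left_mono)
  then show "norm (Db (Sol z v) (Lin z e v)) <= L * (2 * r * exp (2 * L * s))"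
   using Db_bound[of "Sol z v" "Lin z e v"] by linarith
 qed
 finally show ?thesis using s by (simp add: mult_ac)
qed

text \<open>The forcing term is an integral over \<open>[0,s]\<close> in which \<open>Lin\<close>
  occurs twice; the two exponential factors from there and the one from Gronwall's inequality make
  up the cube.\<close>

lemma Quad_small:
 assumes z: "bpath z" and p: "bpath e" "bpath u" and r: "!!s. norm (e s) <= r"
  and q: "!!s. norm (u s) <= q" and s: "0 <= s" "s <= T"
 shows "norm (Quad z e u s) <= 8 * L * exp (2 * L * s)^3 * s * r * q"
proof -
 have r0: "r >= 0" by (rule order_trans[OF norm_ge_zero r[of 0]])
 have q0: "q >= 0" by (rule order_trans[OF norm_ge_zero q[of 0]])
 have "norm (Quad z e u s) <= 2 * (L * (2 * q * exp (2 * L * s)) * (2 * r * exp (2 * L * s)) * s) * exp (2 * L * max 0 (min s T))"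
 proof (rule linear_gronwall[OF z])
  show "bpath (vint T (%v. D2b (Sol z v) (Lin z u v) (Lin z e v)))"
   by (intro bpath_vint bpath_D2b_Lin z p)
  show "bpath (Quad z e u)" by (intro bpath_Quad z p)
  show "Quad z e u s = vint T (%v. D2b (Sol z v) (Lin z u v) (Lin z e v)) s + vint T (%v. Db (Sol z v) (Quad z e u v)) s" for s
   by (rule Quad_eq[OF z p])
  fix t assume t: "t <= s"
  have "norm (vint T (%v. D2b (Sol z v) (Lin z u v) (Lin z e v)) t)
   <= (L * (2 * q * exp (2 * L * s)) * (2 * r * exp (2 * L * s))) * max 0 (min t T)"
  proof (rule norm_vint_bound)
   show "bpath (%v. D2b (Sol z v) (Lin z u v) (Lin z e v))" by (intro bpath_D2b_Lin z p)
   fix v assume v: "0 <= v" "v <= t" "v <= T"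
   have "norm (Lin z e v) <= 2 * r * exp (2 * L * max 0 (min v T))"
    by (rule Lin_bound_upto[OF z p(1) r])
   also have "... <= 2 * r * exp (2 * L * s)"
    using v t L0 r0 by (intro mult_left_mono) (auto intro!: mult_left_mono)
   finally have 1: "norm (Lin z e v) <= 2 * r * exp (2 * L * s)" .
   have "norm (Lin z u v) <= 2 * q * exp (2 * L * max 0 (min v T))"
    by (rule Lin_bound_upto[OF z p(2) q])
   also have "... <= 2 * q * exp (2 * L * s)"
    using v t L0 q0 by (intro mult_left_mono) (auto intro!: mult_left_mono)
   finally have 2: "norm (Lin z u v) <= 2 * q * exp (2 * L * s)" .
   have "norm (D2b (Sol z v) (Lin z u v) (Lin z e v)) <= L * norm (Lin z u v) * norm (Lin z e v)"
    by (rule D2b_bound)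
   also have "... <= L * (2 * q * exp (2 * L * s)) * (2 * r * exp (2 * L * s))"
    using 1 2 L0 q0 by (intro mult_mono mult_left_mono) auto
   finally show "norm (D2b (Sol z v) (Lin z u v) (Lin z e v)) <= L * (2 * q * exp (2 * L * s)) * (2 * r * exp (2 * L * s))" .
  qed
  also have "... <= (L * (2 * q * exp (2 * L * s)) * (2 * r * exp (2 * L * s))) * s"
   using t s L0 q0 r0 by (intro mult_left_mono) auto
  finally show "norm (vint T (%v. D2b (Sol z v) (Lin z u v) (Lin z e v)) t) <= ..." .
 qed
 then show ?thesis using s by (simp add: mult_ac power3_eq_cube)
qed

text \<open>From \<open>ta\<close> on the forcing is constant, so \<open>Lin z e\<close> solves a
  homogeneous linear equation with initial value \<open>0\<close> at \<open>ta\<close>. This is why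
  an effect that has been cancelled at \<open>ta\<close> stays cancelled up to
  \<open>T\<close>.\<close>

lemma Lin_vanish:
 assumes z: "bpath z" and p: "bpath e" and tau: "0 <= ta" "ta <= T"
  and const: "!!s. ta <= s ==> s <= T ==> e s = e ta" and v0: "Lin z e ta = 0"
 shows "Lin z e T = 0"
proof -
 define y where "y s = indi {ta..T} s *R Lin z e s" for s
 have pL: "bpath (Lin z e)" by (intro bpath_Lin z p)
 have py: "bpath y" unfolding y_def by (rule bpath_indicator[OF pL]) simp
 have pG: "bpath (%v. Db (Sol z v) (Lin z e v))" by (intro bpath_Db bpath_Sol pL z)
 have "norm (y T) <= 2 * 0 * exp (2 * L * max 0 (min T T))"
 proof (rule gronwall_upto[OF py L0 T0])
  fix s
  show "norm (y s) <= 0 + L * vint T (%v. norm (y v)) s"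
  proof (cases "ta <= s & s <= T")
   case True
   have "vint T (%v. Db (Sol z v) (Lin z e v)) s - vint T (%v. Db (Sol z v) (Lin z e v)) ta
    = vint T (%v. Db (Sol z v) (Lin z e v)) s - vint T (%v. indi {..<ta} v *R Db (Sol z v) (Lin z e v)) s"
   proof -
    have "vint T (%v. Db (Sol z v) (Lin z e v)) ta = vint T (%v. indi {..<ta} v *R Db (Sol z v) (Lin z e v)) s"
     unfolding vint_def set_lebesgue_integral_def
    proof (rule integral_cong_AE)
     have [measurable]: "(%v. Db (Sol z v) (Lin z e v)) : bm" using pG by (rule bpath_meas)
     show "(%x. indicat_real {0..min ta T} x *R Db (Sol z x) (Lin z e x)) : bmf lborel"
      "(%x. indicat_real {0..min s T} x *R indicat_real {..<ta} x *R Db (Sol z x) (Lin z e x)) : bmf lborel" by measurable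
     \<comment> \<open>The integrands differ at most at the point \<open>ta\<close>.\<close>
     show "AE x in lborel. indicat_real {0..min ta T} x *R Db (Sol z x) (Lin z e x) =
       indicat_real {0..min s T} x *R indicat_real {..<ta} x *R Db (Sol z x) (Lin z e x)"
      using AE_lborel_singleton[of ta] by eventually_elim (use True tau in \<open>auto simp: indicator_def\<close>)
    qed
    then show ?thesis by simp
   qed
   also have "... = vint T (%v. Db (Sol z v) (Lin z e v) - indi {..<ta} v *R Db (Sol z v) (Lin z e v)) s"
    by (subst vint_diff) (auto intro: pG bpath_indicator)
   also have "... = vint T (%v. Db (Sol z v) (y v)) s"
    by (rule vint_cong) (auto simp: y_def indicator_def linear_0[OF Db_lin])
   finally have "y s = vint T (%v. Db (Sol z v) (y v)) s"
    using True v0 const[of s] Lin_eq[OF z p, of s] Lin_eq[OF z p, of ta]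
    by (simp add: y_def algebra_simps)
   then show ?thesis using norm_vint_Db_le[OF bpath_Sol[OF z] py, of s] by simp
  next
   case False
   then have "y s = 0" by (auto simp: y_def)
   then show ?thesis using vint_nonneg[OF bpath_norm[OF py], of T s] L0 by simp
  qed
 qed simp
 then show ?thesis using tau by (simp add: y_def)
qed

end

lemma has_vector_derivative_seqD:
 assumes "(f has_vector_derivative d) (at (0::real))" "!!n. e n ~= 0" "e ----> 0"
 shows "(%n. (f (e n) - f 0) /\<^sub>R e n) ----> d"
proof -
 have "((%h. norm (f (0 + h) - f 0 - h *R d) / norm h) \<longlongrightarrow> 0) (at 0)"
  using assms(1) unfolding has_vector_derivative_def has_derivative_at by blast
 then have "(%n. norm (f (0 + e n) - f 0 - e n *R d) / norm (e n)) ----> 0"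
  unfolding tendsto_at_iff_sequentially comp_def using assms(2,3) by auto
 moreover have "norm (f (0 + e n) - f 0 - e n *R d) / norm (e n) = norm ((f (e n) - f 0) /\<^sub>R e n - d)" for n
 proof -
  have "(f (e n) - f 0) /\<^sub>R e n - d = (f (0 + e n) - f 0 - e n *R d) /\<^sub>R e n"
   using assms(2)[of n] by (simp add: algebra_simps)
  then show ?thesis by (simp add: divide_inverse mult.commute)
 qed
 ultimately have "(%n. norm ((f (e n) - f 0) /\<^sub>R e n - d)) ----> 0" by simp
 then show ?thesis using tendsto_norm_zero_iff LIM_zero_iff by blast
qed

text \<open>Differentiability is reduced to sequences because dominated convergence is applied along
  sequences.\<close>

lemma has_vector_derivative_seqI:
 assumes "!!e. (!!n. e n ~= 0) ==> e ----> 0 ==> (%n. (f (e n) - f 0) /\<^sub>R e n) ----> d"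
 shows "(f has_vector_derivative d) (at (0::real))"
proof -
 have "((%h. norm (f (0 + h) - f 0 - h *R d) / norm h) \<longlongrightarrow> 0) (at 0)"
  unfolding tendsto_at_iff_sequentially comp_def
 proof (intro allI impI)
  fix e :: "nat => real" assume e: "ALL i. e i : UNIV - {0}" "e ----> 0"
  then have "(%n. (f (e n) - f 0) /\<^sub>R e n) ----> d" by (intro assms) auto
  then have "(%n. norm ((f (e n) - f 0) /\<^sub>R e n - d)) ----> 0"
   by (simp add: LIM_zero tendsto_norm_zero)
  moreover have "norm (f (0 + e n) - f 0 - e n *R d) / norm (e n) = norm ((f (e n) - f 0) /\<^sub>R e n - d)" for n
  proof -
   have "(f (e n) - f 0) /\<^sub>R e n - d = (f (0 + e n) - f 0 - e n *R d) /\<^sub>R e n"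
    using e(1) by (simp add: algebra_simps)
   then show ?thesis by (simp add: divide_inverse mult.commute)
  qed
  ultimately show "(%n. norm (f (0 + e n) - f 0 - e n *R d) / norm (e n)) ----> 0" by simp
 qed
 then show ?thesis
  unfolding has_vector_derivative_def has_derivative_at by (simp add: bounded_linear_scaleR_left)
qed

context flow
begin

lemma Lin_lip:
 assumes z: "bpath z" and z': "bpath z'" and p: "bpath e"
  and r: "!!s. norm (z s - z' s) <= r" and q: "!!s. norm (e s) <= q"
 shows "norm (Lin z' e s - Lin z e s) <= L * (r * WT) * (q * WT) * T * WT"
proof -
 have r0: "r >= 0" by (rule order_trans[OF norm_ge_zero r[of 0]])
 have q0: "q >= 0" by (rule order_trans[OF norm_ge_zero q[of 0]])
 define a where "a v = vint T (%v. Db (Sol z' v) (Lin z' e v) - Db (Sol z v) (Lin z' e v)) v" for v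
 note P = bpath_Sol[OF z] bpath_Sol[OF z'] bpath_Lin[OF z' p] bpath_Lin[OF z p]
 have pd: "bpath (%v. Db (Sol z' v) (Lin z' e v) - Db (Sol z v) (Lin z' e v))"
  by (intro bpath_diff bpath_Db P)
 show ?thesis
 proof (rule linear_gronwall_WT[OF z, of a "%s. Lin z' e s - Lin z e s"])
  show "bpath a" unfolding a_def by (intro bpath_vint pd)
  show "bpath (%s. Lin z' e s - Lin z e s)" by (intro bpath_diff P)
  fix s
  have "vint T (%v. Db (Sol z v) (Lin z' e v - Lin z e v)) s =
   vint T (%v. Db (Sol z v) (Lin z' e v)) s - vint T (%v. Db (Sol z v) (Lin z e v)) s"
   by (subst vint_diff[symmetric]) (auto intro!: bpath_Db P simp: Db_diff)
  moreover have "a s = vint T (%v. Db (Sol z' v) (Lin z' e v)) s - vint T (%v. Db (Sol z v) (Lin z' e v)) s"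
   unfolding a_def by (subst vint_diff) (auto intro!: bpath_Db P)
  ultimately show "Lin z' e s - Lin z e s = a s + vint T (%v. Db (Sol z v) (Lin z' e v - Lin z e v)) s"
   using Lin_eq[OF z p, of s] Lin_eq[OF z' p, of s] by (simp add: algebra_simps)
  have "norm (a s) <= L * (r * WT) * (q * WT) * max 0 (min s T)"
   unfolding a_def
  proof (rule norm_vint_bound[OF pd])
   fix v
   have "norm (Db (Sol z' v) (Lin z' e v) - Db (Sol z v) (Lin z' e v)) <= L * norm (Sol z' v - Sol z v) * norm (Lin z' e v)"
    by (rule Db_lip)
   also have "... <= L * (r * WT) * (q * WT)"
    using Sol_lip[OF z z' r, of v] Lin_bound[OF z' p q, of v] L0 WT_pos r0
    by (intro mult_mono) (auto simp: norm_minus_commute)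
   finally show "norm (Db (Sol z' v) (Lin z' e v) - Db (Sol z v) (Lin z' e v)) <= L * (r * WT) * (q * WT)" .
  qed
  also have "... <= L * (r * WT) * (q * WT) * T"
   using L0 WT_pos r0 q0 T0 by (intro mult_left_mono) auto
  finally show "norm (a s) <= L * (r * WT) * (q * WT) * T" .
 qed
qed

text \<open>The bound on \<open>D2b\<close> makes the Taylor remainder \<open>g\<close> quadratic in
  \<open>e\<close>, and Gronwall's inequality transfers this order to the defect.\<close>

lemma Sol_deriv:
 assumes z: "bpath z" and p: "bpath u"
 shows "((%e. Sol (%s. z s + e *R u s) s) has_vector_derivative Lin z u s) (at 0)"
proof -
 obtain q where q: "q > 0" "!!s. norm (u s) <= q" using bpath_bound[OF p] by auto
 show ?thesis
 proof (rule quadratic_bound_imp_deriv)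
  fix e :: real
  let ?z = "%s. z s + e *R u s"
  have z': "bpath ?z" by (intro bpath_add bpath_scaleR z p)
  note P = bpath_Sol[OF z] bpath_Sol[OF z'] bpath_Lin[OF z p]
  have d: "norm (Sol ?z v - Sol z v) <= \<bar>e\<bar> * q * WT" for v
   by (rule Sol_lip[OF z' z]) (use q(2) in \<open>simp add: mult_left_mono\<close>)
  define g where "g v = b (Sol ?z v) - b (Sol z v) - Db (Sol z v) (Sol ?z v - Sol z v)" for v
  have pg: "bpath g" unfolding g_def by (intro bpath_diff bpath_b bpath_Db P)
  have gb: "norm (g v) <= L * (\<bar>e\<bar> * q * WT)\<^sup>2" for v
  proof -
   have "norm (g v) <= L * (norm (Sol ?z v - Sol z v))\<^sup>2" unfolding g_def by (rule b_taylor)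
   also have "... <= L * (\<bar>e\<bar> * q * WT)\<^sup>2" using d L0 by (intro mult_left_mono power_mono) auto
   finally show ?thesis .
  qed
  have "norm (Sol ?z s - Sol z s - e *R Lin z u s) <= (L * (\<bar>e\<bar> * q * WT)\<^sup>2 * T) * WT"
  proof (rule linear_gronwall_WT[OF z, of "vint T g"])
   show "bpath (vint T g)" by (intro bpath_vint pg)
   show "bpath (%s. Sol ?z s - Sol z s - e *R Lin z u s)" by (intro bpath_diff bpath_scaleR P)
   fix s
   have "vint T g s = vint T (%v. b (Sol ?z v) - b (Sol z v)) s - vint T (%v. Db (Sol z v) (Sol ?z v - Sol z v)) s"
    unfolding g_def by (subst vint_diff) (auto intro!: bpath_diff bpath_b bpath_Db P)
   moreover have "vint T (%v. b (Sol ?z v) - b (Sol z v)) s = vint T (%v. b (Sol ?z v)) s - vint T (%v. b (Sol z v)) s"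
    by (subst vint_diff) (auto intro!: bpath_b P)
   moreover have "vint T (%v. Db (Sol z v) (Sol ?z v - Sol z v - e *R Lin z u v)) s
    = vint T (%v. Db (Sol z v) (Sol ?z v - Sol z v)) s - vint T (%v. Db (Sol z v) (e *R Lin z u v)) s"
    by (subst vint_diff[symmetric]) (auto intro!: bpath_diff bpath_scaleR bpath_Db P simp: Db_diff)
   ultimately show "Sol ?z s - Sol z s - e *R Lin z u s = vint T g s + vint T (%v. Db (Sol z v) (Sol ?z v - Sol z v - e *R Lin z u v)) s"
    using Lin_eq[OF z p, of s] Sol_eq[OF z, of s] Sol_eq[OF z', of s]
    by (simp add: vint_Db_scaleR algebra_simps)
   have "norm (vint T g s) <= L * (\<bar>e\<bar> * q * WT)\<^sup>2 * max 0 (min s T)"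
    by (rule norm_vint_bound[OF pg gb])
   also have "... <= L * (\<bar>e\<bar> * q * WT)\<^sup>2 * T" using L0 T0 by (intro mult_left_mono) auto
   finally show "norm (vint T g s) <= L * (\<bar>e\<bar> * q * WT)\<^sup>2 * T" .
  qed
  then show "norm (Sol ?z s - Sol (%s. z s + 0 *R u s) s - e *R Lin z u s) <= (L * (q * WT)\<^sup>2 * T * WT) * e\<^sup>2"
   by (simp add: power_mult_distrib mult_ac)
 qed
qed

lemma vint_abs_le:
 fixes g :: "real => 'a"
 assumes "bpath g" shows "norm (vint T g s) <= vint T (%v. norm (g v)) T"
proof -
 have "norm (vint T g s) <= vint T (%v. norm (g v)) s" by (rule norm_vint_le[OF assms])
 also have "... <= vint T (%v. norm (g v)) T"
  unfolding vint_def set_lebesgue_integral_def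
 proof (rule integral_mono)
  have I: "integrable lborel (%v. indicat_real {0..min s T} v *R norm (g v))" for s
   using bpath_set_integrable[OF bpath_norm[OF assms], of 0 "min s T"] unfolding set_integrable_def .
  show "integrable lborel (%v. indicat_real {0..min s T} v *R norm (g v))"
   "integrable lborel (%v. indicat_real {0..min T T} v *R norm (g v))" by (rule I)+
 qed (auto simp: indicator_def)
 finally show ?thesis .
qed

text \<open>Gronwall's inequality is fed with the integral of \<open>norm (g n)\<close> over
  \<open>[0,T]\<close> instead of a supremum, so that bounded pointwise convergence of the forcing
  is enough.\<close>

lemma linear_limit:
 assumes z: "bpath z" and y: "!!n. bpath (y n)" and g: "!!n. bpath (g n)"
  and eq: "!!n s. y n s = vint T (g n) s + vint T (%v. Db (Sol z v) (y n v)) s"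
  and G: "!!n v. norm (g n v) <= G" and lim: "!!v. (%n. g n v) ----> 0"
 shows "(%n. y n s) ----> 0"
proof -
 have "(%n. vint T (%v. norm (g n v)) T) ----> (LINT v::real|lborel. 0)"
  unfolding vint_def set_lebesgue_integral_def
 proof (rule integral_dominated_convergence[where w="%v. indi {0..min T T} v *R G"])
  show "integrable lborel (%v. indi {0..min T T} v *R G)"
   using bpath_set_integrable[of "%v. G"] by (simp add: set_integrable_def)
  have [measurable]: "g n : bm" for n using g by (auto dest: bpath_meas)
  show "(%v. indi {0..min T T} v *R norm (g n v)) : bmf lborel" for n by measurable
  have "(%n. indi {0..min T T} v *R norm (g n v)) ----> indi {0..min T T} v *R 0" for v
   by (intro tendsto_intros tendsto_norm_zero lim)
  then show "AE v in lborel. (%n. indi {0..min T T} v *R norm (g n v)) ----> 0"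
   by simp
  show "AE v in lborel. norm (indi {0..min T T} v *R norm (g n v)) <= indi {0..min T T} v *R G" for n
   by (intro AE_I2) (use G in \<open>auto simp: indicator_def\<close>)
 qed simp
 then have l: "(%n. vint T (%v. norm (g n v)) T * WT) ----> 0"
  by (simp add: tendsto_mult_left_zero)
 show ?thesis
 proof (rule Lim_null_comparison[OF always_eventually l], rule allI)
  fix n
  show "norm (y n s) <= vint T (%v. norm (g n v)) T * WT"
   by (rule linear_gronwall_WT[OF z bpath_vint[OF g] y eq vint_abs_le[OF g]])
 qed
qed

lemma D2b_tendsto:
 assumes "x ----> x0" "w ----> w0" "v ----> v0"
 shows "(%n. D2b (x n) (w n) (v n)) ----> D2b x0 w0 v0"
proof -
 have "(%n. D2b (x n) i j) ----> D2b x0 i j" for i j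
  by (rule continuous_on_tendsto_compose[OF D2b_cont assms(1)]) auto
 then have "(%n. SUM i:Basis. SUM j:Basis. ((w n \<bullet> i) * (v n \<bullet> j)) *R D2b (x n) i j)
  ----> (SUM i:Basis. SUM j:Basis. ((w0 \<bullet> i) * (v0 \<bullet> j)) *R D2b x0 i j)"
  by (intro tendsto_intros assms) auto
 then show ?thesis by (simp flip: D2b_basis)
qed

lemma Sol_tendsto:
 assumes z: "bpath z" and z': "!!n. bpath (z' n)" and r: "!!n s. norm (z' n s - z s) <= r n" "r ----> 0"
 shows "(%n. Sol (z' n) s) ----> Sol z s"
proof (rule Lim_null_comparison[where g="%n. r n * WT", THEN LIM_zero_cancel])
 show "\<forall>\<^sub>F n in sequentially. norm (Sol (z' n) s - Sol z s) <= r n * WT"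
  by (intro always_eventually allI Sol_lip z z' r(1))
qed (use tendsto_mult_left_zero[OF r(2)] in auto)

lemma Lin_tendsto:
 assumes z: "bpath z" and z': "!!n. bpath (z' n)" and r: "!!n s. norm (z' n s - z s) <= r n" "r ----> 0"
  and p: "bpath e"
 shows "(%n. Lin (z' n) e s) ----> Lin z e s"
proof -
 obtain q where q: "q > 0" "!!s. norm (e s) <= q" using bpath_bound[OF p] by auto
 show ?thesis
 proof (rule Lim_null_comparison[where g="%n. L * (r n * WT) * (q * WT) * T * WT", THEN LIM_zero_cancel])
  show "\<forall>\<^sub>F n in sequentially. norm (Lin (z' n) e s - Lin z e s) <= L * (r n * WT) * (q * WT) * T * WT"
   by (intro always_eventually allI Lin_lip z z' p q) (use r in \<open>auto simp: norm_minus_commute\<close>)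
  have "(%n. L * (r n * WT) * (q * WT) * T * WT) ----> L * (0 * WT) * (q * WT) * T * WT"
   by (intro tendsto_intros r)
  then show "(%n. L * (r n * WT) * (q * WT) * T * WT) ----> 0" by simp
 qed
qed

text \<open>As \<open>D2b\<close> is merely continuous in the base point, the remainder has no rate.
  The defect \<open>y n\<close> solves a linear equation whose forcing \<open>g n\<close> is bounded
  and tends to \<open>0\<close> pointwise, which is the situation of
  \<open>linear_limit\<close>.\<close>

lemma Lin_deriv:
 assumes z: "bpath z" and p: "bpath u" and p': "bpath ze"
 shows "((%e. Lin (%s. z s + e *R ze s) u s) has_vector_derivative Quad z u ze s) (at 0)"
proof (rule has_vector_derivative_seqI)
 fix e :: "nat => real" assume e0: "!!n. e n ~= 0" and e: "e ----> 0"
 obtain q where q: "q > 0" "!!s. norm (u s) <= q" using bpath_bound[OF p] by auto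
 obtain q' where q': "q' > 0" "!!s. norm (ze s) <= q'" using bpath_bound[OF p'] by auto
 define z' where "z' n s = z s + e n *R ze s" for n s
 have z': "bpath (z' n)" for n unfolding z'_def by (intro bpath_add bpath_scaleR z p')
 have r: "norm (z' n s - z s) <= \<bar>e n\<bar> * q'" for n s
  by (simp add: z'_def q' mult_left_mono)
 have r': "(%n. \<bar>e n\<bar> * q') ----> 0" using e by (intro tendsto_mult_left_zero tendsto_rabs_zero)
 note P = bpath_Sol[OF z] bpath_Sol[OF z'] bpath_Lin[OF z p] bpath_Lin[OF z' p] bpath_Lin[OF z p'] bpath_Quad[OF z p p']
 define g where "g n v = (Db (Sol (z' n) v) (Lin (z' n) u v) - Db (Sol z v) (Lin (z' n) u v)) /\<^sub>R e n
   - D2b (Sol z v) (Lin z ze v) (Lin z u v)" for n v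
 define y where "y n s = (Lin (z' n) u s - Lin z u s) /\<^sub>R e n - Quad z u ze s" for n s
 have "(%n. y n s) ----> 0"
 proof (rule linear_limit[OF z])
  show "bpath (y n)" for n unfolding y_def by (intro bpath_diff bpath_scaleR P)
  show pg: "bpath (g n)" for n unfolding g_def by (intro bpath_diff bpath_scaleR bpath_Db bpath_D2b P)
  fix n s
  have 1: "vint T (%v. Db (Sol z v) (y n v)) s =
   (vint T (%v. Db (Sol z v) (Lin (z' n) u v)) s - vint T (%v. Db (Sol z v) (Lin z u v)) s) /\<^sub>R e n
   - vint T (%v. Db (Sol z v) (Quad z u ze v)) s"
   unfolding y_def
   by (subst vint_diff[symmetric], (intro bpath_Db P)+, subst vint_scaleR[symmetric], subst vint_diff[symmetric])
    (auto intro!: bpath_Db P bpath_scaleR bpath_diff simp: linear_scale[OF Db_lin] linear_diff[OF Db_lin] simp del: scaleR_right_diff_distrib)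
  have 2: "vint T (g n) s = (vint T (%v. Db (Sol (z' n) v) (Lin (z' n) u v)) s - vint T (%v. Db (Sol z v) (Lin (z' n) u v)) s) /\<^sub>R e n
    - vint T (%v. D2b (Sol z v) (Lin z ze v) (Lin z u v)) s"
   unfolding g_def
   by (subst vint_diff, (intro bpath_Db bpath_D2b P bpath_scaleR bpath_diff)+, subst vint_scaleR, subst vint_diff)
    (auto intro!: bpath_Db P)
  have 3: "Lin (z' n) u s - Lin z u s = vint T (%v. Db (Sol (z' n) v) (Lin (z' n) u v)) s - vint T (%v. Db (Sol z v) (Lin z u v)) s"
   using Lin_eq[OF z p, of s] Lin_eq[OF z' p, of n s] by simp
  show "y n s = vint T (g n) s + vint T (%v. Db (Sol z v) (y n v)) s"
   unfolding 1 2 by (subst y_def, subst 3, subst Quad_eq[OF z p p', of s]) (simp add: algebra_simps)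
  show "norm (g n v) <= L * (q' * WT) * (q * WT) + L * (q' * WT) * (q * WT)" for v
  proof -
   have "norm ((Db (Sol (z' n) v) (Lin (z' n) u v) - Db (Sol z v) (Lin (z' n) u v)) /\<^sub>R e n)
    <= (L * norm (Sol (z' n) v - Sol z v) * norm (Lin (z' n) u v)) / \<bar>e n\<bar>"
    using Db_lip[of "Sol (z' n) v" "Lin (z' n) u v" "Sol z v"] by (simp add: divide_inverse mult.commute mult_left_mono)
   also have "... <= (L * (\<bar>e n\<bar> * q' * WT) * (q * WT)) / \<bar>e n\<bar>"
    using Sol_lip[OF z' z r, of n v] Lin_bound[OF z' p q(2), of n v] L0 WT_pos q'
    by (intro divide_right_mono mult_mono mult_left_mono) auto
   also have "... = L * (q' * WT) * (q * WT)" using e0[of n] by simp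
   finally have A: "norm ((Db (Sol (z' n) v) (Lin (z' n) u v) - Db (Sol z v) (Lin (z' n) u v)) /\<^sub>R e n) <= L * (q' * WT) * (q * WT)" .
   have "norm (D2b (Sol z v) (Lin z ze v) (Lin z u v)) <= L * norm (Lin z ze v) * norm (Lin z u v)" by (rule D2b_bound)
   also have "... <= L * (q' * WT) * (q * WT)"
    using Lin_bound[OF z p q(2), of v] Lin_bound[OF z p' q'(2), of v] L0 WT_pos q'
    by (intro mult_mono mult_left_mono) auto
   finally show ?thesis unfolding g_def using A norm_triangle_ineq4 add_mono order_trans by blast
  qed
  fix v
  have "((%e. Db (Sol (%s. z s + e *R ze s) v) (Lin z u v)) has_vector_derivative D2b (Sol z v) (Lin z ze v) (Lin z u v)) (at 0)"
  proof -
   have d: "((%e. Sol (%s. z s + e *R ze s) v) has_derivative (%e. e *R Lin z ze v)) (at 0)"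
    using Sol_deriv[OF z p', of v] by (simp add: has_vector_derivative_def)
   show ?thesis
    using has_derivative_compose[OF d, of "%x. Db x (Lin z u v)" "%w. D2b (Sol z v) w (Lin z u v)"]
     Db_deriv[of "Lin z u v" "Sol z v"]
    by (simp add: has_vector_derivative_def linear_scale[OF D2b_lin1])
  qed
  from has_vector_derivative_seqD[OF this e0 e]
  have "(%n. (Db (Sol (z' n) v) (Lin z u v) - Db (Sol z v) (Lin z u v)) /\<^sub>R e n - D2b (Sol z v) (Lin z ze v) (Lin z u v)) ----> 0"
   by (simp add: z'_def[abs_def] LIM_zero)
  \<comment> \<open>Freezing the direction at \<open>Lin z u v\<close> in the difference quotient is
    harmless: the quotient is Lipschitz in the direction with a constant independent of
    \<open>n\<close>, and the directions converge.\<close>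
  moreover have "(%n. (Db (Sol (z' n) v) (Lin (z' n) u v - Lin z u v) - Db (Sol z v) (Lin (z' n) u v - Lin z u v)) /\<^sub>R e n) ----> 0"
  proof (rule Lim_null_comparison)
   have "(%n. (L * q' * WT) * norm (Lin (z' n) u v - Lin z u v)) ----> (L * q' * WT) * norm (Lin z u v - Lin z u v)"
    by (intro tendsto_intros Lin_tendsto[OF z z' r r' p])
   then show "(%n. (L * q' * WT) * norm (Lin (z' n) u v - Lin z u v)) ----> 0" by simp
   show "\<forall>\<^sub>F n in sequentially. norm ((Db (Sol (z' n) v) (Lin (z' n) u v - Lin z u v) - Db (Sol z v) (Lin (z' n) u v - Lin z u v)) /\<^sub>R e n)
     <= (L * q' * WT) * norm (Lin (z' n) u v - Lin z u v)"
   proof (intro always_eventually allI)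
    fix n
    let ?d = "Lin (z' n) u v - Lin z u v"
    have "norm ((Db (Sol (z' n) v) ?d - Db (Sol z v) ?d) /\<^sub>R e n) <= (L * norm (Sol (z' n) v - Sol z v) * norm ?d) / \<bar>e n\<bar>"
     using Db_lip[of "Sol (z' n) v" ?d "Sol z v"] by (simp add: divide_inverse mult.commute mult_left_mono)
    also have "... <= (L * (\<bar>e n\<bar> * q' * WT) * norm ?d) / \<bar>e n\<bar>"
     using Sol_lip[OF z' z r, of n v] L0 by (intro divide_right_mono mult_right_mono mult_left_mono) auto
    also have "... = (L * q' * WT) * norm ?d" using e0[of n] by simp
    finally show "norm ((Db (Sol (z' n) v) ?d - Db (Sol z v) ?d) /\<^sub>R e n) <= (L * q' * WT) * norm ?d" .
   qed
  qed
  ultimately have "(%n. ((Db (Sol (z' n) v) (Lin z u v) - Db (Sol z v) (Lin z u v)) /\<^sub>R e n - D2b (Sol z v) (Lin z ze v) (Lin z u v))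
   + (Db (Sol (z' n) v) (Lin (z' n) u v - Lin z u v) - Db (Sol z v) (Lin (z' n) u v - Lin z u v)) /\<^sub>R e n) ----> 0 + 0"
   by (rule tendsto_add)
  moreover have "((Db (Sol (z' n) v) (Lin z u v) - Db (Sol z v) (Lin z u v)) /\<^sub>R e n - D2b (Sol z v) (Lin z ze v) (Lin z u v))
   + (Db (Sol (z' n) v) (Lin (z' n) u v - Lin z u v) - Db (Sol z v) (Lin (z' n) u v - Lin z u v)) /\<^sub>R e n = g n v" for n
   unfolding g_def by (simp add: Db_diff[symmetric] algebra_simps)
  ultimately show "(%n. g n v) ----> 0" by simp
 qed
 then have "(%n. (Lin (z' n) u s - Lin z u s) /\<^sub>R e n) ----> Quad z u ze s"
  unfolding y_def by (rule LIM_zero_cancel)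
 then show "(%n. (Lin (%s. z s + e n *R ze s) u s - Lin (%s. z s + 0 *R ze s) u s) /\<^sub>R e n) ----> Quad z u ze s"
  by (simp add: z'_def[abs_def])
qed

lemma D2b_Lin_bound:
 assumes z: "bpath z" and p: "bpath e" "bpath u" and r: "!!s. norm (e s) <= r" and q: "!!s. norm (u s) <= q"
 shows "norm (D2b (Sol z v) (Lin z u v) (Lin z e v)) <= L * (q * WT) * (r * WT)"
proof -
 have q0: "q >= 0" by (rule order_trans[OF norm_ge_zero q[of 0]])
 have "norm (D2b (Sol z v) (Lin z u v) (Lin z e v)) <= L * norm (Lin z u v) * norm (Lin z e v)" by (rule D2b_bound)
 also have "... <= L * (q * WT) * (r * WT)"
  using Lin_bound[OF z p(1) r, of v] Lin_bound[OF z p(2) q, of v] L0 WT_pos q0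
  by (intro mult_mono mult_left_mono) auto
 finally show ?thesis .
qed

lemma Quad_bound:
 assumes z: "bpath z" and p: "bpath e" "bpath u" and r: "!!s. norm (e s) <= r" and q: "!!s. norm (u s) <= q"
 shows "norm (Quad z e u s) <= (L * (q * WT) * (r * WT) * T) * WT"
proof (rule linear_gronwall_WT[OF z _ _ Quad_eq[OF z p]])
 have r0: "r >= 0" by (rule order_trans[OF norm_ge_zero r[of 0]])
 have q0: "q >= 0" by (rule order_trans[OF norm_ge_zero q[of 0]])
 show "bpath (vint T (%v. D2b (Sol z v) (Lin z u v) (Lin z e v)))" by (intro bpath_vint bpath_D2b_Lin z p)
 show "bpath (Quad z e u)" by (intro bpath_Quad z p)
 fix s
 have "norm (vint T (%v. D2b (Sol z v) (Lin z u v) (Lin z e v)) s) <= L * (q * WT) * (r * WT) * max 0 (min s T)"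
  by (rule norm_vint_bound[OF bpath_D2b_Lin[OF z p] D2b_Lin_bound[OF z p r q]])
 also have "... <= L * (q * WT) * (r * WT) * T"
  using L0 WT_pos r0 q0 T0 by (intro mult_left_mono) auto
 finally show "norm (vint T (%v. D2b (Sol z v) (Lin z u v) (Lin z e v)) s) <= L * (q * WT) * (r * WT) * T" .
qed

lemma Quad_tendsto:
 assumes z: "bpath z" and z': "!!n. bpath (z' n)" and r: "!!n s. norm (z' n s - z s) <= r n" "r ----> 0"
  and p: "bpath e" and p': "bpath u"
 shows "(%n. Quad (z' n) e u s) ----> Quad z e u s"
proof -
 obtain q where q: "q > 0" "!!s. norm (e s) <= q" using bpath_bound[OF p] by auto
 obtain q' where q': "q' > 0" "!!s. norm (u s) <= q'" using bpath_bound[OF p'] by auto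
 obtain R where R: "R > 0" "!!n. norm (r n) <= R" using r(2) by (metis BseqE convergentI convergent_imp_Bseq)
 note P = bpath_Sol[OF z] bpath_Sol[OF z'] bpath_Lin[OF z p] bpath_Lin[OF z' p] bpath_Lin[OF z p'] bpath_Lin[OF z' p']
  bpath_Quad[OF z p p'] bpath_Quad[OF z' p p']
 define B where "B = (L * (q' * WT) * (q * WT) * T) * WT"
 have B: "norm (Quad (z' n) e u v) <= B" for n v
  unfolding B_def by (rule Quad_bound[OF z' p p' q(2) q'(2)])
 define g where "g n v = (Db (Sol (z' n) v) (Quad (z' n) e u v) - Db (Sol z v) (Quad (z' n) e u v))
   + (D2b (Sol (z' n) v) (Lin (z' n) u v) (Lin (z' n) e v) - D2b (Sol z v) (Lin z u v) (Lin z e v))" for n v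
 have gn: "norm (Db (Sol (z' n) v) (Quad (z' n) e u v) - Db (Sol z v) (Quad (z' n) e u v)) <= L * (norm (r n) * WT) * B" for n v
 proof -
  have "norm (Db (Sol (z' n) v) (Quad (z' n) e u v) - Db (Sol z v) (Quad (z' n) e u v)) <= L * norm (Sol (z' n) v - Sol z v) * norm (Quad (z' n) e u v)"
   by (rule Db_lip)
  also have "... <= L * (norm (r n) * WT) * B"
  proof (intro mult_mono mult_left_mono)
   have "norm (z' n s - z s) <= norm (r n)" for s using r(1)[of n s] by simp
   then show "norm (Sol (z' n) v - Sol z v) <= norm (r n) * WT" by (intro Sol_lip z z')
  qed (use B L0 WT_pos in auto)
  finally show ?thesis .
 qed
 have "(%n. Quad (z' n) e u s - Quad z e u s) ----> 0"
 proof (rule linear_limit[OF z])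
  show "bpath (%s. Quad (z' n) e u s - Quad z e u s)" for n by (intro bpath_diff P)
  show "bpath (g n)" for n unfolding g_def by (intro bpath_diff bpath_add bpath_Db bpath_D2b P)
  fix n s
  have 1: "vint T (%v. Db (Sol z v) (Quad (z' n) e u v - Quad z e u v)) s =
   vint T (%v. Db (Sol z v) (Quad (z' n) e u v)) s - vint T (%v. Db (Sol z v) (Quad z e u v)) s"
   by (subst vint_diff[symmetric]) (auto intro!: bpath_Db P simp: linear_diff[OF Db_lin])
  have 2: "vint T (g n) s = (vint T (%v. Db (Sol (z' n) v) (Quad (z' n) e u v)) s - vint T (%v. Db (Sol z v) (Quad (z' n) e u v)) s)
    + (vint T (%v. D2b (Sol (z' n) v) (Lin (z' n) u v) (Lin (z' n) e v)) s - vint T (%v. D2b (Sol z v) (Lin z u v) (Lin z e v)) s)"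
   unfolding g_def
   by (subst vint_add, (intro bpath_Db bpath_D2b P bpath_diff)+, subst vint_diff, (intro bpath_Db bpath_D2b P)+, subst vint_diff)
    (auto intro!: bpath_D2b P)
  show "Quad (z' n) e u s - Quad z e u s = vint T (g n) s + vint T (%v. Db (Sol z v) (Quad (z' n) e u v - Quad z e u v)) s"
   unfolding 1 2 using Quad_eq[OF z p p', of s] Quad_eq[OF z' p p', of n s] by (simp add: algebra_simps)
  fix v
  show "norm (g n v) <= L * (R * WT) * B + (L * (q' * WT) * (q * WT) + L * (q' * WT) * (q * WT))"
  proof -
   have B0: "B >= 0" by (rule order_trans[OF norm_ge_zero B])
   have "L * (norm (r n) * WT) * B <= L * (R * WT) * B"
    using R L0 WT_pos B0 by (intro mult_right_mono mult_left_mono) auto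
   with gn[of n v] have "norm (Db (Sol (z' n) v) (Quad (z' n) e u v) - Db (Sol z v) (Quad (z' n) e u v)) <= L * (R * WT) * B"
    by linarith
   moreover have "norm (D2b (Sol (z' n) v) (Lin (z' n) u v) (Lin (z' n) e v) - D2b (Sol z v) (Lin z u v) (Lin z e v))
     <= L * (q' * WT) * (q * WT) + L * (q' * WT) * (q * WT)"
    by (rule order_trans[OF norm_triangle_ineq4])
     (intro add_mono D2b_Lin_bound z z' p p' q q')
   ultimately show ?thesis unfolding g_def by (intro norm_triangle_le add_mono)
  qed
  show "(%n. g n v) ----> 0"
   unfolding g_def
  proof (rule tendsto_add_zero)
   show "(%n. Db (Sol (z' n) v) (Quad (z' n) e u v) - Db (Sol z v) (Quad (z' n) e u v)) ----> 0"
   proof (rule Lim_null_comparison[OF always_eventually])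
    have "(%n. L * (norm (r n) * WT) * B) ----> L * (norm (0::real) * WT) * B"
     by (intro tendsto_intros r)
    then show "(%n. L * (norm (r n) * WT) * B) ----> 0" by simp
   qed (use gn in blast)
   show "(%n. D2b (Sol (z' n) v) (Lin (z' n) u v) (Lin (z' n) e v) - D2b (Sol z v) (Lin z u v) (Lin z e v)) ----> 0"
    by (intro LIM_zero D2b_tendsto Sol_tendsto[OF z z' r] Lin_tendsto[OF z z' r] p p')
  qed
 qed
 then show ?thesis by (rule LIM_zero_cancel)
qed

lemma Sol_measurable:
 fixes a :: "'l => real => 'a"
 assumes a: "(%(l, v). a l v) : bmf (N \<Otimes>\<^sub>M borel)" and p: "!!l. bpath (a l)"
 shows "(%l. Sol (a l) s) : bmf N"
proof (rule borel_measurable_LIMSEQ_metric)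
 show "(%n. picard T (a l) (%v. b) n s) ----> Sol (a l) s" for l
  unfolding Sol_def by (rule vsol_lim[OF p lip_field_b T0])
 show "(%l. picard T (a l) (%v. b) n s) : bmf N" for n
  using measurable_compose[OF measurable_Pair[OF measurable_ident measurable_const] picard_measurable_param[OF a b_meas], of s T n]
  by simp
qed

text \<open>\<open>Lin\<close> is a limit of difference quotients of \<open>Sol\<close>, so
  measurability of \<open>Sol\<close> in its parameters settles this too.\<close>

lemma Lin_measurable:
 fixes a u :: "'l => real => 'a"
 assumes a: "(%(l, v). a l v) : bmf (N \<Otimes>\<^sub>M borel)" and p: "!!l. bpath (a l)"
  and e: "(%(l, v). u l v) : bmf (N \<Otimes>\<^sub>M borel)" and q: "!!l. bpath (u l)"
 shows "(%l. Lin (a l) (u l) s) : bmf N"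
proof (rule borel_measurable_LIMSEQ_metric)
 let ?e = "%n. inverse (real (Suc n))"
 show "(%n. (Sol (%s. a l s + ?e n *R u l s) s - Sol (%s. a l s + 0 *R u l s) s) /\<^sub>R ?e n) ----> Lin (a l) (u l) s" for l
  by (rule has_vector_derivative_seqD[OF Sol_deriv[OF p q]]) (use LIMSEQ_inverse_real_of_nat in \<open>auto simp del: of_nat_Suc\<close>)
 fix n
 have "(%l. Sol (%s. a l s + c *R u l s) s) : bmf N" for c
 proof (rule Sol_measurable)
  show "(%(l, v). a l v + c *R u l v) : bmf (N \<Otimes>\<^sub>M borel)"
   using a e by (simp add: case_prod_beta)
 qed (intro bpath_add bpath_scaleR p q)
 then show "(%l. (Sol (%s. a l s + ?e n *R u l s) s - Sol (%s. a l s + 0 *R u l s) s) /\<^sub>R ?e n) : bmf N"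
  by (intro borel_measurable_scaleR borel_measurable_diff borel_measurable_const)
qed

end

section \<open>Additional jumps and the direction that imitates a shift of the starting
  point\<close>

definition jumps :: "real => real ^ 'd => real ^ 'd => real => real ^ 'd::finite" where
 "jumps T s a v = (\<chi> j. a $ j * indi {s $ j..T} v)"

lemma norm_jumps: "norm (jumps T s a v) <= norm a"
 by (rule norm_le_componentwise_cart) (auto simp: jumps_def indicator_def)

lemma borel_measurable_vec_nth[measurable (raw)]:
 fixes f :: "'l => real ^ 'd"
 assumes "f : bmf N" shows "(%x. f x $ j) : bmf N"
proof -
 have "(%x::real ^ 'd. x $ j) : bm"
  by (intro borel_measurable_continuous_onI continuous_intros)
 from measurable_compose[OF assms this] show ?thesis .
qed

lemma jumps_measurable:
 assumes [measurable]: "s : bmf N" "a : bmf N"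
 shows "(%(l, v). jumps T (s l) (a l) v) : bmf (N \<Otimes>\<^sub>M borel)"
proof -
 have "(%p. SUM j:UNIV. (a (fst p) $ j * indi {v. s (fst p) $ j <= v & v <= T} (snd p)) *R axis j (1::real)) : bmf (N \<Otimes>\<^sub>M borel)"
  by measurable
 moreover have eq: "jumps T s a v = (SUM j:UNIV. (a $ j * indi {v. s $ j <= v & v <= T} v) *R axis j (1::real))" for s a :: "real ^ 'd" and v
  by (simp add: vec_eq_iff jumps_def axis_def if_distrib cong: if_cong) (auto simp: indicator_def)
 ultimately show ?thesis unfolding case_prod_beta eq by simp
qed

lemma bpath_jumps: "bpath (jumps T s a)"
proof (rule bpathI[OF _ norm_jumps])
 have "(%(l::unit, v). jumps T s a v) : bmf (count_space UNIV \<Otimes>\<^sub>M borel)"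
  by (rule jumps_measurable) auto
 from measurable_compose[OF measurable_Pair[OF measurable_const measurable_ident] this, of "()"]
 show "jumps T s a : bm" by simp
qed

lemma jumps_add: "jumps T s (a + c) v = jumps T s a v + jumps T s c v"
 by (simp add: jumps_def vec_eq_iff algebra_simps)

lemma jumps_scaleR: "jumps T s (r *R a) v = r *R jumps T s a v"
 by (simp add: jumps_def vec_eq_iff algebra_simps)

lemma vec_sum_axis: "(SUM j:UNIV. (a $ j) *R axis j (1::real)) = a"
 by (simp add: vec_eq_iff axis_def if_distrib cong: if_cong)

lemma near_id_inverse:
 fixes M :: "'a::euclidean_space => 'a"
 assumes lin: "linear M" and near: "!!a. norm (M a - a) <= norm a / 2"
 shows near_id_lower: "norm a <= 2 * norm (M a)"
  and near_id_ex1: "EX! a. M a = y"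
proof -
 show low: "norm a <= 2 * norm (M a)" for a
  using near[of a] norm_triangle_ineq2[of a "M a"] by (simp add: norm_minus_commute)
 have inj: "inj M"
  unfolding linear_injective_0[OF lin]
 proof (intro allI impI)
  fix a assume "M a = 0" then show "a = 0" using low[of a] by simp
 qed
 have "surj M" by (rule linear_injective_imp_surjective[OF lin inj]) (rule refl)
 then obtain a where "M a = y" by (metis surjD)
 then show "EX! a. M a = y" using injD[OF inj] by blast
qed

locale jump_flow = flow b Db D2b L T
 for b :: "real ^ 'd::finite => real ^ 'd" and Db D2b L T +
 fixes ta :: real
 assumes tau0: "0 <= ta" and tauT: "ta <= T" and small: "2 * L * exp (2 * L * ta) * ta <= 1 / 2"
begin

definition jtimes :: "real ^ 'd => bool" where "jtimes s \<longleftrightarrow> (ALL j. 0 <= s $ j & s $ j <= ta)"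

lemma jumps_after: "jtimes s ==> ta <= v ==> v <= T ==> jumps T s a v = a"
 by (auto simp: jtimes_def jumps_def vec_eq_iff indicator_def intro: order_trans)

text \<open>The first-order effect at time \<open>ta\<close> of changing the sizes of the jumps at
  the times \<open>s\<close> by \<open>a\<close>.\<close>

definition Mop :: "(real => real ^ 'd) => real ^ 'd => real ^ 'd => real ^ 'd" where
 "Mop z s a = Lin z (jumps T s a) ta"

text \<open>Changing the jumps by \<open>alpha z s h\<close> acts at time \<open>ta\<close>, hence at all later times, like moving the starting point by \<open>h\<close>.\<close>

definition alpha :: "(real => real ^ 'd) => real ^ 'd => real ^ 'd => real ^ 'd" where
 "alpha z s h = (THE a. Mop z s a = Lin z (%_. h) ta)"

definition cc :: real where "cc = 2 * L * exp (2 * L * ta) * ta"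

lemma Lin_const_near: "bpath z ==> norm (Lin z (%_. h) ta - h) <= cc * norm h"
 using Lin_minus_small[of z "%_. h" "norm h" ta] tau0 tauT by (simp add: cc_def)

lemma cc: "0 <= cc" "cc <= 1/2"
 using small L0 tau0 by (auto simp: cc_def)

lemma Mop_near:
 assumes "bpath z" "jtimes s" shows "norm (Mop z s a - a) <= cc * norm a"
proof -
 have "norm (Lin z (jumps T s a) ta - jumps T s a ta) <= cc * norm a"
  unfolding cc_def by (rule Lin_minus_small[OF assms(1) bpath_jumps norm_jumps tau0 tauT])
 then show ?thesis using jumps_after[OF assms(2), of ta a] tauT by (simp add: Mop_def)
qed

lemma Mop_near2:
 assumes "bpath z" "jtimes s" shows "norm (Mop z s a - a) <= norm a / 2"
 using Mop_near[OF assms, of a] mult_right_mono[OF cc(2), of "norm a"] by simp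

lemma Mop_linear: assumes "bpath z" shows "linear (Mop z s)"
proof (rule linearI)
 fix x y show "Mop z s (x + y) = Mop z s x + Mop z s y"
  unfolding Mop_def jumps_add[abs_def] by (rule Lin_add[OF assms bpath_jumps bpath_jumps])
next
 fix r x show "Mop z s (r *R x) = r *R Mop z s x"
  unfolding Mop_def jumps_scaleR[abs_def] by (rule Lin_scaleR[OF assms bpath_jumps])
qed

lemma Mop_lower:
 assumes "bpath z" "jtimes s" shows "norm a <= 2 * norm (Mop z s a)"
 by (rule near_id_lower[OF Mop_linear[OF assms(1)] Mop_near2[OF assms]])

lemma Mop_alpha:
 assumes "bpath z" "jtimes s" shows "Mop z s (alpha z s h) = Lin z (%_. h) ta"
 unfolding alpha_def
 by (rule theI'[OF near_id_ex1[OF Mop_linear[OF assms(1)] Mop_near2[OF assms]]])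

lemma alpha_unique:
 assumes "bpath z" "jtimes s" "Mop z s a = Lin z (%_. h) ta" shows "alpha z s h = a"
 unfolding alpha_def
 by (rule the1_equality[OF near_id_ex1[OF Mop_linear[OF assms(1)] Mop_near2[OF assms(1,2)]] assms(3)])

lemma Lin_const_add: "bpath z ==> Lin z (%_. h + k) v = Lin z (%_. h) v + Lin z (%_. k) v"
 using Lin_add[of z "%_. h" "%_. k" v] by simp

lemma Lin_const_scaleR: "bpath z ==> Lin z (%_. c *R h) v = c *R Lin z (%_. h) v"
 using Lin_scaleR[of z "%_. h" c v] by simp

lemma alpha_linear: assumes "bpath z" "jtimes s" shows "linear (alpha z s)"
proof (rule linearI)
 fix x y show "alpha z s (x + y) = alpha z s x + alpha z s y"
  by (rule alpha_unique[OF assms])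
   (simp add: linear_add[OF Mop_linear[OF assms(1)]] Mop_alpha[OF assms] Lin_const_add assms)
next
 fix r x show "alpha z s (r *R x) = r *R alpha z s x"
  by (rule alpha_unique[OF assms])
   (simp add: linear_scale[OF Mop_linear[OF assms(1)]] Mop_alpha[OF assms] Lin_const_scaleR assms)
qed

lemma alpha_near:
 assumes "bpath z" "jtimes s" shows "norm (alpha z s h - h) <= 4 * cc * norm h"
proof -
 have "norm (alpha z s h - h) <= 2 * norm (Mop z s (alpha z s h - h))"
  by (rule Mop_lower[OF assms])
 also have "Mop z s (alpha z s h - h) = (Lin z (%_. h) ta - h) - (Mop z s h - h)"
  by (simp add: linear_diff[OF Mop_linear[OF assms(1)]] Mop_alpha[OF assms])
 also have "norm ... <= norm (Lin z (%_. h) ta - h) + norm (Mop z s h - h)" by (rule norm_triangle_ineq4)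
 also have "... <= cc * norm h + cc * norm h"
  by (intro add_mono Mop_near Lin_const_near assms)
 finally show ?thesis by (simp add: mult_ac)
qed

lemma alpha_bound:
 assumes "bpath z" "jtimes s" shows "norm (alpha z s h) <= 3 * norm h"
proof -
 have "4 * cc * norm h <= 2 * norm h" using cc by (intro mult_right_mono) auto
 then show ?thesis using alpha_near[OF assms, of h] norm_triangle_ineq2[of "alpha z s h" h] by linarith
qed

text \<open>At \<open>ta\<close> the identity is the defining property of \<open>alpha\<close>, and
  \<open>Lin_vanish\<close> carries it to \<open>T\<close>. It writes a derivative in the starting
  point as a combination of derivatives in single jump sizes, in which integration by parts is
  possible.\<close>

lemma Lin_const_T:
 assumes z: "bpath z" and s: "jtimes s"
 shows "Lin z (%_. h) T = (SUM j:UNIV. (alpha z s h $ j) *R Lin z (jumps T s (axis j 1)) T)"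
proof -
 let ?e = "%v. h + (- 1) *R jumps T s (alpha z s h) v"
 have p: "bpath (%v. (- 1) *R jumps T s (alpha z s h) v)" by (intro bpath_scaleR bpath_jumps)
 have eq: "Lin z ?e v = Lin z (%_. h) v - Lin z (jumps T s (alpha z s h)) v" for v
  using Lin_add[OF z bpath_const p, of h v] Lin_scaleR[OF z bpath_jumps, of "-1" T s "alpha z s h" v]
  by simp
 have "Lin z ?e T = 0"
 proof (rule Lin_vanish[OF z _ tau0 tauT])
  show "bpath ?e" by (intro bpath_add bpath_const p)
  show "Lin z ?e ta = 0" using Mop_alpha[OF z s, of h] unfolding eq Mop_def by simp
  show "?e v = ?e ta" if "ta <= v" "v <= T" for v
   using that tauT by (simp add: jumps_after[OF s])
 qed
 then have "Lin z (%_. h) T = Lin z (jumps T s (alpha z s h)) T" unfolding eq by simp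
 also have "Lin z (jumps T s a) T = (SUM j:UNIV. (a $ j) *R Lin z (jumps T s (axis j 1)) T)" for a
 proof -
  have lin: "linear (%a. Lin z (jumps T s a) T)"
   by (rule linearI) (simp_all add: jumps_add[abs_def] jumps_scaleR[abs_def] Lin_add[OF z bpath_jumps bpath_jumps] Lin_scaleR[OF z bpath_jumps])
  show ?thesis
   using linear_sum[OF lin, of "%j. (a $ j) *R axis j 1" UNIV] unfolding vec_sum_axis linear_scale[OF lin] .
 qed
 finally show ?thesis .
qed

lemma Mop_sum: "bpath z ==> Mop z s a = (SUM j:UNIV. (a $ j) *R Mop z s (axis j 1))"
 using linear_sum[OF Mop_linear[of z s], of "%j. (a $ j) *R axis j 1" UNIV]
 by (simp only: vec_sum_axis linear_scale[OF Mop_linear])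

lemma Mop_tendsto:
 assumes z: "bpath z" and z': "!!n. bpath (z' n)" and r: "!!n v. norm (z' n v - z v) <= r n" "r ----> 0"
 shows "(%n. Mop (z' n) s a) ----> Mop z s a"
 unfolding Mop_def by (rule Lin_tendsto[OF z z' r bpath_jumps])

text \<open>The lower bound \<open>Mop_lower\<close> does not depend on the path, so the residual
  \<open>y n - Mop (z' n) s a0\<close> controls the error. Continuity of \<open>alpha\<close> and of
  \<open>dalpha\<close> and the derivative of \<open>alpha\<close> are all instances.\<close>

lemma Mop_solve_tendsto:
 assumes z: "bpath z" and z': "!!n. bpath (z' n)" and r: "!!n v. norm (z' n v - z v) <= r n" "r ----> 0"
  and s: "jtimes s" and eq: "!!n. Mop (z' n) s (a n) = y n" "Mop z s a0 = y0" and y: "y ----> y0"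
 shows "a ----> a0"
proof (rule Lim_null_comparison[where g="%n. 2 * norm (y n - Mop (z' n) s a0)", THEN LIM_zero_cancel])
 have "norm (a n - a0) <= 2 * norm (y n - Mop (z' n) s a0)" for n
  using Mop_lower[OF z' s, of "a n - a0" n] by (simp add: linear_diff[OF Mop_linear[OF z']] eq)
 then show "\<forall>\<^sub>F n in sequentially. norm (a n - a0) <= 2 * norm (y n - Mop (z' n) s a0)" by simp
 have "(%n. 2 * norm (y n - Mop (z' n) s a0)) ----> 2 * norm (y0 - Mop z s a0)"
  by (intro tendsto_intros y Mop_tendsto[OF z z' r])
 then show "(%n. 2 * norm (y n - Mop (z' n) s a0)) ----> 0" using eq by simp
qed

lemma alpha_tendsto:
 assumes z: "bpath z" and z': "!!n. bpath (z' n)" and r: "!!n v. norm (z' n v - z v) <= r n" "r ----> 0"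
  and s: "jtimes s"
 shows "(%n. alpha (z' n) s h) ----> alpha z s h"
 by (rule Mop_solve_tendsto[OF z z' r s Mop_alpha[OF z' s] Mop_alpha[OF z s] Lin_tendsto[OF z z' r bpath_const]])

text \<open>The result of differentiating the equation
  \<open>Mop z s (alpha z s h) = Lin z (%_. h) ta\<close> implicitly in the size of the
  \<open>k\<close>-th jump.\<close>

definition dalpha :: "(real => real ^ 'd) => real ^ 'd => 'd => real ^ 'd => real ^ 'd" where
 "dalpha z s k h = (THE a. Mop z s a = Quad z (%_. h) (jumps T s (axis k 1)) ta
   - (SUM j:UNIV. (alpha z s h $ j) *R Quad z (jumps T s (axis j 1)) (jumps T s (axis k 1)) ta))"

lemma Mop_dalpha:
 assumes "bpath z" "jtimes s"
 shows "Mop z s (dalpha z s k h) = Quad z (%_. h) (jumps T s (axis k 1)) ta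
   - (SUM j:UNIV. (alpha z s h $ j) *R Quad z (jumps T s (axis j 1)) (jumps T s (axis k 1)) ta)"
 unfolding dalpha_def
 by (rule theI'[OF near_id_ex1[OF Mop_linear[OF assms(1)] Mop_near2[OF assms]]])

lemma dalpha_tendsto:
 assumes z: "bpath z" and z': "!!n. bpath (z' n)" and r: "!!n v. norm (z' n v - z v) <= r n" "r ----> 0"
  and s: "jtimes s"
 shows "(%n. dalpha (z' n) s k h) ----> dalpha z s k h"
proof (rule Mop_solve_tendsto[OF z z' r s Mop_dalpha[OF z' s] Mop_dalpha[OF z s]])
 have "(%n. alpha (z' n) s h $ j) ----> alpha z s h $ j" for j
  by (rule tendsto_vec_nth[OF alpha_tendsto[OF z z' r s]])
 then show "(%n. Quad (z' n) (%_. h) (jumps T s (axis k 1)) ta - (SUM j:UNIV. (alpha (z' n) s h $ j) *R Quad (z' n) (jumps T s (axis j 1)) (jumps T s (axis k 1)) ta))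
  ----> Quad z (%_. h) (jumps T s (axis k 1)) ta - (SUM j:UNIV. (alpha z s h $ j) *R Quad z (jumps T s (axis j 1)) (jumps T s (axis k 1)) ta)"
  by (intro tendsto_diff tendsto_sum tendsto_scaleR Quad_tendsto[OF z z' r] bpath_jumps bpath_const)
qed

lemma alpha_deriv:
 assumes z: "bpath z" and s: "jtimes s"
 shows "((%e. alpha (%v. z v + e *R jumps T s (axis k 1) v) s h) has_vector_derivative dalpha z s k h) (at 0)"
proof (rule has_vector_derivative_seqI)
 fix e :: "nat => real" assume e0: "!!n. e n ~= 0" and e: "e ----> 0"
 let ?J = "jumps T s (axis k 1)"
 define z' where "z' n v = z v + e n *R ?J v" for n v
 have z'_eq: "z' n = (%v. z v + e n *R ?J v)" for n by (simp add: z'_def[abs_def])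
 have z': "bpath (z' n)" for n unfolding z'_eq by (intro bpath_add bpath_scaleR z bpath_jumps)
 have r: "norm (z' n v - z v) <= \<bar>e n\<bar>" for n v
 proof -
  have "norm (?J v) <= 1" using norm_jumps[of T s "axis k 1" v] by simp
  then have "\<bar>e n\<bar> * norm (?J v) <= \<bar>e n\<bar> * 1" by (intro mult_left_mono) auto
  then show ?thesis by (simp add: z'_def)
 qed
 have r': "(%n. \<bar>e n\<bar>) ----> 0" using e by (intro tendsto_rabs_zero)
 let ?a = "alpha z s h"
 have "(%n. (alpha (z' n) s h - ?a) /\<^sub>R e n) ----> dalpha z s k h"
 proof (rule Mop_solve_tendsto[OF z z' r r' s _ Mop_dalpha[OF z s]])
  fix n
  show "Mop (z' n) s ((alpha (z' n) s h - ?a) /\<^sub>R e n) =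
   (Lin (z' n) (%_. h) ta - Lin z (%_. h) ta) /\<^sub>R e n - (SUM j:UNIV. (?a $ j) *R ((Mop (z' n) s (axis j 1) - Mop z s (axis j 1)) /\<^sub>R e n))"
  proof -
   have "(SUM j:UNIV. (?a $ j) *R ((Mop (z' n) s (axis j 1) - Mop z s (axis j 1)) /\<^sub>R e n))
    = ((SUM j:UNIV. (?a $ j) *R Mop (z' n) s (axis j 1)) - (SUM j:UNIV. (?a $ j) *R Mop z s (axis j 1))) /\<^sub>R e n"
    by (simp add: sum_subtractf[symmetric] scaleR_sum_right algebra_simps)
   also have "... = (Mop (z' n) s ?a - Mop z s ?a) /\<^sub>R e n"
    by (simp flip: Mop_sum[OF z'] Mop_sum[OF z])
   finally have "(SUM j:UNIV. (?a $ j) *R ((Mop (z' n) s (axis j 1) - Mop z s (axis j 1)) /\<^sub>R e n)) = (Mop (z' n) s ?a - Mop z s ?a) /\<^sub>R e n" .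
   then show ?thesis
    by (simp add: linear_scale[OF Mop_linear[OF z']] linear_diff[OF Mop_linear[OF z']] Mop_alpha[OF z' s] Mop_alpha[OF z s])
     (simp add: algebra_simps)
  qed
 next
  have L: "(%n. (Lin (z' n) q ta - Lin z q ta) /\<^sub>R e n) ----> Quad z q ?J ta" if "bpath q" for q
   using has_vector_derivative_seqD[OF Lin_deriv[OF z that bpath_jumps, of T s "axis k 1" ta] e0 e] by (simp add: z'_eq)
  show "(%n. (Lin (z' n) (%_. h) ta - Lin z (%_. h) ta) /\<^sub>R e n - (SUM j:UNIV. (?a $ j) *R ((Mop (z' n) s (axis j 1) - Mop z s (axis j 1)) /\<^sub>R e n)))
   ----> Quad z (%_. h) ?J ta - (SUM j:UNIV. (?a $ j) *R Quad z (jumps T s (axis j 1)) ?J ta)"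
   unfolding Mop_def by (intro tendsto_intros L bpath_const bpath_jumps)
 qed
 then show "(%n. (alpha (%v. z v + e n *R ?J v) s h - alpha (%v. z v + 0 *R ?J v) s h) /\<^sub>R e n) ----> dalpha z s k h"
  by (simp add: z'_eq)
qed

lemma dalpha_lin:
 assumes z: "bpath z" and s: "jtimes s"
 shows "dalpha z s k h = (SUM l:UNIV. (h $ l) *R dalpha z s k (axis l 1))"
proof -
 have p: "bpath (%v. z v + e *R jumps T s (axis k 1) v)" for e
  by (intro bpath_add bpath_scaleR z bpath_jumps)
 have eq: "alpha z' s h = (SUM l:UNIV. (h $ l) *R alpha z' s (axis l 1))" if "bpath z'" for z'
  using linear_sum[OF alpha_linear[OF that s], of "%l. (h $ l) *R axis l 1" UNIV]
  unfolding vec_sum_axis linear_scale[OF alpha_linear[OF that s]] .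
 have "((%e. SUM l:UNIV. (h $ l) *R alpha (%v. z v + e *R jumps T s (axis k 1) v) s (axis l 1)) has_vector_derivative
   (SUM l:UNIV. (h $ l) *R dalpha z s k (axis l 1))) (at 0)"
  by (intro has_vector_derivative_sum bounded_linear.has_vector_derivative[OF bounded_linear_scaleR_right] alpha_deriv z s)
 then have "((%e. alpha (%v. z v + e *R jumps T s (axis k 1) v) s h) has_vector_derivative
   (SUM l:UNIV. (h $ l) *R dalpha z s k (axis l 1))) (at 0)"
  by (simp flip: eq[OF p])
 then show ?thesis using alpha_deriv[OF z s] vector_derivative_unique_at by blast
qed

text \<open>The \<open>8\<close> of \<open>Quad_small\<close> is doubled by
  \<open>Mop_lower\<close>; \<open>1 + 3 * CARD('d)\<close> counts the term of the starting point
  and one term per jump, each of the latter with the factor \<open>3\<close> of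
  \<open>alpha_bound\<close>.\<close>

definition kk :: real where "kk = 16 * L * exp (2 * L * ta) ^ 3 * (1 + 3 * CARD('d)) * ta"

lemma dalpha_bound:
 assumes z: "bpath z" and s: "jtimes s"
 shows "norm (dalpha z s k h) <= kk * norm h"
proof -
 let ?J = "jumps T s (axis k 1)" and ?c = "8 * L * exp (2 * L * ta) ^ 3 * ta"
 have J: "norm (jumps T s (axis j 1) v) <= 1" for j v
  using norm_jumps[of T s "axis j 1" v] by simp
 have c0: "?c >= 0" using L0 tau0 by simp
 have 1: "norm (Quad z (%_. h) ?J ta) <= ?c * norm h"
  using Quad_small[OF z bpath_const bpath_jumps order_refl J tau0 tauT] by simp
 have 2: "norm (Quad z (jumps T s (axis j 1)) ?J ta) <= ?c" for j
  using Quad_small[OF z bpath_jumps bpath_jumps J J tau0 tauT] by simp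
 have "norm (SUM j:UNIV. (alpha z s h $ j) *R Quad z (jumps T s (axis j 1)) ?J ta) <= (SUM j:(UNIV::'d set). (3 * norm h) * ?c)"
 proof (rule sum_norm_le)
  fix j
  have "\<bar>alpha z s h $ j\<bar> <= 3 * norm h"
   using component_le_norm_cart[of "alpha z s h" j] alpha_bound[OF z s, of h] by linarith
  then show "norm ((alpha z s h $ j) *R Quad z (jumps T s (axis j 1)) ?J ta) <= (3 * norm h) * ?c"
   unfolding norm_scaleR real_norm_def using 2 c0 by (intro mult_mono) auto
 qed
 then have 3: "norm (SUM j:UNIV. (alpha z s h $ j) *R Quad z (jumps T s (axis j 1)) ?J ta) <= CARD('d) * ((3 * norm h) * ?c)"
  by simp
 have "norm (dalpha z s k h) <= 2 * norm (Mop z s (dalpha z s k h))" by (rule Mop_lower[OF z s])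
 also have "... <= 2 * (?c * norm h + CARD('d) * ((3 * norm h) * ?c))"
  unfolding Mop_dalpha[OF z s]
  by (intro mult_left_mono order_trans[OF norm_triangle_ineq4] add_mono 1 3) auto
 finally show ?thesis by (simp add: kk_def algebra_simps)
qed

text \<open>Neumann iterates: they show that \<open>alpha\<close> is measurable.\<close>

primrec neum :: "(real => real ^ 'd) => real ^ 'd => real ^ 'd => nat => real ^ 'd" where
 "neum z s h 0 = 0"
| "neum z s h (Suc n) = Lin z (%_. h) ta + neum z s h n - Mop z s (neum z s h n)"

lemma neum_tendsto:
 assumes z: "bpath z" and s: "jtimes s" shows "neum z s h ----> alpha z s h"
proof -
 have "norm (neum z s h n - alpha z s h) <= norm (alpha z s h) * (1/2)^n" for n
 proof (induction n)
  case (Suc n)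
  let ?d = "neum z s h n - alpha z s h"
  have "Mop z s ?d = Mop z s (neum z s h n) - Lin z (%_. h) ta"
   unfolding linear_diff[OF Mop_linear[OF z]] Mop_alpha[OF z s] ..
  then have "neum z s h (Suc n) - alpha z s h = ?d - Mop z s ?d" by simp
  then have "norm (neum z s h (Suc n) - alpha z s h) = norm (Mop z s ?d - ?d)"
   by (simp only: norm_minus_commute)
  also have "... <= norm ?d / 2" by (rule Mop_near2[OF z s])
  also have "... <= (norm (alpha z s h) * (1/2)^n) / 2" by (rule divide_right_mono[OF Suc]) simp
  finally show ?case by (simp only: power_Suc times_divide_eq_left mult_1_left times_divide_eq_right)
 qed simp
 moreover have "(%n. norm (alpha z s h) * (1/2)^n) ----> norm (alpha z s h) * 0"
  by (intro tendsto_intros) (simp add: LIMSEQ_realpow_zero)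
 ultimately have "(%n. neum z s h n - alpha z s h) ----> 0"
  by (intro Lim_null_comparison[of "%n. neum z s h n - alpha z s h" "%n. norm (alpha z s h) * (1/2)^n"]) simp_all
 then show ?thesis by (rule LIM_zero_cancel)
qed

lemma alpha_measurable:
 fixes z :: "'l => real => real ^ 'd"
 assumes a: "(%(l, v). z l v) : bmf (N \<Otimes>\<^sub>M borel)" and p: "!!l. bpath (z l)"
  and s: "s : bmf N" "!!l. jtimes (s l)"
 shows "(%l. alpha (z l) (s l) h) : bmf N"
proof (rule borel_measurable_LIMSEQ_metric[OF _ neum_tendsto[OF p s(2)]])
 fix n show "(%l. neum (z l) (s l) h n) : bmf N"
 proof (induction n)
  case (Suc n)
  have "(%l. Lin (z l) (%_. h) ta) : bmf N"
   by (rule Lin_measurable[OF a p]) (simp_all add: case_prod_beta)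
  moreover have "(%l. Lin (z l) (jumps T (s l) (neum (z l) (s l) h n)) ta) : bmf N"
   by (rule Lin_measurable[OF a p jumps_measurable[OF s(1) Suc] bpath_jumps])
  ultimately show ?case using Suc by (simp add: Mop_def)
 qed simp
qed

lemma dalpha_measurable:
 fixes z :: "'l => real => real ^ 'd"
 assumes a: "(%(l, v). z l v) : bmf (N \<Otimes>\<^sub>M borel)" and p: "!!l. bpath (z l)"
  and s: "s : bmf N" "!!l. jtimes (s l)"
 shows "(%l. dalpha (z l) (s l) k h) : bmf N"
proof (rule borel_measurable_LIMSEQ_metric)
 let ?e = "%n. inverse (real (Suc n))"
 let ?z = "%e l v. z l v + e *R jumps T (s l) (axis k 1) v"
 show "(%n. (alpha (?z (?e n) l) (s l) h - alpha (?z 0 l) (s l) h) /\<^sub>R ?e n) ----> dalpha (z l) (s l) k h" for l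
  by (rule has_vector_derivative_seqD[OF alpha_deriv[OF p[of l] s(2)[of l], of k h]])
   (simp del: of_nat_Suc, rule LIMSEQ_inverse_real_of_nat)
 have M: "(%l. alpha (?z e l) (s l) h) : bmf N" for e
 proof (rule alpha_measurable[OF _ _ s])
  show "(%(l, v). ?z e l v) : bmf (N \<Otimes>\<^sub>M borel)"
  proof -
   have "(%(l, v). jumps T (s l) (axis k 1) v) : bmf (N \<Otimes>\<^sub>M borel)"
    by (rule jumps_measurable[OF s(1)]) simp
   with a show ?thesis unfolding case_prod_beta
    by (intro borel_measurable_add borel_measurable_scaleR borel_measurable_const)
  qed
  show "bpath (?z e l)" for l by (intro bpath_add bpath_scaleR p bpath_jumps)
 qed
 show "(%l. (alpha (?z (?e n) l) (s l) h - alpha (?z 0 l) (s l) h) /\<^sub>R ?e n) : bmf N" for n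
  by (rule borel_measurable_scaleR[OF borel_measurable_const borel_measurable_diff[OF M M]])
qed

end

section \<open>From partial derivatives to differentials\<close>

lemma partial_deriv_shift:
 fixes g :: "real ^ 'd::finite => real"
 assumes "C1_function g"
 shows "((%h. g (y + h *R axis j 1)) has_real_derivative partial_deriv j g (y + h *R axis j 1)) (at h)"
proof -
 have "(%e. g ((y + h *R axis j 1) + e *R axis j 1)) differentiable (at 0)"
  using assms by (auto simp: C1_function_def)
 then have "((%e. g ((y + h *R axis j 1) + e *R axis j 1)) has_real_derivative partial_deriv j g (y + h *R axis j 1)) (at 0)"
  unfolding partial_deriv_def by (simp add: DERIV_deriv_iff_real_differentiable)
 then have "((%e. g (y + (h + e) *R axis j 1)) has_real_derivative partial_deriv j g (y + h *R axis j 1)) (at 0)"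
  by (simp add: algebra_simps)
 then show ?thesis
  using DERIV_shift[of "%h. g (y + h *R axis j 1)" "partial_deriv j g (y + h *R axis j 1)" 0 h]
  by (simp add: add.commute)
qed

text \<open>The increment is built up one coordinate at a time: \<open>pr S\<close> keeps the
  coordinates in \<open>S\<close>, and each insertion is controlled by the mean value theorem in one
  variable and continuity of the partial derivative at \<open>x\<close>.\<close>

lemma C1_function_has_derivative:
 fixes g :: "real ^ 'd::finite => real"
 assumes g: "C1_function g"
 shows "(g has_derivative (%v. SUM j:UNIV. partial_deriv j g x * v $ j)) (at x)"
 unfolding has_derivative_at_alt
proof (intro conjI allI impI)
 show "bounded_linear (%v. SUM j:UNIV. partial_deriv j g x * v $ j)"
  by (intro bounded_linear_sum bounded_linear_const_mult bounded_linear_vec_nth)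
 fix e :: real assume e: "0 < e"
 define n where "n = real CARD('d)"
 have n: "n > 0" by (simp add: n_def)
 have "ALL j. EX d>0. ALL y. dist y x < d --> dist (partial_deriv j g y) (partial_deriv j g x) < e / n"
 proof
  fix j
  have "isCont (partial_deriv j g) x"
   using g by (simp add: C1_function_def continuous_on_eq_continuous_at)
  then show "EX d>0. ALL y. dist y x < d --> dist (partial_deriv j g y) (partial_deriv j g x) < e / n"
   unfolding continuous_at_eps_delta using e n by simp
 qed
 then obtain d where d: "!!j. d j > 0" "!!j y. dist y x < d j ==> dist (partial_deriv j g y) (partial_deriv j g x) < e / n"
  by metis
 define D where "D = Min (range d)"
 have D: "D > 0" using d(1) by (auto simp: D_def)
 have D': "D <= d j" for j by (auto simp: D_def)
 show "EX D>0. ALL y. norm (y - x) < D --> norm (g y - g x - (SUM j:UNIV. partial_deriv j g x * (y - x) $ j)) <= e * norm (y - x)"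
 proof (intro exI[of _ D] conjI D allI impI)
  fix y assume y: "norm (y - x) < D"
  define v where "v = y - x"
  define pr where "pr S = (\<chi> j. if j : S then v $ j else 0)" for S :: "'d set"
  have "\<bar>g (x + pr S) - g x - (SUM j:S. partial_deriv j g x * v $ j)\<bar> <= (SUM j:S. e / n * \<bar>v $ j\<bar>)" if "finite S" for S
   using that
  proof (induction S rule: finite_induct)
   case empty
   have "pr {} = 0" by (simp add: pr_def vec_eq_iff)
   then show ?case by simp
  next
   case (insert k S)
   have prk: "pr (insert k S) = pr S + (v $ k) *R axis k 1"
    using insert(2) by (auto simp: pr_def vec_eq_iff axis_def)
   let ?ph = "%h. g (x + pr S + h *R axis k 1)"
   have der: "(?ph has_real_derivative partial_deriv k g (x + pr S + h *R axis k 1)) (at h)" for h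
    by (rule partial_deriv_shift[OF g])
   have "EX t. \<bar>t\<bar> <= \<bar>v $ k\<bar> & ?ph (v $ k) - ?ph 0 = v $ k * partial_deriv k g (x + pr S + t *R axis k 1)"
   proof (cases "v $ k" "0::real" rule: linorder_cases)
    case less
    from MVT2[OF this, of ?ph "%h. partial_deriv k g (x + pr S + h *R axis k 1)"] der
    obtain t where "v $ k < t" "t < 0" "?ph 0 - ?ph (v $ k) = (0 - v $ k) * partial_deriv k g (x + pr S + t *R axis k 1)" by auto
    then show ?thesis by (intro exI[of _ t]) (auto simp: algebra_simps)
   next
    case greater
    from MVT2[OF this, of ?ph "%h. partial_deriv k g (x + pr S + h *R axis k 1)"] der
    obtain t where "0 < t" "t < v $ k" "?ph (v $ k) - ?ph 0 = (v $ k - 0) * partial_deriv k g (x + pr S + t *R axis k 1)" by auto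
    then show ?thesis by (intro exI[of _ t]) auto
   qed auto
   then obtain t where t: "\<bar>t\<bar> <= \<bar>v $ k\<bar>" "?ph (v $ k) - ?ph 0 = v $ k * partial_deriv k g (x + pr S + t *R axis k 1)" by blast
   have "norm (pr S + t *R axis k 1) <= norm v"
   proof (rule norm_le_componentwise_cart)
    fix i show "norm ((pr S + t *R axis k 1) $ i) <= norm (v $ i)"
     using t(1) insert(2) by (auto simp: pr_def axis_def)
   qed
   then have "dist (x + pr S + t *R axis k 1) x < d k"
    using y D'[of k] by (simp add: dist_norm v_def add.assoc)
   then have "\<bar>partial_deriv k g (x + pr S + t *R axis k 1) - partial_deriv k g x\<bar> <= e / n"
    using d(2)[of _ k] by (fastforce simp: dist_real_def)
   then have "\<bar>v $ k * (partial_deriv k g (x + pr S + t *R axis k 1) - partial_deriv k g x)\<bar> <= e / n * \<bar>v $ k\<bar>"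
    by (subst abs_mult, subst mult.commute) (intro mult_right_mono, auto)
   moreover have "g (x + pr (insert k S)) - g x - (SUM j:insert k S. partial_deriv j g x * v $ j)
    = (g (x + pr S) - g x - (SUM j:S. partial_deriv j g x * v $ j))
     + v $ k * (partial_deriv k g (x + pr S + t *R axis k 1) - partial_deriv k g x)"
    using t(2) insert(1,2) by (simp add: prk algebra_simps)
   ultimately show ?case using insert by simp
  qed
  note * = this
  have "\<bar>g y - g x - (SUM j:UNIV. partial_deriv j g x * (y - x) $ j)\<bar> <= (SUM j:UNIV. e / n * \<bar>v $ j\<bar>)"
  proof -
   have "x + pr UNIV = y" by (simp add: pr_def v_def vec_eq_iff)
   with *[of UNIV] show ?thesis by (simp add: v_def)
  qed
  also have "... <= (SUM j:(UNIV::'d set). e / n * norm v)"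
   using e n component_le_norm_cart[of v] by (intro sum_mono mult_left_mono) auto
  also have "... = e * norm v" using n by (simp add: n_def)
  finally show "norm (g y - g x - (SUM j:UNIV. partial_deriv j g x * (y - x) $ j)) <= e * norm (y - x)"
   by (simp add: v_def)
 qed
qed

lemma has_derivative_vec_lambda:
 fixes f :: "'a::real_normed_vector => real ^ 'd::finite"
 assumes "!!i. ((%x. f x $ i) has_derivative (%v. f' v $ i)) (at x)"
 shows "(f has_derivative f') (at x)"
proof -
 have "((%x. SUM i:UNIV. (f x $ i) *R axis i (1::real)) has_derivative (%v. SUM i:UNIV. (f' v $ i) *R axis i 1)) (at x)"
  by (intro has_derivative_sum has_derivative_scaleR_left assms)
 then show ?thesis by (simp only: vec_sum_axis)
qed

definition jac :: "(real ^ 'd => real ^ 'd) => real ^ 'd => real ^ 'd => real ^ 'd::finite" where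
 "jac b x v = (\<chi> i. SUM j:UNIV. partial_deriv j (%x. b x $ i) x * v $ j)"

definition hess :: "(real ^ 'd => real ^ 'd) => real ^ 'd => real ^ 'd => real ^ 'd => real ^ 'd::finite" where
 "hess b x w v = (\<chi> i. SUM j:UNIV. (SUM k:UNIV. partial_deriv k (partial_deriv j (%x. b x $ i)) x * w $ k) * v $ j)"

lemma norm_vec_bound:
 fixes v :: "real ^ 'd::finite" and c :: real
 assumes "!!i. \<bar>v $ i\<bar> <= c" shows "norm v <= CARD('d) * c"
proof -
 have "norm v <= (SUM i:UNIV. \<bar>v $ i\<bar>)" by (rule norm_le_l1_cart)
 also have "... <= (SUM i:(UNIV::'d set). c)" by (intro sum_mono assms)
 finally show ?thesis by simp
qed

lemma flow_instance:
 fixes b :: "real ^ 'd::finite => real ^ 'd"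
 assumes b: "!!i. C2_function (%x. b x $ i)"
  and b1: "!!i j. bounded (range (partial_deriv j (%x. b x $ i)))"
  and b2: "!!i j k. bounded (range (partial_deriv j (partial_deriv k (%x. b x $ i))))"
 shows "EX L. ALL T>=0. flow b (jac b) (hess b) L T"
proof -
 let ?n = "real CARD('d)"
 have n: "?n >= 1" by simp
 have "EX B. ALL i j x. \<bar>partial_deriv j (%x. b x $ i) x\<bar> <= B"
 proof -
  have "ALL p::'d \<times> 'd. EX B. ALL x. \<bar>partial_deriv (snd p) (%x. b x $ (fst p)) x\<bar> <= B"
   using b1 by (auto simp: bounded_iff)
  then obtain B where B: "!!p x. \<bar>partial_deriv (snd p) (%x. b x $ (fst p)) x\<bar> <= B p" by metis
  show ?thesis
  proof (intro exI allI)
   fix i j x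
   have "\<bar>partial_deriv j (%x. b x $ i) x\<bar> <= B (i, j)" using B[where p="(i, j)" and x=x] by simp
   also have "... <= Max (range B)" by (rule Max_ge) auto
   finally show "\<bar>partial_deriv j (%x. b x $ i) x\<bar> <= Max (range B)" .
  qed
 qed
 then obtain B1 where B1: "!!i j x. \<bar>partial_deriv j (%x. b x $ i) x\<bar> <= B1" by blast
 have "EX B. ALL i j k x. \<bar>partial_deriv j (partial_deriv k (%x. b x $ i)) x\<bar> <= B"
 proof -
  have "ALL p::'d \<times> 'd \<times> 'd. EX B. ALL x. \<bar>partial_deriv (fst (snd p)) (partial_deriv (snd (snd p)) (%x. b x $ (fst p))) x\<bar> <= B"
   using b2 by (auto simp: bounded_iff)
  then obtain B where B: "!!p x. \<bar>partial_deriv (fst (snd p)) (partial_deriv (snd (snd p)) (%x. b x $ (fst p))) x\<bar> <= B p" by metis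
  show ?thesis
  proof (intro exI allI)
   fix i j k x
   have "\<bar>partial_deriv j (partial_deriv k (%x. b x $ i)) x\<bar> <= B (i, j, k)" using B[where p="(i, j, k)" and x=x] by simp
   also have "... <= Max (range B)" by (rule Max_ge) auto
   finally show "\<bar>partial_deriv j (partial_deriv k (%x. b x $ i)) x\<bar> <= Max (range B)" .
  qed
 qed
 then obtain B2 where B2: "!!i j k x. \<bar>partial_deriv j (partial_deriv k (%x. b x $ i)) x\<bar> <= B2" by blast
 have B0: "0 <= B1" "0 <= B2" using order_trans[OF abs_ge_zero B1] order_trans[OF abs_ge_zero B2] by auto
 \<comment> \<open>One constant that dominates the bounds for \<open>jac\<close> and for
   \<open>hess\<close>.\<close>
 define L where "L = ?n * (?n * B1) + ?n * (?n * (?n * B2))"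
 have c1: "C1_function (%x. b x $ i)" and c2: "C1_function (partial_deriv j (%x. b x $ i))" for i j
  using b by (auto simp: C2_function_def)
 have "flow b (jac b) (hess b) L T" if "T >= 0" for T
 proof (rule flow.intro)
  fix x v w
  show "(b has_derivative jac b x) (at x)"
   by (rule has_derivative_vec_lambda) (use C1_function_has_derivative[OF c1] in \<open>simp add: jac_def\<close>)
  show "((%x. jac b x v) has_derivative (%w. hess b x w v)) (at x)"
   by (rule has_derivative_vec_lambda)
    (auto simp: jac_def hess_def intro!: has_derivative_sum has_derivative_mult_left C1_function_has_derivative[OF c2])
  have "norm (jac b x v) <= ?n * (?n * (B1 * norm v))"
  proof (rule norm_vec_bound)
   fix i
   have "\<bar>jac b x v $ i\<bar> <= (SUM j:UNIV. \<bar>partial_deriv j (%x. b x $ i) x * v $ j\<bar>)"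
    unfolding jac_def by (simp add: sum_abs)
   also have "... <= (SUM j:(UNIV::'d set). B1 * norm v)"
    unfolding abs_mult by (intro sum_mono mult_mono B1 component_le_norm_cart B0) auto
   finally show "\<bar>jac b x v $ i\<bar> <= ?n * (B1 * norm v)" by simp
  qed
  also have "... <= L * norm v"
   using B0 n by (simp add: L_def algebra_simps)
  finally show "norm (jac b x v) <= L * norm v" .
  have "norm (hess b x w v) <= ?n * (?n * (?n * (B2 * norm w) * norm v))"
  proof (rule norm_vec_bound)
   fix i
   have "\<bar>hess b x w v $ i\<bar> <= (SUM j:UNIV. \<bar>(SUM k:UNIV. partial_deriv k (partial_deriv j (%x. b x $ i)) x * w $ k) * v $ j\<bar>)"
    unfolding hess_def by (simp add: sum_abs)
   also have "... <= (SUM j:(UNIV::'d set). (?n * (B2 * norm w)) * norm v)"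
   proof (rule sum_mono, unfold abs_mult, rule mult_mono)
    fix j
    have "\<bar>SUM k:UNIV. partial_deriv k (partial_deriv j (%x. b x $ i)) x * w $ k\<bar> <= (SUM k:UNIV. \<bar>partial_deriv k (partial_deriv j (%x. b x $ i)) x * w $ k\<bar>)"
     by (rule sum_abs)
    also have "... <= (SUM k:(UNIV::'d set). B2 * norm w)"
     unfolding abs_mult by (intro sum_mono mult_mono B2 component_le_norm_cart B0) auto
    finally show "\<bar>SUM k:UNIV. partial_deriv k (partial_deriv j (%x. b x $ i)) x * w $ k\<bar> <= ?n * (B2 * norm w)" by simp
   qed (use B0 in \<open>auto simp: component_le_norm_cart\<close>)
   finally show "\<bar>hess b x w v $ i\<bar> <= ?n * (?n * (B2 * norm w) * norm v)" by simp
  qed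
  also have "... <= L * norm w * norm v"
   using B0 n by (simp add: L_def algebra_simps)
  finally show "norm (hess b x w v) <= L * norm w * norm v" .
  show "linear (%v. hess b x w v)"
   by (rule linearI) (simp_all add: hess_def vec_eq_iff algebra_simps sum.distrib sum_distrib_left)
  have "continuous_on UNIV (partial_deriv k (partial_deriv j (%x. b x $ i)))" for i j k
   using c2 by (auto simp: C1_function_def)
  then show "continuous_on UNIV (%x. hess b x w v)"
   unfolding hess_def by (intro continuous_intros)
  show "L >= 0" using B0 n by (simp add: L_def)
  show "T >= 0" by (rule that)
 qed
 then show ?thesis by blast
qed

section \<open>Uniqueness of joint characteristic functions\<close>

text \<open>Normalised weights are probability densities, which reduces the claim to Levy's
  uniqueness theorem on the line. The total masses agree by \<open>t = 0\<close>; mass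
  \<open>0\<close> cannot be normalised and is treated apart.\<close>

lemma weighted_char_unique:
 fixes X1 :: "'a => real" and X2 :: "'b => real"
 assumes M: "prob_space M1" "prob_space M2"
  and X1[measurable]: "X1 : bmf M1" and X2[measurable]: "X2 : bmf M2"
  and g1[measurable]: "g1 : bmf M1" and g2[measurable]: "g2 : bmf M2"
  and g1b: "!!x. 0 <= g1 x" "!!x. g1 x <= C" and g2b: "!!x. 0 <= g2 x" "!!x. g2 x <= C"
  and eq: "!!t. (LINT x|M1. of_real (g1 x) * ei (t * X1 x)) = (LINT x|M2. of_real (g2 x) * ei (t * X2 x))"
  and B[measurable]: "B : sets borel"
 shows "(LINT x|M1. g1 x * indi B (X1 x)) = (LINT x|M2. g2 x * indi B (X2 x))"
proof -
 interpret M1: prob_space M1 by (rule M)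
 interpret M2: prob_space M2 by (rule M)
 have i1: "integrable M1 g1" by (rule M1.integrable_const_bound[where B=C]) (use g1b in auto)
 have i2: "integrable M2 g2" by (rule M2.integrable_const_bound[where B=C]) (use g2b in auto)
 define c where "c = (LINT x|M1. g1 x)"
 have c2: "c = (LINT x|M2. g2 x)" using eq[of 0] by (simp add: c_def)
 have c0: "c >= 0" unfolding c_def using g1b by (intro integral_nonneg_AE) auto
 show ?thesis
 proof (cases "c = 0")
  case True
  have "AE x in M1. g1 x = 0" using integral_nonneg_eq_0_iff_AE[OF i1] g1b True by (simp add: c_def)
  then have "(LINT x|M1. g1 x * indi B (X1 x)) = (LINT x|M1. 0)" by (intro integral_cong_AE) auto
  moreover have "AE x in M2. g2 x = 0" using integral_nonneg_eq_0_iff_AE[OF i2] g2b True c2 by simp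
  then have "(LINT x|M2. g2 x * indi B (X2 x)) = (LINT x|M2. 0)" by (intro integral_cong_AE) auto
  ultimately show ?thesis by simp
 next
  case False
  with c0 have c: "c > 0" by simp
  let ?D1 = "distr (density M1 (%x. ennreal (g1 x / c))) borel X1" and ?D2 = "distr (density M2 (%x. ennreal (g2 x / c))) borel X2"
  have n1: "(\<integral>\<^sup>+ x. ennreal (g1 x / c) \<partial>M1) = 1"
   using nn_integral_eq_integral[of M1 "%x. g1 x / c"] i1 g1b c by (simp add: c_def)
  have n2: "(\<integral>\<^sup>+ x. ennreal (g2 x / c) \<partial>M2) = 1"
   using nn_integral_eq_integral[of M2 "%x. g2 x / c"] i2 g2b c by (simp add: c2)
  interpret D1: prob_space "density M1 (%x. ennreal (g1 x / c))"
   by (rule prob_spaceI) (simp add: emeasure_density n1 cong: nn_integral_cong)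
  interpret D2: prob_space "density M2 (%x. ennreal (g2 x / c))"
   by (rule prob_spaceI) (simp add: emeasure_density n2 cong: nn_integral_cong)
  have "?D1 = ?D2"
  proof (rule Levy_uniqueness)
   show "real_distribution ?D1" by (rule D1.real_distribution_distr) simp
   show "real_distribution ?D2" by (rule D2.real_distribution_distr) simp
   show "char ?D1 = char ?D2"
   proof
    fix t
    have "char ?D1 t = (LINT x|M1. (g1 x / c) *R ei (t * X1 x))"
     unfolding char_def by (subst integral_distr, simp, measurable, subst integral_density) (use g1b c in auto)
    also have "... = (LINT x|M1. of_real (g1 x) * ei (t * X1 x)) / of_real c"
     by (simp add: scaleR_conv_of_real)
    also have "... = (LINT x|M2. (g2 x / c) *R ei (t * X2 x))"
     unfolding eq by (simp add: scaleR_conv_of_real)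
    also have "... = char ?D2 t"
     unfolding char_def by (subst integral_distr, simp, measurable, subst integral_density) (use g2b c in auto)
    finally show "char ?D1 t = char ?D2 t" .
   qed
  qed
  then have "(\<integral>y. (indi B y :: real) \<partial>?D1) = (\<integral>y. (indi B y :: real) \<partial>?D2)" by simp
  moreover have "(\<integral>y. (indi B y :: real) \<partial>?D1) = (LINT x|M1. g1 x * indi B (X1 x)) / c"
   by (subst integral_distr, simp, measurable, subst integral_density) (use g1b c in auto)
  moreover have "(\<integral>y. (indi B y :: real) \<partial>?D2) = (LINT x|M2. g2 x * indi B (X2 x)) / c"
   by (subst integral_distr, simp, measurable, subst integral_density) (use g2b c in auto)
  ultimately show ?thesis using c by simp
 qed
qed

lemma integral_complex_parts:
 fixes f g :: "'a => real"
 assumes "integrable M f" "integrable M g"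
 shows "(LINT x|M. complex_of_real (f x) + \<i> * of_real (g x)) = of_real (LINT x|M. f x) + \<i> * of_real (LINT x|M. g x)"
 using assms by (subst Bochner_Integration.integral_add) (auto simp: integrable_of_real)

text \<open>Induction moves the coordinates one by one from the exponential into the product of
  indicators. Each move is the one-dimensional uniqueness theorem with the factors already converted
  as weight.\<close>

lemma joint_char_unique_aux:
 fixes X1 :: "'i => 'a => real" and X2 :: "'i => 'b => real"
 assumes M: "prob_space M1" "prob_space M2"
  and X1[measurable]: "!!i. X1 i : bmf M1" and X2[measurable]: "!!i. X2 i : bmf M2"
  and eq: "!!J u. finite J ==> (LINT x|M1. ei (SUM a:J. u a * X1 a x)) = (LINT x|M2. ei (SUM a:J. u a * X2 a x))"
  and J1: "finite J1" and B: "!!a. B a : sets borel"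
 shows "finite J2 ==> J1 \<inter> J2 = {} ==> (LINT x|M1. (PROD a:J1. indi (B a) (X1 a x)) * ei (SUM a:J2. u a * X1 a x))
  = (LINT x|M2. (PROD a:J1. indi (B a) (X2 a x)) * ei (SUM a:J2. u a * X2 a x))"
 using J1
proof (induction J1 arbitrary: J2 u rule: finite_induct)
 case empty
 then show ?case using eq[OF empty(1)] by simp
next
 case (insert k J1)
 interpret M1: prob_space M1 by (rule M)
 interpret M2: prob_space M2 by (rule M)
 note [measurable] = B
 note fin = insert.hyps(1) insert.prems(1)
 define P1 where "P1 x = (PROD a:J1. indi (B a) (X1 a x) :: real)" for x
 define P2 where "P2 x = (PROD a:J1. indi (B a) (X2 a x) :: real)" for x
 define S1 where "S1 x = (SUM a:J2. u a * X1 a x)" for x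
 define S2 where "S2 x = (SUM a:J2. u a * X2 a x)" for x
 have [measurable]: "P1 : bmf M1" "P2 : bmf M2" "S1 : bmf M1" "S2 : bmf M2"
  unfolding P1_def[abs_def] P2_def[abs_def] S1_def[abs_def] S2_def[abs_def] by measurable
 have P1: "0 <= P1 x" "P1 x <= 1" for x unfolding P1_def by (auto intro!: prod_nonneg prod_le_1)
 have P2: "0 <= P2 x" "P2 x <= 1" for x unfolding P2_def by (auto intro!: prod_nonneg prod_le_1)
 \<comment> \<open>A free scale \<open>c\<close> is needed because multiplication by the cosine or
   sine of the remaining phase produces that phase with factors \<open>1\<close> and
   \<open>-1\<close>.\<close>
 have IH: "(LINT x|M1. of_real (P1 x) * ei (t * X1 k x + c * S1 x)) = (LINT x|M2. of_real (P2 x) * ei (t * X2 k x + c * S2 x))" for t c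
 proof -
  have k: "k ~: J2" using insert.prems(2) by auto
  have "(LINT x|M1. (PROD a:J1. indi (B a) (X1 a x)) * ei (SUM a:insert k J2. (if a = k then t else c * u a) * X1 a x))
   = (LINT x|M2. (PROD a:J1. indi (B a) (X2 a x)) * ei (SUM a:insert k J2. (if a = k then t else c * u a) * X2 a x))"
   by (rule insert.IH) (use fin insert.prems(2) insert.hyps(2) in auto)
  moreover have "(SUM a:insert k J2. (if a = k then t else c * u a) * Y a) = t * Y k + c * (SUM a:J2. u a * Y a)" for Y :: "'i => real"
  proof -
   have "(SUM a:J2. (if a = k then t else c * u a) * Y a) = (SUM a:J2. c * (u a * Y a))"
    by (rule sum.cong) (use k in auto)
   then show ?thesis using k fin by (simp add: sum_distrib_left)
  qed
  ultimately show ?thesis by (simp add: P1_def P2_def S1_def S2_def of_real_indicator)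
 qed
 have i1: "integrable M1 (%x. of_real (P1 x) * ei (t * X1 k x + c * S1 x) :: complex)" for t c
  by (rule M1.integrable_const_bound[where B=1]) (use P1 in \<open>auto simp: norm_mult\<close>)
 have i2: "integrable M2 (%x. of_real (P2 x) * ei (t * X2 k x + c * S2 x) :: complex)" for t c
  by (rule M2.integrable_const_bound[where B=1]) (use P2 in \<open>auto simp: norm_mult\<close>)
 have cosx: "of_real (cos y) * ei z = (ei (z + 1 * y) + ei (z + (-1) * y)) / 2" for y z
  unfolding cos_of_real[symmetric] cos_exp_eq by (simp add: exp_add exp_diff exp_minus field_simps)
 have sinx: "of_real (sin y) * ei z = (ei (z + 1 * y) - ei (z + (-1) * y)) / (2 * \<i>)" for y z
  unfolding sin_of_real[symmetric] sin_exp_eq by (simp add: exp_add exp_diff exp_minus field_simps)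
 have tb: "0 <= P * (2 + c)" "P * (2 + c) <= 3" if "0 <= P" "P <= 1" "- 1 <= c" "c <= 1" for P c :: real
  using that mult_mono[of P 1 "2 + c" 3] by auto
 have w0: "(LINT x|M1. P1 x * indi (B k) (X1 k x)) = (LINT x|M2. P2 x * indi (B k) (X2 k x))"
  by (rule weighted_char_unique[OF M, where C=1]) (use P1 P2 B IH[of _ 0] in auto)
 \<comment> \<open>Weights must be nonnegative, whereas the remaining phase is complex: its real and
   imaginary parts enter as \<open>2 + cos\<close> and \<open>2 + sin\<close>, and twice
   \<open>w0\<close> is subtracted afterwards.\<close>
 have wc: "(LINT x|M1. (P1 x * (2 + cos (S1 x))) * indi (B k) (X1 k x)) = (LINT x|M2. (P2 x * (2 + cos (S2 x))) * indi (B k) (X2 k x))"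
 proof (rule weighted_char_unique[OF M, where C=3])
  fix t
  have e: "of_real (P * (2 + cos y)) * ei (t * z) = 2 * (of_real P * ei (t * z + 0 * y)) +
    ((of_real P * ei (t * z + 1 * y)) + of_real P * ei (t * z + (-1) * y)) / 2" for P y z :: real
   using cosx[of y "t * z"] by (simp add: algebra_simps)
  show "(LINT x|M1. of_real (P1 x * (2 + cos (S1 x))) * ei (t * X1 k x)) = (LINT x|M2. of_real (P2 x * (2 + cos (S2 x))) * ei (t * X2 k x))"
   unfolding e
   by (subst (1 2) Bochner_Integration.integral_add, (intro integrable_mult_right i1 i2 integrable_divide Bochner_Integration.integrable_add)+,
    subst (1 2) integral_divide_zero, subst (1 2) Bochner_Integration.integral_add, (intro i1 i2)+, simp only: integral_mult_right_zero IH)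
  show "P1 x * (2 + cos (S1 x)) <= 3" "0 <= P1 x * (2 + cos (S1 x))" for x
   by (intro tb P1 cos_le_one cos_ge_minus_one)+
  show "P2 x * (2 + cos (S2 x)) <= 3" "0 <= P2 x * (2 + cos (S2 x))" for x
   by (intro tb P2 cos_le_one cos_ge_minus_one)+
 qed (use B in auto)
 have ws: "(LINT x|M1. (P1 x * (2 + sin (S1 x))) * indi (B k) (X1 k x)) = (LINT x|M2. (P2 x * (2 + sin (S2 x))) * indi (B k) (X2 k x))"
 proof (rule weighted_char_unique[OF M, where C=3])
  fix t
  have e: "of_real (P * (2 + sin y)) * ei (t * z) = 2 * (of_real P * ei (t * z + 0 * y)) +
    ((of_real P * ei (t * z + 1 * y)) - of_real P * ei (t * z + (-1) * y)) / (2 * \<i>)" for P y z :: real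
   using sinx[of y "t * z"] by (simp add: algebra_simps)
  show "(LINT x|M1. of_real (P1 x * (2 + sin (S1 x))) * ei (t * X1 k x)) = (LINT x|M2. of_real (P2 x * (2 + sin (S2 x))) * ei (t * X2 k x))"
   unfolding e
   by (subst (1 2) Bochner_Integration.integral_add, (intro integrable_mult_right i1 i2 integrable_divide Bochner_Integration.integrable_diff)+,
    subst (1 2) integral_divide_zero, subst (1 2) Bochner_Integration.integral_diff, (intro i1 i2)+, simp only: integral_mult_right_zero IH)
  show "P1 x * (2 + sin (S1 x)) <= 3" "0 <= P1 x * (2 + sin (S1 x))" for x
   by (intro tb P1 sin_le_one sin_ge_minus_one)+
  show "P2 x * (2 + sin (S2 x)) <= 3" "0 <= P2 x * (2 + sin (S2 x))" for x
   by (intro tb P2 sin_le_one sin_ge_minus_one)+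
 qed (use B in auto)
 have ri: "integrable M1 (%x. (P1 x * f (S1 x)) * indi (B k) (X1 k x))" "integrable M2 (%x. (P2 x * f (S2 x)) * indi (B k) (X2 k x))"
  if [measurable]: "f : bm" and f: "!!y. \<bar>f y\<bar> <= 1" for f :: "real => real"
 proof -
  show "integrable M1 (%x. (P1 x * f (S1 x)) * indi (B k) (X1 k x))"
   by (rule M1.integrable_const_bound[where B=1])
    (use P1 f in \<open>auto simp: abs_mult indicator_def intro!: mult_le_one AE_I2\<close>)
  show "integrable M2 (%x. (P2 x * f (S2 x)) * indi (B k) (X2 k x))"
   by (rule M2.integrable_const_bound[where B=1])
    (use P2 f in \<open>auto simp: abs_mult indicator_def intro!: mult_le_one AE_I2\<close>)
 qed
 have r: "(LINT x|M1. (P1 x * f (S1 x)) * indi (B k) (X1 k x)) = (LINT x|M2. (P2 x * f (S2 x)) * indi (B k) (X2 k x))"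
  if [measurable]: "f : bm" and f: "!!y. \<bar>f y\<bar> <= 1"
   and e: "(LINT x|M1. (P1 x * (2 + f (S1 x))) * indi (B k) (X1 k x)) = (LINT x|M2. (P2 x * (2 + f (S2 x))) * indi (B k) (X2 k x))" for f :: "real => real"
 proof -
  have "(LINT x|M1. (P1 x * (2 + f (S1 x))) * indi (B k) (X1 k x)) = 2 * (LINT x|M1. (P1 x * 1) * indi (B k) (X1 k x)) + (LINT x|M1. (P1 x * f (S1 x)) * indi (B k) (X1 k x))"
   (is "?l = ?r")
  proof -
   have "?l = (LINT x|M1. 2 * ((P1 x * 1) * indi (B k) (X1 k x)) + (P1 x * f (S1 x)) * indi (B k) (X1 k x))"
    by (intro int_cong refl) (simp add: algebra_simps)
   also have "... = ?r"
    by (subst Bochner_Integration.integral_add) (use ri[of "%_. 1"] ri[OF that(1) f] in auto)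
   finally show ?thesis .
  qed
  moreover have "(LINT x|M2. (P2 x * (2 + f (S2 x))) * indi (B k) (X2 k x)) = 2 * (LINT x|M2. (P2 x * 1) * indi (B k) (X2 k x)) + (LINT x|M2. (P2 x * f (S2 x)) * indi (B k) (X2 k x))"
   (is "?l = ?r")
  proof -
   have "?l = (LINT x|M2. 2 * ((P2 x * 1) * indi (B k) (X2 k x)) + (P2 x * f (S2 x)) * indi (B k) (X2 k x))"
    by (intro int_cong refl) (simp add: algebra_simps)
   also have "... = ?r"
    by (subst Bochner_Integration.integral_add) (use ri[of "%_. 1"] ri[OF that(1) f] in auto)
   finally show ?thesis .
  qed
  ultimately show ?thesis using w0 e by simp
 qed
 have split: "(PROD a:insert k J1. indi (B a) (Y a)) * ei z = of_real ((P * cos z) * indi (B k) (Y k)) + \<i> * of_real ((P * sin z) * indi (B k) (Y k))"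
  if "P = (PROD a:J1. indi (B a) (Y a) :: real)" for Y :: "'i => real" and P z
 proof -
  have "(PROD a:insert k J1. indi (B a) (Y a)) = complex_of_real (P * indi (B k) (Y k))"
   using insert.hyps by (simp add: that of_real_prod of_real_indicator mult.commute)
  moreover have "ei z = of_real (cos z) + \<i> * of_real (sin z)"
   by (simp add: cis_conv_exp[symmetric] complex_eq_iff)
  ultimately show ?thesis by (simp add: algebra_simps)
 qed
 show ?case
  unfolding S1_def[symmetric] S2_def[symmetric]
  unfolding split[OF P1_def] split[OF P2_def]
  by (subst (1 2) integral_complex_parts) (use ri[of cos] ri[of sin] r[of cos] r[of sin] wc ws in \<open>simp_all\<close>)
qed

lemma PiM_char_unique:
 fixes M1 M2 :: "('i => real) measure"
 assumes M: "prob_space M1" "prob_space M2"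
  and s1[measurable_cong]: "sets M1 = sets (PiM UNIV (%_. borel))" and s2[measurable_cong]: "sets M2 = sets (PiM UNIV (%_. borel))"
  and eq: "!!J u. finite J ==> (LINT x|M1. ei (SUM a:J. u a * x a)) = (LINT x|M2. ei (SUM a:J. u a * x a))"
 shows "M1 = M2"
proof (rule measure_eqI_PiM_infinite[OF s1 s2])
 interpret M1: prob_space M1 by (rule M)
 interpret M2: prob_space M2 by (rule M)
 show "finite_measure M1" by unfold_locales
 fix A :: "'i => real set" and J :: "'i set" assume J: "finite J" and A: "!!i. i : J ==> A i : sets borel"
 \<comment> \<open>The value outside \<open>J\<close> is a dummy that makes every \<open>B i\<close>
   measurable.\<close>
 define B where "B i = (if i : J then A i else {})" for i
 have B[measurable]: "B i : sets borel" for i using A by (auto simp: B_def)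
 have c1: "(%x. x i) : bmf M1" and c2: "(%x. x i) : bmf M2" for i by measurable
 let ?E = "prod_emb UNIV (%_. borel) J (Pi\<^sub>E J A)"
 have E: "?E : sets (PiM UNIV (%_. borel))" using J A by (intro sets_PiM_I) auto
 have ind: "(PROD a:J. indi (B a) (x a)) = complex_of_real (indi ?E x)" for x
 proof (cases "x : ?E")
  case True
  then have "x a : B a" if "a : J" for a using that by (auto simp: prod_emb_def B_def PiE_iff)
  then show ?thesis using True by simp
 next
  case False
  then obtain a where "a : J" "x a ~: B a" by (auto simp: prod_emb_def B_def PiE_iff)
  then have "(PROD a:J. indi (B a) (x a)) = (0::complex)" using \<open>a : J\<close> by (intro prod_zero J bexI[of _ a]) auto
  then show ?thesis using False by simp
 qed
 have "(LINT x|M1. (PROD a:J. indi (B a) (x a)) * ei (SUM a:{}. (0::real) * x a))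
   = (LINT x|M2. (PROD a:J. indi (B a) (x a)) * ei (SUM a:{}. (0::real) * x a))"
  by (rule joint_char_unique_aux[OF M c1 c2 eq J B]) auto
 then have "(LINT x|M1. complex_of_real (indi ?E x)) = (LINT x|M2. complex_of_real (indi ?E x))"
  unfolding ind by simp
 then have "complex_of_real (measure M1 ?E) = of_real (measure M2 ?E)"
  using E s1 s2 sets_eq_imp_space_eq[OF s1] sets_eq_imp_space_eq[OF s2] by (simp add: space_PiM)
 then show "emeasure M1 ?E = emeasure M2 ?E"
  by (simp add: M1.emeasure_eq_measure M2.emeasure_eq_measure)
qed

section \<open>Poisson random measures\<close>

locale poisson_rm = prob_space M for M :: "'w measure" +
 fixes N :: "'w => 'e measure" and nu :: "'e measure"
 assumes prm: "poisson_random_measure M N nu"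
begin

lemma sets_N: "w : space M ==> sets (N w) = sets nu"
 using prm by (auto simp: poisson_random_measure_def)

lemma space_N: "w : space M ==> space (N w) = space nu"
 using sets_N sets_eq_imp_space_eq by blast

lemma meas_N: "w : space M ==> bmf (N w) = bmf nu"
 by (intro measurable_cong_sets sets_N refl)

lemma N_measurable[measurable]: "A : sets nu ==> (%w. emeasure (N w) A) : bmf M"
 using prm by (auto simp: poisson_random_measure_def)

lemma N_pois:
 "A : sets nu ==> emeasure nu A < \<infinity> ==>
  prob {w:space M. emeasure (N w) A = of_nat k} = measure nu A ^ k / fact k * exp (- measure nu A)"
 using prm by (auto simp: poisson_random_measure_def)

lemma N_indep:
 "range A \<subseteq> sets nu ==> disjoint_family A ==>
  indep_vars (%_. borel) (%i w. emeasure (N w) (A i)) (UNIV :: nat set)"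
 using prm by (auto simp: poisson_random_measure_def)

text \<open>Only the probabilities of the values \<open>k\<close> are prescribed; as they add up to
  \<open>1\<close>, no other value occurs with positive probability.\<close>

lemma AE_N_nat:
 assumes A: "A : sets nu" "emeasure nu A < \<infinity>"
 shows "AE w in M. EX k. emeasure (N w) A = of_nat k"
proof -
 define E where "E k = {w:space M. emeasure (N w) A = of_nat k}" for k :: nat
 have E: "E k : events" for k unfolding E_def using A by measurable
 have "(%k. prob (E k)) sums prob (\<Union>k. E k)"
  using E by (intro finite_measure_UNION) (auto simp: disjoint_family_on_def E_def)
 moreover have "(%k. prob (E k)) sums 1"
 proof -
  let ?m = "measure nu A"
  have "(%k. ?m ^ k /\<^sub>R fact k * exp (- ?m)) sums (exp ?m * exp (- ?m))"
   by (intro sums_mult2 exp_converges)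
  then show ?thesis unfolding E_def N_pois[OF A] by (simp add: exp_minus divide_inverse mult_ac)
 qed
 ultimately have "prob (\<Union>k. E k) = 1" using sums_unique2 by blast
 from AE_prob_1[OF this] show ?thesis by eventually_elim (auto simp: E_def)
qed

lemma AE_N_finite:
 assumes A: "A : sets nu" "emeasure nu A < \<infinity>"
 shows "AE w in M. emeasure (N w) A < \<infinity>"
 using AE_N_nat[OF A] by eventually_elim (auto simp: of_nat_less_top)

text \<open>Complex \<open>c\<close> in the left half plane combine the Laplace transform, required
  for \<open>exp(-t S)\<close>, with the characteristic function of the path.\<close>

lemma N_exp:
 assumes A: "A : sets nu" "emeasure nu A < \<infinity>" and c: "Re c <= 0"
 shows "(LINT w|M. exp (c * of_real (measure (N w) A))) = exp (of_real (measure nu A) * (exp c - 1))"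
proof -
 let ?m = "measure nu A"
 define E where "E k = {w:space M. emeasure (N w) A = of_nat k}" for k :: nat
 have E[measurable]: "E k : events" for k unfolding E_def using A by measurable
 define f where "f k w = indi (E k) w *R exp (c * of_nat k)" for k w
 have f_at: "f k w = (if k = k0 then exp (c * of_nat k) else 0)" if "w : space M" "emeasure (N w) A = of_nat k0" for k k0 w
  using that by (auto simp: f_def E_def)
 have int: "integrable M (f k)" for k unfolding f_def
  by (rule integrable_scaleR_left, rule integrable_real_indicator[OF E]) (simp add: less_top[symmetric])
 have intn: "(LINT w|M. norm (f k w)) = prob (E k) * norm (exp (c * of_nat k))" for k
 proof -
  have eq: "(%w. norm (f k w)) = (%w. indi (E k) w *R norm (exp (c * of_nat k)))"
   by (rule ext) (simp add: f_def del: norm_exp_eq_Re)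
  have "integrable M (indi (E k) :: _ => real)"
   by (rule integrable_real_indicator[OF E]) (simp add: less_top[symmetric])
  then show ?thesis unfolding eq by (subst integral_scaleR_left) simp_all
 qed
 have intf: "(LINT w|M. f k w) = of_real (prob (E k)) * exp (c * of_nat k)" for k
 proof -
  have "integrable M (indi (E k) :: _ => real)"
   by (rule integrable_real_indicator[OF E]) (simp add: less_top[symmetric])
  then show ?thesis unfolding f_def by (subst integral_scaleR_left) (simp_all add: scaleR_conv_of_real)
 qed
 have ne: "norm (exp (c * of_nat k)) <= 1" for k
  using c by (simp add: norm_exp_eq_Re mult_nonpos_nonneg)
 have pE: "prob (E k) = ?m ^ k / fact k * exp (- ?m)" for k unfolding E_def by (rule N_pois[OF A])
 have "summable (%k. ?m ^ k /\<^sub>R fact k * exp (- ?m))"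
  using sums_mult2[OF exp_converges[of ?m], of "exp (- ?m)"] by (rule sums_summable)
 then have sE: "summable (%k. prob (E k))" unfolding pE by (simp add: divide_inverse mult_ac)
 have s1: "summable (%k. \<integral>w. norm (f k w) \<partial>M)"
  unfolding intn
  by (rule summable_comparison_test'[OF sE, of 0]) (use ne in \<open>auto simp: mult_left_le\<close>)
 have AEk: "AE w in M. EX k. emeasure (N w) A = of_nat k" by (rule AE_N_nat[OF A])
 have s2: "AE w in M. summable (%k. norm (f k w))"
  using AEk AE_space
 proof eventually_elim
  case (elim w)
  then obtain k0 where "emeasure (N w) A = of_nat k0" by blast
  from f_at[OF elim(2) this] show ?case
   by (intro summable_finite[of "{k0}"]) auto
 qed
 have "(LINT w|M. exp (c * of_real (measure (N w) A))) = (LINT w|M. (\<Sum>k. f k w))"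
 proof (rule integral_cong_AE)
  show "(%w. exp (c * of_real (measure (N w) A))) : bmf M"
   unfolding measure_def using A by measurable
  show "(%w. \<Sum>k. f k w) : bmf M"
   using int by (intro borel_measurable_suminf) auto
  show "AE w in M. exp (c * of_real (measure (N w) A)) = (\<Sum>k. f k w)"
   using AEk AE_space
  proof eventually_elim
   case (elim w)
   then obtain k0 where k0: "emeasure (N w) A = of_nat k0" by blast
   have "(\<Sum>k. f k w) = (SUM k:{k0}. f k w)"
    by (rule suminf_finite) (auto simp: f_at[OF elim(2) k0])
   also have "... = exp (c * of_nat k0)" by (simp add: f_at[OF elim(2) k0])
   finally show ?case using k0 by (simp add: measure_def)
  qed
 qed
 also have "... = (\<Sum>k. \<integral>w. f k w \<partial>M)" by (rule integral_suminf[OF int s2 s1])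
 also have "... = (\<Sum>k. (of_real ?m * exp c) ^ k /\<^sub>R fact k * exp (- of_real ?m))"
  unfolding intf pE
  by (intro suminf_cong) (simp add: exp_of_nat2_mult power_mult_distrib scaleR_conv_of_real divide_inverse exp_of_real[symmetric] mult_ac)
 also have "... = exp (of_real ?m * exp c) * exp (- of_real ?m)"
  by (intro sums_unique[symmetric] sums_mult2 exp_converges)
 also have "... = exp (of_real ?m * (exp c - 1))" by (simp add: exp_add[symmetric] algebra_simps)
 finally show ?thesis .
qed

lemma nn_integral_N_measurable:
 assumes "f : bmf nu" shows "(%w. \<integral>\<^sup>+ z. f z \<partial>N w) : bmf M"
 using assms
proof (induction f rule: borel_measurable_induct)
 case (cong f g)
 have "(\<integral>\<^sup>+ z. f z \<partial>N w) = (\<integral>\<^sup>+ z. g z \<partial>N w)" if "w : space M" for w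
  using cong(3) space_N[OF that] by (intro nn_integral_cong) auto
 from measurable_cong[THEN iffD2, OF this cong(4)] show ?case by simp
next
 case (set A)
 have "(\<integral>\<^sup>+ z. indi A z \<partial>N w) = emeasure (N w) A" if "w : space M" for w
  using set sets_N[OF that] by simp
 from measurable_cong[THEN iffD2, OF this N_measurable[OF set]] show ?case by simp
next
 case (mult u c)
 have "(\<integral>\<^sup>+ z. c * u z \<partial>N w) = c * (\<integral>\<^sup>+ z. u z \<partial>N w)" if "w : space M" for w
  using mult(2) meas_N[OF that] by (intro nn_integral_cmult) auto
 moreover have "(%w. c * (\<integral>\<^sup>+ z. u z \<partial>N w)) : bmf M" using mult(4) by measurable
 ultimately show ?case by (rule measurable_cong[THEN iffD2])
next
 case (add u v)
 have "(\<integral>\<^sup>+ z. v z + u z \<partial>N w) = (\<integral>\<^sup>+ z. v z \<partial>N w) + (\<integral>\<^sup>+ z. u z \<partial>N w)" if "w : space M" for w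
  using add.hyps(1,3) meas_N[OF that] by (intro nn_integral_add) auto
 moreover have "(%w. (\<integral>\<^sup>+ z. v z \<partial>N w) + (\<integral>\<^sup>+ z. u z \<partial>N w)) : bmf M" using add.IH by measurable
 ultimately show ?case by (rule measurable_cong[THEN iffD2])
next
 case (seq U)
 have "(\<integral>\<^sup>+ z. (SUP i. U i) z \<partial>N w) = (SUP i. \<integral>\<^sup>+ z. U i z \<partial>N w)" if "w : space M" for w
  using seq.hyps(1,3) meas_N[OF that] unfolding SUP_apply
  by (intro nn_integral_monotone_convergence_SUP) auto
 moreover have "(%w. SUP i. \<integral>\<^sup>+ z. U i z \<partial>N w) : bmf M" using seq.IH by measurable
 ultimately show ?case by (rule measurable_cong[THEN iffD2])
qed

text \<open>Where the integrand is not integrable the integral has the default value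
  \<open>0\<close>, so the set where this happens has to be shown measurable along with the
  integral.\<close>

lemma integral_N_measurable:
 fixes f :: "'e => real"
 assumes f[measurable]: "f : bmf nu" shows "(%w. \<integral>z. f z \<partial>N w) : bmf M"
proof -
 let ?a = "%w. \<integral>\<^sup>+ z. ennreal (norm (f z)) \<partial>N w"
 have [measurable]: "?a : bmf M"
  "(%w. \<integral>\<^sup>+ z. ennreal (f z) \<partial>N w) : bmf M"
  "(%w. \<integral>\<^sup>+ z. ennreal (- f z) \<partial>N w) : bmf M"
  by (intro nn_integral_N_measurable; measurable)+
 have "(\<integral>z. f z \<partial>N w) = (if ?a w < \<infinity> then enn2real (\<integral>\<^sup>+ z. ennreal (f z) \<partial>N w) - enn2real (\<integral>\<^sup>+ z. ennreal (- f z) \<partial>N w) else 0)"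
  if "w : space M" for w
 proof (cases "?a w < \<infinity>")
  case True
  have "f : bmf (N w)" unfolding meas_N[OF that] by (rule f)
  with True have "integrable (N w) f" by (simp add: integrable_iff_bounded)
  then show ?thesis using True by (simp add: real_lebesgue_integral_def)
 next
  case False
  then have "~ integrable (N w) f" by (simp add: integrable_iff_bounded)
  then show ?thesis using False by (simp add: not_integrable_integral_eq)
 qed
 moreover have "(%w. if ?a w < \<infinity> then enn2real (\<integral>\<^sup>+ z. ennreal (f z) \<partial>N w) - enn2real (\<integral>\<^sup>+ z. ennreal (- f z) \<partial>N w) else 0) : bmf M"
  by measurable
 ultimately show ?thesis by (rule measurable_cong[THEN iffD2])
qed

lemma set_integral_N_measurable:
 fixes f :: "'e => real"
 assumes [measurable]: "f : bmf nu" "B : sets nu"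
 shows "(%w. LINT z:B|N w. f z) : bmf M"
 unfolding set_lebesgue_integral_def by (rule integral_N_measurable) measurable

text \<open>\<open>f\<close> may be unbounded, but the intensity of the sets \<open>C j\<close>
  where it exceeds \<open>j\<close> tends to \<open>0\<close>. Hence almost surely some
  \<open>C j\<close> contains no point, and \<open>f\<close> is bounded on the finitely many points
  in \<open>B\<close>.\<close>

lemma AE_N_integrable:
 fixes f :: "'e => real"
 assumes f[measurable]: "f : bmf nu" and B[measurable]: "B : sets nu" and fin: "emeasure nu B < \<infinity>"
 shows "AE w in M. set_integrable (N w) B f"
proof -
 define C where "C j = {z:space nu. z : B & \<bar>f z\<bar> >= real j}" for j :: nat
 have C[measurable]: "C j : sets nu" for j unfolding C_def by measurable
 have CB: "C j \<subseteq> B" for j by (auto simp: C_def)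
 have Cfin: "emeasure nu (C j) < \<infinity>" for j
  using emeasure_mono[OF CB B] fin by (rule le_less_trans)
 have "(%j. measure nu (C j)) ----> measure nu (\<Inter>j. C j)"
 proof (rule Lim_measure_decseq)
  show "decseq C" by (auto simp: decseq_def C_def)
  show "emeasure nu (C i) ~= \<infinity>" for i using Cfin[of i] by simp
 qed auto
 moreover have "(\<Inter>j. C j) = {}"
 proof -
  have "EX j. z ~: C j" for z using reals_Archimedean2[of "\<bar>f z\<bar>"] by (auto simp: C_def not_le)
  then show ?thesis by blast
 qed
 ultimately have C0: "(%j. measure nu (C j)) ----> 0" by simp
 define Z where "Z = {w:space M. ALL j. emeasure (N w) (C j) ~= 0}"
 have Z[measurable]: "Z : events" unfolding Z_def by measurable
 have le: "prob Z <= 1 - exp (- measure nu (C j))" for j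
 proof -
  have "prob Z <= prob (space M - {w:space M. emeasure (N w) (C j) = of_nat 0})"
   by (rule finite_measure_mono) (auto simp: Z_def)
  also have "... = 1 - prob {w:space M. emeasure (N w) (C j) = of_nat 0}"
   by (rule prob_compl) measurable
  finally show ?thesis unfolding N_pois[OF C Cfin] by simp
 qed
 have "(%j. 1 - exp (- measure nu (C j))) ----> 1 - exp (- 0)" by (intro tendsto_intros C0)
 then have "prob Z <= 0" by (intro LIMSEQ_le_const[of _ 0]) (use le in auto)
 then have "prob Z = 0" using measure_nonneg[of M Z] by linarith
 then have "AE w in M. w ~: Z" by (simp add: prob_eq_0)
 with AE_N_finite[OF B fin] AE_space show ?thesis
 proof eventually_elim
  case (elim w)
  then obtain j where j: "emeasure (N w) (C j) = 0" by (auto simp: Z_def)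
  note s = sets_N[OF elim(2)]
  have 1: "integrable (N w) (%z. indi B z *R real j)"
   by (intro integrable_scaleR_left) (use elim s in \<open>auto simp: integrable_indicator_iff\<close>)
  have "AE z in N w. z ~: C j" using j s by (intro AE_not_in) (auto simp: null_sets_def)
  then have 2: "AE z in N w. norm (indi B z *R f z) <= norm (indi B z *R real j)"
   using AE_space by eventually_elim (use space_N[OF elim(2)] in \<open>auto simp: C_def indicator_def\<close>)
  have 3: "(%z. indi B z *R f z) : bmf (N w)"
   unfolding meas_N[OF elim(2)] by measurable
  show ?case unfolding set_integrable_def by (rule int_bound[OF 1 3 2])
 qed
qed

text \<open>On the joint level sets of \<open>(f, h)\<close> both integrals are finite combinations
  of independent Poisson counts, and \<open>N_exp\<close> evaluates each factor.\<close>

lemma campbell_simple: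
 fixes f h :: "'e => real"
 assumes f: "simple_function nu f" and h: "simple_function nu h" and f0: "!!z. z : space nu ==> 0 <= f z"
  and B[measurable]: "B : sets nu" and fin: "emeasure nu B < \<infinity>"
 shows "(LINT w|M. exp (Complex (- (LINT z:B|N w. f z)) (LINT z:B|N w. h z)))
  = exp (LINT z:B|nu. exp (Complex (- f z) (h z)) - 1)"
proof -
 define R where "R = (%z. (f z, h z)) ` space nu"
 have "R \<subseteq> f ` space nu \<times> h ` space nu" by (auto simp: R_def)
 then have finR: "finite R"
  using f h by (meson finite_SigmaI finite_subset simple_functionD(1))
 define n where "n = card R"
 obtain r where r: "bij_betw r {0..<n} R" using ex_bij_betw_nat_finite[OF finR] unfolding n_def by blast
 \<comment> \<open>Padding with empty sets, since independence is stated for infinite disjoint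
   sequences.\<close>
 define A where "A i = (if i < n then {z:space nu. z : B & f z = fst (r i) & h z = snd (r i)} else {})" for i
 have [measurable]: "f : bmf nu" "h : bmf nu"
  using f h by (auto intro: borel_measurable_simple_function)
 have A[measurable]: "A i : sets nu" for i unfolding A_def by (auto; measurable)
 have Afin: "emeasure nu (A i) < \<infinity>" for i
  by (rule le_less_trans[OF emeasure_mono[OF _ B] fin]) (auto simp: A_def)
 have inj: "r i = r j \<longleftrightarrow> i = j" if "i < n" "j < n" for i j
  using r that unfolding bij_betw_def inj_on_def by auto
 have disj: "disjoint_family A"
  unfolding disjoint_family_on_def
 proof safe
  fix i j z assume "i ~= j" "z : A i" "z : A j"
  then have "i < n" "j < n" "r i = r j" by (auto simp: A_def prod_eq_iff split: if_splits)
  with inj \<open>i ~= j\<close> show "z : {}" by auto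
 qed
 have dec: "EX! i. i < n & z : A i" if "z : space nu" "z : B" for z
 proof -
  have "(f z, h z) : R" using that by (auto simp: R_def)
  then obtain i where i: "i < n" "r i = (f z, h z)" using r unfolding bij_betw_def by force
  then have "z : A i" using that by (auto simp: A_def)
  moreover have "j = i" if "j < n" "z : A j" for j
   using disj \<open>z : A i\<close> that by (auto simp: disjoint_family_on_def)
  ultimately show ?thesis using i by blast
 qed
 have expand: "indi B z *R ph (f z, h z) = (SUM i<n. indi (A i) z *R ph (r i))" if z: "z : space nu"
  for z and ph :: "real \<times> real => 'b::real_vector"
 proof (cases "z : B")
  case True
  from dec[OF z True] obtain i where i: "i < n" "z : A i" by blast
  have ni: "z ~: A j" if "j < n" "j ~= i" for j using dec[OF z True] i that by blast
  have "(SUM j<n. indi (A j) z *R ph (r j)) = (SUM j<n. if j = i then ph (r i) else 0)"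
  proof (rule sum.cong[OF refl])
   fix j assume "j : {..<n}"
   then show "indi (A j) z *R ph (r j) = (if j = i then ph (r i) else 0)"
    using ni[of j] i by (cases "j = i") simp_all
  qed
  also have "... = ph (r i)" using i by simp
  also have "r i = (f z, h z)" using i by (auto simp: A_def prod_eq_iff)
  finally show ?thesis using True by simp
 next
  case False
  then have "z ~: A i" for i by (auto simp: A_def)
  with False show ?thesis by simp
 qed
 have int_expand: "(LINT z:B|K. ph (f z, h z)) = (SUM i<n. measure K (A i) *R ph (r i))"
  if K: "sets K = sets nu" "emeasure K B < \<infinity>" for K and ph :: "real \<times> real => 'b::{banach, second_countable_topology}"
 proof -
  have sp: "space K = space nu" using K(1) by (rule sets_eq_imp_space_eq)
  have KA: "emeasure K (A i) < \<infinity>" for i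
   by (rule le_less_trans[OF emeasure_mono K(2)]) (use K(1) B in \<open>auto simp: A_def\<close>)
  have "(LINT z:B|K. ph (f z, h z)) = (LINT z|K. (SUM i<n. indi (A i) z *R ph (r i)))"
   unfolding set_lebesgue_integral_def by (intro int_cong refl expand) (simp add: sp)
  also have "... = (SUM i<n. \<integral>z. indi (A i) z *R ph (r i) \<partial>K)"
   by (rule Bochner_Integration.integral_sum) (use K KA A in \<open>auto intro!: integrable_scaleR_left simp: integrable_indicator_iff\<close>)
  also have "... = (SUM i<n. measure K (A i) *R ph (r i))"
   using K KA A by (intro sum.cong refl) (simp add: sets.Int_space_eq2)
  finally show ?thesis .
 qed
 define c where "c i = Complex (- fst (r i)) (snd (r i))" for i
 have cRe: "Re (c i) <= 0" if "i < n" for i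
 proof -
  have "r i : R" using r that unfolding bij_betw_def by auto
  then show ?thesis using f0 by (auto simp: c_def R_def)
 qed
 have "AE w in M. exp (Complex (- (LINT z:B|N w. f z)) (LINT z:B|N w. h z)) = (PROD i<n. exp (c i * of_real (measure (N w) (A i))))"
  using AE_N_finite[OF B fin] AE_space
 proof eventually_elim
  case (elim w)
  have "Complex (- (LINT z:B|N w. f z)) (LINT z:B|N w. h z) = (SUM i<n. c i * of_real (measure (N w) (A i)))"
   using int_expand[OF sets_N[OF elim(2)] elim(1), of fst] int_expand[OF sets_N[OF elim(2)] elim(1), of snd]
   by (simp add: complex_eq_iff Re_sum Im_sum c_def sum_negf mult.commute)
  then show ?case by (simp add: exp_sum)
 qed
 then have "(LINT w|M. exp (Complex (- (LINT z:B|N w. f z)) (LINT z:B|N w. h z))) = (LINT w|M. (PROD i<n. exp (c i * of_real (measure (N w) (A i)))))"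
 proof (rule integral_cong_AE[rotated 2])
  have [measurable]: "(%w. LINT z:B|N w. f z) : bmf M" "(%w. LINT z:B|N w. h z) : bmf M"
   by (intro set_integral_N_measurable; measurable)+
  show "(%w. exp (Complex (- (LINT z:B|N w. f z)) (LINT z:B|N w. h z))) : bmf M"
   unfolding Complex_eq by measurable
  show "(%w. PROD i<n. exp (c i * of_real (measure (N w) (A i)))) : bmf M"
   unfolding measure_def by measurable
 qed
 also have "... = (PROD i<n. \<integral>w. exp (c i * of_real (measure (N w) (A i))) \<partial>M)"
 proof (rule indep_vars_lebesgue_integral)
  have "indep_vars (%_. borel) (%i w. emeasure (N w) (A i)) (UNIV :: nat set)"
   using A disj by (intro N_indep) auto
  then have "indep_vars (%_. borel) (%i w. emeasure (N w) (A i)) {..<n}" by (rule indep_vars_subset) simp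
  then show "indep_vars (%_. borel) (%i w. exp (c i * of_real (measure (N w) (A i)))) {..<n}"
   unfolding measure_def by (rule indep_vars_compose2) measurable
  fix i assume i: "i : {..<n}"
  show "integrable M (%w. exp (c i * of_real (measure (N w) (A i))))"
  proof (rule integrable_const_bound[where B=1])
   show "AE w in M. norm (exp (c i * of_real (measure (N w) (A i)))) <= 1"
    using cRe i by (auto simp: norm_exp_eq_Re mult_nonpos_nonneg)
   show "(%w. exp (c i * of_real (measure (N w) (A i)))) : bmf M"
    unfolding measure_def by measurable
  qed
 qed simp
 also have "... = (PROD i<n. exp (of_real (measure nu (A i)) * (exp (c i) - 1)))"
  by (intro prod.cong refl N_exp A Afin cRe) simp
 also have "... = exp (SUM i<n. measure nu (A i) *R (exp (c i) - 1))"
  by (simp add: exp_sum scaleR_conv_of_real)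
 also have "(SUM i<n. measure nu (A i) *R (exp (c i) - 1)) = (LINT z:B|nu. exp (Complex (- f z) (h z)) - 1)"
  using int_expand[OF refl fin, of "%p. exp (Complex (- fst p) (snd p)) - 1"] by (simp add: c_def)
 finally show ?thesis .
qed

lemma campbell:
 fixes f h :: "'e => real"
 assumes f[measurable]: "f : bmf nu" and h[measurable]: "h : bmf nu" and f0: "!!z. 0 <= f z"
  and B[measurable]: "B : sets nu" and fin: "emeasure nu B < \<infinity>"
 shows "(LINT u|M. exp (Complex (- (LINT z:B|N u. f z)) (LINT z:B|N u. h z)))
  = exp (LINT z:B|nu. exp (Complex (- f z) (h z)) - 1)"
proof -
 obtain F where F: "!!i. simple_function nu (F i)" "!!x. x : space nu ==> (%i. F i x) ----> f x"
  "!!i x. x : space nu ==> norm (F i x) <= 2 * norm (f x)"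
  using borel_measurable_implies_sequence_metric[OF f, of 0] unfolding norm_conv_dist by metis
 obtain H where H: "!!i. simple_function nu (H i)" "!!x. x : space nu ==> (%i. H i x) ----> h x"
  "!!i x. x : space nu ==> norm (H i x) <= 2 * norm (h x)"
  using borel_measurable_implies_sequence_metric[OF h, of 0] unfolding norm_conv_dist by metis
 \<comment> \<open>The approximating simple functions of \<open>f\<close> may be negative; their
   absolute values still converge to \<open>f\<close> because \<open>f\<close> is
   nonnegative.\<close>
 define G where "G i z = \<bar>F i z\<bar>" for i z
 have Gs: "simple_function nu (G i)" for i unfolding G_def by (rule simple_function_compose1[OF F(1)])
 have Gl: "(%i. G i x) ----> f x" if "x : space nu" for x
  using tendsto_rabs[OF F(2)[OF that]] f0[of x] by (simp add: G_def)
 have Gb: "norm (G i x) <= 2 * norm (f x)" if "x : space nu" for i x using F(3)[OF that] by (simp add: G_def)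
 have [measurable]: "G i : bmf nu" "H i : bmf nu" for i
  using Gs H(1) by (auto intro: borel_measurable_simple_function)
 have conv: "(%i. LINT z:B|K. g i z) ----> (LINT z:B|K. k z)"
  if K: "sets K = sets nu" "set_integrable K B k" and g: "!!i. g i : bmf nu" "k : bmf nu"
   "!!x. x : space nu ==> (%i. g i x) ----> k x" "!!i x. x : space nu ==> norm (g i x) <= 2 * norm (k x)"
  for K and g :: "nat => 'e => real" and k
  unfolding set_lebesgue_integral_def
 proof (rule integral_dominated_convergence[where w="%z. 2 * norm (indi B z *R k z)"])
  have sp: "space K = space nu" using K(1) by (rule sets_eq_imp_space_eq)
  have [measurable]: "g i : bmf K" "k : bmf K" "B : sets K" for i
   unfolding measurable_cong_sets[OF K(1) refl] K(1) by (fact g(1) g(2) B)+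
  show "(%z. indi B z *R k z) : bmf K" by measurable
  show "(%z. indi B z *R g i z) : bmf K" for i by measurable
  show "integrable K (%z. 2 * norm (indi B z *R k z))"
   using K(2) unfolding set_integrable_def by (intro integrable_mult_right integrable_norm)
  show "AE z in K. (%i. indi B z *R g i z) ----> indi B z *R k z"
   by (rule AE_I2) (intro tendsto_intros g(3), simp add: sp)
  show "AE z in K. norm (indi B z *R g i z) <= 2 * norm (indi B z *R k z)" for i
   by (rule AE_I2) (use g(4) sp in \<open>auto simp: indicator_def\<close>)
 qed
 let ?I = "%f h u. exp (Complex (- (LINT z:B|N u. f z)) (LINT z:B|N u. h z))"
 have Imeas: "?I f h : bmf M" if [measurable]: "f : bmf nu" "h : bmf nu" for f h
 proof -
  have [measurable]: "(%u. LINT z:B|N u. f z) : bmf M" "(%u. LINT z:B|N u. h z) : bmf M"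
   by (intro set_integral_N_measurable; measurable)+
  show ?thesis unfolding Complex_eq by measurable
 qed
 have "(%i. \<integral>u. ?I (G i) (H i) u \<partial>M) ----> (LINT u|M. ?I f h u)"
 proof (rule integral_dominated_convergence[where w="%_. 1"])
  show "?I f h : bmf M" "?I (G i) (H i) : bmf M" for i by (intro Imeas; measurable)+
  show "AE u in M. (%i. ?I (G i) (H i) u) ----> ?I f h u"
   using AE_N_integrable[OF f B fin] AE_N_integrable[OF h B fin] AE_space
  proof eventually_elim
   case (elim u)
   show ?case unfolding Complex_eq
    by (intro tendsto_intros conv[OF sets_N[OF elim(3)] elim(1)] conv[OF sets_N[OF elim(3)] elim(2)] Gl Gb H) auto
  qed
  show "AE u in M. norm (?I (G i) (H i) u) <= 1" for i
  proof (rule AE_I2)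
   fix u
   have "0 <= (LINT z:B|N u. G i z)"
    unfolding set_lebesgue_integral_def by (rule integral_nonneg_AE) (auto simp: G_def)
   then show "norm (?I (G i) (H i) u) <= 1" by (simp add: norm_exp_eq_Re)
  qed
 qed simp
 moreover have "(LINT u|M. ?I (G i) (H i) u) = exp (LINT z:B|nu. exp (Complex (- G i z) (H i z)) - 1)" for i
  by (rule campbell_simple[OF Gs H(1) _ B fin]) (simp add: G_def)
 moreover have "(%i. exp (LINT z:B|nu. exp (Complex (- G i z) (H i z)) - 1)) ----> exp (LINT z:B|nu. exp (Complex (- f z) (h z)) - 1)"
 proof (rule tendsto_exp, unfold set_lebesgue_integral_def, rule integral_dominated_convergence[where w="%z. indi B z *R 2"])
  show "(%z. indi B z *R (exp (Complex (- f z) (h z)) - 1)) : bmf nu"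
   unfolding Complex_eq by measurable
  show "(%z. indi B z *R (exp (Complex (- G i z) (H i z)) - 1)) : bmf nu" for i
   unfolding Complex_eq by measurable
  show "integrable nu (%z. indi B z *R (2::real))"
   by (intro integrable_scaleR_left) (use fin in \<open>auto simp: integrable_indicator_iff\<close>)
  show "AE z in nu. (%i. indi B z *R (exp (Complex (- G i z) (H i z)) - 1)) ----> indi B z *R (exp (Complex (- f z) (h z)) - 1)"
   unfolding Complex_eq by (rule AE_I2) (intro tendsto_intros Gl H)
  show "AE z in nu. norm (indi B z *R (exp (Complex (- G i z) (H i z)) - 1)) <= indi B z *R 2" for i
  proof (rule AE_I2)
   fix z
   have "norm (exp (Complex (- G i z) (H i z)) - 1) <= norm (exp (Complex (- G i z) (H i z))) + norm (1::complex)"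
    by (rule norm_triangle_ineq4)
   also have "... <= 2" by (simp add: norm_exp_eq_Re G_def)
   finally show "norm (indi B z *R (exp (Complex (- G i z) (H i z)) - 1)) <= indi B z *R 2"
    by (auto simp: indicator_def)
  qed
 qed
 ultimately show ?thesis using LIMSEQ_unique by fastforce
qed

end

section \<open>One coordinate as a limit of truncated jump sums\<close>

locale levy_coord = prob_space M for M :: "'w measure" +
 fixes Z :: "real => 'w => real" and N :: "'w => (real \<times> real) measure" and m :: "real measure"
 assumes lm: "levy_measure m" and pr: "poisson_random_measure M N (jump_intensity m)"
  and pj: "purely_jump_type M N m Z" and Z_meas: "!!t. t >= 0 ==> Z t : bmf M"
begin

sublocale P: poisson_rm M N "jump_intensity m"
 by unfold_locales (rule pr)

lemma sets_m[measurable_cong, simp]: "sets m = sets borel"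
 using lm by (simp add: levy_measure_def)

lemma space_m[simp]: "space m = UNIV"
 using sets_eq_imp_space_eq[OF sets_m] by simp

lemma m_0: "emeasure m {0} = 0"
 using lm by (simp add: levy_measure_def)

lemma m_tail: assumes e: "e > 0" shows "emeasure m {x. e <= \<bar>x\<bar>} < \<infinity>"
proof -
 let ?c = "min (e\<^sup>2) 1"
 have c: "?c > 0" using e by simp
 have "ennreal ?c * emeasure m {x. e <= \<bar>x\<bar>} = (\<integral>\<^sup>+ x. ennreal ?c * indi {x. e <= \<bar>x\<bar>} x \<partial>m)"
  by (subst nn_integral_cmult_indicator) auto
 also have "... <= (\<integral>\<^sup>+ x. ennreal (min (x\<^sup>2) 1) \<partial>m)"
 proof (rule nn_integral_mono)
  fix x :: real
  have "e\<^sup>2 <= x\<^sup>2" if "e <= \<bar>x\<bar>" using that e by (metis abs_le_square_iff abs_of_pos)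
  then show "ennreal ?c * indi {x. e <= \<bar>x\<bar>} x <= ennreal (min (x\<^sup>2) 1)"
   by (auto simp: indicator_def intro!: ennreal_leI)
 qed
 also have "... < \<infinity>" using lm by (simp add: levy_measure_def)
 finally show ?thesis using c by (auto simp: ennreal_mult_less_top)
qed

lemma sigma_finite_m: "sigma_finite_measure m"
proof
 let ?A = "insert {0} (range (%n. {x. inverse (real (Suc n)) <= \<bar>x\<bar>}))"
 have "EX n. inverse (real (Suc n)) <= \<bar>x\<bar>" if "x ~= 0" for x :: real
  using reals_Archimedean[of "\<bar>x\<bar>"] that by (auto intro: less_imp_le)
 then have U: "\<Union> ?A = UNIV" by blast
 show "EX A. countable A & A \<subseteq> sets m & \<Union> A = space m & (ALL a:A. emeasure m a ~= \<infinity>)"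
 proof (intro exI[of _ ?A] conjI ballI)
  show "\<Union> ?A = space m" using U by simp
  fix a assume a: "a : ?A"
  have t: "emeasure m {x. inverse (real (Suc n)) <= \<bar>x\<bar>} ~= \<infinity>" for n
   using m_tail[of "inverse (real (Suc n))"] by simp
  from a consider "a = {0}" | n where "a = {x. inverse (real (Suc n)) <= \<bar>x\<bar>}" by blast
  then show "emeasure m a ~= \<infinity>" by cases (use m_0 t in \<open>auto simp del: of_nat_Suc\<close>)
 qed auto
qed

sublocale m: sigma_finite_measure m by (rule sigma_finite_m)

abbreviation "nu == jump_intensity m"

lemma sets_nu_times[measurable]: "B : sets borel ==> {0..t} \<times> B : sets nu"
 unfolding jump_intensity_def by (intro pair_measureI) (auto simp: sets_restrict_space_iff)

lemma fst_nu[measurable]: "fst : bmf nu"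
 unfolding jump_intensity_def
 by (rule measurable_compose[OF measurable_fst, where g="%x. x", simplified]) (simp add: measurable_restrict_space1)

lemma snd_nu[measurable]: "snd : bmf nu"
 unfolding jump_intensity_def
 using measurable_snd[of "restrict_space lborel {0::real..}" m] by (simp add: measurable_cong_sets[OF refl sets_m])

lemma nu_meas:
 assumes "g : bmf (borel \<Otimes>\<^sub>M borel)" shows "g : bmf nu"
 using measurable_compose[OF measurable_Pair[OF fst_nu snd_nu] assms] by (simp only: prod.collapse)

lemma nn_integral_nu:
 assumes [measurable]: "(%(s, x). f s x) : bmf (borel \<Otimes>\<^sub>M borel)" and t: "t >= 0"
  and [measurable]: "B : sets borel"
 shows "(\<integral>\<^sup>+ z. indi ({0..t} \<times> B) z * f (fst z) (snd z) \<partial>nu) = (\<integral>\<^sup>+ s. indi {0..t} s * (\<integral>\<^sup>+ x. indi B x * f s x \<partial>m) \<partial>lborel)"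
proof -
 have [measurable]: "(%z. f (fst z) (snd z)) : bmf (borel \<Otimes>\<^sub>M borel)" using assms(1) by (simp add: case_prod_beta)
 have [measurable]: "{0..t} \<times> B : sets (borel \<Otimes>\<^sub>M borel)" by (intro pair_measureI) auto
 have me: "(%z. indi ({0..t} \<times> B) z * f (fst z) (snd z)) : bmf nu"
  by (intro nu_meas) measurable
 have "(\<integral>\<^sup>+ z. indi ({0..t} \<times> B) z * f (fst z) (snd z) \<partial>nu)
   = (\<integral>\<^sup>+ s. \<integral>\<^sup>+ x. indi ({0..t} \<times> B) (s, x) * f s x \<partial>m \<partial>restrict_space lborel {0..})"
  unfolding jump_intensity_def
  by (subst m.nn_integral_fst[OF me[unfolded jump_intensity_def], symmetric]) simp
 also have "... = (\<integral>\<^sup>+ s. (\<integral>\<^sup>+ x. indi ({0..t} \<times> B) (s, x) * f s x \<partial>m) * indi {0..} s \<partial>lborel)"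
  by (rule nn_integral_restrict_space) simp
 also have "... = (\<integral>\<^sup>+ s. indi {0..t} s * (\<integral>\<^sup>+ x. indi B x * f s x \<partial>m) \<partial>lborel)"
  by (intro nn_integral_cong) (auto simp: indicator_def)
 finally show ?thesis .
qed

lemma emeasure_nu: assumes "B : sets borel" "t >= 0" shows "emeasure nu ({0..t} \<times> B) = ennreal t * emeasure m B"
proof -
 have "emeasure nu ({0..t} \<times> B) = (\<integral>\<^sup>+ z. indi ({0..t} \<times> B) z * 1 \<partial>nu)"
  using sets_nu_times[OF assms(1)] by simp
 also have "... = (\<integral>\<^sup>+ s. indi {0..t} s * (\<integral>\<^sup>+ x. indi B x * 1 \<partial>m) \<partial>lborel)"
  by (rule nn_integral_nu) (use assms in auto)
 also have "... = ennreal t * emeasure m B"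
  using assms by (simp add: nn_integral_multc)
 finally show ?thesis .
qed

definition reg :: "real => real => (real \<times> real) set" where "reg e t = {0..t} \<times> {x. e <= \<bar>x\<bar>}"

lemma reg_meas[measurable]: "reg e t : sets nu"
 unfolding reg_def by (rule sets_nu_times) measurable

lemma reg_finite: "e > 0 ==> t >= 0 ==> emeasure nu (reg e t) < \<infinity>"
 unfolding reg_def using m_tail by (subst emeasure_nu) (auto simp: ennreal_mult_less_top)

definition comp :: "real => real" where "comp e = (LINT x:{x. e <= \<bar>x\<bar> & \<bar>x\<bar> < 1}|m. x)"

text \<open>Time is moved from the domain into the integrand, so that the values at finitely many
  times become integrals over one common region and a linear combination of them is again one
  integral.\<close>

lemma jumps_eq:
 assumes e: "0 < e" "e < 1" and s: "0 <= s" "s <= T"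
 shows "AE w in M. large_jumps N s w + truncated_small_jumps N m e s w = (LINT z:reg e T|N w. indi {..s} (fst z) * snd z) - s * comp e"
proof -
 let ?A = "{0..s} \<times> {x. 1 <= \<bar>x\<bar>} :: (real \<times> real) set" and ?B = "{0..s} \<times> {x. e <= \<bar>x\<bar> & \<bar>x\<bar> < 1} :: (real \<times> real) set"
 have [measurable]: "?A : sets nu" "?B : sets nu" by (intro sets_nu_times; measurable)+
 have AB: "?A \<union> ?B = reg e s" "?A \<inter> ?B = {}" using e by (auto simp: reg_def)
 have "emeasure nu ?A <= emeasure nu (reg e s)" "emeasure nu ?B <= emeasure nu (reg e s)"
  by (intro emeasure_mono; use AB in auto)+
 then have fin: "emeasure nu ?A < \<infinity>" "emeasure nu ?B < \<infinity>"
  using reg_finite[OF e(1) s(1)] by auto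
 have A: "AE w in M. set_integrable (N w) ?A snd" by (intro P.AE_N_integrable fin) measurable
 have B: "AE w in M. set_integrable (N w) ?B snd" by (intro P.AE_N_integrable fin) measurable
 from A B show ?thesis
 proof eventually_elim
  case (elim w)
  have "large_jumps N s w + truncated_small_jumps N m e s w = (LINT z:?A \<union> ?B|N w. snd z) - s * comp e"
   unfolding large_jumps_def truncated_small_jumps_def comp_def
   by (subst set_integral_Un[OF AB(2) elim]) simp
  also have "(LINT z:?A \<union> ?B|N w. snd z) = (LINT z:reg e T|N w. indi {..s} (fst z) * snd z)"
   unfolding AB(1) set_lebesgue_integral_def
   by (intro int_cong refl) (use s in \<open>auto simp: reg_def indicator_def\<close>)
  finally show ?case .
 qed
qed

end

text \<open>The factors converge in different senses, the phases in mean and the damping factors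
  almost surely; boundedness of both lets the limits be combined.\<close>

lemma tendsto_integral_bounded_mult:
 fixes f :: "nat => 'w => complex" and h :: "nat => 'w => real"
 assumes M: "prob_space M" and [measurable]: "!!n. f n : bmf M" "g : bmf M"
  "!!n. h n : bmf M" "k : bmf M"
  and f1: "!!n u. norm (f n u) <= 1" and g1: "!!u. norm (g u) <= 1" and h1: "!!n u. \<bar>h n u\<bar> <= 1"
  and hk: "AE u in M. (%n. h n u) ----> k u" and k1: "!!u. \<bar>k u\<bar> <= 1"
  and fg: "(%n. \<integral>u. norm (f n u - g u) \<partial>M) ----> 0"
 shows "(%n. \<integral>u. f n u * of_real (h n u) \<partial>M) ----> (LINT u|M. g u * of_real (k u))"
proof -
 interpret prob_space M by (rule M)
 have b1: "norm (f n u * of_real (h n u)) <= 1" for n u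
  unfolding norm_mult using f1[of n u] h1[of n u] by (simp add: mult_le_one)
 have b2: "norm (g u * of_real (h n u)) <= 1" for n u
  unfolding norm_mult using g1[of u] h1[of n u] by (simp add: mult_le_one)
 have i1: "integrable M (%u. f n u * of_real (h n u))" for n
  by (rule integrable_const_bound[where B=1]) (use b1 in auto)
 have i2: "integrable M (%u. g u * of_real (h n u))" for n
  by (rule integrable_const_bound[where B=1]) (use b2 in auto)
 have i3: "integrable M (%u. norm (f n u - g u))" for n
 proof (rule integrable_const_bound[where B=2])
  show "AE u in M. norm (norm (f n u - g u)) <= 2"
  proof (rule AE_I2)
   fix u
   have "norm (f n u - g u) <= norm (f n u) + norm (g u)" by (rule norm_triangle_ineq4)
   then show "norm (norm (f n u - g u)) <= 2" using f1[of n u] g1[of u] by simp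
  qed
 qed measurable
 have "(%n. (LINT u|M. f n u * of_real (h n u)) - (LINT u|M. g u * of_real (h n u))) ----> 0"
 proof (rule Lim_null_comparison[OF always_eventually fg], rule allI)
  fix n
  have "norm ((LINT u|M. f n u * of_real (h n u)) - (LINT u|M. g u * of_real (h n u))) = norm (LINT u|M. (f n u - g u) * of_real (h n u))"
   by (subst Bochner_Integration.integral_diff[OF i1 i2, symmetric]) (simp add: algebra_simps)
  also have "... <= (LINT u|M. norm (f n u - g u))"
  proof (rule order_trans[OF integral_norm_bound integral_mono])
   show "integrable M (%u. norm ((f n u - g u) * of_real (h n u)))"
    by (rule integrable_norm) (use Bochner_Integration.integrable_diff[OF i1 i2] in \<open>simp add: algebra_simps\<close>)
   show "norm ((f n u - g u) * of_real (h n u)) <= norm (f n u - g u)" for u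
    unfolding norm_mult using h1[of n u] by (simp add: mult_left_le)
  qed (rule i3)
  finally show "norm ((LINT u|M. f n u * of_real (h n u)) - (LINT u|M. g u * of_real (h n u))) <= (LINT u|M. norm (f n u - g u))" .
 qed
 moreover have "(%n. \<integral>u. g u * of_real (h n u) \<partial>M) ----> (LINT u|M. g u * of_real (k u))"
 proof (rule integral_dominated_convergence[where w="%_. 1"])
  show "AE u in M. (%n. g u * of_real (h n u)) ----> g u * of_real (k u)"
   using hk by eventually_elim (intro tendsto_intros)
  show "AE u in M. norm (g u * of_real (h n u)) <= 1" for n using b2 by auto
 qed auto
 ultimately show ?thesis by (rule Lim_transform[rotated])
qed

lemma norm_exp_ii_diff: "norm (ei a - ei b) <= \<bar>a - b\<bar>"
proof -
 have "ei a - ei b = ei b * (ei (a - b) - 1)"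
  by (simp add: exp_diff algebra_simps)
 then have "norm (ei a - ei b) = norm (ei (a - b) - 1)"
  by (simp add: norm_mult)
 also have "... <= \<bar>a - b\<bar>"
  using iexp_approx1[of "a - b" 0] by simp
 finally show ?thesis .
qed

text \<open>Starting at \<open>1/2\<close> keeps the truncation level below \<open>1\<close>, the
  border between small and large jumps.\<close>

definition eps :: "nat => real" where "eps n = inverse (real (Suc (Suc n)))"

lemma eps: "0 < eps n" "eps n < 1" by (auto simp: eps_def inverse_eq_divide)

lemma eps_lim: "eps ----> 0"
 unfolding eps_def by (rule LIMSEQ_Suc[OF LIMSEQ_inverse_real_of_nat])

lemma eps_Suc: "eps (Suc n) <= eps n" by (simp add: eps_def field_simps)

text \<open>Bounds a first moment by a second one and takes the place of the Cauchy-Schwarz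
  inequality in \<open>approx_L1\<close>.\<close>

lemma le_add_square_div: "0 < e ==> 0 <= x ==> x <= e + x * x / e" for x e :: real
proof -
 assume e: "0 < e" and x: "0 <= x"
 show ?thesis
 proof (cases "x <= e")
  case True then show ?thesis using e x by (intro add_increasing2) auto
 next
  case False
  then have "x * e <= x * x" using x by (intro mult_left_mono) auto
  then have "x <= x * x / e" using e by (simp add: pos_le_divide_eq)
  then show ?thesis using e by simp
 qed
qed

context levy_coord
begin

lemma approx_meas: "s >= 0 ==> (%w. large_jumps N s w + truncated_small_jumps N m e s w) : bmf M"
 unfolding large_jumps_def truncated_small_jumps_def
 by (intro borel_measurable_add borel_measurable_diff borel_measurable_const P.set_integral_N_measurable sets_nu_times) measurable

text \<open>Mean-square convergence of the truncated sums suffices because the phase is a Lipschitz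
  function of the path values.\<close>

lemma approx_L1:
 assumes J: "finite J" and t: "!!a. a : J ==> 0 <= t a"
 shows "(%n. \<integral>w. norm (ei (SUM a:J. u a * (large_jumps N (t a) w + truncated_small_jumps N m (eps n) (t a) w))
   - ei (SUM a:J. u a * Z (t a) w)) \<partial>M) ----> 0"
proof -
 define D where "D n s w = Z s w - (large_jumps N s w + truncated_small_jumps N m (eps n) s w)" for n s w
 have Dm[measurable]: "D n s : bmf M" if "s >= 0" for n s
  unfolding D_def using Z_meas[OF that] approx_meas[OF that] by measurable
 define r where "r n s = (\<integral>\<^sup>+ w. ennreal ((D n s w)\<^sup>2) \<partial>M)" for n s
 have r0: "(%n. r n s) ----> 0" if s: "s >= 0" for s
 proof -
  obtain S where S: "is_compensated_small_jumps M N m s S" "AE w in M. Z s w = large_jumps N s w + S w"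
   using pj s unfolding purely_jump_type_def by blast
  have "r n s = (\<integral>\<^sup>+ w. ennreal ((S w - truncated_small_jumps N m (eps n) s w)\<^sup>2) \<partial>M)" for n
   unfolding r_def by (rule nn_integral_cong_AE) (use S(2) in eventually_elim, simp add: D_def)
  moreover have "(%n. \<integral>\<^sup>+ w. ennreal ((S w - truncated_small_jumps N m (eps n) s w)\<^sup>2) \<partial>M) ----> 0"
  proof -
   have "filterlim eps (at_right 0) sequentially"
    unfolding filterlim_at by (simp add: eps_lim eps(1) eps(1)[THEN less_imp_neq, symmetric])
   then show ?thesis
    using S(1) filterlim_compose unfolding is_compensated_small_jumps_def by blast
  qed
  ultimately show ?thesis by simp
 qed
 define q where "q n s = sqrt (enn2real (r n s))" for n s
 have q0: "(%n. q n s) ----> 0" if s: "s >= 0" for s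
 proof -
  have "(%n. enn2real (r n s)) ----> 0" by (rule tendsto_enn2real) (use r0[OF s] in simp_all)
  then have "(%n. sqrt (enn2real (r n s))) ----> sqrt 0" by (rule tendsto_real_sqrt)
  then show ?thesis by (simp add: q_def)
 qed
 define ph where "ph n w = norm (ei (SUM a:J. u a * (large_jumps N (t a) w + truncated_small_jumps N m (eps n) (t a) w))
   - ei (SUM a:J. u a * Z (t a) w))" for n w
 have phm[measurable]: "ph n : bmf M" for n
 proof -
  have "(%w. SUM a:J. u a * (large_jumps N (t a) w + truncated_small_jumps N m (eps n) (t a) w)) : bmf M"
   by (intro borel_measurable_sum borel_measurable_times borel_measurable_const approx_meas t)
  moreover have "(%w. SUM a:J. u a * Z (t a) w) : bmf M"
   by (intro borel_measurable_sum borel_measurable_times borel_measurable_const Z_meas t)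
  ultimately show ?thesis unfolding ph_def by measurable
 qed
 have "\<forall>\<^sub>F n in sequentially. (LINT w|M. ph n w) <= (SUM a:J. \<bar>u a\<bar> * (2 * q n (t a) + eps n))"
 proof -
  have "\<forall>\<^sub>F n in sequentially. ALL a:J. r n (t a) < \<infinity>"
  proof (intro eventually_ball_finite ballI J)
   fix a assume "a : J"
   show "\<forall>\<^sub>F n in sequentially. r n (t a) < \<infinity>"
    using order_tendstoD(2)[OF r0[OF t[OF \<open>a : J\<close>]], of \<infinity>] by simp
  qed
  then show ?thesis
  proof eventually_elim
   case (elim n)
   have int: "integrable M (%w. (D n (t a) w)\<^sup>2)" if "a : J" for a
    using elim that Dm[OF t[OF that]] by (intro integrableI_bounded) (auto simp: r_def)
   have qq: "(LINT w|M. (D n (t a) w)\<^sup>2) = (q n (t a))\<^sup>2" if "a : J" for a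
    using Dm[OF t[OF that]] by (simp add: q_def r_def integral_eq_nn_integral)
   \<comment> \<open>The root mean square \<open>q n (t a)\<close> is the natural splitting
     parameter; adding \<open>eps n\<close> makes it strictly positive.\<close>
   let ?e = "%a. q n (t a) + eps n"
   have e0: "?e a > 0" for a using eps(1)[of n] by (simp add: q_def add_nonneg_pos)
   have bnd: "ph n w <= (SUM a:J. \<bar>u a\<bar> * (?e a + (D n (t a) w)\<^sup>2 / ?e a))" for w
   proof -
    have "ph n w <= \<bar>(SUM a:J. u a * (large_jumps N (t a) w + truncated_small_jumps N m (eps n) (t a) w)) - (SUM a:J. u a * Z (t a) w)\<bar>"
     unfolding ph_def by (rule norm_exp_ii_diff)
    also have "... = \<bar>SUM a:J. u a * (- D n (t a) w)\<bar>"
     by (simp add: sum_subtractf[symmetric] D_def algebra_simps)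
    also have "... <= (SUM a:J. \<bar>u a * (- D n (t a) w)\<bar>)" by (rule sum_abs)
    also have "... <= (SUM a:J. \<bar>u a\<bar> * (?e a + (D n (t a) w)\<^sup>2 / ?e a))"
    proof (rule sum_mono)
     fix a
     let ?x = "\<bar>D n (t a) w\<bar>"
     have "?x <= ?e a + ?x * ?x / ?e a" by (rule le_add_square_div[OF e0]) simp
     then have "?x <= ?e a + (D n (t a) w)\<^sup>2 / ?e a" by (simp add: power2_eq_square)
     then show "\<bar>u a * (- D n (t a) w)\<bar> <= \<bar>u a\<bar> * (?e a + (D n (t a) w)\<^sup>2 / ?e a)"
      unfolding abs_mult abs_minus_cancel by (intro mult_left_mono) auto
    qed
    finally show ?thesis .
   qed
   have "(LINT w|M. ph n w) <= (LINT w|M. (SUM a:J. \<bar>u a\<bar> * (?e a + (D n (t a) w)\<^sup>2 / ?e a)))"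
   proof (rule integral_mono[OF _ _ bnd])
    show i: "integrable M (%w. SUM a:J. \<bar>u a\<bar> * (?e a + (D n (t a) w)\<^sup>2 / ?e a))"
     using int by (intro Bochner_Integration.integrable_sum integrable_mult_right Bochner_Integration.integrable_add integrable_divide) auto
    show "integrable M (ph n)"
     by (rule int_bound[OF i phm]) (use bnd in \<open>auto intro!: AE_I2 order_trans[OF _ abs_ge_self] simp: ph_def\<close>)
   qed
   also have "... = (SUM a:J. \<bar>u a\<bar> * (?e a + (q n (t a))\<^sup>2 / ?e a))"
    using int by (subst Bochner_Integration.integral_sum) (auto simp: qq prob_space intro!: sum.cong)
   also have "... <= (SUM a:J. \<bar>u a\<bar> * (2 * q n (t a) + eps n))"
   proof (intro sum_mono mult_left_mono)
    fix a
    have q: "q n (t a) >= 0" by (simp add: q_def)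
    have "(q n (t a))\<^sup>2 <= q n (t a) * ?e a" using q eps(1)[of n] by (simp add: power2_eq_square mult_left_mono)
    then have "(q n (t a))\<^sup>2 / ?e a <= q n (t a)" using e0[of a] by (simp add: pos_divide_le_eq)
    then show "?e a + (q n (t a))\<^sup>2 / ?e a <= 2 * q n (t a) + eps n" by simp
   qed auto
   finally show ?case .
  qed
 qed
 moreover have "(%n. SUM a:J. \<bar>u a\<bar> * (2 * q n (t a) + eps n)) ----> (SUM a:J. \<bar>u a\<bar> * (2 * 0 + 0))"
  by (intro tendsto_intros q0 t eps_lim)
 moreover have "\<forall>\<^sub>F n in sequentially. 0 <= (LINT w|M. ph n w)" by (simp add: ph_def)
 ultimately have "(%n. \<integral>w. ph n w \<partial>M) ----> 0"
  using real_tendsto_sandwich[of "%_. 0" "%n. \<integral>w. ph n w \<partial>M" sequentially "%n. SUM a:J. \<bar>u a\<bar> * (2 * q n (t a) + eps n)" 0] by simp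
 then show ?thesis by (simp add: ph_def)
qed

end

section \<open>Joint law of the path and the functional \<open>S\<close>\<close>

locale levy_shift = levy_coord +
 fixes V :: "real => real" and ta :: real
 assumes V_meas[measurable]: "V : bm" and V0: "!!x. 0 <= V x" "V 0 = 0"
  and V_int: "integrable m V" and ta0: "0 <= ta"
begin

definition S :: "nat => 'a => real" where "S n w = (LINT z:reg (eps n) ta|N w. V (snd z))"

text \<open>The infimum stands for \<open>exp(-t S)\<close>, \<open>S\<close> being the possibly infinite limit of \<open>S n\<close>.\<close>

definition H :: "real => 'a => real" where "H t w = (INF n. exp (- t * S n w))"

lemma S0: "0 <= S n w"
 unfolding S_def set_lebesgue_integral_def by (rule integral_nonneg_AE) (auto simp: V0)

lemma Vsnd[measurable]: "(%z. V (snd z)) : bmf nu"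
 by (rule measurable_compose[OF snd_nu V_meas])

lemma S_meas[measurable]: "S n : bmf M"
 unfolding S_def by (intro P.set_integral_N_measurable) measurable

lemma H_bdd: "bdd_below (range (%n. exp (- t * S n w)))"
 by (rule bdd_belowI2[of _ 0]) simp

lemma H_bounds: assumes "t >= 0" shows "0 <= H t w" "H t w <= 1"
proof -
 show "0 <= H t w" unfolding H_def by (rule cINF_greatest) auto
 have "H t w <= exp (- t * S 0 w)" unfolding H_def by (rule cINF_lower[OF H_bdd]) simp
 also have "... <= 1" using assms S0[of 0 w] by simp
 finally show "H t w <= 1" .
qed

lemma H_meas: "(%p. H (snd p) (fst p)) : bmf (M \<Otimes>\<^sub>M borel)"
 unfolding H_def by (rule borel_measurable_cINF) (auto intro!: bdd_belowI2[of _ 0])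

lemma H_meas1[measurable]: "H t : bmf M"
 unfolding H_def[abs_def] by (rule borel_measurable_cINF) (auto intro!: bdd_belowI2[of _ 0])

text \<open>\<open>S n\<close> increases in \<open>n\<close> where all truncated integrals exist.
  Elsewhere the default value \<open>0\<close> of an integral could destroy monotonicity, hence the
  restriction to almost every \<open>w\<close>.\<close>

lemma H_lim: assumes "t >= 0" shows "AE w in M. (%n. exp (- t * S n w)) ----> H t w"
proof -
 have "AE w in M. ALL n. set_integrable (N w) (reg (eps n) ta) (%z. V (snd z))"
  unfolding AE_all_countable by (intro allI P.AE_N_integrable reg_finite eps ta0) measurable
 with AE_space show ?thesis
 proof eventually_elim
  case (elim w)
  have mono: "S n w <= S (Suc n) w" for n
   unfolding S_def set_lebesgue_integral_def
  proof (rule integral_mono)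
   show "integrable (N w) (%z. indi (reg (eps n) ta) z *R V (snd z))"
    "integrable (N w) (%z. indi (reg (eps (Suc n)) ta) z *R V (snd z))"
    using elim(2) unfolding set_integrable_def by blast+
   show "indi (reg (eps n) ta) z *R V (snd z) <= indi (reg (eps (Suc n)) ta) z *R V (snd z)" for z
    using eps_Suc[of n] by (auto simp: indicator_def reg_def V0)
  qed
  have "decseq (%n. exp (- t * S n w))"
   unfolding decseq_Suc_iff using mono assms by (auto intro: mult_left_mono)
  then show ?case unfolding H_def using H_bdd by (intro LIMSEQ_decseq_INF)
 qed
qed

lemma V_nu_integrable: "integrable nu (%z. indi ({0..ta} \<times> UNIV) z * V (snd z))"
proof (rule integrableI_nonneg)
 have [measurable]: "{0..ta} \<times> (UNIV :: real set) : sets nu" by (rule sets_nu_times) simp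
 show "(%z. indi ({0..ta} \<times> UNIV) z * V (snd z)) : bmf nu" by measurable
 have "(\<integral>\<^sup>+ z. ennreal (indi ({0..ta} \<times> UNIV) z * V (snd z)) \<partial>nu) = (\<integral>\<^sup>+ z. indi ({0..ta} \<times> UNIV) z * ennreal (V (snd z)) \<partial>nu)"
  by (intro nn_integral_cong) (auto simp: indicator_def)
 also have "... = (\<integral>\<^sup>+ s. indi {0..ta} s * (\<integral>\<^sup>+ x. indi UNIV x * ennreal (V x) \<partial>m) \<partial>lborel)"
  by (rule nn_integral_nu) (use ta0 in auto)
 also have "... = ennreal ta * (\<integral>\<^sup>+ x. ennreal (V x) \<partial>m)"
  using ta0 by (simp add: nn_integral_multc)
 also have "... < \<infinity>"
  using V_int by (auto simp: integrable_iff_bounded V0 ennreal_mult_less_top)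
 finally show "(\<integral>\<^sup>+ z. ennreal (indi ({0..ta} \<times> UNIV) z * V (snd z)) \<partial>nu) < \<infinity>" .
qed (auto simp: V0)

text \<open>The change of the Levy exponent caused by the factor \<open>exp(-t S)\<close>. The bound
  \<open>1 - exp(-t V) <= t V\<close> makes it absolutely convergent down to jump size
  \<open>0\<close>.\<close>

definition KK :: "(real => real) => real => complex" where
 "KK h t = (LINT z|nu. indi ({0..ta} \<times> UNIV) z *R (ei (h (fst z) * snd z) * of_real (1 - exp (- t * V (snd z)))))"

text \<open>A jump \<open>x\<close> at time \<open>s\<close> changes
  \<open>SUM a:J. u a * Z (t a)\<close> by \<open>stepfun J u t s * x\<close>.\<close>

definition stepfun :: "'i set => ('i => real) => ('i => real) => real => real" where
 "stepfun J u t s = (SUM a:J. u a * indi {..t a} s)"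

lemma stepfun_meas[measurable]: "finite J ==> stepfun J u t : bm"
 unfolding stepfun_def[abs_def] by (intro borel_measurable_sum) measurable

lemma one_minus_exp_le: "0 <= x ==> \<bar>1 - exp (- x)\<bar> <= x" for x :: real
 using exp_ge_add_one_self[of "-x"] by simp

text \<open>The exponents of the truncated jump sums need not converge without compensation, but the
  change \<open>K n\<close> produced by damping does. The compensator is deterministic and
  contributes the same phase to both sides, so the limit is taken in a multiplicative relation
  between the two expectations.\<close>

theorem joint_cf:
 assumes J: "finite J" and t: "!!a. a : J ==> 0 <= t a" and th: "th >= 0"
 shows "(LINT q|M. ei (SUM a:J. u a * Z (t a) q) * of_real (H th q))
   = (LINT q|M. ei (SUM a:J. u a * Z (t a) q)) * exp (- KK (stepfun J u t) th)"
proof -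
 define T where "T = ta + (SUM a:J. t a)"
 have Tta: "ta <= T" using t by (auto simp: T_def intro: sum_nonneg)
 have Tt: "t a <= T" if "a : J" for a
  using member_le_sum[OF that, of t] t J ta0 by (auto simp: T_def)
 have T0: "T >= 0" using Tta ta0 by simp
 let ?h = "stepfun J u t"
 have hm[measurable]: "?h : bm" using J by simp
 define g where "g z = ?h (fst z) * snd z" for z :: "real \<times> real"
 have gm[measurable]: "g : bmf nu"
  unfolding g_def[abs_def] using measurable_compose[OF fst_nu hm] by measurable
 define f where "f z = th * (indi {..ta} (fst z) * V (snd z))" for z :: "real \<times> real"
 have fm[measurable]: "f : bmf nu"
 proof -
  have "(%z. indi {..ta} (fst z) :: real) : bmf nu"
   by (rule measurable_compose[OF fst_nu]) measurable
  then show ?thesis unfolding f_def[abs_def] by measurable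
 qed
 have f0: "0 <= f z" for z unfolding f_def using th V0 by (auto simp: indicator_def)
 define I where "I n q = (LINT z:reg (eps n) T|N q. g z)" for n q
 have Im[measurable]: "I n : bmf M" for n
  unfolding I_def by (intro P.set_integral_N_measurable) measurable
 have fS: "(LINT z:reg (eps n) T|N q. f z) = th * S n q" for n q
 proof -
  have "(LINT z:reg (eps n) T|N q. f z) = (\<integral>z. th * (indi (reg (eps n) ta) z *R V (snd z)) \<partial>N q)"
   unfolding set_lebesgue_integral_def
   by (intro int_cong refl) (use Tta in \<open>auto simp: f_def reg_def indicator_def\<close>)
  then show ?thesis unfolding S_def set_lebesgue_integral_def by simp
 qed
 define K where "K n = (LINT z:reg (eps n) T|nu. ei (g z) * of_real (1 - exp (- f z)))" for n
 have fin: "emeasure nu (reg (eps n) T) < \<infinity>" for n by (intro reg_finite eps T0)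
 have bint: "set_integrable nu (reg (eps n) T) k"
  if k[measurable]: "k : bmf nu" and kb: "!!z. norm (k z) <= 2" for n and k :: "_ => complex"
  unfolding set_integrable_def
 proof (rule int_bound)
  show "integrable nu (%z. indi (reg (eps n) T) z *R (2::real))"
   by (intro integrable_scaleR_left integrable_real_indicator fin) measurable
  show "AE z in nu. norm (indi (reg (eps n) T) z *R k z) <= norm (indi (reg (eps n) T) z *R (2::real))"
   using kb by (auto simp: indicator_def)
 qed measurable
 have cf: "(LINT q|M. ei (I n q) * of_real (exp (- th * S n q))) = (LINT q|M. ei (I n q)) * exp (- K n)" for n
 proof -
  have c1: "exp (Complex (- x) y) = ei y * of_real (exp (- x))" for x y
   by (simp add: Complex_eq exp_of_real[symmetric] exp_add[symmetric])
  have "(LINT q|M. ei (I n q) * of_real (exp (- (th * S n q)))) = exp (LINT z:reg (eps n) T|nu. exp (Complex (- f z) (g z)) - 1)"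
   using P.campbell[OF fm gm f0 reg_meas fin] unfolding fS I_def[symmetric] c1 .
  also have "(LINT z:reg (eps n) T|nu. exp (Complex (- f z) (g z)) - 1) = (LINT z:reg (eps n) T|nu. (exp (Complex (- 0) (g z)) - 1) - ei (g z) * of_real (1 - exp (- f z)))"
   by (intro set_lebesgue_integral_cong) (auto simp: c1 c1[of 0, simplified] algebra_simps)
  also have "... = (LINT z:reg (eps n) T|nu. exp (Complex (- 0) (g z)) - 1) - K n"
   unfolding K_def
  proof (rule set_integral_diff(2))
   show "set_integrable nu (reg (eps n) T) (%z. exp (Complex (- 0) (g z)) - 1)"
   proof (rule bint)
    show "(%z. exp (Complex (- 0) (g z)) - 1) : bmf nu" unfolding Complex_eq by measurable
    show "norm (exp (Complex (- 0) (g z)) - 1) <= 2" for z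
     using norm_triangle_ineq4[of "exp (Complex (- 0) (g z))" 1] by (simp add: norm_exp_eq_Re)
   qed
   show "set_integrable nu (reg (eps n) T) (%z. ei (g z) * of_real (1 - exp (- f z)))"
   proof (rule bint)
    show "(%z. ei (g z) * of_real (1 - exp (- f z))) : bmf nu" by measurable
    show "norm (ei (g z) * of_real (1 - exp (- f z))) <= 2" for z
     using f0[of z] exp_ge_zero[of "- f z"] by (simp add: norm_mult abs_le_iff del: of_real_diff exp_ge_zero)
   qed
  qed
  also have "exp ((LINT z:reg (eps n) T|nu. exp (Complex (- 0) (g z)) - 1) - K n) = exp (LINT z:reg (eps n) T|nu. exp (Complex (- 0) (g z)) - 1) * exp (- K n)"
   by (simp add: exp_add[symmetric])
  also have "exp (LINT z:reg (eps n) T|nu. exp (Complex (- 0) (g z)) - 1) = (LINT q|M. exp (Complex (- (LINT z:reg (eps n) T|N q. 0)) (LINT z:reg (eps n) T|N q. g z)))"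
   by (rule P.campbell[OF _ gm _ reg_meas fin, symmetric]) auto
  finally show ?thesis unfolding I_def c1 by simp
 qed
 have Klim: "K ----> KK ?h th"
  unfolding K_def[abs_def] KK_def set_lebesgue_integral_def
 proof (rule integral_dominated_convergence[where w="%z. th * (indi ({0..ta} \<times> UNIV) z * V (snd z))"])
  have [measurable]: "{0..ta} \<times> (UNIV :: real set) : sets nu" by (rule sets_nu_times) simp
  have [measurable]: "(%z. ?h (fst z)) : bmf nu" by (rule measurable_compose[OF fst_nu hm])
  show "(%z. indi ({0..ta} \<times> UNIV) z *R (ei (?h (fst z) * snd z) * of_real (1 - exp (- th * V (snd z))))) : bmf nu"
   by measurable
  show "(%z. indi (reg (eps n) T) z *R (ei (g z) * of_real (1 - exp (- f z)))) : bmf nu" for n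
   by measurable
  show "integrable nu (%z. th * (indi ({0..ta} \<times> UNIV) z * V (snd z)))"
   by (intro integrable_mult_right V_nu_integrable)
  show "AE z in nu. (%n. indi (reg (eps n) T) z *R (ei (g z) * of_real (1 - exp (- f z))))
    ----> indi ({0..ta} \<times> UNIV) z *R (ei (?h (fst z) * snd z) * of_real (1 - exp (- th * V (snd z))))"
  proof (rule AE_I2)
   fix z assume "z : space nu"
   then have z0: "0 <= fst z" by (auto simp: jump_intensity_def space_pair_measure space_restrict_space)
   show "(%n. indi (reg (eps n) T) z *R (ei (g z) * of_real (1 - exp (- f z))))
    ----> indi ({0..ta} \<times> UNIV) z *R (ei (?h (fst z) * snd z) * of_real (1 - exp (- th * V (snd z))))"
   \<comment> \<open>The truncated regions exhaust all jump sizes except \<open>0\<close>, where the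
     integrand vanishes because \<open>V 0 = 0\<close>.\<close>
   proof (cases "snd z = 0")
    case True
    then show ?thesis by (simp add: f_def V0)
   next
    case False
    then have "\<forall>\<^sub>F n in sequentially. eps n < \<bar>snd z\<bar>" using order_tendstoD(2)[OF eps_lim] by simp
    then have "\<forall>\<^sub>F n in sequentially. indi (reg (eps n) T) z *R (ei (g z) * of_real (1 - exp (- f z)))
      = indi ({0..ta} \<times> UNIV) z *R (ei (?h (fst z) * snd z) * of_real (1 - exp (- th * V (snd z))))"
     by eventually_elim (use z0 Tta in \<open>auto simp: reg_def indicator_def f_def g_def mem_Times_iff\<close>)
    then show ?thesis by (rule tendsto_eventually)
   qed
  qed
  show "AE z in nu. norm (indi (reg (eps n) T) z *R (ei (g z) * of_real (1 - exp (- f z))))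
    <= th * (indi ({0..ta} \<times> UNIV) z * V (snd z))" for n
  proof (rule AE_I2)
   fix z assume "z : space nu"
   then have z0: "0 <= fst z" by (auto simp: jump_intensity_def space_pair_measure space_restrict_space)
   have "norm (indi (reg (eps n) T) z *R (ei (g z) * of_real (1 - exp (- f z)))) <= \<bar>1 - exp (- f z)\<bar>"
    by (simp add: norm_mult indicator_def del: of_real_diff)
   also have "... <= f z" by (rule one_minus_exp_le[OF f0])
   also have "f z = th * (indi ({0..ta} \<times> UNIV) z * V (snd z))"
    using z0 by (auto simp: f_def indicator_def mem_Times_iff)
   finally show "norm (indi (reg (eps n) T) z *R (ei (g z) * of_real (1 - exp (- f z))))
    <= th * (indi ({0..ta} \<times> UNIV) z * V (snd z))" .
  qed
 qed
 define W where "W n q = (SUM a:J. u a * (large_jumps N (t a) q + truncated_small_jumps N m (eps n) (t a) q))" for n q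
 define W' where "W' q = (SUM a:J. u a * Z (t a) q)" for q
 define c where "c n = (SUM a:J. u a * (t a * comp (eps n)))" for n
 have Wm[measurable]: "W n : bmf M" for n unfolding W_def
  by (intro borel_measurable_sum borel_measurable_times borel_measurable_const approx_meas t)
 have W'm[measurable]: "W' : bmf M" unfolding W'_def
  by (intro borel_measurable_sum borel_measurable_times borel_measurable_const Z_meas t)
 have WI: "AE q in M. W n q = I n q - c n" for n
 proof -
  have 1: "AE q in M. ALL a:J. large_jumps N (t a) q + truncated_small_jumps N m (eps n) (t a) q = (LINT z:reg (eps n) T|N q. indi {..t a} (fst z) * snd z) - t a * comp (eps n)"
   by (intro AE_finite_allI J jumps_eq eps t Tt)
  have "(%z. indi {..t a} (fst z) * snd z :: real) : bmf nu" for a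
  proof -
   have "(%z. indi {..t a} (fst z) :: real) : bmf nu"
    by (rule measurable_compose[OF fst_nu]) measurable
   then show ?thesis by measurable
  qed
  then have 2: "AE q in M. ALL a:J. set_integrable (N q) (reg (eps n) T) (%z. indi {..t a} (fst z) * snd z)"
   by (intro AE_finite_allI J P.AE_N_integrable fin) measurable
  from 1 2 show ?thesis
  proof eventually_elim
   case (elim q)
   have "I n q = (\<integral>z. (SUM a:J. u a * (indi (reg (eps n) T) z *R (indi {..t a} (fst z) * snd z))) \<partial>N q)"
    unfolding I_def set_lebesgue_integral_def
    by (intro int_cong refl) (simp add: g_def stepfun_def sum_distrib_left sum_distrib_right mult_ac)
   also have "... = (SUM a:J. u a * (LINT z:reg (eps n) T|N q. indi {..t a} (fst z) * snd z))"
    unfolding set_lebesgue_integral_def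
   proof (subst Bochner_Integration.integral_sum)
    fix a assume "a : J"
    then show "integrable (N q) (%z. u a * (indi (reg (eps n) T) z *R (indi {..t a} (fst z) * snd z)))"
     using elim(2) unfolding set_integrable_def by (intro integrable_mult_right) blast
   qed (intro sum.cong refl Bochner_Integration.integral_mult_right_zero)
   finally have "I n q = (SUM a:J. u a * (LINT z:reg (eps n) T|N q. indi {..t a} (fst z) * snd z))" .
   moreover have "W n q = (SUM a:J. u a * ((LINT z:reg (eps n) T|N q. indi {..t a} (fst z) * snd z) - t a * comp (eps n)))"
    unfolding W_def by (intro sum.cong refl) (use elim(1) in auto)
   ultimately show ?case by (simp add: c_def right_diff_distrib sum_subtractf)
  qed
 qed
 have We: "(LINT q|M. ei (W n q) * of_real (k q)) = exp (- \<i> * of_real (c n)) * (LINT q|M. ei (I n q) * of_real (k q))"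
  if [measurable]: "k : bmf M" for k n
 proof -
  have "(LINT q|M. ei (W n q) * of_real (k q)) = (LINT q|M. exp (- \<i> * of_real (c n)) * (ei (I n q) * of_real (k q)))"
  proof (rule integral_cong_AE)
   show "AE q in M. ei (W n q) * of_real (k q) = exp (- \<i> * of_real (c n)) * (ei (I n q) * of_real (k q))"
    using WI[of n] by eventually_elim (simp add: exp_add[symmetric] right_diff_distrib)
  qed measurable
  then show ?thesis by simp
 qed
 have L: "(%n. \<integral>q. norm (ei (W n q) - ei (W' q)) \<partial>M) ----> 0"
  unfolding W_def W'_def by (rule approx_L1[OF J t])
 have m1: "(%q. exp (\<i> * complex_of_real (W n q))) : bmf M" for n by measurable
 have m2: "(%q. exp (\<i> * complex_of_real (W' q))) : bmf M" by measurable
 have m3: "(%q. exp (- th * S n q)) : bmf M" for n by measurable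
 have "(%n. \<integral>q. ei (W n q) * of_real (exp (- th * S n q)) \<partial>M) ----> (LINT q|M. ei (W' q) * of_real (H th q))"
 proof (rule tendsto_integral_bounded_mult[OF prob_space_axioms m1 m2 m3 H_meas1 _ _ _ H_lim[OF th] _ L])
  show "\<bar>exp (- th * S n q)\<bar> <= 1" for n q using th S0[of n q] by simp
  show "\<bar>H th q\<bar> <= 1" for q using H_bounds[OF th, of q] by simp
 qed auto
 moreover have "(LINT q|M. ei (W n q) * of_real (exp (- th * S n q))) = (LINT q|M. ei (W n q) * of_real 1) * exp (- K n)" for n
 proof -
  have "(LINT q|M. ei (W n q) * of_real (exp (- th * S n q))) = exp (- \<i> * of_real (c n)) * ((LINT q|M. ei (I n q)) * exp (- K n))"
   by (subst We) (simp_all only: cf, measurable)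
  moreover have "(LINT q|M. ei (W n q) * of_real 1) = exp (- \<i> * of_real (c n)) * (LINT q|M. ei (I n q) * of_real 1)"
   by (rule We) simp
  ultimately show ?thesis by simp
 qed
 moreover have "(%n. (LINT q|M. ei (W n q) * of_real 1) * exp (- K n)) ----> (LINT q|M. ei (W' q) * of_real 1) * exp (- KK ?h th)"
  by (intro tendsto_intros Klim tendsto_integral_bounded_mult[OF prob_space_axioms m1 m2 _ _ _ _ _ _ _ L]) auto
 ultimately have "(LINT q|M. ei (W' q) * of_real (H th q)) = (LINT q|M. ei (W' q) * of_real 1) * exp (- KK ?h th)"
  using LIMSEQ_unique by fastforce
 then show ?thesis by (simp add: W'_def)
qed

end

lemma local_quadratic_bound_deriv:
 fixes f :: "real => 'a::real_normed_vector"
 assumes "!!e. \<bar>e\<bar> <= 1 ==> norm (f (x + e) - f x - e *R d) <= C * e\<^sup>2"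
 shows "(f has_vector_derivative d) (at x)"
proof -
 have lim: "((%h. C * \<bar>h\<bar>) \<longlongrightarrow> C * \<bar>0\<bar>) (at (0::real))" by (intro tendsto_intros)
 have "((%h. norm (f (x + h) - f x - h *R d) / norm h) \<longlongrightarrow> 0) (at 0)"
 proof (rule Lim_null_comparison)
  show "((%h. C * \<bar>h\<bar>) \<longlongrightarrow> 0) (at (0::real))" using lim by simp
  have "\<forall>\<^sub>F h in at 0. \<bar>h::real\<bar> <= 1 & h ~= 0"
   unfolding eventually_at by (intro exI[of _ 1]) (auto simp: dist_real_def)
  then show "\<forall>\<^sub>F h in at 0. norm (norm (f (x + h) - f x - h *R d) / norm h) <= C * \<bar>h\<bar>"
  proof eventually_elim
   case (elim h)
   have "norm (f (x + h) - f x - h *R d) / \<bar>h\<bar> <= C * h\<^sup>2 / \<bar>h\<bar>"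
    using assms elim by (intro divide_right_mono) auto
   also have "... = C * \<bar>h\<bar>" using elim by (simp add: power2_eq_square field_simps)
   finally show ?case by simp
  qed
 qed
 then show ?thesis
  unfolding has_vector_derivative_def has_derivative_at by (simp add: bounded_linear_scaleR_left)
qed

lemma exp_diff_bound:
 fixes a b c :: real
 assumes "- c <= a" "- c <= b" "0 <= c" shows "\<bar>exp (- a) - exp (- b)\<bar> <= exp c * \<bar>a - b\<bar>"
proof -
 have *: "exp (- x) - exp (- y) <= exp c * (y - x)" if "x <= y" "- c <= x" for x y
 proof -
  have "exp (- x) * (1 + (x - y)) <= exp (- x) * exp (x - y)"
   by (intro mult_left_mono exp_ge_add_one_self) simp
  also have "... = exp (- y)" by (simp add: exp_add[symmetric])
  finally have "exp (- x) - exp (- y) <= exp (- x) * (y - x)" by (simp add: algebra_simps)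
  also have "... <= exp c * (y - x)" using that by (intro mult_right_mono) auto
  finally show ?thesis .
 qed
 show ?thesis
 proof (cases "a <= b")
  case True
  then have "exp (- b) <= exp (- a)" by simp
  with True *[OF True assms(1)] show ?thesis by (simp add: abs_if)
 next
  case False
  then have "exp (- a) <= exp (- b)" by simp
  with False *[of b a] assms show ?thesis by (simp add: abs_if)
 qed
qed

lemma exp_taylor_bound:
 fixes a b c :: real
 assumes "- c <= a" "- c <= b" "0 <= c" shows "\<bar>exp (- b) - exp (- a) + (b - a) * exp (- a)\<bar> <= exp c * (b - a)\<^sup>2"
proof -
 have low: "0 <= exp (- b) - exp (- a) + (b - a) * exp (- a)"
 proof -
  have "exp (- a) * (1 + (a - b)) <= exp (- a) * exp (a - b)"
   by (intro mult_left_mono exp_ge_add_one_self) simp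
  then show ?thesis by (simp add: exp_add[symmetric] algebra_simps)
 qed
 have "exp (- b) * (1 + (b - a)) <= exp (- b) * exp (b - a)"
  by (intro mult_left_mono exp_ge_add_one_self) simp
 then have "exp (- b) - exp (- a) + (b - a) * exp (- a) <= (b - a) * (exp (- a) - exp (- b))"
  by (simp add: exp_add[symmetric] algebra_simps)
 also have "... <= \<bar>b - a\<bar> * \<bar>exp (- a) - exp (- b)\<bar>" by (simp add: abs_mult[symmetric])
 also have "... <= \<bar>b - a\<bar> * (exp c * \<bar>a - b\<bar>)" by (intro mult_left_mono exp_diff_bound assms) auto
 also have "... = exp c * (b - a)\<^sup>2" by (simp add: power2_eq_square abs_minus_commute abs_mult[symmetric] flip: abs_mult) (simp add: algebra_simps)
 finally show ?thesis using low by simp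
qed

section \<open>Derivatives of the exponent in \<open>t\<close>\<close>

locale levy_shift_density = levy_shift +
 fixes r :: "real => real" and Vb :: real
 assumes r_meas[measurable]: "r : bm" and r0: "!!x. 0 <= r x"
  and Vr: "density m (%x. ennreal (V x)) = density lborel (%x. ennreal (r x))"
  and Vb: "!!x. V x <= Vb"
  and a_inf: "filterlim (%t. \<integral>x. 1 - exp (- t * V x) \<partial>m) at_top at_top"
  and tapos: "0 < ta"
begin

lemma Vb0: "0 <= Vb" using V0(1)[of 0] Vb[of 0] by linarith

text \<open>The derivative of \<open>KK h\<close> in \<open>t\<close>. By \<open>DK_eq\<close> it is
  at the same time the phase of one new jump integrated over its time and its size; this double role
  makes the law on the enlarged space agree with the original one.\<close>

definition DK :: "(real => real) => real => complex" where
 "DK h t = (LINT z|nu. indi ({0..ta} \<times> UNIV) z *R (ei (h (fst z) * snd z) * of_real (V (snd z) * exp (- t * V (snd z)))))"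

lemma strip_meas[measurable]: "{0..ta} \<times> (UNIV :: real set) : sets nu" by (rule sets_nu_times) simp

lemma strip_integrable:
 fixes k :: "real \<times> real => complex"
 assumes [measurable]: "k : bmf nu" and b: "!!z. norm (k z) <= C * V (snd z)"
 shows "integrable nu (%z. indi ({0..ta} \<times> UNIV) z *R k z)"
  "norm (LINT z|nu. indi ({0..ta} \<times> UNIV) z *R k z) <= C * (LINT z|nu. indi ({0..ta} \<times> UNIV) z * V (snd z))"
proof -
 have i: "integrable nu (%z. C * (indi ({0..ta} \<times> UNIV) z * V (snd z)))"
  by (intro integrable_mult_right V_nu_integrable)
 have le: "norm (indi ({0..ta} \<times> UNIV) z *R k z) <= C * (indi ({0..ta} \<times> UNIV) z * V (snd z))" for z
  using b[of z] by (auto simp: indicator_def)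
 show i2: "integrable nu (%z. indi ({0..ta} \<times> UNIV) z *R k z)"
 proof (rule int_bound[OF i])
  show "AE z in nu. norm (indi ({0..ta} \<times> UNIV) z *R k z) <= norm (C * (indi ({0..ta} \<times> UNIV) z * V (snd z)))"
   unfolding real_norm_def by (rule AE_I2) (rule order_trans[OF le abs_ge_self])
 qed measurable
 have "norm (LINT z|nu. indi ({0..ta} \<times> UNIV) z *R k z) <= (LINT z|nu. norm (indi ({0..ta} \<times> UNIV) z *R k z))"
  by (rule integral_norm_bound)
 also have "... <= (LINT z|nu. C * (indi ({0..ta} \<times> UNIV) z * V (snd z)))"
  by (intro integral_mono integrable_norm i2 i le)
 finally show "norm (LINT z|nu. indi ({0..ta} \<times> UNIV) z *R k z) <= C * (LINT z|nu. indi ({0..ta} \<times> UNIV) z * V (snd z))"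
  by simp
qed

abbreviation "IV == (LINT z|nu. indi ({0..ta} \<times> UNIV) z * V (snd z))"

lemma phase_meas: assumes [measurable]: "h : bm"
 shows "(%z. ei (h (fst z) * snd z) :: complex) : bmf nu"
proof -
 have [measurable]: "(%z. h (fst z)) : bmf nu" by (rule measurable_compose[OF fst_nu assms])
 show ?thesis by measurable
qed

lemma thV: assumes "- 1 <= t" shows "- Vb <= t * V x"
proof -
 have "- 1 * Vb <= - 1 * V x" using Vb[of x] by simp
 also have "... <= t * V x" using assms V0(1) by (rule mult_right_mono)
 finally show ?thesis by simp
qed

lemma
 assumes h: "h : bm" and t: "- 1 <= t"
 shows KK_integrable: "integrable nu (%z. indi ({0..ta} \<times> UNIV) z *R (ei (h (fst z) * snd z) * of_real (1 - exp (- t * V (snd z)))))"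
  and DK_integrable: "integrable nu (%z. indi ({0..ta} \<times> UNIV) z *R (ei (h (fst z) * snd z) * of_real (V (snd z) * exp (- t * V (snd z)))))"
proof -
 note [measurable] = phase_meas[OF h]
 show "integrable nu (%z. indi ({0..ta} \<times> UNIV) z *R (ei (h (fst z) * snd z) * of_real (1 - exp (- t * V (snd z)))))"
 proof (rule strip_integrable(1)[where C="exp Vb * \<bar>t\<bar>"])
  fix z :: "real \<times> real"
  have "\<bar>1 - exp (- t * V (snd z))\<bar> <= exp Vb * \<bar>t * V (snd z)\<bar>"
   using exp_diff_bound[of Vb 0 "t * V (snd z)"] Vb0 thV[OF t] by simp
  then show "norm (ei (h (fst z) * snd z) * of_real (1 - exp (- t * V (snd z)))) <= exp Vb * \<bar>t\<bar> * V (snd z)"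
   using V0(1)[of "snd z"] by (simp add: norm_mult abs_mult mult.assoc del: of_real_diff)
 qed measurable
 show "integrable nu (%z. indi ({0..ta} \<times> UNIV) z *R (ei (h (fst z) * snd z) * of_real (V (snd z) * exp (- t * V (snd z)))))"
 proof (rule strip_integrable(1)[where C="exp Vb"])
  fix z :: "real \<times> real"
  have "exp (- t * V (snd z)) <= exp Vb" using thV[OF t, of "snd z"] by simp
  from mult_left_mono[OF this V0(1)]
  show "norm (ei (h (fst z) * snd z) * of_real (V (snd z) * exp (- t * V (snd z)))) <= exp Vb * V (snd z)"
   using V0(1)[of "snd z"] by (simp add: norm_mult abs_mult mult.commute del: of_real_mult)
 qed measurable
qed

lemma KK_deriv:
 assumes h: "h : bm" and u: "0 <= u"
 shows "(KK h has_vector_derivative DK h u) (at u)"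
proof (rule local_quadratic_bound_deriv[where C="exp Vb * Vb * IV"])
 fix e :: real assume e: "\<bar>e\<bar> <= 1"
 note [measurable] = phase_meas[OF h]
 let ?p = "%z. ei (h (fst z) * snd z) :: complex"
 have t: "- 1 <= u" "- 1 <= u + e" using u e by auto
 have eq: "KK h (u + e) - KK h u - e *R DK h u = (LINT z|nu. indi ({0..ta} \<times> UNIV) z *R
   (?p z * of_real ((1 - exp (- (u + e) * V (snd z))) - (1 - exp (- u * V (snd z))) - e * (V (snd z) * exp (- u * V (snd z))))))"
  unfolding KK_def DK_def
  by (subst integral_scaleR_right[symmetric], subst Bochner_Integration.integral_diff[symmetric], (intro KK_integrable h t)+,
    subst Bochner_Integration.integral_diff[symmetric], (intro Bochner_Integration.integrable_diff KK_integrable integrable_scaleR_right DK_integrable h t)+,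
    rule int_cong[OF refl])
   (simp add: scaleR_conv_of_real algebra_simps)
 have "norm (KK h (u + e) - KK h u - e *R DK h u) <= exp Vb * Vb * e\<^sup>2 * IV"
  unfolding eq
 proof (rule strip_integrable(2))
  fix z :: "real \<times> real"
  let ?V = "V (snd z)"
  have "\<bar>exp (- ((u + e) * ?V)) - exp (- (u * ?V)) + ((u + e) * ?V - u * ?V) * exp (- (u * ?V))\<bar> <= exp Vb * ((u + e) * ?V - u * ?V)\<^sup>2"
   by (rule exp_taylor_bound[OF thV[OF t(1)] thV[OF t(2)] Vb0])
  also have "... = exp Vb * e\<^sup>2 * (?V * ?V)" by (simp add: power2_eq_square algebra_simps)
  also have "... <= exp Vb * e\<^sup>2 * (Vb * ?V)" using V0 Vb by (intro mult_left_mono mult_right_mono) auto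
  finally have "\<bar>(1 - exp (- (u + e) * ?V)) - (1 - exp (- u * ?V)) - e * (?V * exp (- u * ?V))\<bar> <= exp Vb * Vb * e\<^sup>2 * ?V"
   by (simp add: abs_le_iff algebra_simps)
  then show "norm (?p z * of_real ((1 - exp (- (u + e) * ?V)) - (1 - exp (- u * ?V)) - e * (?V * exp (- u * ?V)))) <= exp Vb * Vb * e\<^sup>2 * ?V"
   by (simp only: norm_mult norm_exp_i_times norm_of_real mult_1_left)
 qed measurable
 then show "norm (KK h (u + e) - KK h u - e *R DK h u) <= exp Vb * Vb * IV * e\<^sup>2"
  unfolding mult.assoc mult.commute[of IV] .
qed

lemma DK_cont:
 assumes h: "h : bm"
 shows "continuous_on {0..} (DK h)"
proof (rule continuous_on_subset[OF _ subset_refl], unfold continuous_on_iff, intro ballI allI impI)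
 fix u e :: real assume u: "u : {0..}" and e: "0 < e"
 note [measurable] = phase_meas[OF h]
 let ?p = "%z. ei (h (fst z) * snd z) :: complex"
 have IV0: "0 <= IV" by (rule integral_nonneg_AE) (auto simp: V0)
 define C where "C = exp Vb * Vb * IV + 1"
 have C: "C > 0" using IV0 Vb0 by (simp add: C_def add_nonneg_pos)
 show "EX d>0. ALL x':{0..}. dist x' u < d --> dist (DK h x') (DK h u) < e"
 proof (intro exI[of _ "e / C"] conjI ballI impI)
  show "0 < e / C" using e C by simp
  fix y assume y: "y : {0..}" and d: "dist y u < e / C"
  have t: "- 1 <= u" "- 1 <= y" using u y by auto
  have eq: "DK h y - DK h u = (LINT z|nu. indi ({0..ta} \<times> UNIV) z *R (?p z * of_real (V (snd z) * (exp (- y * V (snd z)) - exp (- u * V (snd z))))))"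
   unfolding DK_def
   by (subst Bochner_Integration.integral_diff[symmetric], (intro DK_integrable h t)+, rule int_cong[OF refl])
    (simp add: scaleR_conv_of_real algebra_simps)
  have "norm (DK h y - DK h u) <= exp Vb * Vb * \<bar>y - u\<bar> * IV"
   unfolding eq
  proof (rule strip_integrable(2))
   fix z :: "real \<times> real"
   let ?V = "V (snd z)"
   have "\<bar>exp (- (y * ?V)) - exp (- (u * ?V))\<bar> <= exp Vb * \<bar>y * ?V - u * ?V\<bar>"
    by (rule exp_diff_bound[OF thV[OF t(2)] thV[OF t(1)] Vb0])
   also have "... = exp Vb * \<bar>y - u\<bar> * ?V"
    using V0(1)[of "snd z"] by (simp add: left_diff_distrib[symmetric] abs_mult)
   also have "... <= exp Vb * \<bar>y - u\<bar> * Vb" using Vb by (intro mult_left_mono) auto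
   finally have "?V * \<bar>exp (- (y * ?V)) - exp (- (u * ?V))\<bar> <= ?V * (exp Vb * \<bar>y - u\<bar> * Vb)"
    using V0(1) by (rule mult_left_mono)
   then show "norm (?p z * of_real (?V * (exp (- y * ?V) - exp (- u * ?V)))) <= exp Vb * Vb * \<bar>y - u\<bar> * ?V"
    using V0(1)[of "snd z"] by (simp add: norm_mult abs_mult mult_ac del: of_real_mult of_real_diff)
  qed measurable
  also have "... <= C * \<bar>y - u\<bar>" by (simp add: C_def algebra_simps)
  also have "... < e" using d C by (simp add: dist_real_def field_simps)
  finally show "dist (DK h y) (DK h u) < e" by (simp add: dist_norm)
 qed
qed

lemma KK_0: "KK h 0 = 0" by (simp add: KK_def)

definition aa :: "real => real" where "aa t = (LINT x|m. 1 - exp (- t * V x))"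

definition da :: "real => real" where "da t = (LINT x|lborel. exp (- t * V x) * r x)"

lemma integral_nu:
 fixes k :: "real \<times> real => complex"
 assumes "integrable nu (%z. indi ({0..ta} \<times> UNIV) z *R k z)"
 shows "(LINT z|nu. indi ({0..ta} \<times> UNIV) z *R k z) = (LINT s|lborel. indi {0..ta} s *R (LINT x|m. k (s, x)))"
proof -
 interpret R: sigma_finite_measure "restrict_space lborel {0::real..}"
  by (rule sigma_finite_measure_restrict_space) (auto intro: sigma_finite_lborel)
 interpret PS: pair_sigma_finite "restrict_space lborel {0::real..}" m ..
 have "(LINT z|nu. indi ({0..ta} \<times> UNIV) z *R k z) = (\<integral>s. \<integral>x. indi ({0..ta} \<times> UNIV) (s, x) *R k (s, x) \<partial>m \<partial>restrict_space lborel {0..})"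
  using assms unfolding jump_intensity_def by (rule PS.integral_fst'[symmetric])
 also have "... = (LINT s|lborel. indi {0..} s *R (LINT x|m. indi ({0..ta} \<times> UNIV) (s, x) *R k (s, x)))"
  by (rule integral_restrict_space) simp
 also have "... = (LINT s|lborel. indi {0..ta} s *R (LINT x|m. k (s, x)))"
  by (intro int_cong refl) (auto simp: indicator_def)
 finally show ?thesis .
qed

lemma integral_V_density:
 fixes k :: "real => complex"
 assumes [measurable]: "k : bm"
 shows "(LINT x|m. V x *R k x) = (LINT x|lborel. r x *R k x)"
proof -
 have "(LINT x|m. V x *R k x) = (\<integral>x. k x \<partial>density m (%x. ennreal (V x)))"
  by (subst integral_density) (auto simp: V0)
 also have "... = (LINT x|lborel. r x *R k x)"
  unfolding Vr by (subst integral_density) (auto simp: r0)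
 finally show ?thesis .
qed

lemma DK_eq:
 assumes h[measurable]: "h : bm" and t: "0 <= t"
 shows "DK h t = (LINT s|lborel. indi {0..ta} s *R (LINT x|lborel. (exp (- t * V x) * r x) *R ei (h s * x)))"
proof -
 have "DK h t = (LINT s|lborel. indi {0..ta} s *R (LINT x|m. ei (h s * x) * of_real (V x * exp (- t * V x))))"
  unfolding DK_def by (subst integral_nu) (use DK_integrable[OF h, of t] t in auto)
 moreover have "(LINT x|m. ei (h s * x) * of_real (V x * exp (- t * V x))) = (LINT x|lborel. (exp (- t * V x) * r x) *R ei (h s * x))" for s
 proof -
  have "(LINT x|m. ei (h s * x) * of_real (V x * exp (- t * V x))) = (LINT x|m. V x *R (exp (- t * V x) *R ei (h s * x)))"
   by (simp add: scaleR_conv_of_real mult_ac)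
  also have "... = (LINT x|lborel. r x *R (exp (- t * V x) *R ei (h s * x)))"
   by (rule integral_V_density) measurable
  finally show ?thesis by (simp add: mult_ac)
 qed
 ultimately show ?thesis by (simp only:)
qed

lemma DK_0: "0 <= t ==> DK (%_. 0) t = of_real (ta * da t)"
 using tapos by (simp add: DK_eq da_def scaleR_conv_of_real flip: of_real_mult)

lemma KK_real: "0 <= t ==> KK (%_. 0) t = of_real (ta * aa t)"
proof -
 assume t: "0 <= t"
 have "KK (%_. 0) t = (LINT s|lborel. indi {0..ta} s *R (LINT x|m. of_real (1 - exp (- t * V x))))"
  unfolding KK_def by (subst integral_nu) (use KK_integrable[of "%_. 0" t] t in auto)
 then show ?thesis using tapos by (simp add: aa_def scaleR_conv_of_real del: of_real_diff)
qed

lemma aa_0: "aa 0 = 0" by (simp add: aa_def)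

lemma da_nonneg: "0 <= da t" unfolding da_def by (rule integral_nonneg_AE) (auto simp: r0)

lemma EH: assumes "0 <= t" shows "(LINT w|M. H t w) = exp (- ta * aa t)"
proof -
 have "(LINT w|M. of_real (H t w)) = (exp (- KK (%_. 0) t) :: complex)"
  using joint_cf[of "{} :: nat set" "%_. 0" t "%_. 0"] assms by (simp add: prob_space stepfun_def[abs_def])
 then have "complex_of_real (LINT w|M. H t w) = of_real (exp (- ta * aa t))"
  using assms by (simp add: KK_real exp_of_real[symmetric])
 then show ?thesis by (simp only: of_real_eq_iff)
qed

lemma aa_deriv: assumes "0 <= u" shows "(aa has_real_derivative da u) (at u)"
proof -
 \<comment> \<open>A derivative at \<open>0\<close> sees negative \<open>t\<close>, so the identity
   of \<open>KK_real\<close> is established again on a larger range.\<close>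
 have R: "Re (KK (%_. 0) t) = ta * aa t" if "- 1 <= t" for t
 proof -
  have "KK (%_. 0) t = (LINT s|lborel. indi {0..ta} s *R (LINT x|m. of_real (1 - exp (- t * V x))))"
   unfolding KK_def by (subst integral_nu) (use KK_integrable[of "%_. 0" t] that in auto)
  then show ?thesis using tapos by (simp add: aa_def scaleR_conv_of_real del: of_real_diff)
 qed
 have "((%t. Re (KK (%_. 0) t)) has_real_derivative Re (DK (%_. 0) u)) (at u)"
  using bounded_linear.has_vector_derivative[OF bounded_linear_Re KK_deriv[of "%_. 0" u]] assms
  by (simp add: has_real_derivative_iff_has_vector_derivative)
 then have "((%t. ta * aa t) has_real_derivative ta * da u) (at u)"
 proof (rule DERIV_cong_ev[THEN iffD1, rotated -1])
  show "\<forall>\<^sub>F t in nhds u. Re (KK (%_. 0) t) = ta * aa t"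
   unfolding eventually_nhds_metric by (intro exI[of _ 1]) (use assms in \<open>auto simp: dist_real_def intro!: R\<close>)
  show "Re (DK (%_. 0) u) = ta * da u" by (simp add: DK_0[OF assms])
 qed simp
 from DERIV_cmult[OF this, of "1 / ta"] show ?thesis using tapos by simp
qed

end

text \<open>Countably many times that determine a right-continuous path. The pairs are a redundant
  enumeration, but they let \<open>Reg\<close> address the refinement level directly.\<close>

definition dyadic :: "nat \<times> nat => real" where "dyadic p = real (snd p) / 2 ^ fst p"

lemma dyadic_nonneg[simp]: "0 <= dyadic p" by (simp add: dyadic_def)

lemma exp_neg_has_vector_derivative:
 fixes f :: "real => complex"
 assumes "(f has_vector_derivative f') (at x)"
 shows "((%t. - c * exp (- f t)) has_vector_derivative c * (f' * exp (- f x))) (at x)"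
proof -
 have "((%y. - c * exp (- y)) has_field_derivative c * exp (- f x)) (at (f x))"
  by (auto intro!: derivative_eq_intros)
 from field_vector_diff_chain_at[OF assms this] show ?thesis by (simp add: comp_def mult_ac)
qed

section \<open>The enlarged space and the law of the path with one more jump\<close>

context levy_shift_density
begin

text \<open>A point is \<open>(((t, s), w), x)\<close>: the jump \<open>x\<close> is added to the path of \<open>w\<close> at time \<open>s\<close>.\<close>

definition B0 :: "((real \<times> real) \<times> 'a) measure" where "B0 = (lborel \<Otimes>\<^sub>M lborel) \<Otimes>\<^sub>M M"

text \<open>The part of the density that does not see the size of the new jump; integration by parts
  in \<open>x\<close> leaves it untouched.\<close>

definition hb :: "(real \<times> real) \<times> 'a => real" where
 "hb u = indi {0..} (fst (fst u)) * indi {0..ta} (snd (fst u)) * H (fst (fst u)) (snd u)"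

definition qd :: "real => real => real" where "qd t x = exp (- t * V x) * r x"

definition Om :: "(((real \<times> real) \<times> 'a) \<times> real) measure" where
 "Om = density (B0 \<Otimes>\<^sub>M lborel) (%p. ennreal (hb (fst p) * qd (fst (fst (fst p))) (snd p)))"

sublocale B0: pair_sigma_finite "lborel \<Otimes>\<^sub>M lborel :: (real \<times> real) measure" M ..

lemma sigma_finite_B0: "sigma_finite_measure B0"
 unfolding B0_def by (rule B0.P.sigma_finite_measure_axioms)

lemma hb_nonneg: "0 <= hb u"
 unfolding hb_def using H_bounds(1) by (auto simp: indicator_def)

lemma qd_nonneg: "0 <= qd t x" by (simp add: qd_def r0)

lemma hb_meas[measurable]: "hb : bmf B0"
proof -
 have "(%u. (snd u, fst (fst u))) : B0 \<rightarrow>\<^sub>M M \<Otimes>\<^sub>M borel"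
  unfolding B0_def by measurable
 from measurable_compose[OF this H_meas]
 have [measurable]: "(%u. H (fst (fst u)) (snd u)) : bmf B0" by simp
 have [measurable]: "(%u. fst (fst u)) : bmf B0" "(%u. snd (fst u)) : bmf B0"
  unfolding B0_def by measurable
 show ?thesis unfolding hb_def[abs_def] by measurable
qed

lemma qd_meas1[measurable]: "qd t : bm"
 unfolding qd_def[abs_def] by measurable

lemma B0_meas[measurable]: "(%u. fst (fst u)) : bmf B0" "(%u. snd (fst u)) : bmf B0" "snd : B0 \<rightarrow>\<^sub>M M"
 unfolding B0_def by measurable

lemma qd_meas2[measurable]: "(%p. qd (fst (fst (fst p))) (snd p)) : bmf (B0 \<Otimes>\<^sub>M lborel)"
 unfolding qd_def by measurable

lemma r_integrable: "integrable lborel r"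
proof (rule integrableI_nonneg)
 have "(\<integral>\<^sup>+ x. ennreal (r x) \<partial>lborel) = emeasure (density lborel (%x. ennreal (r x))) UNIV"
  by (subst emeasure_density) auto
 also have "... = (\<integral>\<^sup>+ x. ennreal (V x) \<partial>m)" unfolding Vr[symmetric] by (subst emeasure_density) auto
 also have "... < \<infinity>" using V_int by (auto simp: integrable_iff_bounded V0)
 finally show "(\<integral>\<^sup>+ x. ennreal (r x) \<partial>lborel) < \<infinity>" .
qed (auto simp: r0)

lemma qd_integrable: assumes "0 <= t" shows "integrable lborel (qd t)"
proof (rule int_bound[OF r_integrable])
 have "qd t x <= r x" for x
  using mult_right_mono[of "exp (- t * V x)" 1 "r x"] r0[of x] V0(1)[of x] assms by (simp add: qd_def)
 then show "AE x in lborel. norm (qd t x) <= norm (r x)" using qd_nonneg r0 by auto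
qed simp

lemma nn_qd: "0 <= t ==> (\<integral>\<^sup>+ x. ennreal (qd t x) \<partial>lborel) = ennreal (da t)"
proof -
 assume "0 <= t"
 moreover have "da t = (LINT x|lborel. qd t x)" unfolding da_def qd_def ..
 ultimately show ?thesis using nn_integral_eq_integral[OF qd_integrable] qd_nonneg by simp
qed

lemma aa_meas[measurable]: "aa : bm"
 unfolding aa_def[abs_def] by (rule m.borel_measurable_lebesgue_integral) measurable

lemma da_meas[measurable]: "da : bm"
 unfolding da_def[abs_def] by (rule lborel.borel_measurable_lebesgue_integral) measurable

lemma nn_H: "0 <= t ==> (\<integral>\<^sup>+ w. ennreal (H t w) \<partial>M) = ennreal (exp (- ta * aa t))"
proof -
 assume t: "0 <= t"
 have "integrable M (H t)"
  by (rule integrable_const_bound[where B=1]) (use H_bounds[OF t] in auto)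
 from nn_integral_eq_integral[OF this] show ?thesis using H_bounds[OF t] EH[OF t] by simp
qed

lemma exp_aa_lim: "((%t. exp (- ta * aa t)) \<longlongrightarrow> 0) at_top"
proof -
 have "filterlim (%t. ta * aa t) at_top at_top"
  unfolding aa_def by (rule filterlim_tendsto_pos_mult_at_top[OF tendsto_const tapos a_inf])
 then have "filterlim (%t. - (ta * aa t)) at_bot at_top" by (simp add: filterlim_uminus_at_bot)
 from filterlim_compose[OF exp_at_bot this] show ?thesis by simp
qed

text \<open>The total derivative of \<open>exp(-ta * aa t)\<close> is integrated. Divergence of
  \<open>aa\<close> means that \<open>S\<close> is almost surely positive; on an event
  \<open>S = 0\<close> the integral of \<open>S exp(-t S)\<close> would be \<open>0\<close> instead
  of \<open>1\<close>.\<close>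

lemma total_mass: "(\<integral>\<^sup>+ t. ennreal (ta * da t * exp (- ta * aa t)) * indi {0..} t \<partial>lborel) = 1"
proof -
 have "(\<integral>\<^sup>+ t. ennreal (ta * da t * exp (- ta * aa t)) * indi {0..} t \<partial>lborel) = ennreal (0 - - exp (- ta * aa 0))"
 proof (rule nn_integral_FTC_atLeast)
  show "((%t. - exp (- ta * aa t)) has_real_derivative ta * da x * exp (- ta * aa x)) (at x)" if "0 <= x" for x
   by (rule derivative_eq_intros aa_deriv that refl | simp)+
  show "((%t. - exp (- ta * aa t)) \<longlongrightarrow> 0) at_top"
   using tendsto_minus[OF exp_aa_lim] by simp
 qed (use da_nonneg ta0 in auto)
 then show ?thesis by (simp add: aa_0)
qed

lemma nn_Om:
 assumes [measurable]: "G : bmf (B0 \<Otimes>\<^sub>M lborel)"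
 shows "(\<integral>\<^sup>+ p. G p \<partial>Om) = (\<integral>\<^sup>+ u. ennreal (hb u) * (\<integral>\<^sup>+ x. ennreal (qd (fst (fst u)) x) * G (u, x) \<partial>lborel) \<partial>B0)"
proof -
 have "(\<integral>\<^sup>+ p. G p \<partial>Om) = (\<integral>\<^sup>+ p. ennreal (hb (fst p) * qd (fst (fst (fst p))) (snd p)) * G p \<partial>(B0 \<Otimes>\<^sub>M lborel))"
  unfolding Om_def by (rule nn_integral_density) measurable
 also have "... = (\<integral>\<^sup>+ u. \<integral>\<^sup>+ x. ennreal (hb u * qd (fst (fst u)) x) * G (u, x) \<partial>lborel \<partial>B0)"
  by (subst lborel.nn_integral_fst[symmetric]) simp_all
 also have "... = (\<integral>\<^sup>+ u. ennreal (hb u) * (\<integral>\<^sup>+ x. ennreal (qd (fst (fst u)) x) * G (u, x) \<partial>lborel) \<partial>B0)"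
 proof (rule nn_integral_cong)
  fix u assume "u : space B0"
  then have [measurable]: "(%x. G (u, x)) : bmf lborel" by measurable
  show "(\<integral>\<^sup>+ x. ennreal (hb u * qd (fst (fst u)) x) * G (u, x) \<partial>lborel) = ennreal (hb u) * (\<integral>\<^sup>+ x. ennreal (qd (fst (fst u)) x) * G (u, x) \<partial>lborel)"
   by (subst nn_integral_cmult[symmetric]) (auto simp: ennreal_mult hb_nonneg qd_nonneg mult.assoc)
 qed
 finally show ?thesis .
qed

lemma nn_B0:
 assumes [measurable]: "g : bm"
 shows "(\<integral>\<^sup>+ u. ennreal (hb u) * g (fst (fst u)) \<partial>B0) = (\<integral>\<^sup>+ t. indi {0..} t * ennreal (ta * exp (- ta * aa t)) * g t \<partial>lborel)"
proof -
 have "(\<integral>\<^sup>+ u. ennreal (hb u) * g (fst (fst u)) \<partial>B0) = (\<integral>\<^sup>+ p. \<integral>\<^sup>+ w. ennreal (hb (p, w)) * g (fst p) \<partial>M \<partial>(lborel \<Otimes>\<^sub>M lborel))"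
 proof -
  have "(%u. ennreal (hb u) * g (fst (fst u))) : bmf B0" by measurable
  from nn_integral_fst[OF this[unfolded B0_def]] show ?thesis unfolding B0_def by simp
 qed
 also have "... = (\<integral>\<^sup>+ p. indi {0..} (fst p) * indi {0..ta} (snd p) * ennreal (exp (- ta * aa (fst p))) * g (fst p) \<partial>(lborel \<Otimes>\<^sub>M lborel))"
 proof (rule nn_integral_cong)
  fix p :: "real \<times> real"
  show "(\<integral>\<^sup>+ w. ennreal (hb (p, w)) * g (fst p) \<partial>M) = indi {0..} (fst p) * indi {0..ta} (snd p) * ennreal (exp (- ta * aa (fst p))) * g (fst p)"
  proof (cases "0 <= fst p & snd p : {0..ta}")
   case True
   then show ?thesis by (subst nn_integral_multc) (auto simp: hb_def nn_H)
  next
   case False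
   then show ?thesis by (auto simp: hb_def indicator_def)
  qed
 qed
 also have "... = (\<integral>\<^sup>+ t. \<integral>\<^sup>+ s. indi {0..ta} s * (indi {0..} t * ennreal (exp (- ta * aa t)) * g t) \<partial>lborel \<partial>lborel)"
  by (subst lborel.nn_integral_fst[symmetric]) (auto simp: mult_ac)
 also have "... = (\<integral>\<^sup>+ t. indi {0..} t * ennreal (ta * exp (- ta * aa t)) * g t \<partial>lborel)"
  using ta0 by (intro nn_integral_cong) (subst nn_integral_multc, auto simp: ennreal_mult mult_ac)
 finally show ?thesis .
qed

lemma prob_space_Om: "prob_space Om"
proof
 have "emeasure Om (space Om) = (\<integral>\<^sup>+ p. 1 \<partial>Om)" by simp
 also have "... = (\<integral>\<^sup>+ u. ennreal (hb u) * (\<integral>\<^sup>+ x. ennreal (qd (fst (fst u)) x) \<partial>lborel) \<partial>B0)"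
  by (subst nn_Om) auto
 also have "... = (\<integral>\<^sup>+ u. ennreal (hb u) * ennreal (da (fst (fst u))) \<partial>B0)"
 proof (rule nn_integral_cong)
  fix u
  show "ennreal (hb u) * (\<integral>\<^sup>+ x. ennreal (qd (fst (fst u)) x) \<partial>lborel) = ennreal (hb u) * ennreal (da (fst (fst u)))"
   by (cases "0 <= fst (fst u)") (auto simp: nn_qd hb_def)
 qed
 also have "... = (\<integral>\<^sup>+ t. indi {0..} t * ennreal (ta * exp (- ta * aa t)) * ennreal (da t) \<partial>lborel)"
  by (rule nn_B0) measurable
 also have "... = (\<integral>\<^sup>+ t. ennreal (ta * da t * exp (- ta * aa t)) * indi {0..} t \<partial>lborel)"
  using ta0 by (intro nn_integral_cong) (auto simp: ennreal_mult da_nonneg mult_ac)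
 finally show "emeasure Om (space Om) = 1" by (simp only: total_mass)
qed

sublocale Om: prob_space Om by (rule prob_space_Om)

lemma sets_Om[measurable_cong]: "sets Om = sets (B0 \<Otimes>\<^sub>M lborel)" by (simp add: Om_def)

sublocale BL: pair_sigma_finite B0 "lborel :: real measure"
 by (intro pair_sigma_finite.intro sigma_finite_B0 sigma_finite_lborel)

lemma integral_Om:
 fixes G :: "_ => 'b::{banach, second_countable_topology}"
 assumes G: "integrable Om G"
 shows "(LINT p|Om. G p) = (LINT u|B0. hb u *R (LINT x|lborel. qd (fst (fst u)) x *R G (u, x)))"
  and integrable_Om: "integrable B0 (%u. hb u *R (LINT x|lborel. qd (fst (fst u)) x *R G (u, x)))"
proof -
 have [measurable]: "G : bmf (B0 \<Otimes>\<^sub>M lborel)"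
  using borel_measurable_integrable[OF G] by measurable
 let ?G = "%p. (hb (fst p) * qd (fst (fst (fst p))) (snd p)) *R G p"
 have i: "integrable (B0 \<Otimes>\<^sub>M lborel) ?G"
  using G unfolding Om_def by (subst (asm) integrable_density) (auto simp: hb_nonneg qd_nonneg)
 have "(LINT p|Om. G p) = (\<integral>p. ?G p \<partial>(B0 \<Otimes>\<^sub>M lborel))"
  unfolding Om_def by (rule integral_density) (auto simp: hb_nonneg qd_nonneg)
 also have "... = (LINT u|B0. \<integral>x. ?G (u, x) \<partial>lborel)" by (rule BL.integral_fst'[OF i, symmetric])
 finally show "(LINT p|Om. G p) = (LINT u|B0. hb u *R (LINT x|lborel. qd (fst (fst u)) x *R G (u, x)))"
  by (simp add: scaleR_scaleR[symmetric] del: scaleR_scaleR)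
 show "integrable B0 (%u. hb u *R (LINT x|lborel. qd (fst (fst u)) x *R G (u, x)))"
  using BL.integrable_fst'[OF i] by (simp add: scaleR_scaleR[symmetric] del: scaleR_scaleR)
qed

definition opath :: "((real \<times> real) \<times> 'a) \<times> real => nat \<times> nat => real" where
 "opath p i = Z (dyadic i) (snd (fst p)) + snd p * indi {..dyadic i} (snd (fst (fst p)))"

lemma Zd_meas[measurable]: "Z (dyadic i) : bmf M" by (rule Z_meas) simp

lemma opath_meas1[measurable]: "(%p. opath p i) : bmf (B0 \<Otimes>\<^sub>M lborel)"
proof -
 have [measurable]: "(%p. Z (dyadic i) (snd (fst p))) : bmf (B0 \<Otimes>\<^sub>M lborel)"
  by (rule measurable_compose[OF _ Zd_meas]) measurable
 show ?thesis unfolding opath_def by measurable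
qed

text \<open>The additional jump contributes the \<open>t\<close>-derivative of \<open>- exp(- KK h t)\<close>, which integrates to \<open>1\<close>.\<close>

lemma opath_cf:
 assumes J: "finite J"
 shows "(LINT p|Om. ei (SUM a:J. u a * opath p a)) = (LINT q|M. ei (SUM a:J. u a * Z (dyadic a) q))"
proof -
 let ?h = "stepfun J u dyadic"
 have hm[measurable]: "?h : bm" using J by simp
 let ?W = "%q. ei (SUM a:J. u a * Z (dyadic a) q)"
 have Wm[measurable]: "?W : bmf M" by measurable
 let ?G = "%p. ei (SUM a:J. u a * opath p a)"
 have Gi: "integrable Om ?G"
  by (rule Om.integrable_const_bound[where B=1]) auto
 have Ge: "?G (y, x) = ?W (snd y) * ei (?h (snd (fst y)) * x)" for y x
 proof -
  have "(SUM a:J. u a * opath (y, x) a) = (SUM a:J. u a * Z (dyadic a) (snd y)) + ?h (snd (fst y)) * x"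
   by (simp add: opath_def stepfun_def sum.distrib sum_distrib_right sum_distrib_left algebra_simps)
  then show ?thesis by (simp add: exp_add algebra_simps flip: of_real_sum)
 qed
 define c where "c p = (LINT x|lborel. qd (fst p) x *R ei (?h (snd p) * x))" for p
 have inner: "hb y *R (LINT x|lborel. qd (fst (fst y)) x *R ?G (y, x)) = hb y *R (?W (snd y) * c (fst y))" for y
 proof -
  have "(LINT x|lborel. qd (fst (fst y)) x *R ?G (y, x)) = (LINT x|lborel. ?W (snd y) * (qd (fst (fst y)) x *R ei (?h (snd (fst y)) * x)))"
   unfolding Ge by (intro int_cong refl) simp
  also have "... = ?W (snd y) * c (fst y)" unfolding c_def by (rule integral_mult_right_zero)
  finally show ?thesis by (simp only:)
 qed
 have i1: "integrable ((lborel \<Otimes>\<^sub>M lborel) \<Otimes>\<^sub>M M) (%y. hb y *R (?W (snd y) * c (fst y)))"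
  using integrable_Om[OF Gi] unfolding inner B0_def .
 let ?ps = "\<integral>q. ?W q \<partial>M"
 have mid: "(LINT q|M. hb (p, q) *R (?W q * c p)) = indi {0..} (fst p) *R (indi {0..ta} (snd p) *R (?ps * exp (- KK ?h (fst p)) * c p))" for p
 proof (cases "0 <= fst p & snd p : {0..ta}")
  case True
  then have "(LINT q|M. hb (p, q) *R (?W q * c p)) = (LINT q|M. (?W q * of_real (H (fst p) q)) * c p)"
   by (intro int_cong refl) (simp add: hb_def scaleR_conv_of_real mult_ac)
  also have "... = (LINT q|M. ?W q * of_real (H (fst p) q)) * c p" by simp
  also have "(LINT q|M. ?W q * of_real (H (fst p) q)) = ?ps * exp (- KK ?h (fst p))"
   by (rule joint_cf[OF J]) (use True in auto)
  finally show ?thesis using True by simp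
 next
  case False
  then show ?thesis by (auto simp: hb_def indicator_def)
 qed
 have i2: "integrable (lborel \<Otimes>\<^sub>M lborel) (%p. indi {0..} (fst p) *R (indi {0..ta} (snd p) *R (?ps * exp (- KK ?h (fst p)) * c p)))"
  using B0.integrable_fst'[OF i1] unfolding fst_conv snd_conv mid .
 have in3: "(LINT s|lborel. indi {0..} t *R (indi {0..ta} s *R (?ps * exp (- KK ?h t) * c (t, s)))) = indi {0..} t *R (?ps * (DK ?h t * exp (- KK ?h t)))" for t
 proof (cases "0 <= t")
  case True
  have "(LINT s|lborel. indi {0..} t *R (indi {0..ta} s *R (?ps * exp (- KK ?h t) * c (t, s)))) = (LINT s|lborel. (?ps * exp (- KK ?h t)) * (indi {0..ta} s *R c (t, s)))"
   using True by (intro int_cong refl) simp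
  also have "... = (?ps * exp (- KK ?h t)) * (LINT s|lborel. indi {0..ta} s *R c (t, s))"
   by (rule integral_mult_right_zero)
  also have "(LINT s|lborel. indi {0..ta} s *R c (t, s)) = DK ?h t"
   unfolding DK_eq[OF hm True] c_def qd_def by simp
  finally show ?thesis using True by simp
 qed simp
 have i3: "integrable lborel (%t. indi {0..} t *R (?ps * (DK ?h t * exp (- KK ?h t))))"
  using lborel_pair.integrable_fst'[OF i2] unfolding fst_conv snd_conv in3 .
 have "(LINT p|Om. ?G p) = (\<integral>y. hb y *R (?W (snd y) * c (fst y)) \<partial>((lborel \<Otimes>\<^sub>M lborel) \<Otimes>\<^sub>M M))"
  unfolding integral_Om[OF Gi] inner B0_def ..
 also have "... = (\<integral>p. indi {0..} (fst p) *R (indi {0..ta} (snd p) *R (?ps * exp (- KK ?h (fst p)) * c p)) \<partial>(lborel \<Otimes>\<^sub>M lborel))"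
  unfolding B0.integral_fst'[OF i1, symmetric] fst_conv snd_conv mid ..
 also have "... = (LINT t|lborel. indi {0..} t *R (?ps * (DK ?h t * exp (- KK ?h t))))"
  unfolding lborel_pair.integral_fst'[OF i2, symmetric] fst_conv snd_conv in3 ..
 also have "... = ?ps"
 proof -
  let ?f = "%t. ?ps * (DK ?h t * exp (- KK ?h t))"
  have "(%n. \<integral>t. indi {0..real n} t *R ?f t \<partial>lborel) ----> (LINT t|lborel. indi {0..} t *R ?f t)"
  proof (rule integral_dominated_convergence[where w="%t. norm (indi {0..} t *R ?f t)"])
   show "(%t. indi {0..} t *R ?f t) : bmf lborel" using i3 by auto
   have "(%t. indi {0..real n} t *R (indi {0..} t *R ?f t)) : bmf lborel" for n
    using borel_measurable_integrable[OF i3] by measurable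
   moreover have "indi {0..real n} t *R (indi {0..} t *R ?f t) = indi {0..real n} t *R ?f t" for n t
    by (auto simp: indicator_def)
   ultimately show "(%t. indi {0..real n} t *R ?f t) : bmf lborel" for n by (simp only:)
   show "integrable lborel (%t. norm (indi {0..} t *R ?f t))" by (rule integrable_norm[OF i3])
   show "AE t in lborel. (%n. indi {0..real n} t *R ?f t) ----> indi {0..} t *R ?f t"
   proof (rule AE_I2)
    fix t :: real
    have "\<forall>\<^sub>F n in sequentially. t <= real n" by (rule eventually_sequentiallyI[of "nat \<lceil>t\<rceil>"]) linarith
    then have "\<forall>\<^sub>F n in sequentially. indi {0..real n} t *R ?f t = indi {0..} t *R ?f t"
     by eventually_elim (auto simp: indicator_def)
    then show "(%n. indi {0..real n} t *R ?f t) ----> indi {0..} t *R ?f t" by (rule tendsto_eventually)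
   qed
  qed (auto simp: indicator_def)
  moreover have "(LINT t|lborel. indi {0..real n} t *R ?f t) = ?ps - ?ps * exp (- KK ?h (real n))" for n
  proof -
   have "(LINT t|lborel. indi {0..real n} t *R ?f t) = - ?ps * exp (- KK ?h (real n)) - (- ?ps * exp (- KK ?h 0))"
   proof (rule integral_FTC_Icc)
    have kd: "((%t. - ?ps * exp (- KK ?h t)) has_vector_derivative ?f x) (at x)" if "0 <= x" for x
     by (rule exp_neg_has_vector_derivative[OF KK_deriv[OF hm that]])
    show "((%t. - ?ps * exp (- KK ?h t)) has_vector_derivative ?f x) (at x within {0..real n})" if "0 <= x" "x <= real n" for x
     by (rule has_vector_derivative_at_within[OF kd[OF that(1)]])
    have kc: "continuous_on {0..real n} (KK ?h)"
     by (intro continuous_at_imp_continuous_on ballI has_vector_derivative_continuous[OF KK_deriv[OF hm]]) auto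
    have dc: "continuous_on {0..real n} (DK ?h)" by (rule continuous_on_subset[OF DK_cont[OF hm]]) auto
    show "continuous_on {0..real n} ?f" by (intro continuous_intros kc dc)
   qed simp
   then show ?thesis by (simp add: KK_0)
  qed
  moreover have "(%n. ?ps - ?ps * exp (- KK ?h (real n))) ----> ?ps - 0"
  proof (intro tendsto_diff tendsto_const Lim_null_comparison[of "%n. ?ps * exp (- KK ?h (real n))" "%n. exp (- ta * aa (real n))"])
   show "(%n. exp (- ta * aa (real n))) ----> 0"
    by (rule filterlim_compose[OF exp_aa_lim filterlim_real_sequentially])
   \<comment> \<open>The boundary term at infinity is bounded by reading \<open>joint_cf\<close>
     backwards: its modulus is at most the expectation of \<open>H\<close>, which \<open>EH\<close>
     evaluates.\<close>
   have "norm (?ps * exp (- KK ?h (real n))) <= exp (- ta * aa (real n))" for n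
   proof -
    have "?ps * exp (- KK ?h (real n)) = (LINT q|M. ?W q * of_real (H (real n) q))"
     by (rule joint_cf[OF J, symmetric]) auto
    also have "norm ... <= (LINT q|M. norm (?W q * of_real (H (real n) q)))" by (rule integral_norm_bound)
    also have "... = (LINT q|M. H (real n) q)"
     using H_bounds(1)[of "real n"] by (simp add: norm_mult)
    also have "... = exp (- ta * aa (real n))" by (rule EH) simp
    finally show ?thesis .
   qed
   then show "\<forall>\<^sub>F n in sequentially. norm (?ps * exp (- KK ?h (real n))) <= exp (- ta * aa (real n))" by simp
  qed
  ultimately show ?thesis using LIMSEQ_unique by fastforce
 qed
 finally show ?thesis .
qed

theorem opath_law:
 "distr Om (PiM UNIV (%_. borel)) opath = distr M (PiM UNIV (%_. borel)) (%w i. Z (dyadic i) w)"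
proof (rule PiM_char_unique)
 have [measurable]: "opath : Om \<rightarrow>\<^sub>M PiM UNIV (%_. borel)"
  using measurable_PiM_single'[of UNIV "%i p. opath p i" Om "%_. borel"] by simp
 have [measurable]: "(%w i. Z (dyadic i) w) : M \<rightarrow>\<^sub>M PiM UNIV (%_. borel)"
  using measurable_PiM_single'[of UNIV "%i w. Z (dyadic i) w" M "%_. borel"] by simp
 show "prob_space (distr Om (PiM UNIV (%_. borel)) opath)" by (rule Om.prob_space_distr) measurable
 show "prob_space (distr M (PiM UNIV (%_. borel)) (%w i. Z (dyadic i) w))" by (rule prob_space_distr) measurable
 fix J :: "(nat \<times> nat) set" and u assume J: "finite J"
 have [measurable]: "(%x. ei (SUM a:J. u a * x a) :: complex) : bmf (PiM UNIV (%_. borel))"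
  by measurable
 show "(\<integral>x. ei (SUM a:J. u a * x a) \<partial>distr Om (PiM UNIV (%_. borel)) opath)
   = (\<integral>x. ei (SUM a:J. u a * x a) \<partial>distr M (PiM UNIV (%_. borel)) (%w i. Z (dyadic i) w))"
  using opath_cf[OF J] by (subst (1 2) integral_distr) auto
qed auto

end

text \<open>The squared positive part is a simple continuously differentiable function vanishing on
  a half line. It underlies \<open>cut\<close>, the cutoff in \<open>ww\<close> and the functions
  that detect half-spaces.\<close>

lemma bump_sq_deriv: "((%y. (max 0 y)\<^sup>2) has_real_derivative 2 * max 0 y) (at y)" for y :: real
proof -
 have "((%y::real. (max 0 y)\<^sup>2) has_vector_derivative 2 * max 0 y) (at y)"
 proof (rule local_quadratic_bound_deriv[where C=1])
  fix h :: real
  have "\<bar>(max 0 (y + h))\<^sup>2 - (max 0 y)\<^sup>2 - h * (2 * max 0 y)\<bar> <= h\<^sup>2"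
  proof (cases "0 <= y"; cases "0 <= y + h")
   assume a: "0 <= y" "~ 0 <= y + h"
   then have "\<bar>- (y * y) - 2 * h * y\<bar> <= h * h"
   proof -
    have "y * (y + 2 * h) <= 0" using a by (intro mult_nonneg_nonpos) auto
    moreover have "h * h + y * (y + 2 * h) = (y + h) * (y + h)" by (simp add: algebra_simps)
    ultimately show ?thesis using zero_le_square[of "y + h"] by (simp add: abs_if algebra_simps)
   qed
   with a show ?thesis by (simp add: power2_eq_square max_def)
  next
   assume a: "~ 0 <= y" "0 <= y + h"
   then have "(y + h) * (y + h) <= h * h" by (intro mult_mono) auto
   with a show ?thesis by (simp add: power2_eq_square max_def)
  qed (auto simp: power2_eq_square max_def algebra_simps)
  then show "norm ((max 0 (y + h))\<^sup>2 - (max 0 y)\<^sup>2 - h *R (2 * max 0 y)) <= 1 * h\<^sup>2" by simp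
 qed
 then show ?thesis by (simp add: has_real_derivative_iff_has_vector_derivative)
qed

section \<open>Integration by parts in the jump size\<close>

text \<open>Cutoffs vanishing near \<open>0\<close>; since \<open>x \<cdot> cut' x\<close> is bounded, the derivative of \<open>cut (n x)\<close> is
 \<open>O(1/|x|)\<close> uniformly in \<open>n\<close> and tends to \<open>0\<close> pointwise.\<close>

definition cut :: "real => real" where "cut x = (max 0 (x\<^sup>2 - 1))\<^sup>2 / (1 + (max 0 (x\<^sup>2 - 1))\<^sup>2)"

definition cut' :: "real => real" where
 "cut' x = 4 * x * max 0 (x\<^sup>2 - 1) / (1 + (max 0 (x\<^sup>2 - 1))\<^sup>2)\<^sup>2"

lemma cut_deriv: "(cut has_real_derivative cut' x) (at x)"
proof -
 have p: "1 + (max 0 (x\<^sup>2 - 1))\<^sup>2 ~= (0::real)" by (smt (verit) zero_le_power2)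
 have d: "((%x. (max 0 (x\<^sup>2 - 1))\<^sup>2) has_real_derivative 2 * max 0 (x\<^sup>2 - 1) * (2 * x)) (at x)" for x :: real
  by (rule DERIV_chain2[OF bump_sq_deriv]) (auto intro!: derivative_eq_intros)
 show ?thesis unfolding cut_def[abs_def] cut'_def
  by (rule derivative_eq_intros d p refl | (simp add: field_simps power2_eq_square; fail))+
qed

lemma cut_bounds: "0 <= cut x" "cut x <= 1" "\<bar>x\<bar> <= 1 ==> cut x = 0" "\<bar>x\<bar> <= 1 ==> cut' x = 0"
proof -
 have "0 < 1 + (max 0 (x\<^sup>2 - 1))\<^sup>2" by (smt (verit) zero_le_power2)
 then show "0 <= cut x" "cut x <= 1" by (auto simp: cut_def)
 assume "\<bar>x\<bar> <= 1"
 then have "x\<^sup>2 <= 1" by (simp add: abs_square_le_1)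
 then show "cut x = 0" "cut' x = 0" by (auto simp: cut_def cut'_def max_def)
qed

text \<open>The decay in \<open>x\<close> goes beyond boundedness: after scaling by \<open>n\<close>
  it yields both the majorant \<open>8 / |x|\<close> and the pointwise limit
  \<open>0\<close>.\<close>

lemma x_cut'_le: "\<bar>x * cut' x\<bar> <= 8 / (1 + (max 0 (x\<^sup>2 - 1)))"
proof -
 define y where "y = max 0 (x\<^sup>2 - 1)"
 have y: "0 <= y" by (simp add: y_def)
 have "x\<^sup>2 * y = (1 + y) * y" by (auto simp: y_def max_def)
 then have eq: "x * cut' x = 4 * ((1 + y) * y) / (1 + y\<^sup>2)\<^sup>2"
  unfolding cut'_def y_def[symmetric] by (simp add: power2_eq_square algebra_simps)
 have "(1 + y) * y * (1 + y) <= 2 * (1 + y\<^sup>2)\<^sup>2"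
 proof -
  have "(1 + y)\<^sup>2 <= 2 * (1 + y\<^sup>2)" using zero_le_square[of "1 - y"] by (simp add: power2_eq_square algebra_simps)
  moreover have "y <= 1 + y\<^sup>2" using zero_le_square[of "y - 1"] y by (simp add: power2_eq_square algebra_simps)
  ultimately have "(1 + y)\<^sup>2 * y <= (2 * (1 + y\<^sup>2)) * (1 + y\<^sup>2)" using y by (intro mult_mono) auto
  then show ?thesis by (simp add: power2_eq_square algebra_simps)
 qed
 from mult_left_mono[OF this, of 4] have "4 * ((1 + y) * y) * (1 + y) <= 8 * (1 + y\<^sup>2)\<^sup>2" by (simp only: mult.assoc[symmetric]) simp
 moreover have "0 < 1 + y\<^sup>2" by (smt (verit) zero_le_power2)
 ultimately have "4 * ((1 + y) * y) / (1 + y\<^sup>2)\<^sup>2 <= 8 / (1 + y)" using y by (simp add: field_simps)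
 then show ?thesis unfolding eq y_def[symmetric] using y by simp
qed

lemma cut_lim: "x ~= 0 ==> (%n. cut (real n * x)) ----> 1" "x ~= 0 ==> (%n. real n * cut' (real n * x)) ----> 0"
proof -
 assume x: "x ~= 0"
 have "filterlim (%n. real n * \<bar>x\<bar>) at_top sequentially"
  using x by (intro filterlim_at_top_mult_tendsto_pos[OF tendsto_const _ filterlim_real_sequentially]) auto
 then have "filterlim (%n. (real n * \<bar>x\<bar>) ^ 2) at_top sequentially" by (intro filterlim_pow_at_top) auto
 then have "filterlim (%n. -1 + (real n * x) ^ 2) at_top sequentially"
  by (intro filterlim_tendsto_add_at_top[OF tendsto_const]) (simp add: power_mult_distrib)
 then have y: "filterlim (%n. max 0 ((real n * x)\<^sup>2 - 1)) at_top sequentially"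
  by (rule filterlim_at_top_mono) auto
 have inv: "(%n. inverse (max 0 ((real n * x)\<^sup>2 - 1))) ----> 0" by (rule tendsto_inverse_0_at_top[OF y])
 have "(%n. 1 / (1 + (inverse (max 0 ((real n * x)\<^sup>2 - 1)))\<^sup>2)) ----> 1 / (1 + 0\<^sup>2)" by (intro tendsto_intros inv) simp
 moreover have "\<forall>\<^sub>F n in sequentially. 1 / (1 + (inverse (max 0 ((real n * x)\<^sup>2 - 1)))\<^sup>2) = cut (real n * x)"
  using filterlim_at_top_dense[THEN iffD1, OF y, rule_format, of 0]
  by eventually_elim (simp add: cut_def field_simps)
 ultimately show "(%n. cut (real n * x)) ----> 1" by (simp add: tendsto_cong)
 show "(%n. real n * cut' (real n * x)) ----> 0"
 proof (rule Lim_null_comparison)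
  have "(%n. 8 / \<bar>x\<bar> * (1 / (1 + max 0 ((real n * x)\<^sup>2 - 1)))) ----> 8 / \<bar>x\<bar> * 0"
   by (intro tendsto_mult tendsto_const tendsto_divide_0[OF tendsto_const] filterlim_at_top_imp_at_infinity
     filterlim_tendsto_add_at_top[OF tendsto_const y])
  then show "(%n. 8 / \<bar>x\<bar> * (1 / (1 + max 0 ((real n * x)\<^sup>2 - 1)))) ----> 0" by simp
  show "\<forall>\<^sub>F n in sequentially. norm (real n * cut' (real n * x)) <= 8 / \<bar>x\<bar> * (1 / (1 + max 0 ((real n * x)\<^sup>2 - 1)))"
  proof (intro always_eventually allI)
   fix n
   have "norm (real n * cut' (real n * x)) = 1 / \<bar>x\<bar> * \<bar>real n * x * cut' (real n * x)\<bar>" using x by (simp add: abs_mult)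
   also have "... <= 1 / \<bar>x\<bar> * (8 / (1 + max 0 ((real n * x)\<^sup>2 - 1)))" by (intro mult_left_mono x_cut'_le) simp
   finally show "norm (real n * cut' (real n * x)) <= 8 / \<bar>x\<bar> * (1 / (1 + max 0 ((real n * x)\<^sup>2 - 1)))" by simp
  qed
 qed
qed

text \<open>\<open>cut (n * x)\<close> vanishes near \<open>0\<close>, so its product with
  \<open>q\<close> and \<open>G\<close> is differentiable on the whole line whatever
  \<open>q\<close> does at \<open>0\<close>. The term in which \<open>cut\<close> is differentiated
  is dominated by a multiple of \<open>|q x / x|\<close> and disappears in the limit.\<close>

lemma ibp_singular:
 fixes q dq G G' :: "real => real"
 assumes q: "!!x. x ~= 0 ==> (q has_real_derivative dq x) (at x)" and supp: "!!x. e <= \<bar>x\<bar> ==> q x = 0" "!!x. e <= \<bar>x\<bar> ==> dq x = 0"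
  and qi: "integrable lborel q" and dqi: "integrable lborel dq" and qx: "integrable lborel (%x. q x / x)"
  and G: "!!x. (G has_real_derivative G' x) (at x)" and Gb: "!!x. \<bar>G x\<bar> <= C" and G'b: "!!x. \<bar>G' x\<bar> <= C" and e: "0 < e"
 shows "(LINT x|lborel. q x * G' x) = - (LINT x|lborel. dq x * G x)"
proof -
 have [measurable]: "G : bm"
  by (intro borel_measurable_continuous_onI continuous_at_imp_continuous_on ballI DERIV_isCont[OF G])
 have [measurable]: "G' : bm"
 proof (rule borel_measurable_LIMSEQ_metric)
  let ?e = "%n. inverse (real (Suc n))"
  show "(%n. (G (x + ?e n) - G x) /\<^sub>R ?e n) ----> G' x" for x
  proof -
   have "((%h. G (x + h)) has_vector_derivative G' x) (at 0)"
    using G[of x] DERIV_shift[of G "G' x" 0 x] by (simp add: has_real_derivative_iff_has_vector_derivative add.commute)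
   from has_vector_derivative_seqD[OF this, of ?e] LIMSEQ_inverse_real_of_nat show ?thesis by simp
  qed
 qed measurable
 have cm[measurable]: "cut : bm" "cut' : bm"
  unfolding cut_def[abs_def] cut'_def[abs_def] by measurable
 have [measurable]: "q : bm" "dq : bm"
  using qi dqi by auto
 have C0: "0 <= C" using Gb[of 0] by linarith
 have i0: "integrable lborel (%x. f x * (c x * h x))"
  if f: "integrable lborel f" and [measurable]: "c : bm" "h : bm"
   and c: "!!x. \<bar>c x\<bar> <= 1" and h: "!!x. \<bar>h x\<bar> <= C" for f c h :: "real => real"
 proof (rule int_bound[OF integrable_mult_left[OF integrable_abs[OF f], of C]])
  have [measurable]: "f : bm" using f by auto
  show "(%x. f x * (c x * h x)) : bmf lborel" by measurable
  have "\<bar>c x\<bar> * \<bar>h x\<bar> <= C" for x using mult_mono[OF c[of x] h[of x]] by simp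
  then have "\<bar>f x\<bar> * (\<bar>c x\<bar> * \<bar>h x\<bar>) <= \<bar>f x\<bar> * C" for x by (intro mult_left_mono) auto
  then show "AE x in lborel. norm (f x * (c x * h x)) <= norm (\<bar>f x\<bar> * C)" using C0 by (simp add: abs_mult)
 qed
 note i1 = i0[OF qi _ _ _ G'b] and i2 = i0[OF dqi _ _ _ Gb]
 have ib: "\<bar>(real n * cut' (real n * x)) * (q x * G x)\<bar> <= \<bar>q x / x\<bar> * (8 * C)" for n x
 proof (cases "x = 0")
  case False
  have "\<bar>real n * x * cut' (real n * x)\<bar> <= 8"
   by (rule order_trans[OF x_cut'_le]) (simp add: divide_le_eq)
  then have "\<bar>real n * x * cut' (real n * x)\<bar> * \<bar>G x\<bar> <= 8 * C" using Gb[of x] by (intro mult_mono) auto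
  from mult_left_mono[OF this, of "\<bar>q x / x\<bar>"] show ?thesis using False by (simp add: abs_mult field_simps)
 qed (simp add: cut_bounds)
 have i3: "integrable lborel (%x. (real n * cut' (real n * x)) * (q x * G x))" for n
  by (rule int_bound[OF integrable_mult_left[OF integrable_norm[OF qx], of "8 * C"]])
   (use ib[of n] C0 in \<open>auto simp: abs_mult\<close>)
 define F' where "F' n x = (real n * cut' (real n * x)) * (q x * G x) + (dq x * (cut (real n * x) * G x) + q x * (cut (real n * x) * G' x))" for n x
 have F'i: "integrable lborel (F' n)" for n unfolding F'_def
  by (intro Bochner_Integration.integrable_add i1 i2 i3) (use cut_bounds in auto)
 have F'0: "(LINT x|lborel. F' n x) = 0" if n: "n > 0" for n
 proof -
  let ?F = "%x. cut (real n * x) * (q x * G x)"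
  have cd: "((%x. cut (real n * x)) has_real_derivative real n * cut' (real n * x)) (at x)" for x
by (rule DERIV_cong[OF DERIV_chain2[OF cut_deriv DERIV_cmult_Id]]) simp
  have der: "(?F has_real_derivative F' n x) (at x)" for x
  proof (cases "x = 0")
   case True
   have "\<forall>\<^sub>F y in nhds 0. cut (real n * y) = 0"
    unfolding eventually_nhds_metric using n
    by (intro exI[of _ "1 / real n"]) (auto intro!: cut_bounds simp: field_simps abs_mult)
   then have "\<forall>\<^sub>F y in nhds 0. ?F y = 0" by eventually_elim simp
   then have "(?F has_real_derivative 0) (at 0)"
    by (subst DERIV_cong_ev[where g="%_. 0", OF refl _ refl]) auto
   then show ?thesis using True by (simp add: F'_def cut_bounds)
  next
   case False
   show ?thesis unfolding F'_def
    by (rule DERIV_cong[OF DERIV_mult[OF cd DERIV_mult[OF q[OF False] G]]]) (simp add: algebra_simps)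
  qed
  have "(F' n has_integral ?F e - ?F (- e)) {- e..e}"
   by (rule fundamental_theorem_of_calculus)
    (use e der in \<open>auto simp: has_real_derivative_iff_has_vector_derivative intro: has_vector_derivative_at_within\<close>)
  moreover have si: "set_integrable lborel {- e..e} (F' n)"
   unfolding set_integrable_def by (rule integrable_mult_indicator[OF _ F'i]) simp
  ultimately have "(LINT x:{- e..e}|lborel. F' n x) = ?F e - ?F (- e)"
   using set_borel_integral_eq_integral(2)[OF si] by (simp add: integral_unique)
  also have "... = 0" using supp e by simp
  also have "(LINT x:{- e..e}|lborel. F' n x) = (LINT x|lborel. F' n x)"
   unfolding set_lebesgue_integral_def
  proof (intro int_cong refl)
   fix x show "indicat_real {- e..e} x *R F' n x = F' n x"
    using supp[of x] by (cases "x : {-e..e}") (auto simp: F'_def abs_if)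
  qed
  finally show ?thesis .
 qed
 have "(%n. \<integral>x. F' n x \<partial>lborel) ----> (LINT x|lborel. 0 + (dq x * (1 * G x) + q x * (1 * G' x)))"
 proof (rule integral_dominated_convergence[where w="%x. \<bar>q x / x\<bar> * (8 * C) + (\<bar>dq x\<bar> * C + \<bar>q x\<bar> * C)"])
  show "integrable lborel (%x. \<bar>q x / x\<bar> * (8 * C) + (\<bar>dq x\<bar> * C + \<bar>q x\<bar> * C))"
   using qi dqi qx by (intro Bochner_Integration.integrable_add integrable_mult_left integrable_abs)
  show "F' n : bmf lborel" for n using F'i by auto
  have l: "(%n. F' n x) ----> 0 * (q x * G x) + (dq x * (1 * G x) + q x * (1 * G' x))" if "x ~= 0" for x
   unfolding F'_def by (intro tendsto_intros cut_lim that)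
  show "AE x in lborel. (%n. F' n x) ----> 0 + (dq x * (1 * G x) + q x * (1 * G' x))"
   using AE_lborel_singleton[of 0] by eventually_elim (use l in simp)
  show "AE x in lborel. norm (F' n x) <= \<bar>q x / x\<bar> * (8 * C) + (\<bar>dq x\<bar> * C + \<bar>q x\<bar> * C)" for n
  proof (rule AE_I2)
   fix x
   have "\<bar>cut (real n * x) * G x\<bar> <= 1 * C" "\<bar>cut (real n * x) * G' x\<bar> <= 1 * C"
    unfolding abs_mult using Gb G'b cut_bounds by (intro mult_mono; simp)+
   then have "\<bar>dq x * (cut (real n * x) * G x)\<bar> <= \<bar>dq x\<bar> * C" "\<bar>q x * (cut (real n * x) * G' x)\<bar> <= \<bar>q x\<bar> * C"
    unfolding abs_mult[of "dq x"] abs_mult[of "q x"] by (intro mult_left_mono; simp)+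
   then show "norm (F' n x) <= \<bar>q x / x\<bar> * (8 * C) + (\<bar>dq x\<bar> * C + \<bar>q x\<bar> * C)"
    unfolding F'_def real_norm_def
    by (intro abs_triangle_ineq[THEN order_trans] add_mono ib)
  qed
 qed measurable
 moreover have "(%n. \<integral>x. F' n x \<partial>lborel) ----> 0"
  by (rule tendsto_eventually, rule eventually_sequentiallyI[of 1]) (use F'0 in auto)
 ultimately have "(LINT x|lborel. dq x * (1 * G x) + q x * (1 * G' x)) = 0"
  using LIMSEQ_unique by fastforce
 then show ?thesis
  using i1[of "%_. 1"] i2[of "%_. 1"] by (simp add: Bochner_Integration.integral_add)
qed

section \<open>The concrete weight, its integrals and the score\<close>

locale levy_score = levy_coord +
 fixes p :: "real => real" and de ka ro :: real
 assumes de0: "0 < de" and ka1: "1 < ka" and ro0: "0 < ro"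
  and small: "0 < Liminf (at_right 0) (%ep. ennreal (ep powr ro) * emeasure m {xi. ep <= \<bar>xi\<bar>})"
  and dens: "restrict_space m {-de<..<de} = density (restrict_space lborel {-de<..<de}) (%xi. ennreal (p xi))"
  and p0: "!!xi. xi : {-de<..<de} - {0} ==> 0 <= p xi"
  and pC1: "p C1_differentiable_on ({-de<..<de} - {0})"
  and int2: "(\<integral>\<^sup>+ xi\<in>{-de<..<de}. ennreal (\<bar>xi\<bar> powr (2 * ka) * (deriv p xi / p xi)\<^sup>2 * p xi) \<partial>lborel) < \<infinity>"
  and int3: "(\<integral>\<^sup>+ xi\<in>{-de<..<de}. ennreal (\<bar>xi\<bar> powr (2 * ka - 2) * p xi) \<partial>lborel) < \<infinity>"
begin

abbreviation Sd :: "real set" where "Sd == {-de<..<de} - {0}"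

text \<open>At most \<open>de / 2\<close>, so that the weight vanishes before the end of the
  interval where \<open>m\<close> has a density, and at most \<open>1\<close>, so that powers of
  \<open>|x|\<close> are comparable on its support.\<close>

definition ee :: real where "ee = min (de / 2) 1"

text \<open>The order \<open>|x| powr ka\<close> at \<open>0\<close> is the one that matches
  \<open>int2\<close> and \<open>int3\<close>; the squared positive part cuts off at
  \<open>ee\<close> while keeping \<open>ww\<close> continuously differentiable away from
  \<open>0\<close>.\<close>

definition ww :: "real => real" where "ww x = \<bar>x\<bar> powr ka * (max 0 (ee\<^sup>2 - x\<^sup>2))\<^sup>2"

definition ww' :: "real => real" where
 "ww' x = ka * \<bar>x\<bar> powr (ka - 1) * sgn x * (max 0 (ee\<^sup>2 - x\<^sup>2))\<^sup>2 - \<bar>x\<bar> powr ka * (4 * x * max 0 (ee\<^sup>2 - x\<^sup>2))"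

definition V :: "real => real" where "V x = (ww x)\<^sup>2"

definition r :: "real => real" where "r x = (if x : Sd then V x * p x else 0)"

definition dq :: "real => real => real" where
 "dq t x = (if x : Sd then exp (- t * V x) * (2 * ww x * ww' x * p x + V x * deriv p x - t * (2 * ww x * ww' x) * (V x * p x)) else 0)"

text \<open>With \<open>w = ww x\<close>, the derivative of \<open>V * p\<close> is
  \<open>w * (2 * w' + w * p' / p) * p\<close>. The squared bracket of \<open>QQ\<close> dominates
  the square of the inner factor.\<close>

definition QQ :: "real => real" where
 "QQ x = (if x : Sd then (2 * (ka + 4) * \<bar>x\<bar> powr (ka - 1) + \<bar>x\<bar> powr ka * \<bar>deriv p x / p x\<bar>)\<^sup>2 * p x else 0)"

lemma ee: "0 < ee" "ee <= 1" "ee < de" using de0 by (auto simp: ee_def)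

lemma bump: "0 <= max 0 (ee\<^sup>2 - x\<^sup>2)" "max 0 (ee\<^sup>2 - x\<^sup>2) <= 1" "ee <= \<bar>x\<bar> ==> max 0 (ee\<^sup>2 - x\<^sup>2) = 0"
proof -
 show "max 0 (ee\<^sup>2 - x\<^sup>2) <= 1" using ee power_le_one[of ee 2] by (smt (verit) zero_le_power2)
 assume "ee <= \<bar>x\<bar>"
 then have "ee\<^sup>2 <= x\<^sup>2" using ee by (metis abs_le_square_iff abs_of_pos)
 then show "max 0 (ee\<^sup>2 - x\<^sup>2) = 0" by simp
qed simp

lemma out: assumes "ee <= \<bar>x\<bar>" shows "ww x = 0" "V x = 0" "r x = 0" "dq t x = 0"
 using bump(3)[OF assms] by (auto simp: ww_def V_def r_def dq_def)

lemma ww_bounds: "0 <= ww x" "ww x <= \<bar>x\<bar> powr ka" "ww x <= \<bar>x\<bar>" "ww x <= 1" "\<bar>x\<bar> < ee ==> \<bar>ww' x\<bar> <= (ka + 4) * \<bar>x\<bar> powr (ka - 1)"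
proof -
 show a: "0 <= ww x" by (simp add: ww_def)
 have b2: "(max 0 (ee\<^sup>2 - x\<^sup>2))\<^sup>2 <= 1" using bump[of x] by (intro power_le_one)
 then show le: "ww x <= \<bar>x\<bar> powr ka" using mult_left_mono[OF b2, of "\<bar>x\<bar> powr ka"] by (simp add: ww_def)
 have "ww x <= \<bar>x\<bar> & ww x <= 1"
 proof (cases "\<bar>x\<bar> < ee")
  case True
  then have "\<bar>x\<bar> powr ka <= \<bar>x\<bar> powr 1" using ee ka1 powr_mono'[of 1 ka "\<bar>x\<bar>"] by auto
  with le True ee show ?thesis by auto
 qed (use out ee in auto)
 then show "ww x <= \<bar>x\<bar>" "ww x <= 1" by auto
 assume x: "\<bar>x\<bar> < ee"
 have "\<bar>ka * \<bar>x\<bar> powr (ka - 1) * sgn x * (max 0 (ee\<^sup>2 - x\<^sup>2))\<^sup>2\<bar> = (ka * \<bar>x\<bar> powr (ka - 1)) * (\<bar>sgn x\<bar> * (max 0 (ee\<^sup>2 - x\<^sup>2))\<^sup>2)"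
  using ka1 by (simp add: abs_mult)
 also have "... <= (ka * \<bar>x\<bar> powr (ka - 1)) * 1"
  using ka1 b2 by (intro mult_left_mono) (auto simp: sgn_if)
 finally have 1: "\<bar>ka * \<bar>x\<bar> powr (ka - 1) * sgn x * (max 0 (ee\<^sup>2 - x\<^sup>2))\<^sup>2\<bar> <= ka * \<bar>x\<bar> powr (ka - 1)" by simp
 have "\<bar>x\<bar> powr ka <= \<bar>x\<bar> powr (ka - 1)" using x ee powr_mono'[of "ka - 1" ka "\<bar>x\<bar>"] by auto
 moreover have "\<bar>x\<bar> * max 0 (ee\<^sup>2 - x\<^sup>2) <= 1" using x ee bump[of x] by (intro mult_le_one) auto
 ultimately have "\<bar>x\<bar> powr ka * (\<bar>x\<bar> * max 0 (ee\<^sup>2 - x\<^sup>2)) <= \<bar>x\<bar> powr (ka - 1) * 1" by (intro mult_mono) auto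
 then have 2: "\<bar>\<bar>x\<bar> powr ka * (4 * x * max 0 (ee\<^sup>2 - x\<^sup>2))\<bar> <= 4 * \<bar>x\<bar> powr (ka - 1)" by (simp add: abs_mult)
 show "\<bar>ww' x\<bar> <= (ka + 4) * \<bar>x\<bar> powr (ka - 1)" unfolding ww'_def distrib_right using 1 2 by linarith
qed

lemma V_bounds: "0 <= V x" "V x <= 1" "V 0 = 0" "V x <= x\<^sup>2"
 using ww_bounds[of x] power_mono[of "ww x" "\<bar>x\<bar>" 2] by (auto simp: V_def ww_def power_le_one)

lemma VW_meas[measurable]: "ww : bm" "ww' : bm" "V : bm"
proof -
 show [measurable]: "ww : bm" unfolding ww_def[abs_def] by measurable
 show "ww' : bm" unfolding ww'_def[abs_def] by measurable
 show "V : bm" unfolding V_def[abs_def] by measurable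
qed

lemma Sd: "open Sd" "Sd : sets borel" by (auto intro: open_Diff)

lemma p_deriv: assumes "x : Sd" shows "(p has_real_derivative deriv p x) (at x)"
proof -
 have "p differentiable at x"
  using pC1 assms unfolding C1_differentiable_on_eq by blast
 then show ?thesis by (simp add: DERIV_deriv_iff_real_differentiable)
qed

text \<open>A zero of a nonnegative differentiable function is a minimum. Hence writing
  \<open>deriv p x\<close> as \<open>p x\<close> times the quotient \<open>deriv p x / p x\<close>
  is correct even where the quotient is a division by \<open>0\<close>.\<close>

lemma p_zero: assumes x: "x : Sd" "p x = 0" shows "deriv p x = 0"
proof -
 from Sd(1) x(1) obtain d where d: "0 < d" "ball x d \<subseteq> Sd" by (meson openE)
 show ?thesis
  by (rule DERIV_local_min[OF p_deriv[OF x(1)] d(1)]) (use d(2) p0 x(2) in \<open>auto simp: subset_eq dist_real_def\<close>)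
qed

lemma p_meas[measurable]: "(%x. if x : Sd then p x else 0) : bm"
  "(%x. if x : Sd then deriv p x else 0) : bm"
proof -
 have c: "continuous_on Sd p"
  by (intro continuous_at_imp_continuous_on ballI DERIV_isCont[OF p_deriv])
 from pC1 obtain D where D: "!!x. x : Sd ==> (p has_vector_derivative D x) (at x)" "continuous_on Sd D"
  unfolding C1_differentiable_on_def by blast
 have "deriv p x = D x" if "x : Sd" for x
  using D(1)[OF that] by (intro DERIV_imp_deriv) (simp add: has_real_derivative_iff_has_vector_derivative)
 with D(2) have c': "continuous_on Sd (deriv p)" by (subst continuous_on_cong[OF refl, of _ _ D]) auto
 have eq: "(%x. indi Sd x *R f x) = (%x. if x : Sd then f x else 0)" for f :: "real => real" by (auto simp: indicator_def)
 show "(%x. if x : Sd then p x else 0) : bm"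
  "(%x. if x : Sd then deriv p x else 0) : bm"
  using borel_measurable_continuous_on_indicator[OF Sd(2) c] borel_measurable_continuous_on_indicator[OF Sd(2) c']
  unfolding eq .
qed

lemma r_meas[measurable]: "r : bm"
proof -
 have "r = (%x. V x * (if x : Sd then p x else 0))" by (auto simp: r_def)
 also have "... : bm" by measurable
 finally show ?thesis .
qed

lemma QQ_meas[measurable]: "QQ : bm"
proof -
 have "QQ = (%x. (2 * (ka + 4) * \<bar>x\<bar> powr (ka - 1) + \<bar>x\<bar> powr ka * \<bar>(if x : Sd then deriv p x else 0) / (if x : Sd then p x else 0)\<bar>)\<^sup>2 * (if x : Sd then p x else 0))"
  by (auto simp: QQ_def)
 also have "... : bm" by measurable
 finally show ?thesis .
qed

lemma dq_meas: "(%z. dq (fst z) (snd z)) : bmf (borel \<Otimes>\<^sub>M borel)"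
proof -
 have "(%z. dq (fst z) (snd z)) = (%(t, x). exp (- t * V x) * (2 * ww x * ww' x * (if x : Sd then p x else 0)
  + V x * (if x : Sd then deriv p x else 0) - t * (2 * ww x * ww' x) * (V x * (if x : Sd then p x else 0))))"
  by (auto simp: dq_def fun_eq_iff)
 also have "... : bmf (borel \<Otimes>\<^sub>M borel)" by measurable
 finally show ?thesis .
qed

lemma ww_deriv: assumes x: "x ~= 0" shows "(ww has_real_derivative ww' x) (at x)"
proof -
 have a: "((%x. \<bar>x\<bar> powr ka) has_real_derivative ka * \<bar>x\<bar> powr (ka - 1) * sgn x) (at x)"
 proof -
  have "(abs has_real_derivative sgn x) (at x)"
  proof -
   have "norm = (abs :: real => real)" "(%h. h * x / \<bar>x\<bar>) = (*) (x / \<bar>x\<bar>)" by (auto simp: fun_eq_iff)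
   with has_derivative_norm[OF x] show ?thesis by (simp add: has_field_derivative_def real_sgn_eq)
  qed
  then show ?thesis by (intro DERIV_chain2[OF has_real_derivative_powr]) (use x in auto)
 qed
 have b: "((%x. (max 0 (ee\<^sup>2 - x\<^sup>2))\<^sup>2) has_real_derivative 2 * max 0 (ee\<^sup>2 - x\<^sup>2) * (- 2 * x)) (at x)"
  by (rule DERIV_chain2[OF bump_sq_deriv]) (auto intro!: derivative_eq_intros)
 show ?thesis unfolding ww_def[abs_def] ww'_def
  by (rule DERIV_cong[OF DERIV_mult[OF a b]]) (simp add: algebra_simps)
qed

lemma V_deriv: assumes x: "x ~= 0" shows "(V has_real_derivative 2 * ww x * ww' x) (at x)"
 unfolding V_def[abs_def] by (rule DERIV_cong[OF DERIV_power[OF ww_deriv[OF x]]]) simp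

lemma qr_deriv: assumes x: "x ~= 0" shows "((%x. exp (- t * V x) * r x) has_real_derivative dq t x) (at x)"
proof (cases "x : Sd")
 case True
 have d: "((%x. exp (- t * V x) * (V x * p x)) has_real_derivative dq t x) (at x)"
  by (rule DERIV_cong[OF DERIV_mult[OF DERIV_chain2[OF DERIV_exp DERIV_cmult[OF V_deriv[OF x]]] DERIV_mult[OF V_deriv[OF x] p_deriv[OF True]]]])
   (use True in \<open>simp add: dq_def algebra_simps\<close>)
 have "\<forall>\<^sub>F y in nhds x. y : Sd" by (rule eventually_nhds_in_open[OF Sd(1) True])
 then have e: "\<forall>\<^sub>F y in nhds x. exp (- t * V y) * r y = exp (- t * V y) * (V y * p y)"
  by eventually_elim (simp add: r_def)
 show ?thesis by (rule DERIV_cong_ev[OF refl e refl, THEN iffD2, OF d])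
next
 case False
 then have "ee < \<bar>x\<bar>" using x ee by auto
 moreover have "open {y :: real. ee < \<bar>y\<bar>}" by (intro open_Collect_less continuous_intros)
 ultimately have "\<forall>\<^sub>F y in nhds x. y : {y. ee < \<bar>y\<bar>}" by (intro eventually_nhds_in_open) auto
 then have e: "\<forall>\<^sub>F y in nhds x. exp (- t * V y) * r y = 0" by eventually_elim (simp add: out)
 have z: "dq t x = 0" using False by (auto simp: dq_def)
 show ?thesis unfolding z by (rule DERIV_cong_ev[OF refl e refl, THEN iffD2]) simp
qed

lemma V_int: "integrable m V"
proof (rule integrableI_nonneg)
 have "(\<integral>\<^sup>+ x. ennreal (V x) \<partial>m) <= (\<integral>\<^sup>+ x. ennreal (min (x\<^sup>2) 1) \<partial>m)"
  using V_bounds by (intro nn_integral_mono ennreal_leI) auto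
 also have "... < \<infinity>" using lm by (simp add: levy_measure_def)
 finally show "(\<integral>\<^sup>+ x. ennreal (V x) \<partial>m) < \<infinity>" .
 show "V : bmf m" by measurable
qed (use V_bounds in auto)

text \<open>Multiplication by \<open>V\<close> removes the point \<open>0\<close> and everything
  outside the interval of the density, so \<open>V m\<close> has a density on the whole
  line.\<close>

lemma Vr: "density m (%x. ennreal (V x)) = density lborel (%x. ennreal (r x))"
proof (rule measure_eqI)
 fix A assume "A : sets (density m (%x. ennreal (V x)))"
 then have [measurable]: "A : sets borel" by simp
 let ?I = "{-de<..<de}"
 \<comment> \<open>The value \<open>p 0\<close> is arbitrary, so the point \<open>0\<close> is
   treated separately.\<close>
 have [measurable]: "(%x. ennreal (p x)) : bmf (restrict_space lborel ?I)"
 proof (subst measurable_cong)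
  fix x assume "x : space (restrict_space lborel ?I)"
  then have "x : ?I" by (simp add: space_restrict_space)
  then show "ennreal (p x) = ennreal (if x = 0 then p 0 else if x : Sd then p x else 0)" by simp
 qed (rule measurable_restrict_space1, measurable)
 have "emeasure (density m (%x. ennreal (V x))) A = (\<integral>\<^sup>+ x. ennreal (V x) * indi A x \<partial>m)"
  by (subst emeasure_density) auto
 also have "... = (\<integral>\<^sup>+ x. ennreal (V x) * indi A x * indi ?I x \<partial>m)"
  by (intro nn_integral_cong) (use out(2) ee in \<open>auto simp: indicator_def\<close>)
 also have "... = (\<integral>\<^sup>+ x. ennreal (V x) * indi A x \<partial>restrict_space m ?I)"
  by (subst nn_integral_restrict_space) auto
 also have "... = (\<integral>\<^sup>+ x. ennreal (p x) * (ennreal (V x) * indi A x) \<partial>restrict_space lborel ?I)"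
  unfolding dens by (subst nn_integral_density) (auto intro!: measurable_restrict_space1)
 also have "... = (\<integral>\<^sup>+ x. ennreal (p x) * (ennreal (V x) * indi A x) * indi ?I x \<partial>lborel)"
  by (subst nn_integral_restrict_space) auto
 also have "... = (\<integral>\<^sup>+ x. ennreal (r x) * indi A x \<partial>lborel)"
 proof (intro nn_integral_cong)
  fix x
  show "ennreal (p x) * (ennreal (V x) * indi A x) * indi ?I x = ennreal (r x) * indi A x"
   using p0[of x] V_bounds(1)[of x] V_bounds(3)
   by (cases "x = 0") (auto simp: r_def indicator_def ennreal_mult' mult.commute)
 qed
 also have "... = emeasure (density lborel (%x. ennreal (r x))) A" by (subst emeasure_density) auto
 finally show "emeasure (density m (%x. ennreal (V x))) A = emeasure (density lborel (%x. ennreal (r x))) A" .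
qed simp

lemma r_nonneg: "0 <= r x" using p0[of x] V_bounds(1)[of x] by (auto simp: r_def)

lemma QQ_nonneg: "0 <= QQ x" using p0[of x] by (auto simp: QQ_def)

lemma QQ_int: "integrable lborel QQ"
proof (rule integrableI_nonneg)
 let ?a = "%xi. ennreal (\<bar>xi\<bar> powr (2 * ka - 2) * p xi) * indi {-de<..<de} xi"
 let ?b = "%xi. ennreal (\<bar>xi\<bar> powr (2 * ka) * (deriv p xi / p xi)\<^sup>2 * p xi) * indi {-de<..<de} xi"
 let ?a' = "%x. ennreal (\<bar>x\<bar> powr (2 * ka - 2) * (if x : Sd then p x else 0))"
 let ?b' = "%x. ennreal (\<bar>x\<bar> powr (2 * ka) * ((if x : Sd then deriv p x else 0) / (if x : Sd then p x else 0))\<^sup>2 * (if x : Sd then p x else 0))"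
 have m: "?a' : bmf lborel" "?b' : bmf lborel" by measurable
 have le: "ennreal (QQ x) <= ennreal (8 * (ka + 4)\<^sup>2) * ?a' x + ennreal 2 * ?b' x" for x
 proof (cases "x : Sd")
  case True
  have sq: "(a + b)\<^sup>2 <= 2 * a\<^sup>2 + 2 * b\<^sup>2" for a b :: real
   using zero_le_power2[of "a - b"] by (simp add: power2_eq_square algebra_simps)
  have pw: "(\<bar>x\<bar> powr (ka - 1))\<^sup>2 = \<bar>x\<bar> powr (2 * ka - 2)" "(\<bar>x\<bar> powr ka)\<^sup>2 = \<bar>x\<bar> powr (2 * ka)"
   by (simp_all add: power2_eq_square algebra_simps flip: powr_add)
  have "QQ x <= (2 * (2 * (ka + 4) * \<bar>x\<bar> powr (ka - 1))\<^sup>2 + 2 * (\<bar>x\<bar> powr ka * \<bar>deriv p x / p x\<bar>)\<^sup>2) * p x"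
   using True p0[OF True] by (simp only: QQ_def if_True) (intro mult_right_mono sq)
  also have "... = 8 * (ka + 4)\<^sup>2 * (\<bar>x\<bar> powr (2 * ka - 2) * p x) + 2 * (\<bar>x\<bar> powr (2 * ka) * (deriv p x / p x)\<^sup>2 * p x)"
   by (simp only: power_mult_distrib pw power2_abs) (simp add: algebra_simps)
  finally have "ennreal (QQ x) <= ennreal (8 * (ka + 4)\<^sup>2 * (\<bar>x\<bar> powr (2 * ka - 2) * p x) + 2 * (\<bar>x\<bar> powr (2 * ka) * (deriv p x / p x)\<^sup>2 * p x))"
   by (rule ennreal_leI)
  then show ?thesis using p0[OF True] True by (simp add: ennreal_plus ennreal_mult')
 next
  case False
  then have "QQ x = 0" unfolding QQ_def by (rule if_not_P)
  then show ?thesis by simp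
 qed
 have ae: "AE x in lborel. ?a x = ?a' x" "AE x in lborel. ?b x = ?b' x"
  using AE_lborel_singleton[of 0] by (auto simp: indicator_def)
 have "(\<integral>\<^sup>+ x. ennreal (QQ x) \<partial>lborel) <= (\<integral>\<^sup>+ x. ennreal (8 * (ka + 4)\<^sup>2) * ?a' x + ennreal 2 * ?b' x \<partial>lborel)"
  by (intro nn_integral_mono le)
 also have "... = ennreal (8 * (ka + 4)\<^sup>2) * (\<integral>\<^sup>+ x. ?a' x \<partial>lborel) + ennreal 2 * (\<integral>\<^sup>+ x. ?b' x \<partial>lborel)"
  using m by (simp add: nn_integral_add nn_integral_cmult)
 also have "... < \<infinity>"
  using int2 int3 unfolding nn_integral_cong_AE[OF ae(1)] nn_integral_cong_AE[OF ae(2)]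
  by (auto simp: ennreal_mult_eq_top_iff ennreal_add_eq_top less_top[symmetric])
 finally show "(\<integral>\<^sup>+ x. ennreal (QQ x) \<partial>lborel) < \<infinity>" .
qed (use QQ_nonneg in auto)

text \<open>Here \<open>ga\<close> is the parameter of Young's inequality, optimised later.\<close>

lemma dq_bound:
 assumes t: "0 <= t" and ga: "0 < ga"
 shows "\<bar>dq t x\<bar> <= 2 * ga * (exp (- t * V x) * r x) + 5 / ga * QQ x"
proof (cases "x : Sd & \<bar>x\<bar> < ee")
 case True
 then have S: "x : Sd" and xe: "\<bar>x\<bar> < ee" by auto
 define w E P A l where "w = ww x" and "E = exp (- t * V x)" and "P = p x"
  and "A = 2 * (ka + 4) * \<bar>x\<bar> powr (ka - 1) + \<bar>x\<bar> powr ka * \<bar>deriv p x / p x\<bar>" and "l = \<bar>deriv p x / p x\<bar>"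
 have w: "0 <= w" "w <= \<bar>x\<bar> powr ka" and w': "\<bar>2 * ww' x\<bar> <= 2 * (ka + 4) * \<bar>x\<bar> powr (ka - 1)"
  using ww_bounds[of x] xe by (auto simp: w_def algebra_simps)
 have P: "0 <= P" using p0[OF S] by (simp add: P_def)
 have E: "0 < E" "E <= 1" using V_bounds(1)[of x] t by (auto simp: E_def)
 have dp: "\<bar>deriv p x\<bar> = l * P" using p_zero[OF S] P by (cases "p x = 0") (auto simp: l_def P_def abs_mult)
 have A1: "\<bar>2 * ww' x\<bar> + w * l <= A"
  unfolding A_def l_def[symmetric] using w w' by (intro add_mono mult_right_mono) (auto simp: l_def)
 have A2: "\<bar>2 * ww' x\<bar> <= A" using A1 w by (smt (verit) l_def mult_nonneg_nonneg abs_ge_zero)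
 have A0: "0 <= A" using A2 by linarith
 have young: "a * b <= ga * a\<^sup>2 + b\<^sup>2 / ga" for a b
 proof -
  have "0 <= (ga * a - b)\<^sup>2 + (ga * a)\<^sup>2 + b\<^sup>2" by simp
  then have "ga * (a * b) <= ga * (ga * a\<^sup>2 + b\<^sup>2 / ga)" using ga by (simp add: power2_eq_square algebra_simps)
  then show ?thesis using ga by simp
 qed
 have V: "V x = w\<^sup>2" by (simp add: V_def w_def)
 have "\<bar>E * (2 * w * ww' x * P + V x * deriv p x)\<bar> <= E * (w * A * P)"
 proof -
  have "\<bar>2 * w * ww' x * P + V x * deriv p x\<bar> <= w * (\<bar>2 * ww' x\<bar> + w * l) * P"
   using abs_triangle_ineq[of "2 * w * ww' x * P" "V x * deriv p x"] w P
   by (simp add: abs_mult dp V power2_eq_square algebra_simps)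
  also have "... <= w * A * P" using A1 w P by (intro mult_right_mono mult_left_mono)
  finally show ?thesis using E by (simp add: abs_mult)
 qed
 also have "... <= E * ((ga * w\<^sup>2 + A\<^sup>2 / ga) * P)" using E P by (intro mult_left_mono mult_right_mono young) auto
 also have "... <= ga * (E * (w\<^sup>2 * P)) + A\<^sup>2 * P / ga"
 proof -
  have "E * (A\<^sup>2 * P / ga) <= A\<^sup>2 * P / ga" using E P ga by (intro mult_left_le_one_le) auto
  then show ?thesis by (simp add: algebra_simps add_divide_distrib)
 qed
 finally have 1: "\<bar>E * (2 * w * ww' x * P + V x * deriv p x)\<bar> <= ga * (E * (w\<^sup>2 * P)) + A\<^sup>2 * P / ga" .
 \<comment> \<open>Differentiating \<open>exp(-t V)\<close> produces a factor \<open>t V\<close>,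
   which the exponential absorbs. The resulting \<open>4\<close> and the \<open>1\<close> from the
   other term give the constant \<open>5\<close>.\<close>
 have y: "(t * w\<^sup>2)\<^sup>2 * E <= 4"
 proof -
  let ?y = "t * w\<^sup>2 / 2"
  have "?y <= exp ?y" using exp_ge_add_one_self[of ?y] by linarith
  then have "?y\<^sup>2 <= (exp ?y)\<^sup>2" using t by (intro power_mono) auto
  also have "... = exp (t * w\<^sup>2)" by (simp add: power2_eq_square flip: exp_add)
  finally have "(t * w\<^sup>2)\<^sup>2 <= 4 * exp (t * w\<^sup>2)" by (simp add: power_divide)
  then have "(t * w\<^sup>2)\<^sup>2 * E <= 4 * exp (t * w\<^sup>2) * E" using E by (intro mult_right_mono) auto
  moreover have "4 * exp (t * w\<^sup>2) * E = 4" by (simp add: E_def V exp_minus)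
  ultimately show ?thesis by linarith
 qed
 have "\<bar>E * (t * (2 * w * ww' x) * (V x * P))\<bar> = E * (w * (\<bar>2 * ww' x\<bar> * (t * w\<^sup>2)) * P)"
  using E w P t by (simp add: abs_mult V power2_eq_square)
 also have "... <= E * (w * (A * (t * w\<^sup>2)) * P)" using E w P t A2 by (intro mult_left_mono mult_right_mono) auto
 also have "... <= E * ((ga * w\<^sup>2 + (A * (t * w\<^sup>2))\<^sup>2 / ga) * P)" using E P by (intro mult_left_mono mult_right_mono young) auto
 also have "... = ga * (E * (w\<^sup>2 * P)) + A\<^sup>2 * P / ga * ((t * w\<^sup>2)\<^sup>2 * E)"
  by (simp add: algebra_simps power_mult_distrib)
 also have "... <= ga * (E * (w\<^sup>2 * P)) + A\<^sup>2 * P / ga * 4" using P ga by (intro add_left_mono mult_left_mono y) auto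
 finally have 2: "\<bar>E * (t * (2 * w * ww' x) * (V x * P))\<bar> <= ga * (E * (w\<^sup>2 * P)) + A\<^sup>2 * P / ga * 4" .
 have "dq t x = E * (2 * w * ww' x * P + V x * deriv p x) - E * (t * (2 * w * ww' x) * (V x * P))"
  using S by (simp add: dq_def E_def w_def P_def right_diff_distrib)
 then have "\<bar>dq t x\<bar> <= 2 * (ga * (E * (w\<^sup>2 * P))) + 5 * (A\<^sup>2 * P / ga)" using 1 2 by linarith
 also have "... = 2 * ga * (exp (- t * V x) * r x) + 5 / ga * QQ x"
  using S by (simp add: E_def P_def A_def QQ_def r_def V)
 finally show ?thesis .
next
 case False
 then have "dq t x = 0" using out(4)[of x t] by (cases "x : Sd") (auto simp: dq_def)
 then show ?thesis using r_nonneg[of x] QQ_nonneg[of x] ga by simp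
qed

lemma dq_zero: assumes "r x = 0" shows "dq t x = 0"
proof (cases "x : Sd")
 case True
 with assms have "V x = 0 | p x = 0" by (simp add: r_def)
 then show ?thesis using p_zero[OF True] by (auto simp: dq_def V_def)
qed (auto simp: dq_def)

lemma aa_int: assumes "0 <= t" shows "integrable m (%x. 1 - exp (- t * V x))" "(LINT x|m. 1 - exp (- t * V x)) <= t * (LINT x|m. V x)"
proof -
 have le: "1 - exp (- t * V x) <= t * V x" for x using exp_ge_add_one_self[of "- t * V x"] by simp
 show i: "integrable m (%x. 1 - exp (- t * V x))"
  by (rule int_bound[OF integrable_mult_right[OF V_int, of t]])
   (use le V_bounds(1) assms in auto)
 show "(LINT x|m. 1 - exp (- t * V x)) <= t * (LINT x|m. V x)"
  using integral_mono[OF i integrable_mult_right[OF V_int, of t]] le by simp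
qed

text \<open>If \<open>u powr ka * sqrt t\<close> is of order one, then \<open>t * V x >= 1\<close>
  for \<open>|x|\<close> between \<open>u\<close> and \<open>ee / 2\<close>, so the integral is at
  least half the mass there, and the tail at \<open>u\<close> is of order
  \<open>u powr (- ro)\<close>, a multiple of \<open>t powr (ro / (2 * ka))\<close>.
  \<open>K\<close> pays for sizes beyond \<open>ee / 2\<close> and for times so small that
  \<open>u\<close> leaves the range of the tail estimate.\<close>

lemma aa_lower: "EX c K. 0 < c & 0 <= K & (ALL t>=0. c * t powr (ro / (2 * ka)) - K <= (LINT x|m. 1 - exp (- t * V x)))"
proof -
 \<comment> \<open>A finite level strictly below the lower limit, which itself may be
   infinite.\<close>
 from dense[OF small] obtain c' where c': "0 < c'" "c' < Liminf (at_right 0) (%ep. ennreal (ep powr ro) * emeasure m {xi. ep <= \<bar>xi\<bar>})"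
  by auto
 then obtain c0 where c0: "c' = ennreal c0" "0 < c0" by (cases c') auto
 have "\<forall>\<^sub>F ep in at_right 0. ennreal c0 < ennreal (ep powr ro) * emeasure m {xi. ep <= \<bar>xi\<bar>}"
  using less_LiminfD[OF c'(2)] c0 by simp
 then obtain b where b: "0 < b" "!!ep. 0 < ep ==> ep < b ==> ennreal c0 < ennreal (ep powr ro) * emeasure m {xi. ep <= \<bar>xi\<bar>}"
  by (auto simp: eventually_at_right_field)
 have tail: "c0 * u powr (- ro) <= measure m {xi. u <= \<bar>xi\<bar>}" if "0 < u" "u < b" for u
 proof -
  have "emeasure m {xi. u <= \<bar>xi\<bar>} = ennreal (measure m {xi. u <= \<bar>xi\<bar>})"
   using m_tail[OF that(1)] by (intro emeasure_eq_ennreal_measure) auto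
  with b(2)[OF that] have "ennreal c0 < ennreal (u powr ro * measure m {xi. u <= \<bar>xi\<bar>})" by (simp add: ennreal_mult')
  then have "c0 < u powr ro * measure m {xi. u <= \<bar>xi\<bar>}" using c0 by (simp add: ennreal_less_iff)
  then show ?thesis using that by (simp add: powr_minus field_simps)
 qed
 \<comment> \<open>\<open>c1\<close> bounds the cutoff factor of \<open>ww\<close> from below on
   \<open>|x| <= ee / 2\<close>, and \<open>K0\<close> is the mass beyond
   \<open>ee / 2\<close>.\<close>
 define c1 K0 sg where "c1 = ee ^ 4 / 4" and "K0 = measure m {xi. ee / 2 <= \<bar>xi\<bar>}" and "sg = ro / (2 * ka)"
 have c1: "0 < c1" using ee by (simp add: c1_def)
 let ?c = "c0 / 2 * c1 powr (ro / ka)" and ?K = "K0 / 2 + c0 / 2 * b powr (- ro)"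
 have "?c * t powr sg - ?K <= (LINT x|m. 1 - exp (- t * V x))" if t: "0 <= t" for t
 proof (cases "t = 0")
  case True
  then have "?c * t powr sg = 0" "(LINT x|m. 1 - exp (- t * V x)) = 0" by simp_all
  moreover have "0 <= ?K" using c0 by (intro add_nonneg_nonneg) (auto simp: K0_def)
  ultimately show ?thesis by linarith
 next
  case False
  with t have t: "0 < t" by simp
  \<comment> \<open>The solution of \<open>c1 * u powr ka * sqrt t = 1\<close>.\<close>
  define u where "u = (c1 * sqrt t) powr (- 1 / ka)"
  have u: "0 < u" using c1 t by (simp add: u_def)
  have "u powr (- ro) = (c1 * sqrt t) powr (ro / ka)" by (simp add: u_def powr_powr)
  also have "... = c1 powr (ro / ka) * t powr sg"
   using c1 t by (simp add: powr_mult sg_def powr_powr flip: powr_half_sqrt)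
  finally have ur: "u powr (- ro) = c1 powr (ro / ka) * t powr sg" .
  have "u powr ka = (c1 * sqrt t) powr (- 1)" using ka1 by (simp only: u_def powr_powr) simp
  then have uk: "c1 * u powr ka * sqrt t = 1" using c1 t by (simp add: powr_minus_divide)
  show ?thesis
  proof (cases "u < b")
   case True
   let ?A = "{xi. u <= \<bar>xi\<bar>}" and ?B = "{xi. ee / 2 <= \<bar>xi\<bar>}"
   have le: "1 / 2 * (indicat_real ?A x - indicat_real ?B x) <= 1 - exp (- t * V x)" for x
   proof (cases "u <= \<bar>x\<bar> & \<bar>x\<bar> < ee / 2")
    case T: True
    then have "x\<^sup>2 <= (ee / 2)\<^sup>2" using ee by (metis abs_le_square_iff abs_of_pos half_gt_zero less_imp_le)
    moreover have "(ee / 2)\<^sup>2 = ee\<^sup>2 / 4" by (simp add: power_divide)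
    ultimately have "ee\<^sup>2 / 2 <= ee\<^sup>2 - x\<^sup>2" using zero_le_power2[of ee] by linarith
    then have "ee\<^sup>2 / 2 <= max 0 (ee\<^sup>2 - x\<^sup>2)" by (rule max.coboundedI2)
    then have "(ee\<^sup>2 / 2)\<^sup>2 <= (max 0 (ee\<^sup>2 - x\<^sup>2))\<^sup>2" by (intro power_mono) auto
    then have "c1 <= (max 0 (ee\<^sup>2 - x\<^sup>2))\<^sup>2" by (simp add: c1_def power_divide flip: power_mult)
    then have "u powr ka * c1 <= ww x" using T u c1 ka1 unfolding ww_def by (intro mult_mono powr_mono2) auto
    then have "1 <= ww x * sqrt t" using uk t mult_right_mono[of "u powr ka * c1" "ww x" "sqrt t"] by (simp add: mult.commute)
    then have "1\<^sup>2 <= (ww x * sqrt t)\<^sup>2" by (intro power_mono) auto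
    then have "1 <= t * V x" using t by (simp add: V_def power_mult_distrib mult.commute)
    then have "2 <= exp (t * V x)" using exp_ge_add_one_self[of "t * V x"] by linarith
    then have "exp (- t * V x) <= 1 / 2" by (simp add: exp_minus field_simps)
    then show ?thesis using T by simp
   next
    case False
    then have "1 / 2 * (indicat_real ?A x - indicat_real ?B x) <= (0::real)" by (auto simp: indicator_def)
    moreover have "exp (- t * V x) <= 1" using t V_bounds(1)[of x] by simp
    ultimately show ?thesis by linarith
   qed
   have fin: "emeasure m ?A < \<infinity>" "emeasure m ?B < \<infinity>" using ee by (intro m_tail u half_gt_zero)+
   then have "integrable m (%x. 1 / 2 * (indicat_real ?A x - indicat_real ?B x))"
    by (intro integrable_mult_right Bochner_Integration.integrable_diff integrable_real_indicator) auto
   from integral_mono[OF this aa_int(1) le] t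
   have "(LINT x|m. 1 / 2 * (indicat_real ?A x - indicat_real ?B x)) <= (LINT x|m. 1 - exp (- t * V x))" by simp
   also have "(LINT x|m. 1 / 2 * (indicat_real ?A x - indicat_real ?B x)) = 1 / 2 * (measure m ?A - K0)"
    using fin by (simp add: Bochner_Integration.integral_diff integrable_real_indicator K0_def)
   finally have "1 / 2 * (measure m ?A - K0) <= (LINT x|m. 1 - exp (- t * V x))" .
   moreover have "1 / 2 * (c0 * u powr (- ro) - K0) <= 1 / 2 * (measure m ?A - K0)" using tail[OF u True] by simp
   moreover have "?c * t powr sg - ?K <= 1 / 2 * (c0 * u powr (- ro) - K0)" using c0 unfolding ur by (simp add: field_simps)
   ultimately show ?thesis by (meson order_trans)
  next
   case False
   then have "u powr (- ro) <= b powr (- ro)" using b ro0 by (intro powr_mono2') auto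
   then have "?c * t powr sg <= c0 / 2 * b powr (- ro)" using c0 by (simp add: ur)
   moreover have "0 <= (LINT x|m. 1 - exp (- t * V x))" using t V_bounds(1) by (intro integral_nonneg_AE) auto
   moreover have "0 <= K0" by (simp add: K0_def)
   ultimately show ?thesis by linarith
  qed
 qed
 moreover have "0 < ?c" "0 <= ?K" using c0 c1 by (auto simp: K0_def)
 ultimately show ?thesis unfolding sg_def[symmetric] by blast
qed

lemma a_inf: "filterlim (%t. \<integral>x. 1 - exp (- t * V x) \<partial>m) at_top at_top"
proof -
 obtain c K where c: "0 < c" and ck: "ALL t>=0. c * t powr (ro / (2 * ka)) - K <= (LINT x|m. 1 - exp (- t * V x))" using aa_lower by blast
 have "0 < ro / (2 * ka)" using ro0 ka1 by simp
 then have "filterlim (%t. c * t powr (ro / (2 * ka)) - K) at_top at_top" using c by real_asymp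
 then show ?thesis by (rule filterlim_at_top_mono) (use ck in \<open>auto intro: eventually_at_top_linorderI[of 0]\<close>)
qed

text \<open>\<open>aa\<close> grows at most linearly because \<open>V\<close> is integrable, and at
  least like \<open>t powr (ro / (2 * ka))\<close>. Consequently \<open>1/2 - ka/ro\<close> is not
  positive, which makes shrinking the time window affordable.\<close>

lemma rho_le: "ro <= 2 * ka"
proof (rule ccontr)
 assume "~ ro <= 2 * ka"
 then have s: "1 < ro / (2 * ka)" using ka1 by simp
 obtain c K where c: "0 < c" and ck: "ALL t>=0. c * t powr (ro / (2 * ka)) - K <= (LINT x|m. 1 - exp (- t * V x))" using aa_lower by blast
 have "filterlim (%t. c * t powr s - K - t * I) at_top at_top" if "1 < s" for s I using c that by real_asymp
 note this[OF s, of "\<integral>x. V x \<partial>m"]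
 then have "\<forall>\<^sub>F t in at_top. 0 < c * t powr (ro / (2 * ka)) - K - t * (LINT x|m. V x)" by (simp only: filterlim_at_top_dense)
 then have "\<forall>\<^sub>F t::real in at_top. False" using eventually_ge_at_top[of 0]
  by eventually_elim (use ck aa_int(2) in fastforce)
 then show False by simp
qed

text \<open>\<open>A = ta powr (- 2 * ka / ro)\<close> is the scale at which
  \<open>ta * u powr (ro / (2 * ka))\<close> equals \<open>1\<close>. Up to \<open>A\<close> the
  integrand is bounded by a constant, beyond \<open>A\<close> by a multiple of
  \<open>(A / u)\<^sup>2\<close>; both ranges contribute order \<open>A\<close>.\<close>

lemma exp_aa_integral: "EX C>0. ALL ta. 0 < ta & ta <= 1 -->
 (\<integral>\<^sup>+ u. indi {0..} u * ennreal (exp (- ta * (LINT x|m. 1 - exp (- u * V x)))) \<partial>lborel) <= ennreal (C * ta powr (- 2 * ka / ro))"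
proof -
 obtain c K where c: "0 < c" and K: "0 <= K" and ck: "!!u. 0 <= u ==> c * u powr (ro / (2 * ka)) - K <= (LINT x|m. 1 - exp (- u * V x))"
  using aa_lower by blast
 define sg where "sg = ro / (2 * ka)"
 have sg: "0 < sg" using ro0 ka1 by (simp add: sg_def)
 \<comment> \<open>With \<open>k * sg >= 2\<close> one has
   \<open>(u / A)^2 <= (u / A)^(sg * k)\<close> for \<open>u >= A\<close>; the elementary bound
   \<open>y^k <= k^k * exp y\<close> then leads to the constant \<open>D\<close>.\<close>
 obtain k where k: "2 / sg <= real k" using real_arch_simple by blast
 have k0: "0 < k" using k sg by (cases k) (auto simp: divide_le_0_iff)
 define D where "D = real k ^ k / c ^ k"
 have D: "0 < D" using c k0 by (simp add: D_def)
 let ?C = "exp K * (1 + D)"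
 have "(\<integral>\<^sup>+ u. indi {0..} u * ennreal (exp (- ta * (LINT x|m. 1 - exp (- u * V x)))) \<partial>lborel) <= ennreal (?C * ta powr (- 2 * ka / ro))"
  if ta: "0 < ta" "ta <= 1" for ta
 proof -
  define A where "A = ta powr (- 2 * ka / ro)"
  have A: "0 < A" using ta by (simp add: A_def)
  have "A powr sg = ta powr (- 2 * ka / ro * (ro / (2 * ka)))" by (simp only: A_def sg_def powr_powr)
  also have "- 2 * ka / ro * (ro / (2 * ka)) = - 1" using ro0 ka1 by simp
  finally have As: "A powr sg = 1 / ta" using ta by (simp add: powr_minus_divide)
  have e1: "exp (- ta * (LINT x|m. 1 - exp (- u * V x))) <= exp K * exp (- (c * (ta * u powr sg)))" if "0 <= u" for u
  proof -
   have "ta * (c * u powr sg - K) <= ta * (LINT x|m. 1 - exp (- u * V x))" using ck[OF that] ta by (intro mult_left_mono) (auto simp: sg_def)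
   moreover have "ta * K <= K" using ta K by (intro mult_left_le_one_le) auto
   ultimately have "- ta * (LINT x|m. 1 - exp (- u * V x)) <= K + - (c * (ta * u powr sg))" by (simp add: algebra_simps)
   then show ?thesis by (simp only: exp_add[symmetric] exp_le_cancel_iff)
  qed
  have e2: "exp (- (c * (ta * u powr sg))) <= D * (A / u)\<^sup>2" if "A <= u" for u
  proof -
   define y where "y = c * (ta * u powr sg)"
   have u: "0 < u" "1 <= u / A" using that A by auto
   have y0: "0 < y" using c ta u by (simp add: y_def)
   have "(u / A)\<^sup>2 = (u / A) powr 2" using u A by (simp add: powr_numeral)
   also have "... <= (u / A) powr (sg * real k)" using k sg u by (intro powr_mono) (auto simp: field_simps)
   also have "... = ((u / A) powr sg) ^ k" using u A by (simp add: powr_powr[symmetric] powr_realpow)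
   also have "(u / A) powr sg = y / c" using u A As ta c by (simp add: powr_divide y_def field_simps)
   finally have "(u / A)\<^sup>2 * c ^ k <= y ^ k" using c by (simp add: power_divide field_simps)
   moreover have "y ^ k / real k ^ k <= exp y"
   proof -
    have "y / real k <= exp (y / real k)" using exp_ge_add_one_self[of "y / real k"] by linarith
    then have "(y / real k) ^ k <= exp (y / real k) ^ k" using y0 by (intro power_mono) auto
    also have "... = exp y" using k0 by (simp flip: exp_of_nat_mult)
    finally show ?thesis by (simp add: power_divide)
   qed
   ultimately have "(u / A)\<^sup>2 * c ^ k / real k ^ k <= exp y"
    by (meson divide_right_mono of_nat_0_le_iff order_trans zero_le_power)
   then have "inverse (exp y) <= inverse ((u / A)\<^sup>2 * c ^ k / real k ^ k)" using u A c k0 by (intro le_imp_inverse_le) auto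
   then show ?thesis unfolding y_def[symmetric] D_def by (simp add: exp_minus field_simps)
  qed
  have t0: "(\<integral>\<^sup>+ u. ennreal (D * (A / u)\<^sup>2) * indi {A..} u \<partial>lborel) = ennreal (0 - - D * A\<^sup>2 / A)"
  proof (rule nn_integral_FTC_atLeast[where F="%x. - D * A\<^sup>2 / x"])
   show "((%x. - D * A\<^sup>2 / x) has_real_derivative D * (A / x)\<^sup>2) (at x)" if "A <= x" for x
    using that A by (auto intro!: derivative_eq_intros simp: power2_eq_square field_simps)
   show "((%x. - D * A\<^sup>2 / x) \<longlongrightarrow> 0) at_top" by real_asymp
  qed (use D in auto)
  have t: "(\<integral>\<^sup>+ u. ennreal (D * (A / u)\<^sup>2) * indi {A..} u \<partial>lborel) = ennreal (D * A)"
   unfolding t0 using A by (simp add: power2_eq_square)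
  have "(\<integral>\<^sup>+ u. indi {0..} u * ennreal (exp (- ta * (LINT x|m. 1 - exp (- u * V x)))) \<partial>lborel)
   <= (\<integral>\<^sup>+ u. ennreal (exp K) * (indi {0..A} u + ennreal (D * (A / u)\<^sup>2) * indi {A..} u) \<partial>lborel)"
  proof (rule nn_integral_mono)
   fix u :: real
   have e3: "exp (- (c * (ta * u powr sg))) <= 1" using c ta by simp
   have "indi {0..} u * ennreal (exp (- ta * (LINT x|m. 1 - exp (- u * V x)))) <= indi {0..} u * ennreal (exp K * exp (- (c * (ta * u powr sg))))"
    by (cases "0 <= u") (use e1 in \<open>auto intro!: ennreal_leI\<close>)
   also have "... = ennreal (exp K) * (indi {0..} u * ennreal (exp (- (c * (ta * u powr sg)))))"
    by (simp add: ennreal_mult' mult_ac)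
   also have "... <= ennreal (exp K) * (indi {0..A} u + ennreal (D * (A / u)\<^sup>2) * indi {A..} u)"
   proof (rule mult_left_mono)
    consider "u < 0" | "0 <= u" "u <= A" | "A <= u" "A ~= u" by linarith
    then show "indi {0..} u * ennreal (exp (- (c * (ta * u powr sg)))) <= indi {0..A} u + ennreal (D * (A / u)\<^sup>2) * indi {A..} u"
    proof cases
     case 2 with e3 show ?thesis by (auto intro!: add_increasing2 simp: ennreal_le_1)
    next
     case 3 with e2 A show ?thesis by (auto intro!: ennreal_leI)
    qed auto
   qed simp
   finally show "indi {0..} u * ennreal (exp (- ta * (LINT x|m. 1 - exp (- u * V x)))) <= ennreal (exp K) * (indi {0..A} u + ennreal (D * (A / u)\<^sup>2) * indi {A..} u)" .
  qed
  also have "... = ennreal (exp K) * (ennreal A + ennreal (D * A))"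
   using A by (simp add: nn_integral_cmult nn_integral_add t)
  also have "... = ennreal (?C * A)" using A D by (simp add: ennreal_mult' flip: ennreal_plus) (simp add: algebra_simps flip: ennreal_mult')
  finally show ?thesis unfolding A_def .
 qed
 moreover have "0 < ?C" using D by simp
 ultimately show ?thesis by blast
qed

end

section \<open>The score on the enlarged space\<close>

locale score_space = levy_score +
 fixes ta :: real
 assumes ta: "0 < ta" "ta <= 1"
begin

sublocale D: levy_shift_density M Z N m V ta r 1
 by unfold_locales (use V_bounds V_int Vr a_inf r_nonneg ta in auto)

text \<open>The logarithmic derivative in the jump size of its density. Where the density vanishes
  the quotient is \<open>0\<close>, which is consistent by \<open>dq_zero\<close>.\<close>

definition sc :: "((real \<times> real) \<times> 'a) \<times> real => real" where
 "sc z = dq (fst (fst (fst z))) (snd z) / D.qd (fst (fst (fst z))) (snd z)"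

lemma sc_meas[measurable]: "sc : bmf (D.B0 \<Otimes>\<^sub>M lborel)"
proof -
 have "(%z. (fst (fst (fst z)), snd z)) : D.B0 \<Otimes>\<^sub>M lborel \<rightarrow>\<^sub>M borel \<Otimes>\<^sub>M borel" by measurable
 from measurable_compose[OF this dq_meas] show ?thesis unfolding sc_def[abs_def] by simp
qed

lemma qd_sc: "D.qd t x * (dq t x / D.qd t x) = dq t x"
 using dq_zero[of x t] by (auto simp: D.qd_def)

lemma dq_integrable: assumes "0 <= t" shows "integrable lborel (dq t)"
proof (rule int_bound)
 show "integrable lborel (%x. 2 * D.qd t x + 5 * QQ x)" using D.qd_integrable[OF assms] QQ_int by simp
 show "dq t : bmf lborel" using measurable_compose[OF _ dq_meas, of "%x. (t, x)" lborel] by simp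
 show "AE x in lborel. norm (dq t x) <= norm (2 * D.qd t x + 5 * QQ x)"
  using dq_bound[OF assms, of 1] QQ_nonneg D.qd_nonneg by (auto simp: D.qd_def abs_of_nonneg)
qed

text \<open>The condition of \<open>ibp_singular\<close> at the singularity. On the support
  \<open>|x| <= 1\<close>, hence \<open>V x / |x|\<close> is at most
  \<open>(|x| powr (ka - 1))\<^sup>2\<close>, which is covered by the first summand in
  \<open>QQ\<close>.\<close>

lemma qd_over_integrable: assumes "0 <= t" shows "integrable lborel (%x. D.qd t x / x)"
proof (rule int_bound[OF QQ_int])
 have "\<bar>D.qd t x / x\<bar> <= QQ x" for x
 proof (cases "x : Sd & \<bar>x\<bar> < ee")
  case True
  then have p: "0 <= p x" and x: "0 < \<bar>x\<bar>" "\<bar>x\<bar> <= 1" using p0 ee by auto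
  have "1 / \<bar>x\<bar> * V x <= 1 / \<bar>x\<bar> * (\<bar>x\<bar> powr ka)\<^sup>2" unfolding V_def using ww_bounds[of x] by (intro mult_left_mono power_mono) auto
  also have "... = \<bar>x\<bar> * (\<bar>x\<bar> powr (ka - 1))\<^sup>2"
  proof -
   have "\<bar>x\<bar> powr ka = \<bar>x\<bar> * \<bar>x\<bar> powr (ka - 1)" using powr_mult_base[of "\<bar>x\<bar>" "ka - 1"] by simp
   then show ?thesis using x by (simp only:) (simp add: power2_eq_square)
  qed
  also have "... <= 1 * (2 * (ka + 4) * \<bar>x\<bar> powr (ka - 1) + \<bar>x\<bar> powr ka * \<bar>deriv p x / p x\<bar>)\<^sup>2"
  proof (intro mult_mono power_mono)
   have "1 * \<bar>x\<bar> powr (ka - 1) <= 2 * (ka + 4) * \<bar>x\<bar> powr (ka - 1)" using ka1 by (intro mult_right_mono) auto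
   moreover have "0 <= \<bar>x\<bar> powr ka * \<bar>deriv p x / p x\<bar>" by simp
   ultimately show "\<bar>x\<bar> powr (ka - 1) <= 2 * (ka + 4) * \<bar>x\<bar> powr (ka - 1) + \<bar>x\<bar> powr ka * \<bar>deriv p x / p x\<bar>" by linarith
  qed (use x in auto)
  finally have "1 / \<bar>x\<bar> * V x * p x <= QQ x" using p True by (simp only: QQ_def mult_1 if_True) (rule mult_right_mono)
  moreover have "\<bar>D.qd t x / x\<bar> = exp (- t * V x) * (1 / \<bar>x\<bar> * V x * p x)"
   using True p V_bounds(1)[of x] by (simp add: D.qd_def r_def abs_mult)
  moreover have "... <= 1 * (1 / \<bar>x\<bar> * V x * p x)" using p V_bounds(1)[of x] assms by (intro mult_right_mono) auto
  ultimately show ?thesis by linarith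
 next
  case False
  then have "D.qd t x = 0" using out(3)[of x] by (cases "x : Sd") (auto simp: D.qd_def r_def)
  then show ?thesis using QQ_nonneg by simp
 qed
 then show "AE x in lborel. norm (D.qd t x / x) <= norm (QQ x)" using QQ_nonneg by auto
qed measurable

text \<open>The part of Young's bound proportional to the density integrates to
  \<open>2 * ga\<close> because \<open>Om\<close> is a probability. The part with \<open>QQ\<close>
  does not depend on \<open>t\<close>, so the mass of \<open>hb\<close> remains, which
  \<open>nn_B0\<close> computes.\<close>

lemma nn_sc:
 assumes ga: "0 < ga"
 shows "(\<integral>\<^sup>+ z. ennreal \<bar>sc z\<bar> \<partial>D.Om) <= ennreal (2 * ga)
  + ennreal (5 / ga * (LINT x|lborel. QQ x)) * (\<integral>\<^sup>+ t. indi {0..} t * ennreal (ta * exp (- ta * D.aa t)) \<partial>lborel)"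
proof -
 let ?c = "ennreal (5 / ga * (LINT x|lborel. QQ x))"
 let ?q = "%u :: (real \<times> real) \<times> 'a. \<integral>\<^sup>+ x. ennreal (D.qd (fst (fst u)) x) \<partial>lborel"
 have "(\<integral>\<^sup>+ z. ennreal \<bar>sc z\<bar> \<partial>D.Om) = (\<integral>\<^sup>+ u. ennreal (D.hb u) * (\<integral>\<^sup>+ x. ennreal (D.qd (fst (fst u)) x) * ennreal \<bar>sc (u, x)\<bar> \<partial>lborel) \<partial>D.B0)"
  by (rule D.nn_Om) measurable
 also have "... <= (\<integral>\<^sup>+ u. ennreal (2 * ga) * (ennreal (D.hb u) * ?q u) + ?c * (ennreal (D.hb u) * 1) \<partial>D.B0)"
 proof (rule nn_integral_mono)
  fix u :: "(real \<times> real) \<times> 'a"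
  obtain t s w where u: "u = ((t, s), w)" by (metis surj_pair)
  show "ennreal (D.hb u) * (\<integral>\<^sup>+ x. ennreal (D.qd (fst (fst u)) x) * ennreal \<bar>sc (u, x)\<bar> \<partial>lborel)
    <= ennreal (2 * ga) * (ennreal (D.hb u) * ?q u) + ?c * (ennreal (D.hb u) * 1)"
  proof (cases "0 <= t")
   case True
   have "ennreal (D.qd t x) * ennreal \<bar>sc (u, x)\<bar> = ennreal \<bar>dq t x\<bar>" for x
    using qd_sc[of t x] D.qd_nonneg[of t x] by (simp add: u sc_def flip: ennreal_mult') (metis abs_mult abs_of_nonneg)
   then have "(\<integral>\<^sup>+ x. ennreal (D.qd (fst (fst u)) x) * ennreal \<bar>sc (u, x)\<bar> \<partial>lborel) = (\<integral>\<^sup>+ x. ennreal \<bar>dq t x\<bar> \<partial>lborel)"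
    by (simp add: u)
   also have "... <= (\<integral>\<^sup>+ x. ennreal (2 * ga) * ennreal (D.qd t x) + ennreal (5 / ga) * ennreal (QQ x) \<partial>lborel)"
    using dq_bound[OF True ga] ga D.qd_nonneg QQ_nonneg
    by (intro nn_integral_mono) (simp add: D.qd_def ennreal_mult'[symmetric] ennreal_plus[symmetric] r_nonneg ennreal_leI del: ennreal_plus)
   also have "... = ennreal (2 * ga) * ?q u + ?c"
   proof -
    have "ennreal (5 / ga) * ennreal (LINT x|lborel. QQ x) = ?c" using ga by (subst ennreal_mult'[symmetric]) auto
    then show ?thesis using QQ_nonneg by (simp add: u nn_integral_add nn_integral_cmult nn_integral_eq_integral[OF QQ_int])
   qed
   finally have "ennreal (D.hb u) * (\<integral>\<^sup>+ x. ennreal (D.qd (fst (fst u)) x) * ennreal \<bar>sc (u, x)\<bar> \<partial>lborel)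
    <= ennreal (D.hb u) * (ennreal (2 * ga) * ?q u + ?c)" by (rule mult_left_mono) simp
   then show ?thesis by (simp add: algebra_simps)
  qed (simp add: u D.hb_def)
 qed
 also have "... = ennreal (2 * ga) * (\<integral>\<^sup>+ u. ennreal (D.hb u) * ?q u \<partial>D.B0) + ?c * (\<integral>\<^sup>+ u. ennreal (D.hb u) * 1 \<partial>D.B0)"
 proof -
  have [measurable]: "?q : bmf D.B0" by (rule lborel.borel_measurable_nn_integral) measurable
  show ?thesis by (simp add: nn_integral_add nn_integral_cmult)
 qed
 also have "(\<integral>\<^sup>+ u. ennreal (D.hb u) * ?q u \<partial>D.B0) = 1"
  using D.nn_Om[of "%_. 1"] D.Om.emeasure_space_1 by simp
 also have "(\<integral>\<^sup>+ u. ennreal (D.hb u) * 1 \<partial>D.B0) = (\<integral>\<^sup>+ t. indi {0..} t * ennreal (ta * exp (- ta * D.aa t)) \<partial>lborel)"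
  using D.nn_B0[of "%_. 1"] by simp
 finally show ?thesis by simp
qed

lemma sc_bound:
 assumes C: "0 < C" "(\<integral>\<^sup>+ t. indi {0..} t * ennreal (exp (- ta * D.aa t)) \<partial>lborel) <= ennreal (C * ta powr (- 2 * ka / ro))"
 shows "integrable D.Om sc" "(LINT z|D.Om. \<bar>sc z\<bar>) <= (2 + 5 * (LINT x|lborel. QQ x) * C) * ta powr (1 / 2 - ka / ro)"
proof -
 \<comment> \<open>This choice balances \<open>ga\<close> against
   \<open>ta powr (1 - 2 * ka / ro) / ga\<close>.\<close>
 let ?ga = "ta powr (1 / 2 - ka / ro)" and ?I = "\<integral>x. QQ x \<partial>lborel" and ?R = "(2 + 5 * (LINT x|lborel. QQ x) * C) * ta powr (1 / 2 - ka / ro)"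
 have I: "0 <= ?I" using QQ_nonneg by (intro integral_nonneg_AE) auto
 have "(\<integral>\<^sup>+ t. indi {0..} t * ennreal (ta * exp (- ta * D.aa t)) \<partial>lborel)
   = ennreal ta * (\<integral>\<^sup>+ t. indi {0..} t * ennreal (exp (- ta * D.aa t)) \<partial>lborel)"
  using ta by (subst nn_integral_cmult[symmetric]) (auto simp: ennreal_mult' mult_ac)
 also have "... <= ennreal ta * ennreal (C * ta powr (- 2 * ka / ro))" by (intro mult_left_mono C) simp
 finally have le: "(\<integral>\<^sup>+ t. indi {0..} t * ennreal (ta * exp (- ta * D.aa t)) \<partial>lborel) <= ennreal ta * ennreal (C * ta powr (- 2 * ka / ro))" .
 have "(\<integral>\<^sup>+ z. ennreal \<bar>sc z\<bar> \<partial>D.Om) <= ennreal (2 * ?ga) + ennreal (5 / ?ga * ?I) * (ennreal ta * ennreal (C * ta powr (- 2 * ka / ro)))"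
  by (rule order_trans[OF nn_sc add_left_mono[OF mult_left_mono[OF le]]]) (use ta in auto)
 also have "... = ennreal (2 * ?ga + 5 / ?ga * ?I * (ta * (C * ta powr (- 2 * ka / ro))))"
  using I C ta by (subst ennreal_mult'[symmetric], simp, subst ennreal_mult'[symmetric], simp, subst ennreal_plus[symmetric]) auto
 also have "2 * ?ga + 5 / ?ga * ?I * (ta * (C * ta powr (- 2 * ka / ro))) = ?R"
 proof -
  have "ta * ta powr (- 2 * ka / ro) = ta powr (1 + - 2 * ka / ro)" using ta by (subst powr_add) simp
  also have "1 + - 2 * ka / ro = (1 / 2 - ka / ro) + (1 / 2 - ka / ro)" by simp
  also have "ta powr ... = ?ga * ?ga" by (rule powr_add)
  finally show ?thesis using ta by (simp add: field_simps)
 qed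
 finally have *: "(\<integral>\<^sup>+ z. ennreal \<bar>sc z\<bar> \<partial>D.Om) <= ennreal ?R" .
 show i: "integrable D.Om sc"
  using * sc_meas by (intro integrableI_bounded) (auto simp: top_unique less_top[symmetric] measurable_cong_sets[OF D.sets_Om refl])
 have "0 <= ?R" using I C by simp
 then show "(LINT z|D.Om. \<bar>sc z\<bar>) <= ?R"
  using * nn_integral_eq_integral[OF integrable_abs[OF i]] by simp
qed

lemma sc_ibp:
 assumes i: "integrable D.Om sc" and Fm[measurable]: "F : bmf (D.B0 \<Otimes>\<^sub>M lborel)"
  and F: "!!u x. ((%y. F (u, y)) has_real_derivative F' (u, x)) (at x)" and Fb: "!!z. \<bar>F z\<bar> <= C" and F'b: "!!z. \<bar>F' z\<bar> <= C"
 shows "integrable D.Om F'" "(LINT z|D.Om. F' z) = - (LINT z|D.Om. F z * sc z)"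
proof -
 have [measurable]: "F' : bmf (D.B0 \<Otimes>\<^sub>M lborel)"
 proof (rule borel_measurable_LIMSEQ_metric)
  let ?e = "%n. inverse (real (Suc n))"
  fix z :: "((real \<times> real) \<times> 'a) \<times> real"
  have "((%h. F (fst z, snd z + h)) has_vector_derivative F' z) (at 0)"
   using F[of "fst z" "snd z"] DERIV_shift[of "%y. F (fst z, y)" "F' z" 0 "snd z"]
   by (simp add: has_real_derivative_iff_has_vector_derivative add.commute)
  from has_vector_derivative_seqD[OF this, of ?e] LIMSEQ_inverse_real_of_nat
  show "(%n. (F (fst z, snd z + ?e n) - F z) /\<^sub>R ?e n) ----> F' z" by simp
 qed measurable
 show i': "integrable D.Om F'"
  by (rule D.Om.integrable_const_bound[where B=C]) (use F'b in \<open>auto simp: measurable_cong_sets[OF D.sets_Om refl]\<close>)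
 have iF: "integrable D.Om (%z. F z * sc z)"
 proof (rule int_bound[OF integrable_mult_right[OF integrable_abs[OF i], of C]])
  show "AE z in D.Om. norm (F z * sc z) <= norm (C * \<bar>sc z\<bar>)"
   using order_trans[OF abs_ge_zero Fb] Fb by (auto simp: abs_mult intro!: mult_right_mono)
 qed (simp add: measurable_cong_sets[OF D.sets_Om refl])
 have "(LINT z|D.Om. F' z) = (LINT u|D.B0. D.hb u *R (LINT x|lborel. D.qd (fst (fst u)) x *R F' (u, x)))" by (rule D.integral_Om[OF i'])
 also have "... = (LINT u|D.B0. - (D.hb u *R (LINT x|lborel. D.qd (fst (fst u)) x *R (F (u, x) * sc (u, x)))))"
 proof (intro int_cong refl)
  fix u :: "(real \<times> real) \<times> 'a"
  obtain t s w where u: "u = ((t, s), w)" by (metis surj_pair)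
  show "D.hb u *R (LINT x|lborel. D.qd (fst (fst u)) x *R F' (u, x)) = - (D.hb u *R (LINT x|lborel. D.qd (fst (fst u)) x *R (F (u, x) * sc (u, x))))"
  proof (cases "0 <= t")
   case True
   have "(LINT x|lborel. D.qd t x * F' (u, x)) = - (LINT x|lborel. dq t x * F (u, x))"
   proof (rule ibp_singular[where e=ee and C=C])
    show "(D.qd t has_real_derivative dq t x) (at x)" if "x ~= 0" for x
     using qr_deriv[OF that] by (simp add: D.qd_def[abs_def])
    show "D.qd t x = 0" if "ee <= \<bar>x\<bar>" for x using out(3)[OF that] by (simp add: D.qd_def)
   qed (use F Fb F'b ee D.qd_integrable[OF True] dq_integrable[OF True] qd_over_integrable[OF True] out in auto)
   also have "(LINT x|lborel. dq t x * F (u, x)) = (LINT x|lborel. D.qd t x * (F (u, x) * sc (u, x)))"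
    by (intro int_cong refl) (subst qd_sc[symmetric], simp only: u sc_def fst_conv snd_conv mult_ac)
   finally show ?thesis by (simp add: u)
  qed (simp add: u D.hb_def)
 qed
 also have "... = - (LINT z|D.Om. F z * sc z)"
  by (subst D.integral_Om[OF iF]) simp
 finally show "(LINT z|D.Om. F' z) = - (LINT z|D.Om. F z * sc z)" .
qed

text \<open>The second part transports almost sure path properties, such as right continuity, from
  the original space to the enlarged one.\<close>

lemma Om_AE: "AE z in D.Om. snd (fst (fst z)) : {0..ta}"
  "A : null_sets M ==> AE z in D.Om. snd (fst z) ~: A"
proof -
 have "AE z in D.B0 \<Otimes>\<^sub>M lborel. 0 < ennreal (D.hb (fst z) * D.qd (fst (fst (fst z))) (snd z)) --> snd (fst (fst z)) : {0..ta}"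
  by (rule AE_I2) (auto simp: D.hb_def indicator_def split: if_splits)
 then show "AE z in D.Om. snd (fst (fst z)) : {0..ta}" unfolding D.Om_def by (subst AE_density) auto
 assume A: "A : null_sets M"
 then have [measurable]: "A : sets M" by auto
 have ae: "AE x in M. indi A x = (0::ennreal)" using AE_not_in[OF A] by eventually_elim simp
 have "(\<integral>\<^sup>+ z. indi A (snd (fst z)) \<partial>(D.B0 \<Otimes>\<^sub>M lborel)) = 0"
 proof -
  have "(\<integral>\<^sup>+ u. indi A (snd u) \<partial>D.B0) = 0"
   unfolding D.B0_def using ae by (subst D.B0.nn_integral_snd[symmetric]) (auto simp: nn_integral_0_iff_AE D.B0_def)
  then show ?thesis
   by (subst lborel.nn_integral_fst[symmetric]) (auto simp: nn_integral_multc)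
 qed
 then have "AE z in D.B0 \<Otimes>\<^sub>M lborel. snd (fst z) ~: A"
  by (subst (asm) nn_integral_0_iff_AE) (auto simp: indicator_def split: if_splits)
 then show "AE z in D.Om. snd (fst z) ~: A" unfolding D.Om_def by (subst AE_density) auto
qed

end

text \<open>Clipping puts the jump time into \<open>[0,ta]\<close> everywhere rather than almost everywhere.\<close>

definition jtime :: "real => ((real \<times> real) \<times> 'w) \<times> real => real" where
 "jtime ta z = max 0 (min ta (snd (fst (fst z))))"

text \<open>All that the multidimensional argument has to know about one coordinate; Poisson
  measures and jump densities do not occur beyond this interface.\<close>

locale scored =
 fixes M :: "'w measure" and Z :: "real => 'w => real" and ta :: real
  and Om :: "(((real \<times> real) \<times> 'w) \<times> real) measure" and sc :: "((real \<times> real) \<times> 'w) \<times> real => real"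
 assumes Om_prob: "prob_space Om" and Om_sets: "sets Om = sets (((lborel \<Otimes>\<^sub>M lborel) \<Otimes>\<^sub>M M) \<Otimes>\<^sub>M lborel)"
  and sc_int: "integrable Om sc"
  and Om_ibp: "!!F F' C. F : bmf Om ==> (!!u x. ((%y. F (u, y)) has_real_derivative F' (u, x)) (at x)) ==>
   (!!z. \<bar>F z\<bar> <= C) ==> (!!z. \<bar>F' z\<bar> <= C) ==> (LINT z|Om. F' z) = - (LINT z|Om. F z * sc z)"
  and Om_law: "distr Om (PiM UNIV (%_. borel)) (%z i. Z (dyadic i) (snd (fst z)) + snd z * indi {jtime ta z..} (dyadic i))
   = distr M (PiM UNIV (%_. borel)) (%w i. Z (dyadic i) w)"
  and Om_null: "!!A. A : null_sets M ==> AE z in Om. snd (fst z) ~: A"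

lemma (in levy_score) scored_exists:
 "EX C>0. ALL ta. 0 < ta & ta <= 1 --> (EX Om sc. scored M Z ta Om sc & (LINT z|Om. \<bar>sc z\<bar>) <= C * ta powr (1 / 2 - ka / ro))"
proof -
 obtain C where C: "0 < C" "!!ta. 0 < ta ==> ta <= 1 ==>
   (\<integral>\<^sup>+ t. indi {0..} t * ennreal (exp (- ta * (LINT x|m. 1 - exp (- t * V x)))) \<partial>lborel) <= ennreal (C * ta powr (- 2 * ka / ro))"
  using exp_aa_integral by blast
 let ?C = "2 + 5 * (LINT x|lborel. QQ x) * C"
 have "0 <= (LINT x|lborel. QQ x)" using QQ_nonneg by (intro integral_nonneg_AE) auto
 then have "0 < ?C" using C(1) by (smt (verit) mult_nonneg_nonneg)
 moreover have "EX Om sc. scored M Z ta Om sc & (LINT z|Om. \<bar>sc z\<bar>) <= ?C * ta powr (1 / 2 - ka / ro)" if ta: "0 < ta" "ta <= 1" for ta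
 proof -
  interpret S: score_space M Z N m p de ka ro ta by unfold_locales (use ta in auto)
  have sets: "sets S.D.Om = sets (S.D.B0 \<Otimes>\<^sub>M lborel)" by (rule S.D.sets_Om)
  have i: "integrable S.D.Om S.sc" and b: "(LINT z|S.D.Om. \<bar>S.sc z\<bar>) <= ?C * ta powr (1 / 2 - ka / ro)"
   using S.sc_bound[OF C(1)] C(2)[OF ta] by (auto simp: S.D.aa_def)
  let ?f = "%z i. Z (dyadic i) (snd (fst z)) + snd z * indi {jtime ta z..} (dyadic i) :: real"
  have "scored M Z ta S.D.Om S.sc"
  proof
   have 1: "S.D.opath : S.D.Om \<rightarrow>\<^sub>M PiM UNIV (%_. borel)"
    using measurable_PiM_single'[of UNIV "%i p. S.D.opath p i" S.D.Om "%_. borel"] S.D.opath_meas1 by simp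
   have "(%z. ?f z i) : bmf (S.D.B0 \<Otimes>\<^sub>M lborel)" for i
   proof -
    have [measurable]: "(%z. Z (dyadic i) (snd (fst z))) : bmf (S.D.B0 \<Otimes>\<^sub>M lborel)"
     by (rule measurable_compose[OF _ S.D.Zd_meas]) measurable
    have "(%z. ?f z i) = (%z. Z (dyadic i) (snd (fst z)) + snd z * indi {..dyadic i} (jtime ta z))" by (auto simp: indicator_def)
    also have "... : bmf (S.D.B0 \<Otimes>\<^sub>M lborel)" unfolding jtime_def by measurable
    finally show ?thesis .
   qed
   then have 2: "?f : S.D.Om \<rightarrow>\<^sub>M PiM UNIV (%_. borel)"
    unfolding measurable_cong_sets[OF sets refl] by (rule measurable_PiM_single') auto
   have "AE z in S.D.Om. ?f z = S.D.opath z"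
    using S.Om_AE(1) by eventually_elim (auto simp: fun_eq_iff S.D.opath_def jtime_def indicator_def)
   from distr_cong_AE[OF refl refl this 2 1] show "distr S.D.Om (PiM UNIV (%_. borel)) ?f = distr M (PiM UNIV (%_. borel)) (%w i. Z (dyadic i) w)"
    by (simp add: S.D.opath_law)
   show "sets S.D.Om = sets (((lborel \<Otimes>\<^sub>M lborel) \<Otimes>\<^sub>M M) \<Otimes>\<^sub>M lborel)" using sets by (simp add: S.D.B0_def)
  qed (use S.Om_AE(2) i S.D.prob_space_Om S.sc_ibp(2)[OF i, unfolded measurable_cong_sets[OF sets[symmetric] refl]] in blast)+
  with b show ?thesis by blast
 qed
 ultimately show ?thesis by blast
qed

section \<open>From smooth to Borel functions\<close>

definition C1b :: "('a::euclidean_space => real) => bool" where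
 "C1b f \<longleftrightarrow> bounded (range f) & (EX f'. (ALL y. (f has_derivative (%h. f' y \<bullet> h)) (at y)) & continuous_on UNIV f' & bounded (range f'))"

lemma C1b_continuous: "C1b f ==> continuous_on UNIV f"
 unfolding C1b_def by (meson continuous_at_imp_continuous_on has_derivative_continuous)

lemma C1b_compose:
 assumes f: "C1b f" and ps: "!!s. (ps has_real_derivative ps' s) (at s)" "continuous_on UNIV ps'"
 shows "C1b (%y. ps (f y))"
proof -
 from f obtain f' where f': "!!y. (f has_derivative (%h. f' y \<bullet> h)) (at y)" "continuous_on UNIV f'" "bounded (range f')"
  and fb: "bounded (range f)" unfolding C1b_def by blast
 have bd: "bounded (range (%y. g (f y)))" if "continuous_on UNIV g" for g :: "real => real"
 proof -
  have "compact (g ` closure (range f))"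
   using fb that by (intro compact_continuous_image) (auto intro: continuous_on_subset)
  then show ?thesis by (rule bounded_subset[OF compact_imp_bounded]) (use closure_subset in fastforce)
 qed
 from bd[OF ps(2)] f'(3) obtain A B where AB: "!!y. \<bar>ps' (f y)\<bar> <= A" "!!y. norm (f' y) <= B" by (auto simp: bounded_iff)
 have "bounded (range (%y. ps' (f y) *R f' y))"
  unfolding bounded_iff using mult_mono[OF AB order_trans[OF abs_ge_zero AB(1)] norm_ge_zero] by auto
 moreover have d: "((%y. ps (f y)) has_derivative (%h. (ps' (f y) *R f' y) \<bullet> h)) (at y)" for y
  using has_derivative_compose[OF f'(1) ps(1)[unfolded has_field_derivative_def]] by simp
 moreover have "continuous_on UNIV (%y. ps' (f y) *R f' y)"
  by (intro continuous_intros f' continuous_on_compose2[OF ps(2)] C1b_continuous[OF f]) auto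
 moreover have "continuous_on UNIV ps" using DERIV_isCont[OF ps(1)] continuous_at_imp_continuous_on by blast
 ultimately show ?thesis
  unfolding C1b_def by (intro conjI exI[of _ "%y. ps' (f y) *R f' y"] allI bd d)
qed

lemma C1b_mult:
 assumes "C1b f" "C1b g" shows "C1b (%y. f y * g y)"
proof -
 from assms obtain f' g' where f: "!!y. (f has_derivative (%h. f' y \<bullet> h)) (at y)" "continuous_on UNIV f'" "bounded (range f')" "bounded (range f)"
  and g: "!!y. (g has_derivative (%h. g' y \<bullet> h)) (at y)" "continuous_on UNIV g'" "bounded (range g')" "bounded (range g)"
  unfolding C1b_def by blast
 from f(3,4) g(3,4) obtain A A' B B' where b: "!!y. norm (f' y) <= A'" "!!y. \<bar>f y\<bar> <= A" "!!y. norm (g' y) <= B'" "!!y. \<bar>g y\<bar> <= B"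
  by (auto simp: bounded_iff)
 have 1: "norm (f y *R g' y + g y *R f' y) <= A * B' + B * A'" for y
  using mult_mono[OF b(2,3) order_trans[OF abs_ge_zero b(2)] norm_ge_zero] mult_mono[OF b(4,1) order_trans[OF abs_ge_zero b(4)] norm_ge_zero]
  by (intro order_trans[OF norm_triangle_ineq add_mono]) auto
 have 2: "norm (f y * g y) <= A * B" for y
  unfolding norm_mult using mult_mono[OF b(2,4) order_trans[OF abs_ge_zero b(2)] abs_ge_zero] by auto
 have 3: "((%y. f y * g y) has_derivative (%h. (f y *R g' y + g y *R f' y) \<bullet> h)) (at y)" for y
  by (rule has_derivative_eq_rhs[OF has_derivative_mult[OF f(1) g(1)]]) (auto simp: inner_add_left algebra_simps)
 have 4: "continuous_on UNIV (%y. f y *R g' y + g y *R f' y)"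
  by (intro continuous_intros f g C1b_continuous assms)
 have "bounded (range (%y. f y * g y))" "bounded (range (%y. f y *R g' y + g y *R f' y))"
  unfolding bounded_iff using 1 2 by blast+
 then show ?thesis unfolding C1b_def by (intro conjI exI[of _ "%y. f y *R g' y + g y *R f' y"] allI 3 4)
qed

text \<open>\<open>arctan\<close> makes the coordinate bounded without changing its order, and the
  squared positive part is nonzero exactly on the open half-space.\<close>

lemma C1b_halfspace: "C1b (%y :: 'a::euclidean_space. (max 0 (arctan (y \<bullet> i) - arctan a))\<^sup>2)"
proof (rule C1b_compose[where f="%y. arctan (y \<bullet> i)" and ps="%s. (max 0 (s - arctan a))\<^sup>2"])
 have "((%y. arctan (y \<bullet> i)) has_derivative (%h. (inverse (1 + (y \<bullet> i)\<^sup>2) *R i) \<bullet> h)) (at y)" for y :: 'a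
  using has_derivative_compose[OF bounded_linear.has_derivative[OF bounded_linear_inner_left has_derivative_ident] DERIV_arctan[unfolded has_field_derivative_def], of i y UNIV]
  by (simp add: inner_commute)
 note d = this
 have "inverse (1 + (y \<bullet> i)\<^sup>2) <= 1" for y :: 'a by (simp add: inverse_le_1_iff)
 then have b: "norm (inverse (1 + (y \<bullet> i)\<^sup>2) *R i) <= norm i" for y :: 'a
  using mult_right_mono[of "inverse (1 + (y \<bullet> i)\<^sup>2)" 1 "norm i"] by (simp add: abs_of_nonneg)
 have "1 + (y \<bullet> i)\<^sup>2 ~= 0" for y :: 'a by (smt (verit) zero_le_power2)
 then have c: "continuous_on UNIV (%y::'a. inverse (1 + (y \<bullet> i)\<^sup>2) *R i)" by (intro continuous_intros) auto
 have "\<bar>arctan (y \<bullet> i)\<bar> <= pi" for y :: 'a using arctan_bounded[of "y \<bullet> i"] pi_gt_zero by linarith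
 then have "bounded (range (%y::'a. arctan (y \<bullet> i)))" unfolding bounded_iff by auto
 moreover have "bounded (range (%y::'a. inverse (1 + (y \<bullet> i)\<^sup>2) *R i))" unfolding bounded_iff using b by blast
 ultimately show "C1b (%y::'a. arctan (y \<bullet> i))"
  unfolding C1b_def by (intro conjI exI[of _ "%y. inverse (1 + (y \<bullet> i)\<^sup>2) *R i"] allI c d)
 show "((%s. (max 0 (s - arctan a))\<^sup>2) has_real_derivative 2 * max 0 (s - arctan a)) (at s)" for s
  by (rule DERIV_cong[OF DERIV_chain2[OF bump_sq_deriv]]) (auto intro!: derivative_eq_intros)
 show "continuous_on UNIV (%s. 2 * max 0 (s - arctan a))" by (intro continuous_intros)
qed

lemma C1b_const: "C1b (%_. c)"
proof -
 have "((%_. c) has_derivative (%h. 0 \<bullet> h)) (at y)" for y :: 'a by (simp only: inner_zero_left has_derivative_const)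
 note d = this
 show ?thesis unfolding C1b_def by (intro conjI exI[of _ "%_. 0"] allI d) auto
qed

text \<open>This generator is stable under intersections, as products of \<open>C1b\<close>
  functions show, and the indicators of its sets are bounded limits of \<open>C1b\<close> functions:
  both are needed for the induction over Borel sets.\<close>

lemma sets_borel_C1b: "sets (borel :: 'a::euclidean_space measure) = sigma_sets UNIV {{y. f y ~= 0} | f. C1b f}"
proof (rule equalityI)
 have "{x :: 'a. a < x \<bullet> i} : {{y. f y ~= 0} | f. C1b f}" for a i
 proof -
  have e: "(max 0 (arctan u - arctan a))\<^sup>2 ~= 0 \<longleftrightarrow> a < u" for u
   using arctan_less_iff[of a u] by (auto simp: max_def simp del: arctan_less_iff)
  have "{x :: 'a. a < x \<bullet> i} = {x. (max 0 (arctan (x \<bullet> i) - arctan a))\<^sup>2 ~= 0}"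
   by (simp only: e)
  then show ?thesis by (intro CollectI exI conjI) (assumption, rule C1b_halfspace)
 qed
 then show "sets (borel :: 'a measure) \<subseteq> sigma_sets UNIV {{y. f y ~= 0} | f. C1b f}"
  unfolding borel_eq_halfspace_greater by (subst sets_measure_of) (auto intro!: sigma_sets_mono')
 have "{y :: 'a. f y ~= 0} : sets borel" if "C1b f" for f
  using open_Collect_neq[OF C1b_continuous[OF that] continuous_on_const, of 0] by auto
 then show "sigma_sets UNIV {{y. f y ~= 0} | f. C1b f} \<subseteq> sets (borel :: 'a measure)"
  by (intro sets.sigma_sets_subset[of _ borel, simplified]) auto
qed

text \<open>An abstract family of laws with a derivative formula for smooth functions. The majorant
  \<open>G\<close> is the same for all starting points, which yields every passage to the limit in
  \<open>x\<close>.\<close>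

locale smoothing = prob_space P for P :: "'o measure" +
 fixes Ph :: "'a::euclidean_space => 'o => 'a" and W :: "'a => 'o => 'a" and G :: "'o => real"
 assumes Ph_meas[measurable]: "!!x. Ph x : bmf P" and W_meas[measurable]: "!!x. W x : bmf P"
  and Ph_cont: "!!w. continuous_on UNIV (%x. Ph x w)" and W_cont: "!!w. continuous_on UNIV (%x. W x w)"
  and W_le: "!!x w. norm (W x w) <= G w" and G_int: "integrable P G"
  and C1b_formula: "!!f x h. C1b f ==> ((%t. \<integral>w. f (Ph (x + t *R h) w) \<partial>P) has_real_derivative (LINT w|P. f (Ph x w) *R W x w) \<bullet> h) (at 0)"
begin

definition F :: "('a => real) => 'a => real" where "F f x = (LINT w|P. f (Ph x w))"

definition v :: "('a => real) => 'a => 'a" where "v f x = (LINT w|P. f (Ph x w) *R W x w)"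

abbreviation "K == \<integral>w. G w \<partial>P"

text \<open>The derivative formula integrated along segments. Unlike the pointwise derivative it
  survives bounded pointwise limits; differentiability is recovered at the end from continuity of
  \<open>v f\<close>.\<close>

definition good :: "('a => real) => bool" where
 "good f \<longleftrightarrow> f : bm & bounded (range f) & (ALL x h. (%s. v f (x + s *R h) \<bullet> h) : bm &
   F f (x + h) - F f x = (LINT s|lborel. indi {0..1} s *R (v f (x + s *R h) \<bullet> h)))"

lemma G_nonneg: "0 <= G w" using W_le[of undefined w] norm_ge_zero order_trans by blast

lemma fW_int:
 fixes f :: "'a => real"
 assumes [measurable]: "f : bm" and b: "!!y. \<bar>f y\<bar> <= c"
 shows "integrable P (%w. f (Ph x w) *R W x w)" "norm (v f x) <= c * K"
proof -
 have le: "norm (f (Ph x w) *R W x w) <= c * G w" for w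
  using mult_mono[OF b W_le order_trans[OF abs_ge_zero b] norm_ge_zero] by simp
 show i: "integrable P (%w. f (Ph x w) *R W x w)"
  by (rule int_bound[OF integrable_mult_right[OF G_int, of c]])
   (auto intro!: AE_I2 order_trans[OF le[unfolded norm_scaleR]])
 have "norm (v f x) <= (LINT w|P. c * G w)"
  unfolding v_def by (rule order_trans[OF integral_norm_bound integral_mono[OF integrable_norm[OF i] integrable_mult_right[OF G_int] le]])
 then show "norm (v f x) <= c * K" by simp
qed

lemma f_int: fixes f :: "'a => real" assumes [measurable]: "f : bm" and b: "!!y. \<bar>f y\<bar> <= c" shows "integrable P (%w. f (Ph x w))"
 by (rule integrable_const_bound[where B=c]) (use b in auto)

lemma bounded_rangeD: "bounded (range f) ==> EX c. ALL y. \<bar>f y\<bar> <= c" for f :: "'a => real" by (auto simp: bounded_iff)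

lemma v_lin:
 assumes "f : bm" "bounded (range f)" "g : bm" "bounded (range g)"
 shows "v (%y. a * f y + g y) x = a *R v f x + v g x" "F (%y. a * f y + g y) x = a * F f x + F g x"
proof -
 obtain c d where b: "!!y. \<bar>f y\<bar> <= c" "!!y. \<bar>g y\<bar> <= d" using assms bounded_rangeD by metis
 show "v (%y. a * f y + g y) x = a *R v f x + v g x" "F (%y. a * f y + g y) x = a * F f x + F g x"
  using fW_int(1)[OF assms(1) b(1), of x] fW_int(1)[OF assms(3) b(2), of x] f_int[OF assms(1) b(1), of x] f_int[OF assms(3) b(2), of x]
  by (simp_all add: v_def F_def scaleR_add_left flip: scaleR_scaleR)
qed

lemma seg_int:
 assumes "(%s. u s \<bullet> h) : bm" "!!s. norm (u s) <= c"
 shows "integrable lborel (%s. indi {0..1::real} s *R (u s \<bullet> h))"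
  "!!s. norm (indi {0..1::real} s *R (u s \<bullet> h)) <= indi {0..1} s * (c * norm h)"
proof -
 show le: "norm (indi {0..1::real} s *R (u s \<bullet> h)) <= indi {0..1} s * (c * norm h)" for s
  using Cauchy_Schwarz_ineq2[of "u s" h] mult_right_mono[OF assms(2)[of s] norm_ge_zero[of h]] by (auto simp: indicator_def)
 show "integrable lborel (%s. indi {0..1::real} s *R (u s \<bullet> h))"
  by (rule int_bound[where f="%s. indi {0..1::real} s * (c * norm h)"])
   (use assms(1) in \<open>auto intro!: AE_I2 order_trans[OF le[unfolded real_norm_def real_scaleR_def]] integrable_mult_left integrable_real_indicator\<close>)
qed

lemma good_lin: assumes "good f" "good g" shows "good (%y. a * f y + g y)"
proof -
 have m: "f : bm" "bounded (range f)" "g : bm" "bounded (range g)"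
  using assms by (auto simp: good_def)
 obtain c d where b: "!!y. \<bar>f y\<bar> <= c" "!!y. \<bar>g y\<bar> <= d" using m bounded_rangeD by metis
 have "\<bar>a * f y + g y\<bar> <= \<bar>a\<bar> * c + d" for y
  using abs_triangle_ineq[of "a * f y" "g y"] mult_left_mono[OF b(1)[of y] abs_ge_zero[of a]] b(2)[of y] by (simp add: abs_mult)
 then have "bounded (range (%y. a * f y + g y))" by (auto simp: bounded_iff)
 moreover have "F (%y. a * f y + g y) (x + h) - F (%y. a * f y + g y) x = (LINT s|lborel. indi {0..1} s *R (v (%y. a * f y + g y) (x + s *R h) \<bullet> h))" for x h
 proof -
  have i: "integrable lborel (%s. indi {0..1::real} s *R (v f (x + s *R h) \<bullet> h))" "integrable lborel (%s. indi {0..1::real} s *R (v g (x + s *R h) \<bullet> h))"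
   by (rule seg_int(1)[OF _ fW_int(2)[OF m(1) b(1)]] seg_int(1)[OF _ fW_int(2)[OF m(3) b(2)]], use assms in \<open>simp add: good_def\<close>)+
  have "F (%y. a * f y + g y) (x + h) - F (%y. a * f y + g y) x = a * (F f (x + h) - F f x) + (F g (x + h) - F g x)"
   by (simp only: v_lin(2)[OF m]) (simp add: algebra_simps)
  also have "... = (LINT s|lborel. a * (indi {0..1} s *R (v f (x + s *R h) \<bullet> h)) + indi {0..1} s *R (v g (x + s *R h) \<bullet> h))"
   using assms i by (simp add: good_def)
  finally show ?thesis by (simp only: v_lin(1)[OF m]) (simp add: inner_add_left algebra_simps)
 qed
 moreover have "(%s. v f (x + s *R h) \<bullet> h) : bm" "(%s. v g (x + s *R h) \<bullet> h) : bm" for x h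
  using assms by (auto simp: good_def)
 then have "(%s. a * (v f (x + s *R h) \<bullet> h) + v g (x + s *R h) \<bullet> h) : bm" for x h
  by (intro borel_measurable_add borel_measurable_times borel_measurable_const)
 ultimately show ?thesis using m unfolding good_def v_lin(1)[OF m] by (auto simp: inner_add_left)
qed

lemma good_lim:
 assumes g: "!!n. good (f n)" and b: "!!n y. \<bar>f n y\<bar> <= c" and lim: "!!y. (%n. f n y) ----> l y"
 shows "good l"
proof -
 have [measurable]: "f n : bm" for n using g by (simp add: good_def)
 have [measurable]: "l : bm" by (rule borel_measurable_LIMSEQ_metric[OF _ lim]) measurable
 have lb: "\<bar>l y\<bar> <= c" for y by (rule LIMSEQ_le_const2[OF tendsto_rabs[OF lim]]) (use b in auto)
 have F: "(%n. F (f n) x) ----> F l x" for x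
  unfolding F_def by (rule integral_dominated_convergence[where w="%_. c"]) (use b lim in auto)
 have v: "(%n. v (f n) x) ----> v l x" for x
  unfolding v_def
 proof (rule integral_dominated_convergence[where w="%u. c * G u"])
  show "AE u in P. norm (f n (Ph x u) *R W x u) <= c * G u" for n
   using mult_mono[OF b W_le order_trans[OF abs_ge_zero b] norm_ge_zero] by (auto intro!: AE_I2)
 qed (use G_int lim in \<open>auto intro!: tendsto_intros\<close>)
 have fm[measurable]: "(%s. v (f n) (x + s *R h) \<bullet> h) : bm" for n x h using g by (simp add: good_def)
 have lm[measurable]: "(%s. v l (x + s *R h) \<bullet> h) : bm" for x h
  by (rule borel_measurable_LIMSEQ_metric[where f="%n s. v (f n) (x + s *R h) \<bullet> h"]) (use v in \<open>auto intro!: tendsto_intros\<close>)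
 have "F l (x + h) - F l x = (LINT s|lborel. indi {0..1} s *R (v l (x + s *R h) \<bullet> h))" for x h
 proof (rule LIMSEQ_unique)
  show "(%n. F (f n) (x + h) - F (f n) x) ----> F l (x + h) - F l x" by (intro tendsto_intros F)
  have "(%n. \<integral>s. indi {0..1} s *R (v (f n) (x + s *R h) \<bullet> h) \<partial>lborel) ----> (LINT s|lborel. indi {0..1} s *R (v l (x + s *R h) \<bullet> h))"
  proof (rule integral_dominated_convergence[where w="%s. indi {0..1} s * (c * K * norm h)"])
   show "AE s in lborel. norm (indi {0..1::real} s *R (v (f n) (x + s *R h) \<bullet> h)) <= indi {0..1} s * (c * K * norm h)" for n
    by (intro AE_I2 seg_int(2)[OF fm] fW_int(2)[OF _ b]) measurable
  qed (auto intro!: tendsto_intros v integrable_mult_left integrable_real_indicator)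
  then show "(%n. F (f n) (x + h) - F (f n) x) ----> (LINT s|lborel. indi {0..1} s *R (v l (x + s *R h) \<bullet> h))"
   using g by (simp add: good_def)
 qed
 then show ?thesis using lb by (auto simp: good_def bounded_iff)
qed

lemma good_C1b: assumes f: "C1b f" shows "good f"
proof -
 have m[measurable]: "f : bm" by (rule borel_measurable_continuous_onI[OF C1b_continuous[OF f]])
 have bd: "bounded (range f)" using f by (simp add: C1b_def)
 then obtain c where b: "!!y. \<bar>f y\<bar> <= c" using bounded_rangeD by metis
 have cv: "continuous_on UNIV (v f)"
  unfolding continuous_on_sequentially
 proof (intro allI ballI impI, elim conjE)
  fix x and X :: "nat => 'a" assume X: "X ----> x"
  have "(%n. v f (X n)) ----> v f x" unfolding v_def
  proof (rule integral_dominated_convergence[where w="%u. c * G u"])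
   show "AE u in P. norm (f (Ph (X n) u) *R W (X n) u) <= c * G u" for n
    using mult_mono[OF b W_le order_trans[OF abs_ge_zero b] norm_ge_zero] by (auto intro!: AE_I2)
   show "AE u in P. (%n. f (Ph (X n) u) *R W (X n) u) ----> f (Ph x u) *R W x u"
    using X by (intro AE_I2 tendsto_intros continuous_on_tendsto_compose[OF C1b_continuous[OF f]] continuous_on_tendsto_compose[OF Ph_cont] continuous_on_tendsto_compose[OF W_cont]) auto
  qed (use G_int in auto)
  then show "(v f \<circ> X) ----> v f x" by (simp add: o_def)
 qed
 have ch: "continuous_on UNIV (%s. v f (x + s *R h) \<bullet> h)" for x h
  by (intro continuous_intros continuous_on_compose2[OF cv]) auto
 have "F f (x + h) - F f x = (LINT s|lborel. indi {0..1} s *R (v f (x + s *R h) \<bullet> h))" for x h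
 proof -
  have d: "((%s. F f (x + s *R h)) has_real_derivative v f (x + s *R h) \<bullet> h) (at s)" for s
   using C1b_formula[OF f, of "x + s *R h" h] DERIV_shift[of "%s. F f (x + s *R h)" _ 0 s]
   by (simp add: F_def v_def algebra_simps)
  have "((%s. v f (x + s *R h) \<bullet> h) has_integral F f (x + 1 *R h) - F f (x + 0 *R h)) {0..1}"
   by (rule fundamental_theorem_of_calculus)
    (use d in \<open>auto simp: has_real_derivative_iff_has_vector_derivative intro: has_vector_derivative_at_within\<close>)
  moreover have si: "set_integrable lborel {0..1} (%s. v f (x + s *R h) \<bullet> h)"
   by (rule borel_integrable_atLeastAtMost') (rule continuous_on_subset[OF ch], simp)
  ultimately show ?thesis
   using set_borel_integral_eq_integral(2)[OF si] by (simp add: integral_unique set_lebesgue_integral_def)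
 qed
 then show ?thesis using borel_measurable_continuous_onI[OF ch] m bd by (auto simp: good_def)
qed

lemma good_indicator: assumes "B : sets borel" shows "good (indicat_real B)"
proof -
 let ?P = "{{y :: 'a. f y ~= 0} | f. C1b f}"
 have "Int_stable ?P"
 proof (rule Int_stableI)
  fix A B assume "A : ?P" "B : ?P"
  then obtain f g where "A = {y. f y ~= 0}" "B = {y. g y ~= 0}" "C1b f" "C1b g" by blast
  then show "A \<inter> B : ?P" using C1b_mult[of f g] by (intro CollectI exI[of _ "%y. f y * g y"]) auto
 qed
 moreover have "?P \<subseteq> Pow UNIV" by simp
 moreover have "B : sigma_sets UNIV ?P" using assms unfolding sets_borel_C1b .
 ultimately show ?thesis
 proof (induction rule: sigma_sets_induct_disjoint)
  case (basic A)
  then obtain f where A: "A = {y. f y ~= 0}" and f: "C1b f" by blast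
  \<comment> \<open>Smooth functions of \<open>s\<close> that converge to the indicator of
    \<open>s ~= 0\<close> and stay in \<open>[0,1]\<close>.\<close>
  define ps where "ps n s = 1 - 1 / (1 + real n * s\<^sup>2)" for n s
  have p: "0 < 1 + real n * s\<^sup>2" for n s by (smt (verit) mult_nonneg_nonneg of_nat_0_le_iff zero_le_power2)
  have g: "good (%y. ps n (f y))" for n
  proof (rule good_C1b[OF C1b_compose[OF f]])
   show "(ps n has_real_derivative 2 * real n * s / (1 + real n * s\<^sup>2)\<^sup>2) (at s)" for s
    unfolding ps_def using p[of n s] by (auto intro!: derivative_eq_intros simp: power2_eq_square)
   show "continuous_on UNIV (%s. 2 * real n * s / (1 + real n * s\<^sup>2)\<^sup>2)"
    using p[of n] by (intro continuous_intros) (auto simp: less_le)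
  qed
  show ?case
  proof (rule good_lim[OF g, where c=1])
   show "\<bar>ps n (f y)\<bar> <= 1" for n y using p[of n "f y"] by (auto simp: ps_def field_simps)
   have "(%n. 1 - 1 / (1 + real n * s\<^sup>2)) ----> 1" if "s ~= 0" for s :: real
   proof -
    have "0 < s\<^sup>2" using that by simp
    then show ?thesis by real_asymp
   qed
   then show "(%n. ps n (f y)) ----> indi A y" for y by (auto simp: ps_def A indicator_def)
  qed
 next
  case empty show ?case using good_C1b[OF C1b_const, of 0] by (simp add: indicator_def)
 next
  case (compl A)
  have "indicat_real (UNIV - A) = (%y. -1 * indi A y + 1)" by (auto simp: indicator_def)
  then show ?case using good_lin[OF compl(2) good_C1b[OF C1b_const], of "- 1" 1] by simp
 next
  case (union A)
  have "good (%y. SUM i<n. indi (A i) y)" for n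
  proof (induction n)
   case (Suc n)
   show ?case using good_lin[OF union(3)[of n] Suc, of 1] by (simp add: add.commute)
  qed (use good_C1b[OF C1b_const, of 0] in simp)
  moreover have s: "(SUM i<n. indi (A i) y) = indicat_real (\<Union>i<n. A i) y" for n y
   using union(1) by (subst indicator_UN_disjoint) (auto simp: disjoint_family_on_def)
  ultimately have g: "good (%y. indicat_real (\<Union>i<n. A i) y)" for n by (simp only:)
  show ?case by (rule good_lim[OF g, where c=1]) (auto intro: LIMSEQ_indicator_UN)
 qed
qed

text \<open>An indicator is bounded by \<open>1\<close>, hence \<open>v\<close> by \<open>K\<close>,
  and the integrated formula gives a Lipschitz bound uniform in \<open>B\<close>, that is, for the
  total variation of the laws.\<close>

lemma law_lipschitz:
 assumes B: "B : sets borel" shows "\<bar>F (indi B) y - F (indi B) x\<bar> <= K * norm (y - x)"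
proof -
 let ?g = "%s. indi {0..1} s *R (v (indi B) (x + s *R (y - x)) \<bullet> (y - x))"
 have g: "good (indicat_real B)" by (rule good_indicator[OF B])
 then have m: "(%s. v (indi B) (x + s *R (y - x)) \<bullet> (y - x)) : bm" by (simp add: good_def)
 have b: "norm (v (indi B) z) <= K" for z using fW_int(2)[of "indi B" 1 z] B by (auto simp: indicator_def)
 have "F (indi B) (x + (y - x)) - F (indi B) x = (LINT s|lborel. ?g s)" using g unfolding good_def by blast
 then have "\<bar>F (indi B) y - F (indi B) x\<bar> = norm (LINT s|lborel. ?g s)" by simp
 also have "... <= (LINT s|lborel. indi {0..1::real} s * (K * norm (y - x)))"
 proof (rule order_trans[OF integral_norm_bound integral_mono])
  show "integrable lborel (%s. norm (?g s))" by (rule integrable_norm[OF seg_int(1)[OF m b]])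
  show "norm (?g s) <= indi {0..1} s * (K * norm (y - x))" for s by (rule seg_int(2)[OF m b])
 qed (auto intro!: integrable_mult_left integrable_real_indicator)
 also have "... = K * norm (y - x)" by simp
 finally show ?thesis .
qed

text \<open>By outer regularity \<open>B\<close> is close to an open set \<open>U\<close> for the law at \<open>x\<close>, and by \<open>law_lipschitz\<close> also for the laws at
nearby points; for \<open>U\<close> pointwise convergence gives one inclusion and equality of the limiting masses the other.\<close>

lemma law_conv:
 assumes B[measurable]: "B : sets borel" and X: "X ----> x"
 shows "(%n. measure P {u:space P. (Ph (X n) u : B) ~= (Ph x u : B)}) ----> 0"
proof (rule tendstoI)
 fix e :: real assume e: "0 < e"
 have mF: "measure P {u:space P. Ph y u : A} = F (indi A) y" "measure (distr P borel (Ph y)) A = F (indi A) y" if [measurable]: "A : sets borel" for y A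
 proof -
  have "F (indi A) y = (LINT u|P. indi {u:space P. Ph y u : A} u)"
   unfolding F_def by (intro int_cong refl) (auto simp: indicator_def)
  then show "measure P {u:space P. Ph y u : A} = F (indi A) y" by simp
  then show "measure (distr P borel (Ph y)) A = F (indi A) y" by (simp add: measure_distr vimage_def Int_def conj_commute)
 qed
 interpret D: prob_space "distr P borel (Ph x)" by (rule prob_space_distr) measurable
 have "emeasure (distr P borel (Ph x)) B < emeasure (distr P borel (Ph x)) B + ennreal (e / 8)"
  using e by (auto simp: D.emeasure_eq_measure intro!: ennreal_lessI add_nonneg_pos simp flip: ennreal_plus)
 moreover have "emeasure (distr P borel (Ph x)) B = (INF U\<in>{U. B \<subseteq> U & open U}. emeasure (distr P borel (Ph x)) U)"
  by (rule outer_regular) (use D.emeasure_space_1 in auto)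
 ultimately obtain U where U: "B \<subseteq> U" "open U" "emeasure (distr P borel (Ph x)) U < emeasure (distr P borel (Ph x)) B + ennreal (e / 8)"
  by (auto simp: INF_less_iff)
 have [measurable]: "U : sets borel" using U(2) by auto
 have UB: "F (indi (U - B)) x <= e / 8"
 proof -
  have "D.prob U < D.prob B + e / 8"
   using U(3) e by (simp add: D.emeasure_eq_measure ennreal_less_iff flip: ennreal_plus)
  moreover have "D.prob (U - B) = D.prob U - D.prob B" by (rule D.finite_measure_Diff) (use U in auto)
  moreover have "D.prob (U - B) = F (indi (U - B)) x" by (rule mF) measurable
  ultimately show ?thesis by linarith
 qed
 define a where "a n = measure P {u:space P. Ph x u : U & Ph (X n) u ~: U}" for n
 have a: "a ----> 0"
 proof -
  have "(%n. \<integral>u. indicat_real {u:space P. Ph x u : U & Ph (X n) u ~: U} u \<partial>P) ----> (LINT u|P. 0)"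
  proof (rule integral_dominated_convergence[where w="%_. 1"])
   show "AE u in P. (%n. indicat_real {u:space P. Ph x u : U & Ph (X n) u ~: U} u) ----> 0"
   proof (rule AE_I2)
    fix u
    have "(%n. Ph (X n) u) ----> Ph x u" using X by (intro continuous_on_tendsto_compose[OF Ph_cont]) auto
    then have "\<forall>\<^sub>F n in sequentially. Ph x u : U --> Ph (X n) u : U" using topological_tendstoD U(2) by (cases "Ph x u : U") auto
    then show "(%n. indicat_real {u:space P. Ph x u : U & Ph (X n) u ~: U} u) ----> 0"
     by (intro tendsto_eventually) (auto elim!: eventually_mono)
   qed
  qed auto
  then show ?thesis by (simp add: a_def[abs_def])
 qed
 have d: "(%n. K * norm (X n - x)) ----> 0"
  using X by (intro tendsto_mult_right_zero tendsto_norm_zero) (simp add: LIM_zero)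
 have "0 < e / 8" using e by simp
 from tendstoD[OF a this] tendstoD[OF d this]
 show "\<forall>\<^sub>F n in sequentially. dist (measure P {u:space P. (Ph (X n) u : B) ~= (Ph x u : B)}) 0 < e"
 proof eventually_elim
  case (elim n)
  let ?A = "{u:space P. Ph x u : U & Ph (X n) u ~: U}" and ?A' = "{u:space P. Ph (X n) u : U & Ph x u ~: U}"
   and ?C = "{u:space P. Ph (X n) u : U - B}" and ?D = "{u:space P. Ph x u : U - B}" and ?I = "{u:space P. Ph (X n) u : U & Ph x u : U}"
  have "measure P {u:space P. (Ph (X n) u : B) ~= (Ph x u : B)} <= measure P ((?A \<union> ?A') \<union> (?C \<union> ?D))"
   using U(1) by (intro finite_measure_mono) auto
  also have "... <= (measure P ?A + measure P ?A') + (measure P ?C + measure P ?D)"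
   by (intro order_trans[OF measure_Un_le] add_mono measure_Un_le) auto
  finally have 1: "measure P {u:space P. (Ph (X n) u : B) ~= (Ph x u : B)} <= (measure P ?A + measure P ?A') + (measure P ?C + measure P ?D)" .
  have "measure P (?I \<union> ?A') = measure P ?I + measure P ?A'" "measure P (?I \<union> ?A) = measure P ?I + measure P ?A"
   by (rule finite_measure_Union; auto)+
  moreover have "?I \<union> ?A' = {u:space P. Ph (X n) u : U}" "?I \<union> ?A = {u:space P. Ph x u : U}" by auto
  ultimately have 2: "measure P ?A' = F (indi U) (X n) - F (indi U) x + measure P ?A"
   using mF(1)[OF \<open>U : sets borel\<close>] by simp
  have 3: "measure P ?C = F (indi (U - B)) (X n)" "measure P ?D = F (indi (U - B)) x" by (rule mF; measurable)+
  have "\<bar>F (indi U) (X n) - F (indi U) x\<bar> <= K * norm (X n - x)" "\<bar>F (indi (U - B)) (X n) - F (indi (U - B)) x\<bar> <= K * norm (X n - x)"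
   by (rule law_lipschitz, measurable)+
  moreover have "measure P ?A < e / 8" "K * norm (X n - x) < e / 8" using elim by (auto simp: a_def dist_real_def)
  ultimately have "measure P {u:space P. (Ph (X n) u : B) ~= (Ph x u : B)} < e" using 1 2 3 UB e by linarith
  then show ?case by simp
 qed
qed

text \<open>The indicator factor changes only on \<open>D n\<close>, whose probability tends to
  \<open>0\<close>. Truncating \<open>G\<close> at a level \<open>k\<close> turns this into
  convergence of the integral of \<open>G\<close> over \<open>D n\<close>; the variation of
  \<open>W\<close> is handled by dominated convergence.\<close>

lemma v_indicator_cont: assumes B[measurable]: "B : sets borel" shows "continuous_on UNIV (v (indi B))"
 unfolding continuous_on_sequentially
proof (intro allI ballI impI, elim conjE)
 fix x and X :: "nat => 'a" assume X: "X ----> x"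
 define D where "D n = {u:space P. (Ph (X n) u : B) ~= (Ph x u : B)}" for n
 have [measurable]: "D n : sets P" "G : bmf P" for n using G_int by (auto simp: D_def)
 have iD: "integrable P (%u. indi (D n) u * G u)" for n
  using integrable_mult_indicator[OF _ G_int, of "D n"] by simp
 have t1: "(%n. \<integral>u. indi (D n) u * G u \<partial>P) ----> 0"
 proof (rule tendstoI)
  fix e :: real assume e: "0 < e"
  have "(%k. \<integral>u. max 0 (G u - real k) \<partial>P) ----> (LINT u|P. 0)"
  proof (rule integral_dominated_convergence[where w=G])
   show "AE u in P. (%k. max 0 (G u - real k)) ----> 0"
   proof (rule AE_I2)
    fix u obtain k where k: "G u <= real k" using real_arch_simple by blast
    have "\<forall>\<^sub>F n in sequentially. max 0 (G u - real n) = 0" using eventually_ge_at_top[of k] by eventually_elim (use k in auto)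
    then show "(%k. max 0 (G u - real k)) ----> 0" by (rule tendsto_eventually)
   qed
  qed (use G_int G_nonneg in auto)
  then have "\<forall>\<^sub>F k in sequentially. (LINT u|P. max 0 (G u - real k)) < e / 2" using e by (intro order_tendstoD) auto
  then obtain k where k: "(LINT u|P. max 0 (G u - real k)) < e / 2" by (auto dest: eventually_happens)
  have "(%n. real k * measure P (D n)) ----> real k * 0" unfolding D_def by (intro tendsto_intros law_conv X B)
  then have "\<forall>\<^sub>F n in sequentially. real k * measure P (D n) < e / 2" using e by (intro order_tendstoD) auto
  then show "\<forall>\<^sub>F n in sequentially. dist (LINT u|P. indi (D n) u * G u) 0 < e"
  proof eventually_elim
   case (elim n)
   have im: "integrable P (%u. max 0 (G u - real k))"
    by (rule int_bound[OF G_int]) (use G_nonneg in auto)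
   have ir: "integrable P (%u. real k * indi (D n) u)" by (intro integrable_mult_right integrable_real_indicator) (auto simp: less_top[symmetric])
   have "(LINT u|P. indi (D n) u * G u) <= (LINT u|P. real k * indi (D n) u + max 0 (G u - real k))"
    by (rule integral_mono[OF iD Bochner_Integration.integrable_add[OF ir im]]) (auto simp: indicator_def)
   also have "... = real k * measure P (D n) + (LINT u|P. max 0 (G u - real k))"
    using ir im by (simp add: Int_absorb2 sets.sets_into_space)
   finally have "(LINT u|P. indi (D n) u * G u) < e" using elim k by linarith
   moreover have "0 <= (LINT u|P. indi (D n) u * G u)" using G_nonneg by (intro integral_nonneg_AE) auto
   ultimately show ?case by simp
  qed
 qed
 have iW: "integrable P (%u. norm (W (X n) u - W x u))" for n
  by (rule int_bound[OF integrable_mult_right[OF G_int, of 2]])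
   (auto intro!: AE_I2 order_trans[OF norm_triangle_ineq4] simp: abs_of_nonneg G_nonneg intro: order_trans[OF add_mono[OF W_le W_le]])
 have t2: "(%n. \<integral>u. norm (W (X n) u - W x u) \<partial>P) ----> (LINT u|P. 0)"
 proof (rule integral_dominated_convergence[where w="%u. 2 * G u"])
  show "AE u in P. (%n. norm (W (X n) u - W x u)) ----> 0"
   using X by (intro AE_I2 tendsto_norm_zero LIM_zero continuous_on_tendsto_compose[OF W_cont]) auto
  show "AE u in P. norm (norm (W (X n) u - W x u)) <= 2 * G u" for n
  proof (rule AE_I2)
   fix u show "norm (norm (W (X n) u - W x u)) <= 2 * G u"
    using norm_triangle_ineq4[of "W (X n) u" "W x u"] W_le[of "X n" u] W_le[of x u] by simp
  qed
 qed (use G_int in auto)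
 have "norm (v (indi B) (X n) - v (indi B) x) <= (LINT u|P. indi (D n) u * G u) + (LINT u|P. norm (W (X n) u - W x u))" for n
 proof -
  have i: "integrable P (%u. indicat_real B (Ph y u) *R W y u)" for y
   by (rule fW_int(1)[where c=1]) (auto simp: indicator_def)
  have "norm (v (indi B) (X n) - v (indi B) x) = norm (LINT u|P. indicat_real B (Ph (X n) u) *R W (X n) u - indicat_real B (Ph x u) *R W x u)"
   using i by (simp add: v_def)
  also have "... <= (LINT u|P. indi (D n) u * G u + norm (W (X n) u - W x u))"
  proof (rule order_trans[OF integral_norm_bound integral_mono])
   fix u assume "u : space P"
   then show "norm (indicat_real B (Ph (X n) u) *R W (X n) u - indicat_real B (Ph x u) *R W x u) <= indi (D n) u * G u + norm (W (X n) u - W x u)"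
    using W_le by (auto simp: indicator_def D_def intro: add_increasing2)
  qed (use i iD iW in auto)
  finally show ?thesis using iD iW by simp
 qed
 note le = this
 have "(%n. (LINT u|P. indi (D n) u * G u) + (LINT u|P. norm (W (X n) u - W x u))) ----> 0"
  using tendsto_add[OF t1 t2] by simp
 then have "(%n. v (indi B) (X n) - v (indi B) x) ----> 0"
  by (rule Lim_null_comparison[OF always_eventually[OF allI[OF le]]])
 then show "(v (indi B) \<circ> X) ----> v (indi B) x" by (simp add: o_def LIM_zero_iff)
qed

lemma good_simple:
 assumes "finite I" "!!i. i : I ==> B i : sets borel"
 shows "good (%y. SUM i:I. c i * indi (B i) y) & continuous_on UNIV (v (%y. SUM i:I. c i * indi (B i) y))"
 using assms
proof (induction I)
 case empty
 then show ?case using good_C1b[OF C1b_const, of 0] by (simp add: v_def[abs_def])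
next
 case (insert i I)
 then have g: "good (indi (B i))" "good (%y. SUM i:I. c i * indi (B i) y)" "continuous_on UNIV (v (%y. SUM i:I. c i * indi (B i) y))"
  by (auto intro: good_indicator)
 have m: "v (%y. c i * indi (B i) y + (SUM i:I. c i * indi (B i) y)) = (%x. c i *R v (indi (B i)) x + v (%y. SUM i:I. c i * indi (B i) y) x)"
  by (rule ext, rule v_lin) (use g in \<open>auto simp only: good_def\<close>)
 have "continuous_on UNIV (%x. c i *R v (indi (B i)) x + v (%y. SUM i:I. c i * indi (B i) y) x)"
  by (intro continuous_intros g v_indicator_cont insert) simp
 then show ?case using good_lin[OF g(1,2), of "c i"] unfolding sum.insert[OF insert(1,2)] m by blast
qed

text \<open>Rounding \<open>f\<close> down to multiples of \<open>1 / Suc n\<close> approximates it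
  uniformly by simple functions, whose \<open>v\<close> is continuous. The majorant \<open>G\<close>
  makes \<open>v (g n)\<close> converge uniformly, so \<open>v f\<close> is continuous and the
  integrated formula can be differentiated.\<close>

theorem gradient_formula:
 assumes f: "f : bm" "bounded (range f)"
 shows "GDERIV (F f) x :> v f x"
proof -
 note [measurable] = f(1)
 obtain c where c: "!!y. \<bar>f y\<bar> <= c" using bounded_rangeD[OF f(2)] by blast
 define B where "B n i = {y. \<lfloor>real (Suc n) * f y\<rfloor> = i}" for n i
 define I where "I n = {- \<lceil>real (Suc n) * c\<rceil> - 1..\<lceil>real (Suc n) * c\<rceil>}" for n
 define g where "g n y = (SUM i:I n. (of_int i / real (Suc n)) * indicat_real (B n i) y)" for n y
 have g: "good (g n) & continuous_on UNIV (v (g n))" for n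
  unfolding g_def by (rule good_simple) (auto simp: I_def B_def)
 have ge: "g n y = of_int \<lfloor>real (Suc n) * f y\<rfloor> / real (Suc n)" for n y
 proof -
  have "\<bar>real (Suc n) * f y\<bar> <= real (Suc n) * c" using c[of y] by (simp add: abs_mult)
  moreover have "- \<lceil>w\<rceil> - 1 <= \<lfloor>u\<rfloor> & \<lfloor>u\<rfloor> <= \<lceil>w\<rceil>" if "\<bar>u\<bar> <= w" for u w :: real using that by linarith
  ultimately have "\<lfloor>real (Suc n) * f y\<rfloor> : I n" unfolding I_def atLeastAtMost_iff by blast
  then show ?thesis unfolding g_def B_def by (subst sum.remove[of "I n" "\<lfloor>real (Suc n) * f y\<rfloor>"]) (auto simp: I_def indicator_def intro!: sum.neutral)
 qed
 have gf: "\<bar>f y - g n y\<bar> <= inverse (real (Suc n))" for n y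
 proof -
  have "\<bar>real (Suc n) * f y - of_int \<lfloor>real (Suc n) * f y\<rfloor>\<bar> <= 1" by linarith
  moreover have "real (Suc n) * (f y - g n y) = real (Suc n) * f y - of_int \<lfloor>real (Suc n) * f y\<rfloor>" by (simp add: ge right_diff_distrib del: of_nat_Suc)
  ultimately have "real (Suc n) * \<bar>f y - g n y\<bar> <= 1" by (metis abs_mult abs_of_nat)
  then show ?thesis by (simp add: field_simps del: of_nat_Suc)
 qed
 have gb: "\<bar>g n y\<bar> <= c + 1" for n y
 proof -
  have "inverse (real (Suc n)) <= 1" by (simp add: inverse_le_1_iff)
  then show ?thesis using gf[of y n] c[of y] by linarith
 qed
 have "good f"
 proof (rule good_lim[where f=g and c="c + 1"])
  show "(%n. g n y) ----> f y" for y
   by (rule LIM_zero_cancel, rule Lim_null_comparison[OF _ LIMSEQ_inverse_real_of_nat])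
    (use gf[of y] in \<open>auto simp: abs_minus_commute\<close>)
 qed (use g gb in auto)
 have "uniform_limit UNIV (%n. v (g n)) (v f) sequentially"
 proof (rule uniform_limitI)
  fix e :: real assume "0 < e"
  have "(%n. inverse (real (Suc n)) * K) ----> 0 * K" by (intro tendsto_intros LIMSEQ_inverse_real_of_nat)
  then have "\<forall>\<^sub>F n in sequentially. inverse (real (Suc n)) * K < e" using \<open>0 < e\<close> by (intro order_tendstoD) auto
  then show "\<forall>\<^sub>F n in sequentially. ALL x:UNIV. dist (v (g n) x) (v f x) < e"
  proof eventually_elim
   case (elim n)
   have gm: "g n : bm" "bounded (range (g n))" using g[of n] by (auto simp: good_def)
   have "v (%y. (- 1) * g n y + f y) x = (- 1) *R v (g n) x + v f x" for x by (rule v_lin(1)[OF gm f])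
   moreover have "norm (v (%y. (- 1) * g n y + f y) x) <= inverse (real (Suc n)) * K" for x
    by (rule fW_int(2)) (use gf gm in auto)
   ultimately have "norm (v f x - v (g n) x) <= inverse (real (Suc n)) * K" for x by simp
   then show ?case using elim by (auto simp: dist_norm norm_minus_commute intro: le_less_trans)
  qed
 qed
 then have cv: "continuous_on UNIV (v f)" by (rule uniform_limit_theorem[rotated]) (use g in auto)
 show ?thesis unfolding gderiv_def has_derivative_at_alt
 proof (intro conjI allI impI)
  show "bounded_linear (%h. h \<bullet> v f x)" by (rule bounded_linear_inner_left)
  fix e :: real assume e: "0 < e"
  from cv e obtain d where d: "0 < d" "!!y. dist y x < d ==> dist (v f y) (v f x) < e" unfolding continuous_on_iff by blast
  show "EX d>0. ALL y. norm (y - x) < d --> norm (F f y - F f x - (y - x) \<bullet> v f x) <= e * norm (y - x)"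
  proof (intro exI[of _ d] conjI allI impI d(1))
   fix y assume y: "norm (y - x) < d"
   let ?h = "y - x"
   let ?u = "%s. indi {0..1} s *R (v f (x + s *R ?h) \<bullet> ?h)"
   have "(%s. v f (x + s *R ?h) \<bullet> ?h) : bm" and eq: "F f (x + ?h) - F f x = (LINT s|lborel. ?u s)"
    using \<open>good f\<close> unfolding good_def by blast+
   from seg_int(1)[OF this(1) fW_int(2)[OF f(1) c]] have i: "integrable lborel ?u" .
   have i2: "integrable lborel (%s. indi {0..1::real} s *R (v f x \<bullet> ?h))" "integrable lborel (%s. indi {0..1::real} s * (e * norm ?h))"
    by (auto intro!: integrable_mult_left integrable_real_indicator)
   have "F f y - F f x - ?h \<bullet> v f x = (LINT s|lborel. ?u s - indi {0..1} s *R (v f x \<bullet> ?h))"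
    using eq i i2 by (simp add: inner_commute)
   also have "norm ... <= (LINT s|lborel. indi {0..1::real} s * (e * norm ?h))"
   proof (rule order_trans[OF integral_norm_bound integral_mono])
    fix s :: real
    show "norm (?u s - indi {0..1} s *R (v f x \<bullet> ?h)) <= indi {0..1} s * (e * norm ?h)"
    proof (cases "s : {0..1}")
     case True
     then have "norm (s *R ?h) <= 1 * norm ?h" by (simp add: mult_left_le_one_le)
     then have "norm (v f (x + s *R ?h) - v f x) <= e" using d(2)[of "x + s *R ?h"] y by (simp add: dist_norm)
     then have "\<bar>(v f (x + s *R ?h) - v f x) \<bullet> ?h\<bar> <= e * norm ?h"
      by (intro order_trans[OF Cauchy_Schwarz_ineq2 mult_right_mono]) auto
     then show ?thesis using True by (simp add: inner_diff_left)
    qed simp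
   qed (use i i2 in auto)
   finally show "norm (F f y - F f x - ?h \<bullet> v f x) <= e * norm ?h" by simp
  qed
 qed
qed

end

lemma borel_measurable_vec_lambda[measurable (raw)]:
 fixes f :: "'d::finite => 'l => real"
 assumes "!!j. f j : bmf N" shows "(%l. \<chi> j. f j l) : bmf N"
proof -
 have "(%l. SUM j:UNIV. f j l *R axis j (1::real)) : bmf N" using assms by measurable
 then show ?thesis using vec_sum_axis[of "\<chi> j. f j _"] by simp
qed

section \<open>The weights\<close>

text \<open>Recovers a right-continuous path from its values at dyadic times. For arguments that come from no such path
\<open>lim\<close> may be a junk value, but \<open>Reg T d\<close> is always bounded and measurable.\<close>

definition Reg :: "real => (nat \<times> nat => real) => real => real" where
 "Reg T d s = (if EX K::nat. ALL p. dyadic p <= T + 1 --> \<bar>d p\<bar> <= K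
   then lim (%n. d (n, nat \<lfloor>2 ^ n * max 0 (min s T)\<rfloor> + 1)) else 0)"

text \<open>The \<open>+ 1\<close> puts the dyadic time strictly to the right of \<open>s\<close>,
  as a limit along \<open>at_right\<close> demands.\<close>

lemma dyadic_approx:
 assumes "0 <= s"
 shows "s < dyadic (n, nat \<lfloor>2 ^ n * s\<rfloor> + 1)" "dyadic (n, nat \<lfloor>2 ^ n * s\<rfloor> + 1) <= s + (1 / 2) ^ n"
proof -
 have "0 <= \<lfloor>2 ^ n * s\<rfloor>" using assms by simp
 then have e: "dyadic (n, nat \<lfloor>2 ^ n * s\<rfloor> + 1) = (of_int \<lfloor>2 ^ n * s\<rfloor> + 1) / 2 ^ n" by (simp add: dyadic_def)
 have "2 ^ n * s < of_int \<lfloor>2 ^ n * s\<rfloor> + 1" "of_int \<lfloor>2 ^ n * s\<rfloor> + 1 <= 2 ^ n * s + 1" by linarith+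
 then show "s < dyadic (n, nat \<lfloor>2 ^ n * s\<rfloor> + 1)" "dyadic (n, nat \<lfloor>2 ^ n * s\<rfloor> + 1) <= s + (1 / 2) ^ n"
  unfolding e by (simp_all add: pos_less_divide_eq pos_divide_le_eq power_one_over algebra_simps)
qed

lemma Reg_measurable:
 assumes [measurable]: "!!i. (%l. D l i) : bmf N"
 shows "(%p. Reg T (D (fst p)) (snd p)) : bmf (N \<Otimes>\<^sub>M borel)"
proof -
 have [measurable]: "(%p. D (fst p) (n, nat \<lfloor>2 ^ n * max 0 (min (snd p) T)\<rfloor> + 1)) : bmf (N \<Otimes>\<^sub>M borel)" for n
  by (rule measurable_compose_countable[where f="%k p. D (fst p) (n, k)"]) measurable
 show ?thesis unfolding Reg_def by measurable
qed

lemma bpath_Reg: assumes T: "0 <= T" shows "bpath (Reg T d)"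
proof (cases "EX K::nat. ALL p. dyadic p <= T + 1 --> \<bar>d p\<bar> <= K")
 case True
 then obtain K :: nat where K: "!!p. dyadic p <= T + 1 ==> \<bar>d p\<bar> <= K" by blast
 \<comment> \<open>\<open>lim\<close> of a divergent sequence is the fixed number
   \<open>THE L. False\<close>, which therefore has to enter the bound.\<close>
 have "\<bar>Reg T d s\<bar> <= max (real K) \<bar>THE L::real. False\<bar>" for s
 proof -
  let ?X = "%n. d (n, nat \<lfloor>2 ^ n * max 0 (min s T)\<rfloor> + 1)"
  have R: "Reg T d s = lim ?X" using True by (simp add: Reg_def)
  show ?thesis
  proof (cases "convergent ?X")
   case c: True
   have "\<bar>?X n\<bar> <= K" for n
   proof (rule K)
    have "(1 / 2) ^ n <= (1::real)" by (rule power_le_one) auto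
    moreover have "0 <= max 0 (min s T)" "max 0 (min s T) <= T" using T by auto
    ultimately show "dyadic (n, nat \<lfloor>2 ^ n * max 0 (min s T)\<rfloor> + 1) <= T + 1" using dyadic_approx(2)[of "max 0 (min s T)" n] by linarith
   qed
   then have "\<bar>lim ?X\<bar> <= K"
    by (intro LIMSEQ_le_const2[OF tendsto_rabs[OF c[unfolded convergent_LIMSEQ_iff]]]) auto
   then show ?thesis unfolding R by linarith
  next
   case False
   then have "lim ?X = (THE L::real. False)" unfolding lim_def convergent_def by simp
   then show ?thesis unfolding R by simp
  qed
 qed
 moreover have "Reg T d : bm"
  using measurable_compose[OF _ Reg_measurable[of "%_::unit. d" "count_space UNIV" T], of "%s. ((), s)" borel] by simp
 ultimately show ?thesis by (intro bpathI[where B="max (real K) \<bar>THE L::real. False\<bar>"]) auto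
next
 case False
 then have "Reg T d = (%s. 0)" by (intro ext) (simp only: Reg_def if_False)
 then show ?thesis by simp
qed

definition bump :: "'d => real => ('d => 'p \<times> real) => 'd => 'p \<times> real" where
 "bump j e w = fun_upd w j (fst (w j), snd (w j) + e)"

section \<open>The product of the enlarged spaces of all coordinates\<close>

locale noise = prob_space M for M :: "'w measure" +
 fixes Z :: "real => 'w => real ^ 'd::finite" and ta T :: real
  and Om :: "'d => (((real \<times> real) \<times> 'w) \<times> real) measure" and sc :: "'d => ((real \<times> real) \<times> 'w) \<times> real => real"
 assumes scored: "!!j. scored M (%t w. Z t w $ j) ta (Om j) (sc j)"
  and Z_meas: "!!t. 0 <= t ==> Z t : bmf M" and ta: "0 <= ta" "ta <= T"
begin

definition PP :: "('d => ((real \<times> real) \<times> 'w) \<times> real) measure" where "PP = PiM UNIV Om"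

definition tm :: "('d => ((real \<times> real) \<times> 'w) \<times> real) => real ^ 'd" where "tm w = (\<chi> j. jtime ta (w j))"

definition ja :: "('d => ((real \<times> real) \<times> 'w) \<times> real) => real ^ 'd" where "ja w = (\<chi> j. snd (w j))"

definition zz :: "('d => ((real \<times> real) \<times> 'w) \<times> real) => real => real ^ 'd" where
 "zz w v = (\<chi> j. Reg T (%i. Z (dyadic i) (snd (fst (w j))) $ j) v)"

definition bp :: "real ^ 'd => ('d => ((real \<times> real) \<times> 'w) \<times> real) => real => real ^ 'd" where
 "bp x w v = x + zz w v + jumps T (tm w) (ja w) v"

lemma prob_Om: "prob_space (Om j)" by (rule scored.Om_prob[OF scored])

lemma sets_Om[measurable_cong]: "sets (Om j) = sets (((lborel \<Otimes>\<^sub>M lborel) \<Otimes>\<^sub>M M) \<Otimes>\<^sub>M lborel)"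
 by (rule scored.Om_sets[OF scored])

sublocale PS: product_prob_space Om UNIV
 by (intro product_prob_space.intro product_sigma_finite.intro product_prob_space_axioms.intro) (auto intro: prob_Om prob_space_imp_sigma_finite)

sublocale P: prob_space PP unfolding PP_def by (rule PS.prob_space_axioms)

lemma comp_meas[measurable]: "(%w. w j) : PP \<rightarrow>\<^sub>M Om j" unfolding PP_def by measurable

lemma comp_meas2: "(%w. w j) : PP \<rightarrow>\<^sub>M ((lborel \<Otimes>\<^sub>M lborel) \<Otimes>\<^sub>M M) \<Otimes>\<^sub>M lborel"
 using comp_meas[of j] measurable_cong_sets[OF refl sets_Om] by blast

lemma jump_meas[measurable]: "(%w. snd (w j)) : bmf PP" "(%w. snd (fst (fst (w j)))) : bmf PP"
 by (rule measurable_compose[OF comp_meas2], measurable)+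

lemma Z_comp_meas[measurable]: "(%w. Z (dyadic i) (snd (fst (w j))) $ j) : bmf PP"
proof -
 have [measurable]: "Z (dyadic i) : bmf M" by (rule Z_meas) simp
 have "(%z. Z (dyadic i) (snd (fst z)) $ j) : bmf (((lborel \<Otimes>\<^sub>M lborel) \<Otimes>\<^sub>M M) \<Otimes>\<^sub>M lborel)" by measurable
 then have "(%z. Z (dyadic i) (snd (fst z)) $ j) : bmf (Om j)" unfolding measurable_cong_sets[OF sets_Om refl] .
 from measurable_compose[OF comp_meas this] show ?thesis .
qed

lemma tm_meas[measurable]: "tm : bmf PP"
 unfolding tm_def[abs_def] jtime_def by measurable

lemma ja_meas[measurable]: "ja : bmf PP"
 unfolding ja_def[abs_def] by measurable

lemma bp_meas: "(%(w, v). bp x w v) : bmf (PP \<Otimes>\<^sub>M borel)"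
proof -
 have "(%p. jumps T (tm (fst p)) (ja (fst p)) (snd p)) : bmf (PP \<Otimes>\<^sub>M borel)"
  using jumps_measurable[OF tm_meas ja_meas] by (simp add: case_prod_beta)
 moreover have "(%p. Reg T (%i. Z (dyadic i) (snd (fst (fst p j))) $ j) (snd p)) : bmf (PP \<Otimes>\<^sub>M borel)" for j
  by (rule Reg_measurable[where D="%w i. Z (dyadic i) (snd (fst (w j))) $ j"]) measurable
 ultimately show ?thesis unfolding bp_def zz_def case_prod_beta by measurable
qed

lemma bpath_bp: "bpath (bp x w)"
proof -
 have "bpath (zz w)"
 proof -
  have "zz w = (%v. SUM j:UNIV. Reg T (%i. Z (dyadic i) (snd (fst (w j))) $ j) v *R axis j 1)"
   using vec_sum_axis[of "zz w _"] by (simp add: zz_def fun_eq_iff)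
  moreover have "bpath (%v. Reg T (%i. Z (dyadic i) (snd (fst (w j))) $ j) v *R axis j (1::real))" for j
   using bpath_Reg[of T "%i. Z (dyadic i) (snd (fst (w j))) $ j"] ta unfolding bpath_def
   by (auto simp: bounded_iff norm_scaleR)
  ultimately show ?thesis by (simp add: bpath_sum)
 qed
 then show ?thesis unfolding bp_def[abs_def] by (intro bpath_add bpath_const bpath_jumps)
qed

lemma bump_simps: "tm (bump j e w) = tm w" "zz (bump j e w) = zz w" "bp x (bump j e w) = (%v. bp x w v + e *R jumps T (tm w) (axis j 1) v)"
proof -
 show 1: "tm (bump j e w) = tm w" "zz (bump j e w) = zz w"
  by (auto simp: tm_def zz_def bump_def jtime_def fun_eq_iff vec_eq_iff)
 have "ja (bump j e w) = ja w + e *R axis j 1" by (auto simp: ja_def bump_def vec_eq_iff axis_def)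
 then show "bp x (bump j e w) = (%v. bp x w v + e *R jumps T (tm w) (axis j 1) v)"
  by (simp add: bp_def fun_eq_iff 1 jumps_add jumps_scaleR)
qed

lemma sc_integrable: "integrable PP (%w. sc j (w j))"
proof -
 have d: "distr PP (Om j) (%w. w j) = Om j" unfolding PP_def by (rule distr_PiM_component) (auto intro: prob_Om)
 have "integrable (distr PP (Om j) (%w. w j)) (sc j)" unfolding d by (rule scored.sc_int[OF scored])
 from integrable_distr[OF comp_meas this] show ?thesis .
qed

lemma PP_sc: "(LINT w|PP. \<bar>sc j (w j)\<bar>) = (LINT z|Om j. \<bar>sc j z\<bar>)"
proof -
 have d: "distr PP (Om j) (%w. w j) = Om j" unfolding PP_def by (rule distr_PiM_component) (auto intro: prob_Om)
 have [measurable]: "sc j : bmf (Om j)" using scored.sc_int[OF scored] by blast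
 have "(LINT z|distr PP (Om j) (%w. w j). \<bar>sc j z\<bar>) = (LINT w|PP. \<bar>sc j (w j)\<bar>)" by (rule integral_distr) measurable
 then show ?thesis unfolding d ..
qed

text \<open>Fubini's theorem isolates the factor \<open>j\<close>, where the one-dimensional formula
  applies. A derivative at \<open>e = 0\<close> for every \<open>w\<close> is enough, because
  bumping translates the jump size and so reaches every point of the line.\<close>

lemma PP_ibp:
 assumes F[measurable]: "F : bmf PP" and F'[measurable]: "F' : bmf PP"
  and d: "!!w. ((%e. F (bump j e w)) has_real_derivative F' w) (at 0)" and b: "!!w. \<bar>F w\<bar> <= C" "!!w. \<bar>F' w\<bar> <= C"
 shows "(LINT w|PP. F' w) = - (LINT w|PP. F w * sc j (w j))" "integrable PP F'" "integrable PP (%w. F w * sc j (w j))"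
proof -
 have C: "0 <= C" using b(1) abs_ge_zero order_trans by blast
 show i1: "integrable PP F'" by (rule P.integrable_const_bound[where B=C]) (use b in auto)
 show i2: "integrable PP (%w. F w * sc j (w j))"
  by (rule int_bound[OF integrable_mult_right[OF sc_integrable[of j], of C]])
   (use b C sc_integrable[of j] in \<open>auto simp: abs_mult intro!: mult_right_mono\<close>)
 let ?I = "UNIV - {j}"
 have I: "finite ?I" "j \<notin> ?I" "insert j ?I = UNIV" by auto
 have "(LINT w|PP. F' w) = (LINT w|PiM ?I Om. LINT y|Om j. F' (fun_upd w j y))"
  using PS.product_integral_insert[OF I(1,2), of F'] i1 unfolding I(3) PP_def by simp
 also have "... = (LINT w|PiM ?I Om. - (LINT y|Om j. F (fun_upd w j y) * sc j y))"
 proof (intro int_cong refl)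
  fix w assume w: "w : space (PiM ?I Om)"
  show "(LINT y|Om j. F' (fun_upd w j y)) = - (LINT y|Om j. F (fun_upd w j y) * sc j y)"
  proof (rule scored.Om_ibp[OF scored])
   show "(%y. F (fun_upd w j y)) : bmf (Om j)"
    by (rule measurable_compose[OF measurable_component_update[OF w I(2)]]) (use F in \<open>simp add: PP_def I\<close>)
   fix u x
   have "bump j e (fun_upd w j (u, x)) = fun_upd w j (u, x + e)" for e by (simp add: bump_def)
   then show "((%y. F (fun_upd w j (u, y))) has_real_derivative F' (fun_upd w j (u, x))) (at x)"
    using d[of "fun_upd w j (u, x)"] DERIV_shift[of "%y. F (fun_upd w j (u, y))" _ 0 x] by (simp add: add.commute)
  qed (use b in auto)
 qed
 also have "... = - (LINT w|PP. F w * sc j (w j))"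
  using PS.product_integral_insert[OF I(1,2), of "%w. F w * sc j (w j)"] i2 unfolding I(3) PP_def by simp
 finally show "(LINT w|PP. F' w) = - (LINT w|PP. F w * sc j (w j))" .
qed

end

locale noise_flow = noise M Z ta T Om sc + jump_flow b Db D2b L T ta
 for M :: "'w measure" and Z :: "real => 'w => real ^ 'd::finite" and ta T Om sc and b :: "real ^ 'd => real ^ 'd" and Db D2b L
begin

definition Ph :: "real ^ 'd => ('d => ((real \<times> real) \<times> 'w) \<times> real) => real ^ 'd" where
 "Ph x w = Sol (bp x w) T"

text \<open>Integrating \<open>f (Ph x w) * alpha\<close> by parts in the \<open>j\<close>-th jump
  yields the score term and a term for the dependence of \<open>alpha\<close> on that jump. With the
  sign in \<open>W\<close> this is the divergence, the adjoint of differentiation, of the random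
  direction \<open>alpha\<close>.\<close>

definition wt :: "real ^ 'd => real ^ 'd => ('d => ((real \<times> real) \<times> 'w) \<times> real) => 'd => real" where
 "wt x h w j = alpha (bp x w) (tm w) h $ j * sc j (w j) + dalpha (bp x w) (tm w) j h $ j"

definition W :: "real ^ 'd => ('d => ((real \<times> real) \<times> 'w) \<times> real) => real ^ 'd" where
 "W x w = (\<chi> k. - (SUM j:UNIV. wt x (axis k 1) w j))"

lemma jtimes_tm: "jtimes (tm w)" using ta by (auto simp: jtimes_def tm_def jtime_def)

lemma Ph_meas[measurable]: "Ph x : bmf PP"
 unfolding Ph_def[abs_def] by (rule Sol_measurable[OF bp_meas bpath_bp])

lemma Lin_const_meas[measurable]: "(%w. Lin (bp x w) (%_. h) T) : bmf PP"
 by (rule Lin_measurable[OF bp_meas bpath_bp]) (simp_all add: case_prod_beta)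

lemma Lin_jump_meas[measurable]: "(%w. Lin (bp x w) (jumps T (tm w) a) T) : bmf PP"
 by (rule Lin_measurable[OF bp_meas bpath_bp jumps_measurable[OF tm_meas] bpath_jumps]) simp

lemma alpha_meas[measurable]: "(%w. alpha (bp x w) (tm w) h) : bmf PP"
 by (rule alpha_measurable[OF bp_meas bpath_bp tm_meas jtimes_tm])

lemma dalpha_meas[measurable]: "(%w. dalpha (bp x w) (tm w) k h) : bmf PP"
 by (rule dalpha_measurable[OF bp_meas bpath_bp tm_meas jtimes_tm])

lemma sc_meas[measurable]: "(%w. sc j (w j)) : bmf PP" using sc_integrable by blast

lemma W_meas[measurable]: "W x : bmf PP"
 unfolding W_def[abs_def] wt_def by measurable

lemma shift_le: "X ----> x ==> (%n. norm (X n - x)) ----> 0" "norm (bp y w v - bp x w v) <= norm (y - x)"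
 by (auto simp: bp_def tendsto_norm_zero_iff LIM_zero_iff)

lemma Ph_cont: "continuous_on UNIV (%x. Ph x w)"
 unfolding continuous_on_sequentially Ph_def o_def
 by (auto intro!: Sol_tendsto[OF bpath_bp bpath_bp shift_le(2) shift_le(1)])

lemma W_cont: "continuous_on UNIV (%x. W x w)"
 unfolding continuous_on_sequentially W_def wt_def o_def
 by (auto intro!: tendsto_intros tendsto_vec_lambda alpha_tendsto[OF bpath_bp bpath_bp shift_le(2) shift_le(1) jtimes_tm] dalpha_tendsto[OF bpath_bp bpath_bp shift_le(2) shift_le(1) jtimes_tm])

lemma dal: "\<bar>dalpha (bp x w) (tm w) k h $ j\<bar> <= kk * norm h"
 using dalpha_bound[OF bpath_bp jtimes_tm] component_le_norm_cart order_trans by blast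

lemma al: "\<bar>alpha (bp x w) (tm w) h $ j\<bar> <= 3 * norm h"
 using alpha_bound[OF bpath_bp jtimes_tm] component_le_norm_cart order_trans by blast

definition GG :: "('d => ((real \<times> real) \<times> 'w) \<times> real) => real" where
 "GG w = CARD('d) * (SUM j:UNIV. 3 * \<bar>sc j (w j)\<bar> + kk)"

lemma W_le: "norm (W x w) <= GG w"
 unfolding GG_def
proof (rule norm_vec_bound)
 fix k
 have "\<bar>wt x (axis k 1) w j\<bar> <= 3 * \<bar>sc j (w j)\<bar> + kk" for j
  using al[of x w "axis k 1" j] dal[of x w j "axis k 1" j] unfolding wt_def
  by (intro order_trans[OF abs_triangle_ineq add_mono]) (auto simp: abs_mult intro!: mult_right_mono)
 then show "\<bar>W x w $ k\<bar> <= (SUM j:UNIV. 3 * \<bar>sc j (w j)\<bar> + kk)"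
  unfolding W_def by (simp del: sum.distrib) (intro order_trans[OF sum_abs sum_mono])
qed

lemma GG_int: "integrable PP GG"
 unfolding GG_def[abs_def] using sc_integrable by (intro integrable_mult_right Bochner_Integration.integrable_sum Bochner_Integration.integrable_add integrable_abs) auto

text \<open>For vanishing drift \<open>alpha\<close> is the identity and \<open>dalpha\<close> is
  \<open>0\<close>, so the weight is \<open>- sc\<close>. The deviation is measured by
  \<open>cc\<close> and \<open>kk\<close>, both proportional to \<open>ta\<close> up to bounded
  exponential factors.\<close>

lemma W_near: "norm (W x w - (\<chi> k. - sc k (w k))) <= CARD('d) * (SUM j:UNIV. 4 * cc * \<bar>sc j (w j)\<bar> + kk)"
proof (rule norm_vec_bound)
 fix k
 have 1: "\<bar>wt x (axis k 1) w j - axis k 1 $ j * sc j (w j)\<bar> <= 4 * cc * \<bar>sc j (w j)\<bar> + kk" for j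
 proof -
  have "wt x (axis k 1) w j - axis k 1 $ j * sc j (w j) = (alpha (bp x w) (tm w) (axis k 1) - axis k 1) $ j * sc j (w j) + dalpha (bp x w) (tm w) j (axis k 1) $ j"
   by (simp add: wt_def algebra_simps)
  moreover have "\<bar>(alpha (bp x w) (tm w) (axis k 1) - axis k 1) $ j\<bar> <= 4 * cc"
   using order_trans[OF component_le_norm_cart alpha_near[OF bpath_bp jtimes_tm, of x w w "axis k 1"]] by simp
  ultimately show ?thesis using dal[of x w j "axis k 1" j]
   by (simp only:) (intro order_trans[OF abs_triangle_ineq add_mono], auto simp: abs_mult intro!: mult_right_mono)
 qed
 have "(SUM j:UNIV. axis k 1 $ j * sc j (w j)) = sc k (w k)" by (simp add: axis_def if_distrib if_distribR cong: if_cong)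
 then have "\<bar>(W x w - (\<chi> k. - sc k (w k))) $ k\<bar> = \<bar>SUM j:UNIV. wt x (axis k 1) w j - axis k 1 $ j * sc j (w j)\<bar>"
  by (simp add: W_def sum_subtractf)
 also have "... <= (SUM j:UNIV. 4 * cc * \<bar>sc j (w j)\<bar> + kk)" by (intro order_trans[OF sum_abs sum_mono] 1)
 finally show "\<bar>(W x w - (\<chi> k. - sc k (w k))) $ k\<bar> <= (SUM j:UNIV. 4 * cc * \<bar>sc j (w j)\<bar> + kk)" .
qed

lemma W_inner: "W x w \<bullet> h = - (SUM j:UNIV. wt x h w j)"
proof -
 have a: "alpha (bp x w) (tm w) h = (SUM k:UNIV. (h $ k) *R alpha (bp x w) (tm w) (axis k 1))"
  using linear_sum[OF alpha_linear[OF bpath_bp jtimes_tm], of x w w "%k. (h $ k) *R axis k 1" UNIV]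
  unfolding vec_sum_axis linear_scale[OF alpha_linear[OF bpath_bp jtimes_tm]] .
 have "wt x h w j = (SUM k:UNIV. wt x (axis k 1) w j * h $ k)" for j
  unfolding wt_def by (subst a, subst dalpha_lin[OF bpath_bp jtimes_tm, of x w w j h])
   (simp add: sum_distrib_left sum_distrib_right sum.distrib algebra_simps)
 then show ?thesis
  by (simp add: W_def inner_vec_def sum_negf sum_distrib_right) (rule sum.swap)
qed

lemma Ph_bump: "((%e. Ph x (bump j e w)) has_vector_derivative Lin (bp x w) (jumps T (tm w) (axis j 1)) T) (at 0)"
 unfolding Ph_def bump_simps by (rule Sol_deriv[OF bpath_bp bpath_jumps])

lemma alpha_bump: "((%e. alpha (bp x (bump j e w)) (tm (bump j e w)) h $ j) has_real_derivative dalpha (bp x w) (tm w) j h $ j) (at 0)"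
 using bounded_linear.has_vector_derivative[OF bounded_linear_vec_nth alpha_deriv[OF bpath_bp jtimes_tm]]
 unfolding bump_simps has_real_derivative_iff_has_vector_derivative .

text \<open>\<open>Lin_const_T\<close> replaces the derivative in the starting point by derivatives
  in the jump sizes with coefficients \<open>alpha\<close>. \<open>PP_ibp\<close> is then applied to
  \<open>f (Ph x w)\<close> times each coefficient, and the product-rule term with
  \<open>dalpha\<close> is moved into the weight.\<close>

lemma C1b_formula:
 assumes f: "C1b f"
 shows "((%t. LINT w|PP. f (Ph (x + t *R h) w)) has_real_derivative (LINT w|PP. f (Ph x w) *R W x w) \<bullet> h) (at 0)"
proof -
 obtain f' where f': "!!y. (f has_derivative (%h. f' y \<bullet> h)) (at y)" "continuous_on UNIV f'" "bounded (range f')" and fb: "bounded (range f)"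
  using f unfolding C1b_def by blast
 obtain A B where A: "!!y. \<bar>f y\<bar> <= A" and B: "!!y. norm (f' y) <= B" using f'(3) fb by (auto simp: bounded_iff)
 have A0: "0 <= A" and B0: "0 <= B" using A[of 0] B[of 0] abs_ge_zero norm_ge_zero order_trans by blast+
 have [measurable]: "f : bm" "f' : bm" using C1b_continuous[OF f] f'(2) by (auto intro: borel_measurable_continuous_onI)
 have ch: "((%e. f (g e)) has_real_derivative f' (g 0) \<bullet> d) (at 0)" if "(g has_vector_derivative d) (at 0)" for g :: "real => real ^ 'd" and d
  using has_derivative_compose[OF that[unfolded has_vector_derivative_def] f'(1)[of "g 0"]]
  by (simp add: has_field_derivative_def fun_eq_iff mult.commute inner_scaleR_right) (simp add: mult.commute[of _ "f' (g 0) \<bullet> d"])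
 let ?D = "%w. f' (Ph x w) \<bullet> Lin (bp x w) (%_. h) T"
 let ?J = "%j w. f' (Ph x w) \<bullet> Lin (bp x w) (jumps T (tm w) (axis j 1)) T"
 let ?a = "%j w. alpha (bp x w) (tm w) h $ j" and ?d = "%j w. dalpha (bp x w) (tm w) j h $ j"
 have ibp: "(LINT w|PP. f (Ph x w) * ?d j w + ?J j w * ?a j w) = - (LINT w|PP. f (Ph x w) * ?a j w * sc j (w j))"
  "integrable PP (%w. f (Ph x w) * ?d j w + ?J j w * ?a j w)" "integrable PP (%w. f (Ph x w) * ?a j w * sc j (w j))" for j
 proof -
  let ?C = "A * (3 * norm h) + (A * (kk * norm h) + B * WT * (3 * norm h))"
  have kk: "0 <= kk" using L0 tau0 by (simp add: kk_def)
  have J: "\<bar>?J j w\<bar> <= B * WT" for w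
  proof -
   have "norm (Lin (bp x w) (jumps T (tm w) (axis j 1)) T) <= 1 * WT"
    by (rule Lin_bound[OF bpath_bp bpath_jumps]) (rule order_trans[OF norm_jumps], simp)
   then show ?thesis by (intro order_trans[OF Cauchy_Schwarz_ineq2] mult_mono B B0) auto
  qed
  have 1: "\<bar>f (Ph x w) * ?a j w\<bar> <= A * (3 * norm h)" for w
   unfolding abs_mult by (intro mult_mono A al A0) auto
  have 2: "\<bar>f (Ph x w) * ?d j w + ?J j w * ?a j w\<bar> <= A * (kk * norm h) + B * WT * (3 * norm h)" for w
   by (rule order_trans[OF abs_triangle_ineq]) (unfold abs_mult, intro add_mono mult_mono A al dal J A0 mult_nonneg_nonneg B0 less_imp_le[OF WT_pos] abs_ge_zero)
  have C: "\<bar>f (Ph x w) * ?a j w\<bar> <= ?C" "\<bar>f (Ph x w) * ?d j w + ?J j w * ?a j w\<bar> <= ?C" for w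
   using 1[of w] 2[of w] abs_ge_zero[of "f (Ph x w) * ?a j w"] abs_ge_zero[of "f (Ph x w) * ?d j w + ?J j w * ?a j w"] by linarith+
  have d: "((%e. f (Ph x (bump j e w)) * ?a j (bump j e w)) has_real_derivative f (Ph x w) * ?d j w + ?J j w * ?a j w) (at 0)" for w
  proof -
   have 0: "bump j 0 w = w" by (simp add: bump_def)
   show ?thesis using DERIV_mult[OF ch[OF Ph_bump[of x j w]] alpha_bump[of x j w h]] by (simp add: 0 add.commute mult.commute)
  qed
  show "(LINT w|PP. f (Ph x w) * ?d j w + ?J j w * ?a j w) = - (LINT w|PP. f (Ph x w) * ?a j w * sc j (w j))"
   "integrable PP (%w. f (Ph x w) * ?d j w + ?J j w * ?a j w)" "integrable PP (%w. f (Ph x w) * ?a j w * sc j (w j))"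
   by (rule PP_ibp[OF _ _ d C]; measurable)+
 qed
 have di: "integrable PP (%w. f (Ph x w) * ?d j w)" for j
 proof (rule P.integrable_const_bound[where B="A * (kk * norm h)"])
  show "AE w in PP. norm (f (Ph x w) * ?d j w) <= A * (kk * norm h)"
   unfolding real_norm_def abs_mult by (intro AE_I2 mult_mono A dal A0) auto
 qed measurable
 have D: "?D w = (SUM j:UNIV. (f (Ph x w) * ?d j w + ?J j w * ?a j w) - f (Ph x w) * ?d j w)" for w
  unfolding Lin_const_T[OF bpath_bp jtimes_tm, of x w h w] by (simp add: inner_sum_right mult.commute)
 have "(LINT w|PP. ?D w) = (SUM j:UNIV. - (LINT w|PP. f (Ph x w) * ?a j w * sc j (w j)) - (LINT w|PP. f (Ph x w) * ?d j w))"
  unfolding D by (subst Bochner_Integration.integral_sum) (intro Bochner_Integration.integrable_diff ibp di, simp only: Bochner_Integration.integral_diff[OF ibp(2) di] ibp(1))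
 also have "... = (LINT w|PP. f (Ph x w) * (W x w \<bullet> h))"
 proof -
  have e: "f (Ph x w) * (W x w \<bullet> h) = (SUM j:UNIV. - (f (Ph x w) * ?a j w * sc j (w j)) - f (Ph x w) * ?d j w)" for w
   unfolding W_inner wt_def sum_negf[symmetric] sum_distrib_left by (rule sum.cong) (simp_all add: algebra_simps)
  show ?thesis unfolding e by (subst Bochner_Integration.integral_sum) (use ibp(3) di in \<open>auto\<close>)
 qed
 also have "... = (LINT w|PP. f (Ph x w) *R W x w) \<bullet> h"
 proof -
  have "integrable PP (%w. f (Ph x w) *R W x w)"
  proof (rule int_bound[OF integrable_mult_right[OF GG_int, of A]])
   show "AE w in PP. norm (f (Ph x w) *R W x w) <= norm (A * GG w)"
    using mult_mono[OF A W_le A0 norm_ge_zero] by (intro AE_I2) (auto intro: order_trans[OF _ abs_ge_self])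
  qed measurable
  from integral_inner_left[OF this, of h] show ?thesis by (simp add: inner_scaleR_left)
 qed
 finally have I: "(LINT w|PP. ?D w) = (LINT w|PP. f (Ph x w) *R W x w) \<bullet> h" .
 have bpx: "bp (x + e *R h) w = (%s. bp x w s + e *R h)" for e w by (simp add: bp_def fun_eq_iff)
 have fi: "integrable PP (%w. f (Ph y w))" for y by (rule P.integrable_const_bound[where B=A]) (use A in auto)
 have "((%t. LINT w|PP. f (Ph (x + t *R h) w)) has_vector_derivative (LINT w|PP. ?D w)) (at 0)"
 proof (rule has_vector_derivative_seqI)
  fix e :: "nat => real" assume e: "!!n. e n ~= 0" "e ----> 0"
  have "(%n. LINT w|PP. (f (Ph (x + e n *R h) w) - f (Ph x w)) /\<^sub>R e n) ----> (LINT w|PP. ?D w)"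
  \<comment> \<open>The constant majorant exists because \<open>f\<close> is Lipschitz with constant
    \<open>B\<close> and the flow is Lipschitz in its starting point with constant
    \<open>WT\<close>.\<close>
  proof (rule integral_dominated_convergence[where w="%_. B * (norm h * WT)"])
   have "((%t. f (Ph (x + t *R h) w)) has_vector_derivative ?D w) (at 0)" for w
    using ch[OF Sol_deriv[OF bpath_bp[of x w] bpath_const[of h], of T]] by (simp add: Ph_def bpx has_real_derivative_iff_has_vector_derivative)
   from has_vector_derivative_seqD[OF this e]
   show "AE w in PP. (%n. (f (Ph (x + e n *R h) w) - f (Ph x w)) /\<^sub>R e n) ----> ?D w" by simp
   have on: "onorm (%h. f' y \<bullet> h) <= B" for y
    by (rule onorm_le) (use mult_right_mono[OF B norm_ge_zero] in \<open>auto intro: order_trans[OF Cauchy_Schwarz_ineq2]\<close>)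
   have lip: "\<bar>f y - f z\<bar> <= B * norm (y - z)" for y z
    using differentiable_bound[OF convex_UNIV f'(1) on, of y z] by simp
   show "AE w in PP. norm ((f (Ph (x + e n *R h) w) - f (Ph x w)) /\<^sub>R e n) <= B * (norm h * WT)" for n
   proof (intro AE_I2)
    fix w
    have "norm (Ph (x + e n *R h) w - Ph x w) <= (\<bar>e n\<bar> * norm h) * WT"
     unfolding Ph_def by (rule Sol_lip[OF bpath_bp bpath_bp]) (simp add: bpx)
    then have "\<bar>f (Ph (x + e n *R h) w) - f (Ph x w)\<bar> <= B * ((\<bar>e n\<bar> * norm h) * WT)"
     using lip[of "Ph (x + e n *R h) w" "Ph x w"] mult_left_mono[OF _ B0] order_trans by blast
    then show "norm ((f (Ph (x + e n *R h) w) - f (Ph x w)) /\<^sub>R e n) <= B * (norm h * WT)"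
     using e(1)[of n] by (simp add: abs_mult field_simps)
   qed
  qed measurable
  then show "(%n. ((LINT w|PP. f (Ph (x + e n *R h) w)) - (LINT w|PP. f (Ph (x + 0 *R h) w))) /\<^sub>R e n) ----> (LINT w|PP. ?D w)"
   by (simp add: Bochner_Integration.integral_diff fi)
 qed
 then show ?thesis unfolding I has_real_derivative_iff_has_vector_derivative .
qed

sublocale S: smoothing PP Ph W GG
 by unfold_locales (use Ph_cont W_cont W_le GG_int C1b_formula in auto)

end

section \<open>From the enlarged space back to the original one\<close>

lemma cadlag_bounded:
 fixes f :: "real => 'a::real_normed_vector"
 assumes r: "!!t. 0 <= t ==> (f \<longlongrightarrow> f t) (at_right t)" and l: "!!t. 0 < t ==> EX l. (f \<longlongrightarrow> l) (at_left t)"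
 shows "EX K. ALL s:{0..c}. norm (f s) <= K"
proof -
 \<comment> \<open>The one-sided limits bound the path near every point, and compactness of
   \<open>{0..c}\<close> makes the bound global. The guard \<open>0 <= u\<close> excludes negative
   times, about which nothing is known.\<close>
 have "EX U K. open U & s : U & (ALL u:U. 0 <= u --> norm (f u) <= K)" if s: "0 <= s" for s
 proof -
  have b: "EX K. eventually (%u. norm (f u) <= K) F" if "(f \<longlongrightarrow> l) F" for l F
   by (rule exI[of _ "norm l + 1"], rule eventually_mono[OF order_tendstoD(2)[OF tendsto_norm[OF that]], of "norm l + 1"]) auto
  obtain K1 where 1: "eventually (%u. norm (f u) <= K1) (at_right s)" using b[OF r[OF s]] by blast
  have "EX K. eventually (%u. 0 <= u --> norm (f u) <= K) (at_left s)"
  proof (cases "s = 0")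
   case True
   have "eventually (%u. u < s) (at_left s)" by (simp add: eventually_at_filter)
   then show ?thesis using True by (intro exI[of _ 0]) (auto elim!: eventually_mono)
  next
   case False
   then obtain l where "(f \<longlongrightarrow> l) (at_left s)" using l s by force
   then obtain K where "eventually (%u. norm (f u) <= K) (at_left s)" using b by blast
   then show ?thesis by (intro exI[of _ K]) (auto elim: eventually_mono)
  qed
  then obtain K2 where 2: "eventually (%u. 0 <= u --> norm (f u) <= K2) (at_left s)" by blast
  let ?K = "max (norm (f s)) (max K1 K2)"
  have "eventually (%u. 0 <= u --> norm (f u) <= ?K) (nhds s)"
   unfolding eventually_nhds_conv_at eventually_at_split
   by (intro conjI, rule eventually_mono[OF 2], simp add: le_max_iff_disj, rule eventually_mono[OF 1], auto)
  then show ?thesis unfolding eventually_nhds by blast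
 qed
 then obtain U K where U: "!!s. 0 <= s ==> open (U s)" "!!s. 0 <= s ==> s : U s" "!!s u. 0 <= s ==> u : U s ==> 0 <= u ==> norm (f u) <= K s"
  by metis
 obtain C where C: "C \<subseteq> {0..c}" "finite C" "{0..c} \<subseteq> (UN s:C. U s)"
  by (rule compactE_image[OF compact_Icc, of "{0..c}" U]) (use U in auto)
 have "norm (f s) <= (SUM s:C. \<bar>K s\<bar>)" if s: "s : {0..c}" for s
 proof -
  obtain a where a: "a : C" "s : U a" using C(3) s by blast
  then have "norm (f s) <= \<bar>K a\<bar>" using U(3)[of a s] C(1) s by fastforce
  also have "... <= (SUM s:C. \<bar>K s\<bar>)" using C(2) a(1) by (intro member_le_sum) auto
  finally show ?thesis .
 qed
 then show ?thesis by blast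
qed

text \<open>The bound reaches up to \<open>T + 1\<close> since dyadic approximations from the right
  may exceed \<open>T\<close>.\<close>

lemma Reg_eq:
 assumes T: "0 <= T" and r: "!!s. 0 <= s ==> (f \<longlongrightarrow> f s) (at_right s)" and K: "!!s. 0 <= s ==> s <= T + 1 ==> \<bar>f s\<bar> <= K"
 shows "Reg T (%i. f (dyadic i)) s = f (max 0 (min s T))"
proof -
 let ?s = "max 0 (min s T)"
 let ?X = "%n. dyadic (n, nat \<lfloor>2 ^ n * ?s\<rfloor> + 1)"
 have s: "0 <= ?s" by simp
 have "?X ----> ?s"
 proof (rule tendsto_sandwich[OF always_eventually always_eventually tendsto_const])
  show "(%n. ?s + (1 / 2) ^ n) ----> ?s" using tendsto_add[OF tendsto_const[of ?s] LIMSEQ_realpow_zero[of "1/2"]] by simp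
 qed (use dyadic_approx[OF s] in \<open>auto intro: less_imp_le\<close>)
 then have "filterlim ?X (at_right ?s) sequentially"
  using dyadic_approx(1)[OF s] by (simp only: filterlim_at) (intro conjI always_eventually allI, simp_all only: greaterThan_iff, metis less_irrefl)
 from filterlim_compose[OF r[OF s] this] have "lim (%n. f (?X n)) = f ?s" by (rule limI)
 moreover have "\<bar>f (dyadic p)\<bar> <= real (nat \<lceil>K\<rceil>)" if "dyadic p <= T + 1" for p
  using K[OF dyadic_nonneg that] by linarith
 ultimately show ?thesis unfolding Reg_def by (subst if_P) (blast, simp)
qed

text \<open>In essence \<open>Y\<close> is the conditional expectation of \<open>g\<close> given the
  path, read as a function of the path and evaluated on the other space. The positive and negative
  parts of \<open>g\<close> give finite measures dominated by the common law, and their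
  Radon-Nikodym derivatives are composed with \<open>D'\<close>.\<close>

lemma cond_density:
 assumes P: "prob_space P" "prob_space M" and D[measurable]: "D : P \<rightarrow>\<^sub>M N" "D' : M \<rightarrow>\<^sub>M N" and eq: "distr P N D = distr M N D'"
  and g: "integrable P (g :: _ => real)"
 shows "EX Y. integrable M Y & (LINT w|M. \<bar>Y w\<bar>) <= (LINT w|P. \<bar>g w\<bar>) &
  (ALL \<phi>:bmf N. bounded (range \<phi>) --> (LINT w|M. \<phi> (D' w) * Y w) = (LINT w|P. \<phi> (D w) * g w))"
proof -
 interpret P: prob_space P by (rule P)
 interpret M: prob_space M by (rule P)
 let ?Q = "distr P N D"
 interpret Q: prob_space ?Q by (rule P.prob_space_distr[OF D(1)])
 have nn: "EX h. h : bmf N & (ALL y. 0 <= h y) & (ALL \<phi>:bmf N. (LINT w|M. h (D' w) * \<phi> (D' w)) = (LINT w|P. u w * \<phi> (D w))) & integrable M (%w. h (D' w))"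
  if u: "integrable P u" "!!w. 0 <= u w" for u :: "_ => real"
 proof -
  have [measurable]: "u : bmf P" using u by blast
  let ?n = "distr (density P (%w. ennreal (u w))) N D"
  have "absolutely_continuous ?Q ?n"
   using absolutely_continuousI_density[of "%w. ennreal (u w)" P] by (auto simp: absolutely_continuous_def null_sets_distr_iff)
  from Q.Radon_Nikodym[OF this] obtain h where h[measurable]: "h : bmf N" and n: "density ?Q h = ?n" by auto
  let ?k = "%y. enn2real (h y)"
  have i1: "integrable ?n (%_. 1 :: real)"
   using u by (subst integrable_distr_eq) (auto simp: integrable_density)
  then have "emeasure ?n (space ?n) < \<infinity>" by (simp add: integrable_iff_bounded)
  moreover have "(\<integral>\<^sup>+ y. h y \<partial>?Q) = emeasure ?n (space ?n)"
   unfolding n[symmetric] by (subst emeasure_density) (auto intro!: nn_integral_cong)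
  ultimately have "(\<integral>\<^sup>+ y. h y \<partial>?Q) < \<infinity>" by simp
  then have "AE y in ?Q. h y = ennreal (?k y)" using nn_integral_noteq_infinite[of h ?Q] by (auto simp: less_top ennreal_enn2real_if)
  then have n': "?n = density ?Q (%y. ennreal (?k y))" unfolding n[symmetric] by (intro density_cong) auto
  have "integrable ?Q ?k" using i1 unfolding n' by (subst (asm) integrable_density) auto
  then have "integrable M (%w. ?k (D' w))" unfolding eq by (rule integrable_distr[OF D(2)])
  moreover have "(LINT w|M. ?k (D' w) * \<phi> (D' w)) = (LINT w|P. u w * \<phi> (D w))" if [measurable]: "\<phi> : bmf N" for \<phi>
  proof -
   have "(LINT w|M. ?k (D' w) * \<phi> (D' w)) = (LINT y|?Q. ?k y * \<phi> y)" unfolding eq by (rule integral_distr[symmetric]) measurable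
   also have "... = (LINT y|?n. \<phi> y)" unfolding n' by (subst integral_density) auto
   also have "... = (LINT w|P. u w * \<phi> (D w))" using u(2) by (simp add: integral_distr integral_density)
   finally show ?thesis .
  qed
  ultimately show ?thesis by (intro exI[of _ ?k]) auto
 qed
 let ?p = "%w. max 0 (g w)" and ?m = "%w. max 0 (- g w)"
 have gi: "integrable P ?p" "integrable P ?m" using g by auto
 obtain h k where [measurable]: "h : bmf N" "k : bmf N" and hk0: "!!y. 0 <= h y" "!!y. 0 <= k y" and i: "integrable M (%w. h (D' w))" "integrable M (%w. k (D' w))"
  and E: "!!\<phi>. \<phi> : bmf N ==> (LINT w|M. h (D' w) * \<phi> (D' w)) = (LINT w|P. ?p w * \<phi> (D w))"
   "!!\<phi>. \<phi> : bmf N ==> (LINT w|M. k (D' w) * \<phi> (D' w)) = (LINT w|P. ?m w * \<phi> (D w))"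
  using nn[OF gi(1)] nn[OF gi(2)] by (auto 0 3)
 let ?Y = "%w. h (D' w) - k (D' w)"
 have "(LINT w|M. \<bar>?Y w\<bar>) <= (LINT w|M. h (D' w) + k (D' w))"
  using hk0 i by (intro integral_mono integrable_abs Bochner_Integration.integrable_diff Bochner_Integration.integrable_add) (auto simp: abs_le_iff add_increasing add_increasing2)
 also have "... = (LINT w|P. ?p w + ?m w)" using E[of "%_. 1"] i gi by simp
 also have "... = (LINT w|P. \<bar>g w\<bar>)" by (intro int_cong) auto
 finally have 1: "(LINT w|M. \<bar>?Y w\<bar>) <= (LINT w|P. \<bar>g w\<bar>)" .
 have 2: "(LINT w|M. \<phi> (D' w) * ?Y w) = (LINT w|P. \<phi> (D w) * g w)" if [measurable]: "\<phi> : bmf N" and b: "bounded (range \<phi>)" for \<phi>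
 proof -
  obtain c where c: "!!y. \<bar>\<phi> y\<bar> <= c" using b by (auto simp: bounded_iff)
  have m: "integrable R (%w. a w * \<phi> (d w))" if "integrable R a" and [measurable]: "d : R \<rightarrow>\<^sub>M N" for R a and d :: "_ => _"
   by (rule int_bound[OF integrable_mult_right[OF integrable_abs[OF that(1)], of c]])
    (use that(1) mult_right_mono[OF order_trans[OF c abs_ge_self] abs_ge_zero] in \<open>auto simp: abs_mult mult.commute[of "\<bar>a _\<bar>"]\<close>)
  have "(LINT w|M. \<phi> (D' w) * ?Y w) = (LINT w|M. h (D' w) * \<phi> (D' w)) - (LINT w|M. k (D' w) * \<phi> (D' w))"
   unfolding Bochner_Integration.integral_diff[OF m[OF i(1) D(2)] m[OF i(2) D(2)], symmetric] by (simp add: algebra_simps)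
  also have "... = (LINT w|P. ?p w * \<phi> (D w) - ?m w * \<phi> (D w))"
   using E by (simp add: Bochner_Integration.integral_diff[OF m[OF gi(1) D(1)] m[OF gi(2) D(1)]])
  also have "... = (LINT w|P. \<phi> (D w) * g w)" by (intro int_cong) (auto simp: max_def)
  finally show ?thesis .
 qed
 show ?thesis by (intro exI[of _ ?Y] conjI 1 ballI impI 2) (use i in auto)
qed

lemma step_right: "((%u. indicat_real {c..} u) \<longlongrightarrow> indi {c..} s) (at_right s)" for s c :: real
proof (rule tendsto_eventually)
 show "eventually (%u. indicat_real {c..} u = indi {c..} s) (at_right s)"
 proof (cases "c <= s")
  case True
  then show ?thesis using eventually_at_right_less[of s] by (auto elim!: eventually_mono simp: indicator_def)
 next
  case False
  then have "eventually (%u. u : {s<..<c}) (at_right s)" by (intro eventually_at_right_real) auto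
  then show ?thesis by (rule eventually_mono) (use False in \<open>auto simp: indicator_def\<close>)
 qed
qed

lemma vec_integrable:
 fixes Y :: "_ => real ^ 'd::finite"
 assumes "!!k. integrable M (%w. Y w $ k)" shows "integrable M Y"
proof -
 have "integrable M (%w. SUM k:UNIV. (Y w $ k) *R axis k (1::real))"
  by (intro Bochner_Integration.integrable_sum integrable_scaleR_left assms)
 then show ?thesis by (simp add: vec_sum_axis)
qed

locale noise_law = noise M Z ta T Om sc
 for M :: "'w measure" and Z :: "real => 'w => real ^ 'd::finite" and ta T Om sc +
 assumes indep: "independent_coordinates M Z"
  and cadlag: "AE w in M. ALL t>=0. ((%s. Z s w) \<longlongrightarrow> Z t w) (at_right t) & (t > 0 --> (EX l. ((%s. Z s w) \<longlongrightarrow> l) (at_left t)))"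
begin

abbreviation BB :: "(nat \<times> nat => real) measure" where "BB == PiM UNIV (%_. borel)"

abbreviation NN :: "('d => nat \<times> nat => real) measure" where "NN == PiM UNIV (%_. BB)"

definition pj :: "'d => ((real \<times> real) \<times> 'w) \<times> real => nat \<times> nat => real" where
 "pj j z i = Z (dyadic i) (snd (fst z)) $ j + snd z * indi {jtime ta z..} (dyadic i)"

definition dp :: "('d => ((real \<times> real) \<times> 'w) \<times> real) => 'd => nat \<times> nat => real" where "dp w j = pj j (w j)"

definition Zd :: "'w => 'd => nat \<times> nat => real" where "Zd w j i = Z (dyadic i) w $ j"

lemma pj_meas[measurable]: "pj j : Om j \<rightarrow>\<^sub>M BB"
proof -
 have [measurable]: "Z (dyadic i) : bmf M" for i by (rule Z_meas) simp
 have "(%z. Z (dyadic i) (snd (fst z)) $ j + snd z * indi {..dyadic i} (jtime ta z)) : bmf (((lborel \<Otimes>\<^sub>M lborel) \<Otimes>\<^sub>M M) \<Otimes>\<^sub>M lborel)" for i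
  unfolding jtime_def by measurable
 moreover have "pj j z i = Z (dyadic i) (snd (fst z)) $ j + snd z * indi {..dyadic i} (jtime ta z)" for z i by (auto simp: pj_def indicator_def)
 ultimately have "(%z. pj j z i) : bmf (Om j)" for i by (simp add: measurable_cong_sets[OF sets_Om refl])
 from measurable_PiM_single'[of UNIV "%i z. pj j z i", OF this] show ?thesis by simp
qed

lemma dp_meas[measurable]: "dp : PP \<rightarrow>\<^sub>M NN"
 by (rule measurable_PiM_single') (auto simp: dp_def space_PiM intro: measurable_compose[OF comp_meas pj_meas])

lemma Zdj_meas: "(%w. Zd w j) : M \<rightarrow>\<^sub>M BB"
proof -
 have [measurable]: "Z (dyadic i) : bmf M" for i by (rule Z_meas) simp
 have "(%w. Zd w j i) : bmf M" for i unfolding Zd_def by measurable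
 from measurable_PiM_single'[of UNIV "%i w. Zd w j i", OF this] show ?thesis by simp
qed

lemma Zd_meas[measurable]: "Zd : M \<rightarrow>\<^sub>M NN"
 by (rule measurable_PiM_single') (auto simp: space_PiM intro: Zdj_meas)

text \<open>Both sides are product measures, the left by construction and the right by independence
  of the coordinates read at dyadic times; the factors agree by \<open>Om_law\<close>.\<close>

lemma law: "distr PP NN dp = distr M NN Zd"
proof -
 let ?D = "%j. distr (Om j) BB (pj j)"
 have "prob_space (?D j)" for j by (rule prob_space.prob_space_distr[OF prob_Om pj_meas])
 then interpret D: product_prob_space ?D UNIV
  by (intro product_prob_space.intro product_sigma_finite.intro product_prob_space_axioms.intro) (auto intro: prob_space_imp_sigma_finite)
 have "distr PP NN dp = PiM UNIV ?D"
 proof (rule D.PiM_eqI)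
  show "sets (distr PP NN dp) = sets (PiM UNIV ?D)" by (simp cong: sets_PiM_cong)
  fix A assume A: "!!j. j : UNIV ==> A j : sets (?D j)"
  then have A': "A j : sets BB" for j by simp
  have "emeasure (distr PP NN dp) (Pi\<^sub>E UNIV A) = emeasure PP (dp -` Pi\<^sub>E UNIV A \<inter> space PP)"
   using A' by (intro emeasure_distr dp_meas sets_PiM_I_finite) auto
  also have "dp -` Pi\<^sub>E UNIV A \<inter> space PP = Pi\<^sub>E UNIV (%j. pj j -` A j \<inter> space (Om j))"
   by (auto simp: PP_def space_PiM dp_def PiE_iff)
  also have "emeasure PP ... = (PROD j:UNIV. emeasure (Om j) (pj j -` A j \<inter> space (Om j)))"
   unfolding PP_def using A' by (intro PS.emeasure_PiM) (auto intro!: measurable_sets[OF pj_meas])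
  also have "... = (PROD j:UNIV. emeasure (?D j) (A j))" using A' by (intro prod.cong refl emeasure_distr[symmetric]) auto
  finally show "emeasure (distr PP NN dp) (Pi\<^sub>E UNIV A) = (PROD j:UNIV. emeasure (?D j) (A j))" .
 qed simp
 also have "?D = (%j. distr M BB (%w. Zd w j))"
  using scored.Om_law[OF scored] by (simp add: fun_eq_iff pj_def[abs_def] Zd_def[abs_def])
 also have "PiM UNIV (%j. distr M BB (%w. Zd w j)) = distr M NN (%w. restrict (Zd w) UNIV)"
 proof (subst indep_vars_iff_distr_eq_PiM'[THEN iffD1, symmetric])
  have "(%f. %i. f (dyadic i)) : PiM {0..} (%_. borel) \<rightarrow>\<^sub>M BB"
   by (rule measurable_PiM_single') (auto intro!: measurable_component_singleton)
  from indep_vars_compose2[OF indep[unfolded independent_coordinates_def] this]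
  show "indep_vars (%_. BB) (%j w. Zd w j) UNIV" by (simp add: Zd_def[abs_def])
 qed (use Zdj_meas in auto)
 finally show ?thesis by (simp add: restrict_UNIV)
qed

definition RV :: "('d => nat \<times> nat => real) => real => real ^ 'd" where "RV d v = (\<chi> j. Reg T (d j) v)"

lemma RV_meas: "(%p. RV (fst p) (snd p)) : bmf (NN \<Otimes>\<^sub>M borel)"
proof -
 have "(%d. d j i) : bmf NN" for j i
  using measurable_compose[OF measurable_component_singleton[of j UNIV "%_. BB"] measurable_component_singleton[of i UNIV "%_. borel"]] by simp
 then have [measurable]: "(%p. Reg T (fst p j) (snd p)) : bmf (NN \<Otimes>\<^sub>M borel)" for j by (rule Reg_measurable)
 show ?thesis unfolding RV_def by measurable
qed

lemma bpath_RV: "bpath (%v. x + RV d v)"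
proof -
 have "RV d = (%v. SUM j:UNIV. Reg T (d j) v *R axis j 1)" using vec_sum_axis[of "RV d _"] by (simp add: RV_def fun_eq_iff)
 moreover have "bpath (%v. Reg T (d j) v *R axis j (1::real))" for j
  using bpath_Reg[of T "d j"] ta unfolding bpath_def by (auto simp: bounded_iff)
 ultimately show ?thesis by (auto intro!: bpath_add bpath_sum)
qed

definition regular :: "'w => bool" where
 "regular w \<longleftrightarrow> (ALL t>=0. ((%s. Z s w) \<longlongrightarrow> Z t w) (at_right t) & (t > 0 --> (EX l. ((%s. Z s w) \<longlongrightarrow> l) (at_left t))))"

lemma AE_regular: "AE w in M. regular w" using cadlag by (simp add: regular_def)

lemma regular_Reg:
 assumes w: "regular w"
 shows "Reg T (%i. Z (dyadic i) w $ j + a * indi {c..} (dyadic i)) v = Z (max 0 (min v T)) w $ j + a * indi {c..} (max 0 (min v T))"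
proof -
 have "EX K. ALL s:{0..T + 1}. norm (Z s w) <= K" by (rule cadlag_bounded) (use w in \<open>auto simp: regular_def\<close>)
 then obtain K where K: "!!s. s : {0..T + 1} ==> norm (Z s w) <= K" by blast
 show ?thesis
 proof (rule Reg_eq[where f="%s. Z s w $ j + a * indi {c..} s" and K="K + \<bar>a\<bar>"])
  show "((%s. Z s w $ j + a * indi {c..} s) \<longlongrightarrow> Z s w $ j + a * indi {c..} s) (at_right s)" if "0 <= s" for s
   using w that unfolding regular_def by (intro tendsto_intros step_right) auto
  show "\<bar>Z s w $ j + a * indi {c..} s\<bar> <= K + \<bar>a\<bar>" if "0 <= s" "s <= T + 1" for s
   using order_trans[OF component_le_norm_cart[of "Z s w" j] K[of s]] that by (auto simp: indicator_def)
 qed (use ta in simp)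
qed

lemma RV_Zd: "regular w ==> RV (Zd w) v = Z (max 0 (min v T)) w"
 using regular_Reg[of w _ 0 0 v] unfolding RV_def Zd_def[abs_def] by (simp add: vec_eq_iff)

text \<open>Right continuity and the existence of left limits carry over to the enlarged space by
  \<open>Om_null\<close>, and adding a right-continuous step preserves what \<open>Reg\<close>
  needs. The exceptional set does not depend on \<open>x\<close>.\<close>

lemma bp_RV: "AE w in PP. ALL x. ALL v:{0..T}. bp x w v = x + RV (dp w) v"
proof -
 have "AE w in PP. regular (snd (fst (w j)))" for j
 proof -
  obtain A where A: "{w : space M. ~ regular w} \<subseteq> A" "A : null_sets M"
   using AE_E[OF AE_regular] by (metis null_setsI)
  have "AE z in Om j. regular (snd (fst z))"
   using scored.Om_null[OF scored A(2)] AE_space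
  proof eventually_elim
   fix z assume "snd (fst z) ~: A" "z : space (Om j)"
   moreover from this(2) have "snd (fst z) : space M" using sets_eq_imp_space_eq[OF sets_Om[of j]] by (auto simp: space_pair_measure)
   ultimately show "regular (snd (fst z))" using A(1) by blast
  qed
  then show ?thesis unfolding PP_def by (intro AE_PiM_component) (auto intro: prob_Om)
 qed
 then have "AE w in PP. ALL j. regular (snd (fst (w j)))" by (simp add: AE_all_countable)
 then show ?thesis
 proof eventually_elim
  fix w :: "'d => ((real \<times> real) \<times> 'w) \<times> real" assume w: "ALL j. regular (snd (fst (w j)))"
  show "ALL x. ALL v:{0..T}. bp x w v = x + RV (dp w) v"
   using regular_Reg[OF w[rule_format]] regular_Reg[OF w[rule_format], of _ _ 0]
   by (simp add: vec_eq_iff bp_def zz_def RV_def dp_def pj_def[abs_def] jumps_def tm_def ja_def) (simp add: indicator_def)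
 qed
qed

definition wgt :: "(('d => ((real \<times> real) \<times> 'w) \<times> real) => real) => ('w => real) => bool" where
 "wgt g Y \<longleftrightarrow> integrable M Y & (ALL \<phi>:bmf NN. bounded (range \<phi>) --> (LINT w|M. \<phi> (Zd w) * Y w) = (LINT w|PP. \<phi> (dp w) * g w))"

lemma wgt_exists: "integrable PP g ==> EX Y. wgt g Y & (LINT w|M. \<bar>Y w\<bar>) <= (LINT w|PP. \<bar>g w\<bar>)"
 by (rule ex_forward[OF cond_density[OF P.prob_space_axioms prob_space_axioms dp_meas Zd_meas law]]) (auto simp: wgt_def)

end

lemma (in flow) Sol_cong_on:
 assumes z: "bpath z" "bpath z'" and e: "!!v. 0 <= v ==> v <= T ==> z v = z' v"
 shows "Sol z T = Sol z' T"
proof (rule vsol_unique_on[where a=z, OF lip_field_b T0 bpath_Sol[OF z(1)] bpath_Sol[OF z(2)] Sol_eq[OF z(1)] _ T0 order_refl])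
 fix s assume s: "0 <= s" "s <= T"
 show "Sol z' s = z s + vint T (%v. b (Sol z' v)) s" unfolding e[OF s] by (rule Sol_eq[OF z(2)])
qed

lemma (in noise_law) wgt_add:
 assumes g: "wgt g Y" "wgt h U" and i: "integrable PP g" "integrable PP h"
 shows "wgt (%w. g w + h w) (%w. Y w + U w)"
proof -
 have m: "integrable R (%w. \<phi> (d w) * a w)" if a: "\<phi> : bmf NN" "bounded (range \<phi>)" "integrable R a" "d : R \<rightarrow>\<^sub>M NN" for R a d and \<phi> :: "_ => real"
 proof -
  obtain c where c: "!!y. \<bar>\<phi> y\<bar> <= c" using a(2) by (auto simp: bounded_iff)
  show ?thesis
   by (rule int_bound[OF integrable_mult_right[OF integrable_abs[OF a(3)], of c]])
    (use a measurable_compose[OF a(4,1)] mult_right_mono[OF order_trans[OF c abs_ge_self] abs_ge_zero] in \<open>auto simp: abs_mult\<close>)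
 qed
 show ?thesis
  using g i m[OF _ _ _ Zd_meas] m[OF _ _ _ dp_meas] by (auto simp: wgt_def distrib_left)
qed

text \<open>With the trivial weight \<open>transfer\<close> becomes equality of the laws of the
  solution on the two spaces.\<close>

lemma (in noise_law) wgt_one: "wgt (%_. 1) (%_. 1)"
proof -
 have "(LINT w|M. \<phi> (Zd w)) = (LINT w|PP. \<phi> (dp w))" if "\<phi> : bmf NN" for \<phi> :: "_ => real"
  using integral_distr[OF Zd_meas that] integral_distr[OF dp_meas that] unfolding law by simp
 then show ?thesis by (simp add: wgt_def)
qed

lemma (in noise_law) base_weight:
 "EX Y. (ALL k. wgt (%w. - sc k (w k)) (%w. Y w $ k)) & integrable M Y & (LINT w|M. norm (Y w)) <= (SUM k:UNIV. LINT z|Om k. \<bar>sc k z\<bar>)"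
proof -
 have "EX U. wgt (%w. - sc k (w k)) U & (LINT w|M. \<bar>U w\<bar>) <= (LINT z|Om k. \<bar>sc k z\<bar>)" for k
  using wgt_exists[of "%w. - sc k (w k)"] sc_integrable[of k] PP_sc[of k] by simp
 then obtain U where U: "!!k. wgt (%w. - sc k (w k)) (U k)" "!!k. (LINT w|M. \<bar>U k w\<bar>) <= (LINT z|Om k. \<bar>sc k z\<bar>)" by metis
 let ?Y = "%w. \<chi> k. U k w"
 have i: "integrable M (U k)" for k using U(1) by (simp add: wgt_def)
 then have iY: "integrable M ?Y" by (intro vec_integrable) simp
 have "(LINT w|M. norm (?Y w)) <= (LINT w|M. (SUM k:UNIV. \<bar>U k w\<bar>))"
  using i by (intro integral_mono integrable_norm iY Bochner_Integration.integrable_sum integrable_abs order_trans[OF norm_le_l1_cart]) auto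
 also have "... <= (SUM k:UNIV. LINT z|Om k. \<bar>sc k z\<bar>)"
  using i by (subst Bochner_Integration.integral_sum) (auto intro!: sum_mono U(2))
 finally show ?thesis using U(1) iY by (intro exI[of _ ?Y]) simp
qed

text \<open>\<open>wgt g Y\<close> says that \<open>Y\<close> represents on the original space the weight \<open>g\<close> of the enlarged one; it does not depend on the drift.\<close>

locale sde_noise = noise_law M Z ta T Om sc + noise_flow M Z ta T Om sc b Db D2b L
 for M :: "'w measure" and Z :: "real => 'w => real ^ 'd::finite" and ta T Om sc and b :: "real ^ 'd => real ^ 'd" and Db D2b L +
 fixes X :: "real ^ 'd => real => 'w => real ^ 'd"
 assumes sde: "!!x. sde_solution M b Z x (X x)"
begin

definition Psi :: "real ^ 'd => ('d => nat \<times> nat => real) => real ^ 'd" where "Psi x d = Sol (%v. x + RV d v) T"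

lemma Psi_meas[measurable]: "Psi x : bmf NN"
proof -
 have "(%(d, v). x + RV d v) : bmf (NN \<Otimes>\<^sub>M borel)"
  unfolding case_prod_beta by (intro borel_measurable_add borel_measurable_const RV_meas)
 from Sol_measurable[OF this bpath_RV] show ?thesis unfolding Psi_def[abs_def] .
qed

lemma Ph_Psi: "AE w in PP. Ph x w = Psi x (dp w)"
 using bp_RV unfolding Ph_def Psi_def by (rule eventually_mono) (rule Sol_cong_on[OF bpath_bp bpath_RV], simp)

text \<open>A given solution comes without boundedness. It equals starting point plus noise plus
  integrated drift, and the latter, cut off at \<open>T\<close>, is a bounded path since its
  integrand is integrable; then uniqueness for bounded paths applies.\<close>

lemma X_Psi: "AE w in M. X x T w = Psi x (Zd w)"
proof -
 have "AE w in M. ALL t>=0. set_integrable lborel {0..t} (%s. b (X x s w)) & X x t w = x + (LINT s:{0..t}|lborel. b (X x s w)) + Z t w"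
  using sde[of x] unfolding sde_solution_def by (rule conjunct2)
 with AE_regular show ?thesis
 proof eventually_elim
  fix w assume r: "regular w" and s: "ALL t>=0. set_integrable lborel {0..t} (%s. b (X x s w)) & X x t w = x + (LINT s:{0..t}|lborel. b (X x s w)) + Z t w"
  define f where "f s = indi {0..T} s *R b (X x s w)" for s
  have fi: "integrable lborel f" using s T0 by (simp add: f_def[abs_def] set_integrable_def)
  then have [measurable]: "f : bm" by auto
  have "bpath (vint T f)"
  proof (rule bpathI)
   have "(%(l::unit, s). vint T f s) : bmf (count_space UNIV \<Otimes>\<^sub>M borel)" by (rule vint_measurable_param) measurable
   from measurable_compose[OF measurable_Pair[OF measurable_const measurable_ident] this, of "()"]
   show "vint T f : bm" by simp
   fix s
   have "norm (vint T f s) <= (LINT v|lborel. norm (indi {0..min s T} v *R f v))"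
    unfolding vint_def set_lebesgue_integral_def by (rule integral_norm_bound)
   also have "... <= (LINT v|lborel. norm (f v))"
    using fi by (intro integral_mono integrable_norm integrable_mult_indicator) (auto simp: indicator_def)
   finally show "norm (vint T f s) <= (LINT v|lborel. norm (f v))" .
  qed
  then have p: "bpath (%s. x + RV (Zd w) s + vint T f s)" by (intro bpath_add bpath_RV)
  have e: "x + RV (Zd w) s + vint T f s = X x s w" if "0 <= s" "s <= T" for s
  proof -
   have "vint T f s = (LINT v:{0..s}|lborel. b (X x v w))"
    unfolding vint_def min_absorb1[OF that(2)] by (intro set_lebesgue_integral_cong) (use that in \<open>auto simp: f_def indicator_def\<close>)
   then show ?thesis using s that by (simp add: RV_Zd[OF r] max_def min_def)
  qed
  have "(%s. x + RV (Zd w) s + vint T f s) = vsol T (%s. x + RV (Zd w) s) (%v. b)"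
  proof (rule vsol_unique[OF lip_field_b T0 bpath_RV p])
   fix s
   have "vint T f s = vint T (%v. b (x + RV (Zd w) v + vint T f v)) s"
    by (rule vint_cong) (use e in \<open>simp add: f_def\<close>)
   then show "x + RV (Zd w) s + vint T f s = x + RV (Zd w) s + vint T (%v. b (x + RV (Zd w) v + vint T f v)) s" by simp
  qed
  from fun_cong[OF this, of T] show "X x T w = Psi x (Zd w)" using e[of T] T0 by (simp add: Psi_def Sol_def)
 qed
qed

lemma X_meas[measurable]: "X x T : bmf M"
 using sde[of x] T0 by (simp add: sde_solution_def)

lemma transfer:
 assumes f[measurable]: "f : bm" and fb: "bounded (range f)" and w: "wgt g Y" and g[measurable]: "g : bmf PP"
 shows "(LINT w|M. f (X x T w) * Y w) = (LINT w|PP. f (Ph x w) * g w)"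
proof -
 have [measurable]: "Y : bmf M" using w by (auto simp: wgt_def)
 have m: "(%d. f (Psi x d)) : bmf NN" "bounded (range (%d. f (Psi x d)))"
  using bounded_subset[OF fb, of "range (%d. f (Psi x d))"] by auto
 have "(LINT w|M. f (X x T w) * Y w) = (LINT w|M. f (Psi x (Zd w)) * Y w)"
  by (rule integral_cong_AE) (use X_Psi[of x] in \<open>auto elim!: eventually_mono\<close>)
 also have "... = (LINT w|PP. f (Psi x (dp w)) * g w)"
  by (rule w[unfolded wgt_def, THEN conjunct2, rule_format, OF m])
 also have "... = (LINT w|PP. f (Ph x w) * g w)"
  by (rule integral_cong_AE) (use Ph_Psi[of x] in \<open>auto elim!: eventually_mono\<close>)
 finally show ?thesis .
qed

lemma GDERIV_X:
 assumes f: "f : bounded_borel" and Y: "!!k. wgt (%w. W x w $ k) (%w. Y w $ k)"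
 shows "GDERIV (transition_semigroup M X T f) x :> (LINT w|M. f (X x T w) *R Y w)"
proof -
 have f'[measurable]: "f : bm" and fb: "bounded (range f)" using f by (auto simp: bounded_borel_def)
 obtain c where c: "!!y. \<bar>f y\<bar> <= c" using fb by (auto simp: bounded_iff)
 have F: "S.F f = transition_semigroup M X T f"
  using transfer[OF f' fb wgt_one] by (simp add: S.F_def transition_semigroup_def fun_eq_iff)
 have iY: "integrable M Y" using Y by (intro vec_integrable) (simp add: wgt_def)
 have i: "integrable M (%w. f (X x T w) *R Y w)"
  by (rule int_bound[OF integrable_scaleR_right[OF iY, of c]])
   (use iY mult_right_mono[OF order_trans[OF c abs_ge_self] norm_ge_zero] in auto)
 have v: "S.v f x = (LINT w|M. f (X x T w) *R Y w)"
  unfolding vec_eq_iff S.v_def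
 proof
  fix k
  have "(LINT w|PP. f (Ph x w) *R W x w) $ k = (LINT w|PP. (f (Ph x w) *R W x w) $ k)"
   by (rule integral_bounded_linear[OF bounded_linear_vec_nth S.fW_int(1)[OF f' c], symmetric])
  also have "... = (LINT w|M. (f (X x T w) *R Y w) $ k)" using transfer[OF f' fb Y, of k x] by simp
  also have "... = (LINT w|M. f (X x T w) *R Y w) $ k"
   by (rule integral_bounded_linear[OF bounded_linear_vec_nth i])
  finally show "(LINT w|PP. f (Ph x w) *R W x w) $ k = (LINT w|M. f (X x T w) *R Y w) $ k" .
 qed
 show ?thesis using S.gradient_formula[OF f' fb, of x] unfolding F v .
qed

text \<open>Only the difference between \<open>W\<close> and the drift-free weight is brought back
  to the original space, and \<open>U\<close> is \<open>Y\<close> plus the result; so the distance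
  of \<open>U\<close> from \<open>Y\<close> inherits the bound of \<open>W_near\<close>. One factor
  \<open>CARD('d)\<close> stems from \<open>W_near\<close>, the other from summing over
  components.\<close>

lemma weight:
 assumes Y: "!!k. wgt (%w. - sc k (w k)) (%w. Y w $ k)"
 shows "EX U. integrable M U & (ALL f:bounded_borel. GDERIV (transition_semigroup M X T f) x :> (LINT w|M. f (X x T w) *R U w)) &
  (LINT w|M. norm (Y w - U w)) <= CARD('d)\<^sup>2 * (SUM j:UNIV. 4 * cc * (LINT z|Om j. \<bar>sc j z\<bar>) + kk)"
proof -
 let ?E = "SUM j:UNIV. 4 * cc * (LINT z|Om j. \<bar>sc j z\<bar>) + kk"
 let ?g = "%k w. W x w $ k + sc k (w k)"
 have W: "integrable PP (W x)" by (rule int_bound[OF GG_int]) (use W_le in \<open>auto intro: order_trans[OF _ abs_ge_self]\<close>)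
 have gi: "integrable PP (?g k)" for k
  using sc_integrable[of k] integrable_bounded_linear[OF bounded_linear_vec_nth W, of k] by auto
 have gE: "(LINT w|PP. \<bar>?g k w\<bar>) <= CARD('d) * ?E" for k
 proof -
  have "(LINT w|PP. \<bar>?g k w\<bar>) <= (LINT w|PP. CARD('d) * (SUM j:UNIV. 4 * cc * \<bar>sc j (w j)\<bar> + kk))"
  proof (rule integral_mono)
   show "integrable PP (%w. CARD('d) * (SUM j:UNIV. 4 * cc * \<bar>sc j (w j)\<bar> + kk))"
    using sc_integrable by (intro integrable_mult_right Bochner_Integration.integrable_sum Bochner_Integration.integrable_add integrable_abs) auto
   show "\<bar>?g k w\<bar> <= CARD('d) * (SUM j:UNIV. 4 * cc * \<bar>sc j (w j)\<bar> + kk)" for w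
    using order_trans[OF component_le_norm_cart W_near, of x w k] by simp
  qed (use gi in auto)
  also have "... = CARD('d) * ?E"
   using sc_integrable by (simp add: Bochner_Integration.integral_sum Bochner_Integration.integral_add PP_sc P.prob_space del: sum.distrib)
  finally show ?thesis .
 qed
 have "EX U. wgt (?g k) U & (LINT w|M. \<bar>U w\<bar>) <= CARD('d) * ?E" for k
  using wgt_exists[OF gi[of k]] gE[of k] order_trans by blast
 then have "EX D. ALL k. wgt (?g k) (D k) & (LINT w|M. \<bar>D k w\<bar>) <= CARD('d) * ?E" by (intro choice allI)
 then obtain D where "ALL k. wgt (?g k) (D k) & (LINT w|M. \<bar>D k w\<bar>) <= CARD('d) * ?E" by (rule exE)
 then have D: "wgt (?g k) (D k)" "(LINT w|M. \<bar>D k w\<bar>) <= CARD('d) * ?E" for k by blast+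
 let ?U = "%w. Y w + (\<chi> k. D k w)"
 have wU: "wgt (%w. W x w $ k) (%w. ?U w $ k)" for k
  using wgt_add[OF Y[of k] D(1)[of k]] sc_integrable[of k] gi[of k] by simp
 have iD: "integrable M (D k)" for k using D(1) by (simp add: wgt_def)
 have "(LINT w|M. norm (Y w - ?U w)) <= (LINT w|M. (SUM k:UNIV. \<bar>D k w\<bar>))"
 proof (rule integral_mono)
  show "integrable M (%w. norm (Y w - ?U w))" using iD by (intro integrable_norm vec_integrable) simp
  show "norm (Y w - ?U w) <= (SUM k:UNIV. \<bar>D k w\<bar>)" for w using norm_le_l1_cart[of "Y w - ?U w"] by simp
 qed (use iD in auto)
 also have "... <= (SUM k:(UNIV::'d set). CARD('d) * ?E)" unfolding Bochner_Integration.integral_sum[OF integrable_abs[OF iD]] by (rule sum_mono[OF D(2)])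
 finally have "(LINT w|M. norm (Y w - ?U w)) <= CARD('d)\<^sup>2 * ?E" by (simp add: power2_eq_square mult.assoc)
 moreover have "integrable M ?U" using wU by (intro vec_integrable) (simp add: wgt_def)
 ultimately show ?thesis using GDERIV_X[OF _ wU] by (intro exI[of _ ?U] conjI ballI) auto
qed

end

section \<open>Choice of the time window and the final estimates\<close>

lemma flow_zero: "0 <= T ==> flow (%_. 0) (%_ _. 0) (%_ _ _. 0) 0 T"
 by unfold_locales (auto intro: linear_zero)

text \<open>On \<open>(0,T]\<close> the ratio of \<open>t\<close> to \<open>min t t0\<close> is at
  most \<open>max 1 (T / t0)\<close>, so for a nonpositive exponent the shortened window costs a
  constant depending on \<open>T\<close> only.\<close>

lemma min_powr_le:
 fixes a t T t0 :: real
 assumes "0 < t" "t <= T" "0 < t0" "a <= 0"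
 shows "min t t0 powr a <= max 1 (T / t0) powr (- a) * t powr a"
proof -
 let ?m = "max 1 (T / t0)"
 have m: "1 <= ?m" "T / t0 <= ?m" by auto
 have "t <= ?m * min t t0"
 proof (cases "t <= t0")
  case True
  then show ?thesis using mult_right_mono[OF m(1), of t] assms by (simp add: min_def)
 next
  case False
  then show ?thesis using mult_right_mono[OF m(2), of t0] assms by (simp add: min_def)
 qed
 then have "t / ?m <= min t t0" using m(1) by (subst pos_divide_le_eq) (auto simp: mult.commute)
 then have "min t t0 powr a <= (t / ?m) powr a" using assms m(1) by (intro powr_mono2') auto
 also have "... = ?m powr (- a) * t powr a" using assms m(1) by (simp add: powr_divide powr_minus_divide)
 finally show ?thesis .
qed

theorem theorem1:
  fixes M :: "'w measure"
    and Z :: "real \<Rightarrow> 'w \<Rightarrow> real ^ 'd::finite"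
    and m :: "'d \<Rightarrow> real measure"
    and N :: "'d \<Rightarrow> 'w \<Rightarrow> (real \<times> real) measure"
    and b :: "real ^ 'd \<Rightarrow> real ^ 'd"
    and X :: "real ^ 'd \<Rightarrow> real \<Rightarrow> 'w \<Rightarrow> real ^ 'd"
    and p :: "'d \<Rightarrow> real \<Rightarrow> real"
    and \<rho> \<delta> \<kappa> :: real
  assumes "prob_space M"
    and "levy_process M Z"
    and "\<And>j. levy_process M (\<lambda>t \<omega>. Z t \<omega> $ j)"
    and "independent_coordinates M Z"
    and "\<And>j. levy_measure (m j)"
    and "\<And>j. poisson_random_measure M (N j) (jump_intensity (m j))"
    and "\<And>j. purely_jump_type M (N j) (m j) (\<lambda>t \<omega>. Z t \<omega> $ j)"
    and "\<And>x. sde_solution M b Z x (X x)"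
    and b_C2: "\<And>i. C2_function (\<lambda>x. b x $ i)"
    and b_bounded1: "\<And>i j. bounded (range (partial_deriv j (\<lambda>x. b x $ i)))"
    and b_bounded2: "\<And>i j k. bounded (range (partial_deriv j (partial_deriv k (\<lambda>x. b x $ i))))"
    and "\<rho> > 0"
    and small_jumps:
      "\<And>j. Liminf (at_right 0) (\<lambda>\<epsilon>. ennreal (\<epsilon> powr \<rho>) * emeasure (m j) {\<xi>. \<epsilon> \<le> \<bar>\<xi>\<bar>}) > 0"
    and "\<delta> > 0"
    and density: "\<And>j. restrict_space (m j) {-\<delta><..<\<delta>} =
        density (restrict_space lborel {-\<delta><..<\<delta>}) (\<lambda>\<xi>. ennreal (p j \<xi>))"
    and density_nonneg: "\<And>j \<xi>. \<xi> \<in> {-\<delta><..<\<delta>} - {0} \<Longrightarrow> p j \<xi> \<ge> 0"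
    and density_C1: "\<And>j. p j C1_differentiable_on ({-\<delta><..<\<delta>} - {0})"
    and "\<kappa> > 1"
    and "\<And>j. (\<integral>\<^sup>+ \<xi>\<in>{-\<delta><..<\<delta>}. ennreal (\<bar>\<xi>\<bar> powr \<kappa> * p j \<xi>) \<partial>lborel) < \<infinity>"
    and "\<And>j. (\<integral>\<^sup>+ \<xi>\<in>{-\<delta><..<\<delta>}.
        ennreal (\<bar>\<xi>\<bar> powr (2 * \<kappa>) * (deriv (p j) \<xi> / p j \<xi>)\<^sup>2 * p j \<xi>) \<partial>lborel) < \<infinity>"
    and "\<And>j. (\<integral>\<^sup>+ \<xi>\<in>{-\<delta><..<\<delta>}. ennreal (\<bar>\<xi>\<bar> powr (2 * \<kappa> - 2) * p j \<xi>) \<partial>lborel) < \<infinity>"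
  shows "\<exists>(Y :: real \<Rightarrow> 'w \<Rightarrow> real ^ 'd) (Yx :: real \<Rightarrow> real ^ 'd \<Rightarrow> 'w \<Rightarrow> real ^ 'd).
     (\<forall>t>0. integrable M (Y t)) \<and>
     (\<forall>t>0. \<forall>x. integrable M (Yx t x)) \<and>
     (\<forall>f\<in>bounded_borel. \<forall>t>0. \<forall>x.
        (GDERIV (transition_semigroup M (\<lambda>y s \<omega>. y + Z s \<omega>) t f) x :>
           (\<integral>\<omega>. f (x + Z t \<omega>) *\<^sub>R Y t \<omega> \<partial>M)) \<and>
        (GDERIV (transition_semigroup M X t f) x :>
           (\<integral>\<omega>. f (X x t \<omega>) *\<^sub>R Yx t x \<omega> \<partial>M))) \<and>
     (\<forall>T>0. \<exists>C. \<forall>t\<in>{0<..T}. \<forall>x.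
        (\<integral>\<omega>. norm (Y t \<omega>) + norm (Yx t x \<omega>) \<partial>M) \<le> C * t powr (- \<kappa> / \<rho> + 1 / 2)) \<and>
     (\<forall>T>0. \<forall>\<epsilon>::real\<in>{0<..<1 / 2}. \<exists>C. \<forall>t\<in>{0<..T}. \<forall>x.
        (\<integral>\<omega>. norm (Y t \<omega> - Yx t x \<omega>) \<partial>M) \<le> C * t powr (- \<kappa> / \<rho> + 3 / 2))"
proof -
 interpret prob_space M by fact
 note lp = \<open>levy_process M Z\<close>
 obtain L where fl: "!!T. 0 <= T ==> flow b (jac b) (hess b) L T"
  using flow_instance[OF b_C2 b_bounded1 b_bounded2] by blast
 have L0: "0 <= L" using flow.L0[OF fl[of 0]] by simp
 have Zm: "0 <= t ==> Z t : bmf M" for t using lp by (simp add: levy_process_def)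
 have cad: "AE w in M. ALL t>=0. ((%s. Z s w) \<longlongrightarrow> Z t w) (at_right t) & (t > 0 --> (EX l. ((%s. Z s w) \<longlongrightarrow> l) (at_left t)))"
  using lp unfolding levy_process_def by (elim conjE)
 have sc: "\<rho> <= 2 * \<kappa> & (EX C>0. ALL ta. 0 < ta & ta <= 1 --> (EX Om sc. scored M (%t w. Z t w $ j) ta Om sc & (LINT z|Om. \<bar>sc z\<bar>) <= C * ta powr (1 / 2 - \<kappa> / \<rho>)))" for j
 proof -
  interpret C: levy_score M "%t w. Z t w $ j" "N j" "m j" "p j" \<delta> \<kappa> \<rho>
   by unfold_locales (use assms Zm in auto)
  show ?thesis using C.rho_le C.scored_exists by blast
 qed
 then obtain C where C: "!!j. 0 < C j" "!!j ta. 0 < ta ==> ta <= 1 ==> EX Om sc. scored M (%t w. Z t w $ j) ta Om sc & (LINT z|Om. \<bar>sc z\<bar>) <= C j * ta powr (1 / 2 - \<kappa> / \<rho>)"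
  by metis
 define a where "a = 1 / 2 - \<kappa> / \<rho>"
 have a0: "a <= 0" using sc \<open>\<rho> > 0\<close> by (simp add: a_def field_simps)
 \<comment> \<open>Small enough that every window up to \<open>t0\<close> meets the smallness
   condition of \<open>jump_flow\<close>; \<open>L + 1\<close> instead of \<open>L\<close> also
   covers \<open>L = 0\<close>.\<close>
 define t0 where "t0 = 1 / (4 * (L + 1) * exp (2 * L))"
 have t0: "0 < t0" "t0 <= 1" "2 * L * exp (2 * L) * t0 <= 1 / 2"
 proof -
  have "1 <= (L + 1) * exp (2 * L)" using mult_mono[of 1 "L + 1" 1 "exp (2 * L)"] L0 by simp
  then have q: "1 <= 4 * (L + 1) * exp (2 * L)" by (simp add: distrib_right)
  then have qp: "0 < 4 * (L + 1) * exp (2 * L)" by linarith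
  with q show "0 < t0" "t0 <= 1" unfolding t0_def by (simp_all only: divide_le_eq_1_pos zero_less_divide_1_iff)
  show "2 * L * exp (2 * L) * t0 <= 1 / 2" unfolding t0_def times_divide_eq_right mult_1_right pos_divide_le_eq[OF qp] by (simp add: algebra_simps)
 qed
 define A where "A = (SUM j:UNIV. C j)"
 define c1 where "c1 = 2 * L * exp (2 * L)"
 define k1 where "k1 = 16 * L * exp (2 * L) ^ 3 * (1 + 3 * CARD('d))"
 define B where "B = CARD('d)\<^sup>2 * (SUM j:(UNIV :: 'd set). 4 * c1 * C j + k1)"
 have A0: "0 <= A" unfolding A_def by (intro sum_nonneg less_imp_le C(1))
 have B0: "0 <= B" unfolding B_def c1_def k1_def
  by (intro mult_nonneg_nonneg sum_nonneg add_nonneg_nonneg less_imp_le[OF C(1)]) (use L0 in auto)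
 \<comment> \<open>Jumps are added before \<open>tt t\<close> only, while the solution is observed
   at \<open>t\<close>.\<close>
 define tt where "tt t = min t t0" for t
 \<comment> \<open>\<open>Y\<close> must serve all \<open>x\<close> and \<open>f\<close> at once, so
   it is chosen first; \<open>U\<close> may depend on \<open>x\<close> and is chosen relative to
   \<open>Y\<close>.\<close>
 let ?Q = "%t Y x U. integrable M U & (ALL f:bounded_borel. GDERIV (transition_semigroup M X t f) x :> (LINT w|M. f (X x t w) *R U w)) & (LINT w|M. norm (Y w - U w)) <= B * (tt t * tt t powr a)"
 let ?P = "%t Y. integrable M Y & (ALL f:bounded_borel. ALL x. GDERIV (transition_semigroup M (%y s w. y + Z s w) t f) x :> (LINT w|M. f (x + Z t w) *R Y w)) &
   (LINT w|M. norm (Y w)) <= A * tt t powr a & (ALL x. EX U. ?Q t Y x U)"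
 have ex: "EX Y. ?P t Y" if t: "0 < t" for t
 proof -
  have ta: "0 < tt t" "tt t <= 1" "tt t <= t" "tt t <= t0" using t t0 by (auto simp: tt_def)
  obtain Om sc where S: "!!j. scored M (%t w. Z t w $ j) (tt t) (Om j) (sc j)" "!!j. (LINT z|Om j. \<bar>sc j z\<bar>) <= C j * tt t powr a"
   using C(2)[OF ta(1,2)] unfolding a_def by metis
  have e: "exp (2 * L * tt t) <= exp (2 * L)" using L0 ta mult_left_mono[of "tt t" 1 "2 * L"] by simp
  have "2 * L * exp (2 * L * tt t) * tt t <= 2 * L * exp (2 * L) * t0" using L0 ta e by (intro mult_mono) auto
  then have sm: "2 * L * exp (2 * L * tt t) * tt t <= 1 / 2" using t0(3) by linarith
  have nl: "noise_law M Z (tt t) t Om sc"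
   by (intro noise_law.intro noise.intro noise_axioms.intro noise_law_axioms.intro prob_space_axioms S(1) Zm assms(4) cad) (use ta in auto)
  interpret S: sde_noise M Z "tt t" t Om sc b "jac b" "hess b" L X
   by (intro sde_noise.intro nl noise_flow.intro noise_law.axioms(1)[OF nl] jump_flow.intro fl jump_flow_axioms.intro sde_noise_axioms.intro assms(8) sm) (use ta t in auto)
  \<comment> \<open>The free process solves the equation with drift \<open>0\<close>, so both
    gradient formulas are instances of one construction on the same enlarged space.\<close>
  have z: "sde_solution M (%_. 0) Z x (%s w. x + Z s w)" for x
   using Zm by (auto simp: sde_solution_def set_integrable_def)
  interpret S0: sde_noise M Z "tt t" t Om sc "%_. 0" "%_ _. 0" "%_ _ _. 0" 0 "%x s w. x + Z s w"
   by (intro sde_noise.intro nl noise_flow.intro noise_law.axioms(1)[OF nl] jump_flow.intro flow_zero jump_flow_axioms.intro sde_noise_axioms.intro z) (use ta t in auto)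
  obtain Y where Y: "!!k. S.wgt (%w. - sc k (w k)) (%w. Y w $ k)" "integrable M Y" "(LINT w|M. norm (Y w)) <= (SUM k:UNIV. LINT z|Om k. \<bar>sc k z\<bar>)"
   using S.base_weight by blast
  \<comment> \<open>For \<open>L = 0\<close> the constants \<open>cc\<close> and \<open>kk\<close>
    vanish, and the estimate \<open>W_near\<close> becomes an equality.\<close>
  have "S0.W x w = (\<chi> k. - sc k (w k))" for x w using S0.W_near[of x w] by (simp add: S0.cc_def S0.kk_def)
  then have Q: "GDERIV (transition_semigroup M (%y s w. y + Z s w) t f) x :> (LINT w|M. f (x + Z t w) *R Y w)" if "f : bounded_borel" for f x
   using S0.GDERIV_X[OF that, of x Y] Y(1) by simp
  have EY: "(LINT w|M. norm (Y w)) <= A * tt t powr a"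
   unfolding A_def sum_distrib_right by (rule order_trans[OF Y(3) sum_mono[OF S(2)]])
  have "CARD('d)\<^sup>2 * (SUM j:UNIV. 4 * S.cc * (LINT z|Om j. \<bar>sc j z\<bar>) + S.kk) <= CARD('d)\<^sup>2 * (SUM j:(UNIV :: 'd set). (4 * c1 * C j + k1) * (tt t * tt t powr a))"
  proof (intro mult_left_mono sum_mono)
   fix j
   \<comment> \<open>\<open>kk\<close> carries no negative power of the window; since
     \<open>a\<close> is nonpositive and the window at most \<open>1\<close>, it is absorbed into
     the common bound.\<close>
   have p1: "1 <= tt t powr a" using powr_mono2'[OF a0, of "tt t" 1] ta by simp
   have 1: "S.cc <= c1 * tt t" unfolding S.cc_def c1_def using L0 ta e by (intro mult_right_mono mult_left_mono) auto
   have "S.kk <= k1 * tt t" unfolding S.kk_def k1_def using L0 ta e by (intro mult_right_mono mult_left_mono power_mono) auto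
   also have "... <= k1 * (tt t * tt t powr a)" using p1 ta L0 by (intro mult_left_mono) (auto simp: k1_def)
   finally have 2: "S.kk <= k1 * (tt t * tt t powr a)" .
   have "4 * S.cc * (LINT z|Om j. \<bar>sc j z\<bar>) <= 4 * (c1 * tt t) * (C j * tt t powr a)"
    using 1 S.cc(1) by (intro mult_mono S(2)) auto
   then show "4 * S.cc * (LINT z|Om j. \<bar>sc j z\<bar>) + S.kk <= (4 * c1 * C j + k1) * (tt t * tt t powr a)"
    using 2 by (simp add: algebra_simps)
  qed auto
  also have "... = B * (tt t * tt t powr a)" by (simp add: B_def sum_distrib_right mult.assoc)
  finally have "EX U. ?Q t Y x U" for x
   using S.weight[OF Y(1), of x] order_trans by blast
  then show ?thesis using Y(2) Q EY by blast
 qed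
 define Y where "Y t = (SOME Y. ?P t Y)" for t
 have Y0: "?P t (Y t)" if "0 < t" for t unfolding Y_def by (rule someI_ex[OF ex[OF that]])
 define U where "U t x = (SOME U. ?Q t (Y t) x U)" for t x
 have U0: "?Q t (Y t) x (U t x)" if "0 < t" for t x
  unfolding U_def by (rule someI_ex[OF Y0[OF that, THEN conjunct2, THEN conjunct2, THEN conjunct2, THEN spec]])
 have Y: "integrable M (Y t)" "(LINT w|M. norm (Y t w)) <= A * tt t powr a"
  "f : bounded_borel ==> GDERIV (transition_semigroup M (%y s w. y + Z s w) t f) x :> (LINT w|M. f (x + Z t w) *R Y t w)" if "0 < t" for t x f
  using Y0[OF that] by simp_all
 have U: "integrable M (U t x)" "(LINT w|M. norm (Y t w - U t x w)) <= B * (tt t * tt t powr a)"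
  "f : bounded_borel ==> GDERIV (transition_semigroup M X t f) x :> (LINT w|M. f (X x t w) *R U t x w)" if "0 < t" for t x f
  using U0[OF that, of x] by simp_all
 have tt: "0 < tt t" "tt t <= 1" "tt t <= t" if "0 < t" for t using that t0 by (auto simp: tt_def)
 have pw: "tt t powr a <= max 1 (T / t0) powr (- a) * t powr a" if "0 < t" "t <= T" for t T
  unfolding tt_def using min_powr_le[OF that t0(1) a0] .
 have 1: "EX K. ALL t:{0<..T}. ALL x. (LINT w|M. norm (Y t w) + norm (U t x w)) <= K * t powr (- \<kappa> / \<rho> + 1 / 2)" for T
 proof (intro exI[of _ "(2 * A + B) * max 1 (T / t0) powr (- a)"] ballI allI)
  fix t x assume t: "t : {0<..T}"
  then have t': "0 < t" "t <= T" by auto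
  have "norm (U t x w) <= norm (Y t w) + norm (Y t w - U t x w)" for w using norm_triangle_ineq4[of "Y t w" "Y t w - U t x w"] by simp
  then have "(LINT w|M. norm (Y t w) + norm (U t x w)) <= (LINT w|M. 2 * norm (Y t w) + norm (Y t w - U t x w))"
   using Y(1) U(1) t' by (intro integral_mono) auto
  also have "... = 2 * (LINT w|M. norm (Y t w)) + (LINT w|M. norm (Y t w - U t x w))" using Y(1) U(1) t' by simp
  also have "... <= 2 * (A * tt t powr a) + B * (1 * tt t powr a)"
   using Y(2)[OF t'(1)] U(2)[OF t'(1), of x] mult_left_mono[OF mult_right_mono[OF tt(2)[OF t'(1)]] B0, of "tt t powr a"] by simp
  also have "... = (2 * A + B) * tt t powr a" by (simp add: algebra_simps)
  also have "... <= (2 * A + B) * (max 1 (T / t0) powr (- a) * t powr a)" using pw[OF t'] A0 B0 by (intro mult_left_mono) auto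
  finally show "(LINT w|M. norm (Y t w) + norm (U t x w)) <= (2 * A + B) * max 1 (T / t0) powr (- a) * t powr (- \<kappa> / \<rho> + 1 / 2)"
   by (simp add: a_def mult.assoc add.commute)
 qed
 have 2: "EX K. ALL t:{0<..T}. ALL x. (LINT w|M. norm (Y t w - U t x w)) <= K * t powr (- \<kappa> / \<rho> + 3 / 2)" for T
 proof (intro exI[of _ "B * max 1 (T / t0) powr (- a)"] ballI allI)
  fix t x assume t: "t : {0<..T}"
  then have t': "0 < t" "t <= T" by auto
  have "(LINT w|M. norm (Y t w - U t x w)) <= B * (tt t * tt t powr a)" by (rule U(2)[OF t'(1)])
  also have "... <= B * (t * (max 1 (T / t0) powr (- a) * t powr a))"
   using tt[OF t'(1)] pw[OF t'] B0 t' by (intro mult_left_mono mult_mono) auto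
  also have "... = B * max 1 (T / t0) powr (- a) * t powr (1 + a)" using t' by (simp add: powr_add)
  finally show "(LINT w|M. norm (Y t w - U t x w)) <= B * max 1 (T / t0) powr (- a) * t powr (- \<kappa> / \<rho> + 3 / 2)"
   by (simp add: a_def add.commute)
 qed
 show ?thesis by (rule exI[of _ Y], rule exI[of _ U]) (use Y(1,3) U(1,3) 1 2 in blast)
qed

end
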